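(* Let $\mathcal H\subset\operatorname{Lip}_{\mathsf d}(L)$ with $\mathsf d(\vartheta,\vartheta')=\|\vartheta-\vartheta'\|$ on $\mathbb R^d$, and assume that $U$ satisfies condition (ULA) with constants $L_U,m_U>0$. Assume additionally that the initial distribution satisfies $\xi\in T_2(\beta)$ for some $\beta>0$. Fix any $\gamma\in(0,2/(m_U+L_U))$ and set $b_n=2\lceil\log(n)/\log(1/\Delta_2)\rceil$ with $\Delta_2=\sqrt{1-\kappa\gamma}$ and $\kappa=2m_UL_U/(m_U+L_U)$. Then, for any $\varepsilon>0$ and $\delta\in(0,1)$, with probability at least $1-\delta$, $$V_\infty^{(\mathsf{ULA})}(\widehat h_{n,\varepsilon})-\inf_{h\in\mathcal H}V_\infty^{(\mathsf{ULA})}(h)\lesssim C_1\,\varepsilon\log(n)+C_2\sqrt{\frac{\log^2(n)\log(|\mathcal H_\varepsilon|/\delta)}{n}}+C_3\frac{\log^2(n)\log(|\mathcal H_\varepsilon|/\delta)}{n},$$ where $\lesssim$ is inequality up to an absolute constant and $$C_1=\frac{\sqrt R+\sqrt D}{\kappa\gamma},\quad C_2=\frac{L\sqrt{(\beta\vee\gamma)(D+R)}}{\kappa^2\gamma^2}+\frac{\sqrt{DR}}{\kappa\gamma},\quad C_3=\frac{L^2(\beta\vee\gamma)}{\kappa^4\gamma^4}+\frac{R}{\kappa\gamma}+\frac{\varsigma}{\kappa^2\gamma^2},$$ with $D=\sup_{h\in\mathcal H}\operatorname{Var}_{\pi_\gamma}(h)$, $\pi_\gamma=\pi_\gamma^{(\mathsf{ULA})}$,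 $$R=A_1L^2(1-\Delta_2)^{-1}W_2^{\mathsf d}(\xi,\pi_\gamma),\qquad A_1=2\inf_{\hat x}W_2^{\mathsf d}(\delta_{\hat x},\pi_\gamma)+2W_2^{\mathsf d}(\xi,\pi_\gamma)+\Bigl[\int\{W_2^{\mathsf d}(\delta_y,\pi_\gamma)\}^2\pi_\gamma(dy)\Bigr]^{1/2},$$ $$\varsigma=L\sqrt D\Bigl[\int\{W_2^{\mathsf d}(\delta_x,\pi_\gamma)\}^2\pi_\gamma(dx)\Bigr]^{1/2}.$$
   Context: $U:\mathbb R^d\to\mathbb R$. Condition (ULA): $U$ is continuously differentiable and 1) there is $L_U>0$ with $\|\nabla U(\theta)-\nabla U(\theta')\|\le L_U\|\theta-\theta'\|$ for all $\theta,\theta'\in\mathbb R^d$; 2) there is $m_U>0$ with $U(\theta')\ge U(\theta)+\langle\nabla U(\theta),\theta'-\theta\rangle+(m_U/2)\|\theta'-\theta\|^2$ for all $\theta,\theta'\in\mathbb R^d$. Unadjusted Langevin Algorithm: $\theta_{k+1}=\theta_k-\gamma\nabla U(\theta_k)+\sqrt{2\gamma}\,\xi_{k+1}$, $\theta_0\sim\xi$, with $(\xi_k)_{k\ge1}$ i.i.d. standard Gaussian in $\mathbb R^d$ (independent of $\theta_0$). Put $X_k=\theta_k$. Under (ULA), for $\gamma\in(0,2/(m_U+L_U))$ this Markov chain is known to have a unique invariant probability measure $\pi_\gamma^{(\mathsf{ULA})}$. $\operatorname{Lip}_{\mathsf d}(L)$ is the set of real functions $h$ with $|h(x)-h(y)|\le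 L\,\mathsf d(x,y)$. $W_2^{\mathsf d}$ is the Wasserstein distance of order 2 for $\mathsf d$. $\xi\in T_2(\beta)$ means $W_2^{\mathsf d}(\xi,\nu)\le\sqrt{2\beta\operatorname{KL}(\nu|\xi)}$ for every probability measure $\nu$ ($\operatorname{KL}$ = Kullback–Leibler divergence). $a\vee b=\max(a,b)$. $\mathcal H=\{f-g:g\in\mathcal G\}$ where $f$ is fixed and $\mathcal G$ is a set of functions with zero mean under the invariant measure, $\pi_\gamma^{(\mathsf{ULA})}(g)=0$; $\mathcal H$ is totally bounded in $L^2(\pi_\gamma^{(\mathsf{ULA})})$. For $h\in\mathcal H$, $$V_\infty^{(\mathsf{ULA})}(h)=\sum_{\ell\in\mathbb Z}\mathsf E_{\pi_\gamma^{(\mathsf{ULA})}}\bigl[(h(X_0)-\pi_\gamma^{(\mathsf{ULA})}(f))(h(X_{|\ell|})-\pi_\gamma^{(\mathsf{ULA})}(f))\bigr],$$ the expectation being for the chain started from $\pi_\gamma^{(\mathsf{ULA})}$. Spectral variance based on $X_0,\dots,X_{n-1}$: $V_n(h)=\sum_{|\ell|<b_n}w_n(\ell)\rho_n^{(h)}(\ell)$, where for $\ell\ge0$, $\rho_n^{(h)}(\ell)=\rho_n^{(h)}(-\ell)=n^{-1}\sum_{k=0}^{n-\ell-1}(h(X_k)-\pi_n(h))(h(X_{k+\ell})-\pi_n(h))$, $\pi_n(h)=n^{-1}\sum_{k=0}^{n-1}h(X_k)$, $w_n(\ell)=w(\ell/b_n)$, $w$ symmetric, non-negative, supported on $[-1,1]$,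 $\sup_{y\in[0,1]}|w(y)|\le1$, $w(y)=1$ on $[-1/2,1/2]$. $\mathcal H_\varepsilon\subset\mathcal H$ is a minimal (smallest cardinality) $\varepsilon$-net of $\mathcal H$ in $L^2(\pi_\gamma^{(\mathsf{ULA})})$, $|\mathcal H_\varepsilon|$ its cardinality, and $\widehat h_{n,\varepsilon}\in\operatorname{argmin}_{h\in\mathcal H_\varepsilon}V_n(h)$. The sample size is $n\ge2$. *)

theory Defs
  imports "HOL-Probability.Probability"
begin

text \<open>
  The constant hidden in the final bound must not depend on the dimension, so the dimension is a
  natural number and not a type: \<open>\<real>\<^sup>d\<close> is the space of the product measure space below, i.e. the
  functions \<^typ>\<open>nat \<Rightarrow> real\<close> that are \<open>undefined\<close> from index \<open>d\<close> on.
\<close>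

abbreviation Rd :: "nat \<Rightarrow> (nat \<Rightarrow> real) measure" where
  "Rd d \<equiv> Pi\<^sub>M {..<d} (\<lambda>_. borel)"

definition eucl_dist :: "nat \<Rightarrow> (nat \<Rightarrow> real) \<Rightarrow> (nat \<Rightarrow> real) \<Rightarrow> real" where
  "eucl_dist d x y = L2_set (\<lambda>i. x i - y i) {..<d}"

definition std_gaussian :: "nat \<Rightarrow> (nat \<Rightarrow> real) measure" where
  "std_gaussian d = Pi\<^sub>M {..<d} (\<lambda>_. std_normal_distribution)"

definition grad :: "nat \<Rightarrow> ((nat \<Rightarrow> real) \<Rightarrow> real) \<Rightarrow> (nat \<Rightarrow> real) \<Rightarrow> nat \<Rightarrow> real" where
  "grad d U x = (\<lambda>i\<in>{..<d}. deriv (\<lambda>t. U (x(i := t))) (x i))"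

text \<open>
  All partial derivatives exist and are continuous. On \<open>space (Rd d)\<close> the product topology of
  \<^typ>\<open>nat \<Rightarrow> real\<close> is the Euclidean one, since the coordinates from \<open>d\<close> on are constant.
\<close>

definition continuously_differentiable :: "nat \<Rightarrow> ((nat \<Rightarrow> real) \<Rightarrow> real) \<Rightarrow> bool" where
  "continuously_differentiable d U \<longleftrightarrow>
    (\<forall>i<d. (\<forall>x\<in>space (Rd d). (\<lambda>t. U (x(i := t))) differentiable (at (x i))) \<and>
           continuous_on (space (Rd d)) (\<lambda>x. grad d U x i))"

definition ula_condition :: "nat \<Rightarrow> ((nat \<Rightarrow> real) \<Rightarrow> real) \<Rightarrow> real \<Rightarrow> real \<Rightarrow> bool" where
  "ula_condition d U L\<^sub>U m\<^sub>U \<longleftrightarrow>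
    continuously_differentiable d U \<and>
    0 < L\<^sub>U \<and>
    (\<forall>x\<in>space (Rd d). \<forall>y\<in>space (Rd d).
       eucl_dist d (grad d U x) (grad d U y) \<le> L\<^sub>U * eucl_dist d x y) \<and>
    0 < m\<^sub>U \<and>
    (\<forall>x\<in>space (Rd d). \<forall>y\<in>space (Rd d).
       U y \<ge> U x + (\<Sum>i<d. grad d U x i * (y i - x i)) + m\<^sub>U / 2 * (eucl_dist d y x)\<^sup>2)"


definition ula_step ::
  "nat \<Rightarrow> ((nat \<Rightarrow> real) \<Rightarrow> real) \<Rightarrow> real \<Rightarrow> (nat \<Rightarrow> real) \<Rightarrow> (nat \<Rightarrow> real) \<Rightarrow> nat \<Rightarrow> real" where
  "ula_step d U \<gamma> x z = (\<lambda>i\<in>{..<d}. x i - \<gamma> * grad d U x i + sqrt (2 * \<gamma>) * z i)"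

text \<open>
  The chain lives on its canonical space: an outcome \<open>(x, z)\<close> consists of the initial state and the
  noise sequence, \<open>z k\<close> being the noise used to go from time \<open>k\<close> to time \<open>Suc k\<close>.
\<close>

type_synonym ula_outcome = "(nat \<Rightarrow> real) \<times> (nat \<Rightarrow> nat \<Rightarrow> real)"

definition ula_space :: "nat \<Rightarrow> (nat \<Rightarrow> real) measure \<Rightarrow> ula_outcome measure" where
  "ula_space d \<xi> = \<xi> \<Otimes>\<^sub>M Pi\<^sub>M UNIV (\<lambda>_::nat. std_gaussian d)"

primrec ula_chain ::
  "nat \<Rightarrow> ((nat \<Rightarrow> real) \<Rightarrow> real) \<Rightarrow> real \<Rightarrow> ula_outcome \<Rightarrow> nat \<Rightarrow> nat \<Rightarrow> real" where
  "ula_chain d U \<gamma> \<omega> 0 = fst \<omega>"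
| "ula_chain d U \<gamma> \<omega> (Suc k) = ula_step d U \<gamma> (ula_chain d U \<gamma> \<omega> k) (snd \<omega> k)"

definition ula_kernel ::
  "nat \<Rightarrow> ((nat \<Rightarrow> real) \<Rightarrow> real) \<Rightarrow> real \<Rightarrow> (nat \<Rightarrow> real) \<Rightarrow> (nat \<Rightarrow> real) measure" where
  "ula_kernel d U \<gamma> x = distr (std_gaussian d) (Rd d) (ula_step d U \<gamma> x)"

definition ula_invariant ::
  "nat \<Rightarrow> ((nat \<Rightarrow> real) \<Rightarrow> real) \<Rightarrow> real \<Rightarrow> (nat \<Rightarrow> real) measure \<Rightarrow> bool" where
  "ula_invariant d U \<gamma> \<pi> \<longleftrightarrow>
    prob_space \<pi> \<and> sets \<pi> = sets (Rd d) \<and> (\<pi> \<bind> ula_kernel d U \<gamma>) = \<pi>"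


definition Lip :: "'a set \<Rightarrow> ('a \<Rightarrow> 'a \<Rightarrow> real) \<Rightarrow> real \<Rightarrow> ('a \<Rightarrow> real) set" where
  "Lip S c L = {h. \<forall>x\<in>S. \<forall>y\<in>S. \<bar>h x - h y\<bar> \<le> L * c x y}"

definition ennreal_sqrt :: "ennreal \<Rightarrow> ennreal" where
  "ennreal_sqrt x = (if x = \<top> then \<top> else ennreal (sqrt (enn2real x)))"

definition couplings :: "'a measure \<Rightarrow> 'b measure \<Rightarrow> ('a \<times> 'b) measure set" where
  "couplings \<mu> \<nu> =
    {q. sets q = sets (\<mu> \<Otimes>\<^sub>M \<nu>) \<and> distr q \<mu> fst = \<mu> \<and> distr q \<nu> snd = \<nu>}"

definition W2 :: "('a \<Rightarrow> 'a \<Rightarrow> real) \<Rightarrow> 'a measure \<Rightarrow> 'a measure \<Rightarrow> ennreal" where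
  "W2 c \<mu> \<nu> = ennreal_sqrt (INF q\<in>couplings \<mu> \<nu>. \<integral>\<^sup>+ (x, y). ennreal ((c x y)\<^sup>2) \<partial>q)"

text \<open>
  \<open>KL \<nu> \<xi>\<close> is the divergence of \<open>\<nu>\<close> from \<open>\<xi>\<close>; \<^const>\<open>KL_divergence\<close> takes the measures in the
  opposite order and is meaningful only in the finite case. For probability measures the negative
  part of \<open>log (d\<nu>/d\<xi>)\<close> is always \<open>\<nu>\<close>-integrable, so non-integrability means the value \<open>\<infinity>\<close>.
\<close>

definition KL :: "'a measure \<Rightarrow> 'a measure \<Rightarrow> ennreal" where
  "KL \<nu> \<xi> =
    (if absolutely_continuous \<xi> \<nu> \<and> integrable \<nu> (entropy_density (exp 1) \<xi> \<nu>)
     then ennreal (KL_divergence (exp 1) \<xi> \<nu>) else \<top>)"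

definition T2 :: "('a \<Rightarrow> 'a \<Rightarrow> real) \<Rightarrow> real \<Rightarrow> 'a measure set" where
  "T2 c \<beta> = {\<xi>. \<forall>\<nu>. prob_space \<nu> \<and> sets \<nu> = sets \<xi> \<longrightarrow>
     W2 c \<xi> \<nu> \<le> ennreal_sqrt (2 * ennreal \<beta> * KL \<nu> \<xi>)}"


definition L2_dist :: "'a measure \<Rightarrow> ('a \<Rightarrow> real) \<Rightarrow> ('a \<Rightarrow> real) \<Rightarrow> real" where
  "L2_dist \<pi> h h' = sqrt (\<integral>x. (h x - h' x)\<^sup>2 \<partial>\<pi>)"

definition eps_net ::
  "'a measure \<Rightarrow> ('a \<Rightarrow> real) set \<Rightarrow> real \<Rightarrow> ('a \<Rightarrow> real) set \<Rightarrow> bool" where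
  "eps_net \<pi> H \<epsilon> N \<longleftrightarrow> finite N \<and> N \<subseteq> H \<and> (\<forall>h\<in>H. \<exists>h'\<in>N. L2_dist \<pi> h h' \<le> \<epsilon>)"

definition minimal_eps_net ::
  "'a measure \<Rightarrow> ('a \<Rightarrow> real) set \<Rightarrow> real \<Rightarrow> ('a \<Rightarrow> real) set \<Rightarrow> bool" where
  "minimal_eps_net \<pi> H \<epsilon> N \<longleftrightarrow>
    eps_net \<pi> H \<epsilon> N \<and> (\<forall>N'. eps_net \<pi> H \<epsilon> N' \<longrightarrow> card N \<le> card N')"

definition totally_bounded_L2 :: "'a measure \<Rightarrow> ('a \<Rightarrow> real) set \<Rightarrow> bool" where
  "totally_bounded_L2 \<pi> H \<longleftrightarrow>
    (\<forall>h\<in>H. h \<in> borel_measurable \<pi> \<and> integrable \<pi> (\<lambda>x. (h x)\<^sup>2)) \<and>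
    (\<forall>\<epsilon>>0. \<exists>N. eps_net \<pi> H \<epsilon> N)"


text \<open>For Lipschitz \<open>h\<close> with \<open>\<pi>(h) = \<pi>(f)\<close> the autocovariances decay geometrically in \<open>\<bar>l\<bar>\<close>.\<close>

definition V_infinity ::
  "nat \<Rightarrow> ((nat \<Rightarrow> real) \<Rightarrow> real) \<Rightarrow> real \<Rightarrow> (nat \<Rightarrow> real) measure \<Rightarrow>
   ((nat \<Rightarrow> real) \<Rightarrow> real) \<Rightarrow> ((nat \<Rightarrow> real) \<Rightarrow> real) \<Rightarrow> real" where
  "V_infinity d U \<gamma> \<pi> f h =
    (\<Sum>\<^sub>\<infinity>l\<in>(UNIV :: int set).
       \<integral>\<omega>. (h (ula_chain d U \<gamma> \<omega> 0) - (\<integral>x. f x \<partial>\<pi>)) *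
           (h (ula_chain d U \<gamma> \<omega> (nat \<bar>l\<bar>)) - (\<integral>x. f x \<partial>\<pi>)) \<partial>ula_space d \<pi>)"

definition emp_mean :: "nat \<Rightarrow> (nat \<Rightarrow> 'a) \<Rightarrow> ('a \<Rightarrow> real) \<Rightarrow> real" where
  "emp_mean n X h = (\<Sum>k<n. h (X k)) / real n"

text \<open>For lags \<open>l \<ge> n\<close> the truncated difference \<open>n - l\<close> is \<open>0\<close> and the sum is empty.\<close>

definition emp_autocov :: "nat \<Rightarrow> (nat \<Rightarrow> 'a) \<Rightarrow> ('a \<Rightarrow> real) \<Rightarrow> nat \<Rightarrow> real" where
  "emp_autocov n X h l =
    (\<Sum>k<n - l. (h (X k) - emp_mean n X h) * (h (X (k + l)) - emp_mean n X h)) / real n"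

definition spectral_variance ::
  "(real \<Rightarrow> real) \<Rightarrow> nat \<Rightarrow> nat \<Rightarrow> (nat \<Rightarrow> 'a) \<Rightarrow> ('a \<Rightarrow> real) \<Rightarrow> real" where
  "spectral_variance w b n X h =
    (\<Sum>l | \<bar>l\<bar> < int b. w (of_int l / real b) * emp_autocov n X h (nat \<bar>l\<bar>))"

definition lag_window :: "(real \<Rightarrow> real) \<Rightarrow> bool" where
  "lag_window w \<longleftrightarrow>
    (\<forall>y. w (- y) = w y) \<and> (\<forall>y. 0 \<le> w y) \<and> (\<forall>y. y \<notin> {-1..1} \<longrightarrow> w y = 0) \<and>
    (\<forall>y\<in>{0..1}. \<bar>w y\<bar> \<le> 1) \<and> (\<forall>y\<in>{-1/2..1/2}. w y = 1)"


definition ula_kappa :: "real \<Rightarrow> real \<Rightarrow> real" where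
  "ula_kappa L\<^sub>U m\<^sub>U = 2 * m\<^sub>U * L\<^sub>U / (m\<^sub>U + L\<^sub>U)"

definition Delta2 :: "real \<Rightarrow> real \<Rightarrow> real" where
  "Delta2 \<kappa> \<gamma> = sqrt (1 - \<kappa> * \<gamma>)"

definition bandwidth :: "real \<Rightarrow> real \<Rightarrow> nat \<Rightarrow> nat" where
  "bandwidth \<kappa> \<gamma> n = 2 * nat \<lceil>ln (real n) / ln (1 / Delta2 \<kappa> \<gamma>)\<rceil>"

definition sup_variance :: "'a measure \<Rightarrow> ('a \<Rightarrow> real) set \<Rightarrow> real" where
  "sup_variance \<pi> H = (SUP h\<in>H. prob_space.variance \<pi> h)"

definition W2_spread :: "nat \<Rightarrow> (nat \<Rightarrow> real) measure \<Rightarrow> ennreal" where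
  "W2_spread d \<pi> = ennreal_sqrt (\<integral>\<^sup>+ y. (W2 (eucl_dist d) (return (Rd d) y) \<pi>)\<^sup>2 \<partial>\<pi>)"

text \<open>
  For \<open>\<pi>\<close> invariant and \<open>\<xi> \<in> T2 (eucl_dist d) \<beta>\<close> both measures have finite second moments, so
  \<^const>\<open>enn2real\<close> is only applied to finite values below.
\<close>

definition const_A1 :: "nat \<Rightarrow> (nat \<Rightarrow> real) measure \<Rightarrow> (nat \<Rightarrow> real) measure \<Rightarrow> ennreal" where
  "const_A1 d \<xi> \<pi> =
    2 * (INF x\<in>space (Rd d). W2 (eucl_dist d) (return (Rd d) x) \<pi>) +
    2 * W2 (eucl_dist d) \<xi> \<pi> + W2_spread d \<pi>"

definition const_R ::
  "nat \<Rightarrow> real \<Rightarrow> real \<Rightarrow> real \<Rightarrow> (nat \<Rightarrow> real) measure \<Rightarrow> (nat \<Rightarrow> real) measure \<Rightarrow> real" where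
  "const_R d L \<kappa> \<gamma> \<xi> \<pi> =
    enn2real (const_A1 d \<xi> \<pi>) * L\<^sup>2 * inverse (1 - Delta2 \<kappa> \<gamma>) *
    enn2real (W2 (eucl_dist d) \<xi> \<pi>)"

definition const_sigma ::
  "nat \<Rightarrow> real \<Rightarrow> (nat \<Rightarrow> real) measure \<Rightarrow> ((nat \<Rightarrow> real) \<Rightarrow> real) set \<Rightarrow> real" where
  "const_sigma d L \<pi> H = L * sqrt (sup_variance \<pi> H) * enn2real (W2_spread d \<pi>)"

definition const_C1 :: "real \<Rightarrow> real \<Rightarrow> real \<Rightarrow> real \<Rightarrow> real" where
  "const_C1 \<kappa> \<gamma> D R = (sqrt R + sqrt D) / (\<kappa> * \<gamma>)"

definition const_C2 :: "real \<Rightarrow> real \<Rightarrow> real \<Rightarrow> real \<Rightarrow> real \<Rightarrow> real \<Rightarrow> real" where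
  "const_C2 L \<beta> \<kappa> \<gamma> D R =
    L * sqrt (max \<beta> \<gamma> * (D + R)) / (\<kappa>\<^sup>2 * \<gamma>\<^sup>2) + sqrt (D * R) / (\<kappa> * \<gamma>)"

definition const_C3 :: "real \<Rightarrow> real \<Rightarrow> real \<Rightarrow> real \<Rightarrow> real \<Rightarrow> real \<Rightarrow> real" where
  "const_C3 L \<beta> \<kappa> \<gamma> R \<sigma> =
    L\<^sup>2 * max \<beta> \<gamma> / (\<kappa> ^ 4 * \<gamma> ^ 4) + R / (\<kappa> * \<gamma>) + \<sigma> / (\<kappa>\<^sup>2 * \<gamma>\<^sup>2)"

end

theory Submission
  imports Defs
begin

text \<open>By co-coercivity of the gradient a step of the chain contracts by \<open>\<Delta>\<^sub>2\<close> under synchronous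
  coupling. The chain need not be reversible, so its \<open>L\<^sup>2(\<pi>)\<close> mixing is obtained from the noise:
  Maurey's property (tau) gives a Gaussian Poincare inequality, and with the Cameron-Martin shift it
  shows that the decrements of \<open>\<parallel>P\<^sup>k u\<parallel>\<^sup>2\<close> decay like \<open>\<Delta>\<^sub>2\<^bsup>2k\<^esup>\<close>. Hence \<open>P\<close> contracts centered functions by
  \<open>\<Delta>\<^sub>2\<close>, which bounds the lag-window and centering biases and makes the asymptotic variance
  Lipschitz in \<open>L\<^sup>2(\<pi>)\<close>.

  For the fluctuations, write \<open>n V\<^sub>n\<close> as the difference of the squares of two seminorms of the
  centered path. Both are Lipschitz functions of the initial state and the noise, hence concentrate:
  in the noise by property (tau), in the initial state by the Bobkov-Goetze form of \<open>T\<^sub>2(\<beta>)\<close>.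
  The expectation is compared with the stationary one through a near-optimal coupling of \<open>\<xi>\<close> and
  \<open>\<pi>\<close>. A union bound over the net finishes the proof; for a one-point net there is nothing random
  to control.\<close>


section \<open>Contraction of the gradient step\<close>

text \<open>The coupling controls Lipschitz constants only, whereas D and the net are measured in
  L^2(\<pi>). Let \<open>local_var\<close> u x be the variance of u after one step from x.
  Stationarity gives |u|^2 - |P u|^2 = \<pi>(\<open>local_var\<close> u). The noise shift bounds the
  local slope of P u by rate / sqrt (2 \<gamma>) times the root of \<open>local_var\<close> u. The
  Poincare inequality for noise of variance 2 \<gamma> turns this slope into a bound on
  \<open>local_var\<close> (P u). The powers of \<gamma> cancel and leave rate^2.

  The window need not be positive definite, so the lag form has no square root by itself. Adding 2 b
  times the squared norm makes it nonnegative, and the added part is again the square of a seminorm.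
  Along the path the Lipschitz constants of both seminorms depend on n only through the bandwidth,
  which produces the rate.

  A one-point net is separate because ln (1 / \<delta>) can be arbitrarily small and then cannot
  absorb numerical constants. With two points ln (card / \<delta>) is at least ln 2.\<close>

lemma sum_mult_le_L2_set: "(\<Sum>i\<in>A. f i * g i) \<le> L2_set f A * L2_set g A" for f g :: "'a \<Rightarrow> real"
proof -
  have "(\<Sum>i\<in>A. f i * g i) \<le> (\<Sum>i\<in>A. \<bar>f i\<bar> * \<bar>g i\<bar>)"
    by (intro sum_mono) (metis abs_ge_self abs_mult)
  with L2_set_mult_ineq[of f g A] show ?thesis by simp
qed

lemma L2_set_power2: "(L2_set f A)\<^sup>2 = (\<Sum>i\<in>A. (f i)\<^sup>2)"
  unfolding L2_set_def by (simp add: sum_nonneg)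

lemma eucl_dist_power2: "(eucl_dist d x y)\<^sup>2 = (\<Sum>i<d. (x i - y i)\<^sup>2)"
  unfolding eucl_dist_def by (rule L2_set_power2)

lemma eucl_dist_nonneg [simp]: "0 \<le> eucl_dist d x y"
  by (simp add: eucl_dist_def)

lemma eucl_dist_commute: "eucl_dist d x y = eucl_dist d y x"
  unfolding eucl_dist_def L2_set_def by (simp add: power2_commute)

lemma eucl_dist_triangle: "eucl_dist d x z \<le> eucl_dist d x y + eucl_dist d y z"
  using L2_set_triangle_ineq[of "\<lambda>i. x i - y i" "\<lambda>i. y i - z i" "{..<d}"]
  by (simp add: eucl_dist_def)

lemma eucl_dist_self [simp]: "eucl_dist d x x = 0"
  by (simp add: eucl_dist_def L2_set_def)

lemma space_Rd: "space (Rd d) = PiE {..<d} (\<lambda>_. UNIV)"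
  by (simp add: space_PiM)

lemma restrict_in_space_Rd [simp]: "restrict f {..<d} \<in> space (Rd d)"
  by (simp add: space_Rd)

text \<open>Convexity between consecutive points of a uniform subdivision of the segment gives the
  descent lemma without any integration along the segment.\<close>

lemma descent_lemma:
  fixes U :: "(nat \<Rightarrow> real) \<Rightarrow> real" and g :: "(nat \<Rightarrow> real) \<Rightarrow> nat \<Rightarrow> real"
  assumes conv: "\<And>x y. x \<in> space (Rd d) \<Longrightarrow> y \<in> space (Rd d) \<Longrightarrow> U y \<ge> U x + (\<Sum>i<d. g x i * (y i - x i))"
    and lip: "\<And>x y. x \<in> space (Rd d) \<Longrightarrow> y \<in> space (Rd d) \<Longrightarrow> eucl_dist d (g x) (g y) \<le> L * eucl_dist d x y"
    and x: "x \<in> space (Rd d)" and y: "y \<in> space (Rd d)"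
  shows "U y \<le> U x + (\<Sum>i<d. g x i * (y i - x i)) + L / 2 * (eucl_dist d x y)\<^sup>2"
proof -
  define r where "r = eucl_dist d x y"
  define s where "s = (\<Sum>i<d. g x i * (y i - x i))"
  \<comment> \<open>Convexity from \<open>p (Suc j)\<close> bounds each increment by the slope at
    the right end of its piece. The resulting right Riemann sum overshoots the quadratic term by the
    factor 1 + 1 / N, which disappears in the limit.\<close>
  have bound: "U y \<le> U x + s + L / 2 * r\<^sup>2 * (1 + 1 / real N)" if N: "N > 0" for N :: nat
  proof -
    define p where "p j = (\<lambda>i\<in>{..<d}. x i + real j / real N * (y i - x i))" for j :: nat
    have pS: "p j \<in> space (Rd d)" for j by (simp add: p_def)
    have p0: "p 0 = x" and pN: "p N = y"
      using x y N by (auto simp: p_def space_Rd PiE_def extensional_def fun_eq_iff)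
    have step: "U (p (Suc j)) - U (p j) \<le> s / N + L * r\<^sup>2 * (real (Suc j) / N\<^sup>2)" for j
    proof -
      have "U (p (Suc j)) - U (p j) \<le> - (\<Sum>i<d. g (p (Suc j)) i * (p j i - p (Suc j) i))"
        using conv[OF pS pS, of "Suc j" j] by linarith
      also have "\<dots> = (\<Sum>i<d. g (p (Suc j)) i * (y i - x i)) / N"
        unfolding sum_negf[symmetric] sum_divide_distrib using N
        by (intro sum.cong) (auto simp: p_def field_simps)
      also have "(\<Sum>i<d. g (p (Suc j)) i * (y i - x i))
          = s + (\<Sum>i<d. (g (p (Suc j)) i - g x i) * (y i - x i))"
        unfolding s_def sum.distrib[symmetric] by (intro sum.cong) (auto simp: algebra_simps)
      also have "(\<Sum>i<d. (g (p (Suc j)) i - g x i) * (y i - x i))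
          \<le> eucl_dist d (g (p (Suc j))) (g x) * eucl_dist d y x"
        unfolding eucl_dist_def by (rule sum_mult_le_L2_set)
      also have "\<dots> \<le> L * eucl_dist d (p (Suc j)) x * eucl_dist d y x"
        by (intro mult_right_mono lip pS x) auto
      also have "eucl_dist d (p (Suc j)) x = real (Suc j) / N * r"
      proof -
        have "eucl_dist d (p (Suc j)) x = L2_set (\<lambda>i. real (Suc j) / N * (y i - x i)) {..<d}"
          unfolding eucl_dist_def by (rule L2_set_cong) (auto simp: p_def)
        also have "\<dots> = real (Suc j) / N * L2_set (\<lambda>i. y i - x i) {..<d}"
          by (subst L2_set_right_distrib) auto
        also have "L2_set (\<lambda>i. y i - x i) {..<d} = r"
          unfolding r_def eucl_dist_commute[of d x y] by (simp add: eucl_dist_def)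
        finally show ?thesis .
      qed
      also have "L * (real (Suc j) / real N * r) * eucl_dist d y x = L * r\<^sup>2 * (real (Suc j) / N)"
        by (simp add: r_def eucl_dist_commute[of d x] power2_eq_square)
      finally have "U (p (Suc j)) - U (p j) \<le> (s + L * r\<^sup>2 * (real (Suc j) / N)) / N"
        using N by (simp add: divide_right_mono)
      then show ?thesis using N by (simp add: add_divide_distrib power2_eq_square distrib_left)
    qed
    have "U y - U x = (\<Sum>j<N. U (p (Suc j)) - U (p j))"
      using sum_lessThan_telescope[of "\<lambda>j. U (p j)" N] by (simp only: p0 pN)
    also have "\<dots> \<le> (\<Sum>j<N. s / N + L * r\<^sup>2 * (real (Suc j) / N\<^sup>2))"
      by (intro sum_mono step)
    also have "\<dots> = s + L * r\<^sup>2 / N\<^sup>2 * (\<Sum>j<N. real (Suc j))"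
      using N by (simp only: sum.distrib sum_distrib_left sum_constant card_lessThan) simp
    also have "(\<Sum>j<N. real (Suc j)) = real N * (real N + 1) / 2"
      by (induction N) (auto simp: field_simps)
    also have "L * r\<^sup>2 / N\<^sup>2 * (real N * (real N + 1) / 2) = L / 2 * r\<^sup>2 * (1 + 1 / real N)"
      using N by (simp add: field_simps power2_eq_square)
    finally show ?thesis by linarith
  qed
  have "(\<lambda>N. U x + s + L / 2 * r\<^sup>2 * (1 + 1 / real N)) \<longlonglongrightarrow> U x + s + L / 2 * r\<^sup>2 * (1 + 0)"
    by (intro tendsto_intros lim_1_over_n)
  then have "U y \<le> U x + s + L / 2 * r\<^sup>2 * (1 + 0)"
  proof (rule tendsto_lowerbound)
    show "\<forall>\<^sub>F N in sequentially. U y \<le> U x + s + L / 2 * r\<^sup>2 * (1 + 1 / real N)"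
      using bound by (intro eventually_sequentiallyI[of 1]) simp
  qed simp
  then show ?thesis by (simp add: r_def s_def)
qed

text \<open>Co-coercivity of the gradient of U - (m / 2) |x|^2, a convex function with smoothness
  constant M = L - m, rewritten in terms of U. Using both constants at once is what produces
  \<kappa> = 2 m L / (m + L).\<close>

lemma ula_cocoercive:
  assumes ula: "ula_condition d U L m" and x: "x \<in> space (Rd d)" and y: "y \<in> space (Rd d)"
  defines "g \<equiv> grad d U"
  shows "(m + L) * (\<Sum>i<d. (g x i - g y i) * (x i - y i))
    \<ge> (eucl_dist d (g x) (g y))\<^sup>2 + m * L * (eucl_dist d x y)\<^sup>2"
proof -
  have m: "0 < m" and L: "0 < L" using ula by (auto simp: ula_condition_def)
  have lip: "eucl_dist d (g x) (g y) \<le> L * eucl_dist d x y"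
    if "x \<in> space (Rd d)" "y \<in> space (Rd d)" for x y
    using ula that by (auto simp: ula_condition_def g_def)
  have sc: "U y \<ge> U x + (\<Sum>i<d. g x i * (y i - x i)) + m / 2 * (eucl_dist d y x)\<^sup>2"
    if "x \<in> space (Rd d)" "y \<in> space (Rd d)" for x y
    using ula that by (auto simp: ula_condition_def g_def)
  have conv: "U y \<ge> U x + (\<Sum>i<d. g x i * (y i - x i))"
    if "x \<in> space (Rd d)" "y \<in> space (Rd d)" for x y
    using sc[OF that] m by (smt (verit) divide_nonneg_nonneg mult_nonneg_nonneg zero_le_power2)
  have desc: "U y \<le> U x + (\<Sum>i<d. g x i * (y i - x i)) + L / 2 * (eucl_dist d x y)\<^sup>2"
    if "x \<in> space (Rd d)" "y \<in> space (Rd d)" for x y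
    using conv lip that by (intro descent_lemma)
  define S where "S x y = (\<Sum>i<d. (g x i - g y i) * (x i - y i))" for x y
  define N where "N x y = (\<Sum>i<d. (x i - y i)\<^sup>2)" for x y :: "nat \<Rightarrow> real"
  define M where "M = L - m"
  define q where "q i = (g x i - g y i) - m * (x i - y i)" for i
  define Q where "Q = (\<Sum>i<d. (q i)\<^sup>2)"
  have N0: "0 \<le> N x y" for x y by (simp add: N_def sum_nonneg)
  have SN: "S x y \<ge> m * N x y"
    using sc[OF x y] sc[OF y x] unfolding eucl_dist_power2 N_def S_def
    by (simp add: algebra_simps sum.distrib sum_subtractf power2_eq_square)
  \<comment> \<open>The test point \<open>z\<close> is a descent step of length \<open>t\<close>
    from \<open>b\<close> along h, the gradient difference of the shifted function. Strong convexity
    from \<open>a\<close> and the descent lemma from \<open>b\<close> enclose U z; comparing them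
    leaves a quadratic in \<open>t\<close>.\<close>
  have half: "U b - U a - (\<Sum>i<d. g a i * (b i - a i)) - m / 2 * N a b
      \<ge> t * (\<Sum>i<d. (h i)\<^sup>2) - M / 2 * t\<^sup>2 * (\<Sum>i<d. (h i)\<^sup>2)"
    if a: "a \<in> space (Rd d)" and b: "b \<in> space (Rd d)"
      and h: "\<And>i. h i = (g b i - g a i) - m * (b i - a i)" for a b t h
  proof -
    define z where "z = (\<lambda>i\<in>{..<d}. b i - t * h i)"
    have z: "z \<in> space (Rd d)" by (simp add: z_def)
    have zi: "i < d \<Longrightarrow> z i = b i - t * h i" for i by (simp add: z_def)
    have 1: "U z \<ge> U a + (\<Sum>i<d. g a i * (z i - a i)) + m / 2 * (\<Sum>i<d. (z i - a i)\<^sup>2)"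
      using sc[OF a z] by (simp add: eucl_dist_power2)
    have 2: "U z \<le> U b + (\<Sum>i<d. g b i * (z i - b i)) + L / 2 * (\<Sum>i<d. (b i - z i)\<^sup>2)"
      using desc[OF b z] by (simp add: eucl_dist_power2)
    have "(\<Sum>i<d. g a i * (z i - a i)) + m / 2 * (\<Sum>i<d. (z i - a i)\<^sup>2)
      - (\<Sum>i<d. g b i * (z i - b i)) - L / 2 * (\<Sum>i<d. (b i - z i)\<^sup>2)
      = (\<Sum>i<d. g a i * (z i - a i) + m / 2 * (z i - a i)\<^sup>2 - g b i * (z i - b i) - L / 2 * (b i - z i)\<^sup>2)"
      by (simp add: sum.distrib sum_subtractf sum_distrib_left)
    also have "\<dots> = (\<Sum>i<d. g a i * (b i - a i) + m / 2 * (a i - b i)\<^sup>2 + t * (h i)\<^sup>2 - M / 2 * t\<^sup>2 * (h i)\<^sup>2)"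
    proof (rule sum.cong[OF refl])
      fix i assume "i \<in> {..<d}"
      then have z: "z i = b i - t * h i" by (simp add: zi)
      have gb: "g b i = h i + g a i + m * (b i - a i)" using h[of i] by simp
      show "g a i * (z i - a i) + m / 2 * (z i - a i)\<^sup>2 - g b i * (z i - b i) - L / 2 * (b i - z i)\<^sup>2
        = g a i * (b i - a i) + m / 2 * (a i - b i)\<^sup>2 + t * (h i)\<^sup>2 - M / 2 * t\<^sup>2 * (h i)\<^sup>2"
        unfolding z gb M_def by (simp add: field_simps power2_eq_square)
    qed
    also have "\<dots> = (\<Sum>i<d. g a i * (b i - a i)) + m / 2 * N a b + t * (\<Sum>i<d. (h i)\<^sup>2) - M / 2 * t\<^sup>2 * (\<Sum>i<d. (h i)\<^sup>2)"
      by (simp add: sum.distrib sum_subtractf sum_distrib_left N_def)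
    finally show ?thesis using 1 2 by linarith
  qed
  have Q2: "(\<Sum>i<d. (- q i)\<^sup>2) = Q" by (simp add: Q_def)
  \<comment> \<open>Adding \<open>half\<close> for (x, y) and (y, x) cancels the function values.
    The best choice of \<open>t\<close> below is 1 / M.\<close>
  have key: "S x y - m * N x y \<ge> (2 * t - M * t\<^sup>2) * Q" for t
  proof -
    have a: "U x - U y - (\<Sum>i<d. g y i * (x i - y i)) - m / 2 * N y x \<ge> t * Q - M / 2 * t\<^sup>2 * Q"
      using half[OF y x, of q t] unfolding Q_def by (simp add: q_def)
    have b: "U y - U x - (\<Sum>i<d. g x i * (y i - x i)) - m / 2 * N x y \<ge> t * Q - M / 2 * t\<^sup>2 * Q"
    proof -
      have "- q i = (g y i - g x i) - m * (y i - x i)" for i by (simp add: q_def algebra_simps)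
      from half[OF x y this, of t] show ?thesis unfolding Q2 .
    qed
    have c: "- (\<Sum>i<d. g y i * (x i - y i)) - (\<Sum>i<d. g x i * (y i - x i)) = S x y"
      unfolding S_def sum_negf[symmetric] sum_subtractf[symmetric]
      by (intro sum.cong) (auto simp: algebra_simps)
    have d: "N y x = N x y" unfolding N_def by (intro sum.cong) (auto simp: power2_commute)
    have "- (\<Sum>i<d. g y i * (x i - y i)) - (\<Sum>i<d. g x i * (y i - x i)) - m * N x y \<ge> 2 * (t * Q - M / 2 * t\<^sup>2 * Q)"
    proof -
      define T where "T = t * Q - M / 2 * t\<^sup>2 * Q"
      define K where "K = m / 2 * N x y"
      have K: "m * N x y = 2 * K" by (simp add: K_def)
      show ?thesis
        using a b unfolding d K T_def[symmetric] K_def[symmetric] by linarith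
    qed
    then show ?thesis unfolding c by (simp add: algebra_simps)
  qed
  have Q0: "0 \<le> Q" by (simp add: Q_def sum_nonneg)
  have main: "Q \<le> M * (S x y - m * N x y)"
  proof (cases "M > 0")
    case True
    have "M * (S x y - m * N x y) \<ge> M * ((2 * (1 / M) - M * (1 / M)\<^sup>2) * Q)"
      using key[of "1 / M"] True by (intro mult_left_mono) auto
    moreover have "M * ((2 * (1 / M) - M * (1 / M)\<^sup>2) * Q) = Q"
      using True by (simp add: field_simps power2_eq_square)
    ultimately show ?thesis by linarith
  next
    \<comment> \<open>M can be negative only when x = y, since m N \<le> S \<le> L N. For M = 0 the
      bound \<open>key\<close> is linear in \<open>t\<close>, which forces Q to vanish.\<close>
    case False
    show ?thesis
    proof (cases "N x y = 0")
      case True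
      have "\<forall>i<d. x i = y i" using True by (simp add: N_def sum_nonneg_eq_0_iff)
      then have "x = y" using x y by (intro PiE_ext[OF x[unfolded space_Rd] y[unfolded space_Rd]]) auto
      then show ?thesis by (simp add: Q_def q_def S_def N_def)
    next
      case False
      have "S x y \<le> eucl_dist d (g x) (g y) * eucl_dist d x y"
        unfolding eucl_dist_def S_def by (rule sum_mult_le_L2_set)
      also have "\<dots> \<le> L * eucl_dist d x y * eucl_dist d x y" by (intro mult_right_mono lip x y) auto
      also have "\<dots> = L * N x y" using eucl_dist_power2[of d x y] by (simp add: N_def power2_eq_square)
      finally have "m * N x y \<le> L * N x y" using SN by linarith
      then have "M \<ge> 0" using False N0[of x y] by (simp add: M_def)
      with \<open>\<not> M > 0\<close> have M: "M = 0" by simp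
      have "Q \<le> 0"
      proof (rule ccontr)
        assume "\<not> Q \<le> 0"
        then show False using key[of "(S x y - m * N x y + 1) / (2 * Q)"] M by (simp add: field_simps)
      qed
      then show ?thesis using M by simp
    qed
  qed
  have "Q = (\<Sum>i<d. (g x i - g y i)\<^sup>2) - 2 * m * S x y + m\<^sup>2 * N x y"
    unfolding Q_def S_def N_def q_def sum_distrib_left sum_subtractf[symmetric] sum.distrib[symmetric]
    by (intro sum.cong) (auto simp: algebra_simps power2_eq_square)
  with main show ?thesis
    unfolding eucl_dist_power2 M_def S_def[symmetric] N_def[symmetric]
    by (simp add: algebra_simps power2_eq_square)
qed

text \<open>Both bounds are strict, so \<open>Delta2\<close> lies strictly between 0 and 1:
  \<open>local_lipschitz_poincare\<close> asks for a positive constant, and the geometric series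
  need a rate below 1.\<close>

lemma kappa_gamma_bounds:
  assumes "0 < L" "0 < m" "0 < \<gamma>" "\<gamma> < 2 / (m + L)"
  shows "0 < ula_kappa L m * \<gamma>" "ula_kappa L m * \<gamma> < 1"
proof -
  show "0 < ula_kappa L m * \<gamma>" using assms by (simp add: ula_kappa_def)
  have k: "0 < ula_kappa L m" using assms by (simp add: ula_kappa_def)
  have "ula_kappa L m * \<gamma> < ula_kappa L m * (2 / (m + L))"
    using assms k by (intro mult_strict_left_mono) auto
  also have "\<dots> = 4 * m * L / (m + L)\<^sup>2" by (simp add: ula_kappa_def power2_eq_square)
  also have "\<dots> \<le> 1"
  proof -
    have "4 * m * L \<le> (m + L)\<^sup>2" using zero_le_power2[of "m - L"] by (simp add: power2_eq_square algebra_simps)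
    then show ?thesis using assms by simp
  qed
  finally show "ula_kappa L m * \<gamma> < 1" .
qed

lemma Delta2_bounds:
  assumes "0 < \<kappa> * \<gamma>" "\<kappa> * \<gamma> < 1"
  shows "0 < Delta2 \<kappa> \<gamma>" "Delta2 \<kappa> \<gamma> < 1" "(Delta2 \<kappa> \<gamma>)\<^sup>2 = 1 - \<kappa> * \<gamma>"
    "\<kappa> * \<gamma> / 2 \<le> 1 - Delta2 \<kappa> \<gamma>" "1 - Delta2 \<kappa> \<gamma> \<le> \<kappa> * \<gamma>"
proof -
  let ?D = "Delta2 \<kappa> \<gamma>"
  show 1: "0 < ?D" and 2: "?D < 1" and 3: "?D\<^sup>2 = 1 - \<kappa> * \<gamma>" using assms by (auto simp: Delta2_def)
  have "(1 - ?D) * (1 + ?D) = \<kappa> * \<gamma>" using 3 by (simp add: algebra_simps power2_eq_square)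
  then show "\<kappa> * \<gamma> / 2 \<le> 1 - ?D" "1 - ?D \<le> \<kappa> * \<gamma>"
    using 1 2 mult_left_mono[of "1 + ?D" 2 "1 - ?D"] mult_left_mono[of 1 "1 + ?D" "1 - ?D"] by auto
qed

lemma gradient_step_contraction:
  assumes ula: "ula_condition d U L m" and \<gamma>: "0 < \<gamma>" "\<gamma> < 2 / (m + L)"
    and x: "x \<in> space (Rd d)" and y: "y \<in> space (Rd d)"
  shows "eucl_dist d (\<lambda>i. x i - \<gamma> * grad d U x i) (\<lambda>i. y i - \<gamma> * grad d U y i)
    \<le> Delta2 (ula_kappa L m) \<gamma> * eucl_dist d x y"
proof -
  have m: "0 < m" and L: "0 < L" using ula by (auto simp: ula_condition_def)
  let ?g = "grad d U"
  define S where "S = (\<Sum>i<d. (?g x i - ?g y i) * (x i - y i))"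
  define N where "N = (eucl_dist d x y)\<^sup>2"
  define G where "G = (eucl_dist d (?g x) (?g y))\<^sup>2"
  have coc: "(m + L) * S \<ge> G + m * L * N"
    using ula_cocoercive[OF ula x y] by (simp add: S_def N_def G_def)
  have S: "S \<ge> G / (m + L) + m * L * N / (m + L)"
    using coc m L by (simp add: add_divide_distrib[symmetric] pos_divide_le_eq mult.commute)
  have "(eucl_dist d (\<lambda>i. x i - \<gamma> * ?g x i) (\<lambda>i. y i - \<gamma> * ?g y i))\<^sup>2 = N - 2 * \<gamma> * S + \<gamma>\<^sup>2 * G"
    unfolding N_def G_def S_def eucl_dist_power2 sum_distrib_left sum_subtractf[symmetric] sum.distrib[symmetric]
    by (intro sum.cong) (auto simp: algebra_simps power2_eq_square)
  also have "\<dots> \<le> N - 2 * \<gamma> * (G / (m + L) + m * L * N / (m + L)) + \<gamma>\<^sup>2 * G"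
    using S \<gamma> by (intro add_right_mono diff_left_mono mult_left_mono) auto
  also have "\<dots> = (1 - ula_kappa L m * \<gamma>) * N - \<gamma> * G * (2 / (m + L) - \<gamma>)"
    by (simp add: ula_kappa_def algebra_simps power2_eq_square)
  \<comment> \<open>The step-size condition enters here: \<gamma> < 2 / (m + L) gives the gradient
    term a favourable sign.\<close>
  also have "\<dots> \<le> (1 - ula_kappa L m * \<gamma>) * N"
    using \<gamma> by (simp add: G_def)
  also have "\<dots> = (Delta2 (ula_kappa L m) \<gamma> * eucl_dist d x y)\<^sup>2"
    using Delta2_bounds(3)[OF kappa_gamma_bounds[OF L m \<gamma>]] by (simp add: N_def power_mult_distrib)
  finally show ?thesis
    using Delta2_bounds(1)[OF kappa_gamma_bounds[OF L m \<gamma>]] by (auto intro: power2_le_imp_le)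
qed

lemma ula_step_in_space [simp]: "ula_step d U \<gamma> x z \<in> space (Rd d)"
  by (simp add: ula_step_def)

lemma ula_step_dist:
  assumes ula: "ula_condition d U L m" and \<gamma>: "0 < \<gamma>" "\<gamma> < 2 / (m + L)"
    and x: "x \<in> space (Rd d)" and y: "y \<in> space (Rd d)"
  shows "eucl_dist d (ula_step d U \<gamma> x z) (ula_step d U \<gamma> y z')
    \<le> Delta2 (ula_kappa L m) \<gamma> * eucl_dist d x y + sqrt (2 * \<gamma>) * eucl_dist d z z'"
proof -
  let ?g = "grad d U"
  have "eucl_dist d (ula_step d U \<gamma> x z) (ula_step d U \<gamma> y z')
    = L2_set (\<lambda>i. ((x i - \<gamma> * ?g x i) - (y i - \<gamma> * ?g y i)) + sqrt (2 * \<gamma>) * (z i - z' i)) {..<d}"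
    unfolding eucl_dist_def by (intro L2_set_cong) (auto simp: ula_step_def algebra_simps)
  also have "\<dots> \<le> eucl_dist d (\<lambda>i. x i - \<gamma> * ?g x i) (\<lambda>i. y i - \<gamma> * ?g y i)
      + L2_set (\<lambda>i. sqrt (2 * \<gamma>) * (z i - z' i)) {..<d}"
    unfolding eucl_dist_def by (rule L2_set_triangle_ineq)
  also have "L2_set (\<lambda>i. sqrt (2 * \<gamma>) * (z i - z' i)) {..<d} = sqrt (2 * \<gamma>) * eucl_dist d z z'"
    unfolding eucl_dist_def using \<gamma> by (subst L2_set_right_distrib) auto
  finally show ?thesis using gradient_step_contraction[OF ula \<gamma> x y] by linarith
qed

section \<open>Property (tau) for Gaussian measures\<close>

lemma nn_integral_layer_cake:
  assumes "sigma_finite_measure M" and [measurable]: "a \<in> borel_measurable M" and "\<And>x. 0 \<le> a x"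
  shows "(\<integral>\<^sup>+x. ennreal (a x) \<partial>M)
    = (\<integral>\<^sup>+t. indicator {0<..} t * emeasure M {x\<in>space M. t < a x} \<partial>lborel)"
proof -
  interpret M: sigma_finite_measure M by fact
  interpret pair_sigma_finite M lborel ..
  have "(\<integral>\<^sup>+x. ennreal (a x) \<partial>M) = (\<integral>\<^sup>+x. (\<integral>\<^sup>+t. indicator {0<..<a x} t \<partial>lborel) \<partial>M)"
    using assms by (intro nn_integral_cong) simp
  also have "\<dots> = (\<integral>\<^sup>+x. (\<integral>\<^sup>+t. (if 0 < t \<and> t < a x then 1 else 0) \<partial>lborel) \<partial>M)"
    by (intro nn_integral_cong) (auto simp: indicator_def)
  also have "\<dots> = (\<integral>\<^sup>+t. (\<integral>\<^sup>+x. (if 0 < t \<and> t < a x then 1 else 0) \<partial>M) \<partial>lborel)"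
    by (rule Fubini'[symmetric]) measurable
  also have "\<dots> = (\<integral>\<^sup>+t. indicator {0<..} t * emeasure M {x\<in>space M. t < a x} \<partial>lborel)"
  proof (rule nn_integral_cong)
    fix t :: real
    have "(\<integral>\<^sup>+x. (if 0 < t \<and> t < a x then 1 else 0) \<partial>M)
      = (\<integral>\<^sup>+x. indicator {0<..} t * indicator {x\<in>space M. t < a x} x \<partial>M)"
      by (intro nn_integral_cong) (auto simp: indicator_def)
    then show "(\<integral>\<^sup>+x. (if 0 < t \<and> t < a x then 1 else 0) \<partial>M)
      = indicator {0<..} t * emeasure M {x\<in>space M. t < a x}"
      by (simp add: nn_integral_cmult)
  qed
  finally show ?thesis .
qed

text \<open>One-dimensional Brunn-Minkowski inequality when A + B lies in the interval from -2 r to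
  2 r. Comparing suprema and infima avoids asking whether the sum set is measurable.\<close>

lemma emeasure_add_le_of_sums_bounded:
  fixes A B :: "real set"
  assumes "A \<in> sets borel" "B \<in> sets borel" "A \<noteq> {}" "B \<noteq> {}"
    and r: "\<And>x y. x \<in> A \<Longrightarrow> y \<in> B \<Longrightarrow> \<bar>x + y\<bar> \<le> 2 * r"
  shows "emeasure lborel A + emeasure lborel B \<le> ennreal (4 * r)"
proof -
  obtain x0 y0 where x0: "x0 \<in> A" and y0: "y0 \<in> B" using assms by auto
  have bA: "bdd_above A" "bdd_below A"
    using r[OF _ y0] by (intro bdd_aboveI[of _ "2 * r - y0"] bdd_belowI[of _ "- 2 * r - y0"]; fastforce)+
  have bB: "bdd_above B" "bdd_below B"
    using r[OF x0] by (intro bdd_aboveI[of _ "2 * r - x0"] bdd_belowI[of _ "- 2 * r - x0"]; fastforce)+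
  have "Sup A \<le> 2 * r - Sup B"
  proof (rule cSup_least[OF \<open>A \<noteq> {}\<close>])
    fix x assume x: "x \<in> A"
    have "Sup B \<le> 2 * r - x" using r[OF x] by (intro cSup_least[OF \<open>B \<noteq> {}\<close>]) fastforce
    then show "x \<le> 2 * r - Sup B" by simp
  qed
  moreover have "- 2 * r - Inf B \<le> Inf A"
  proof (rule cInf_greatest[OF \<open>A \<noteq> {}\<close>])
    fix x assume x: "x \<in> A"
    have "- 2 * r - x \<le> Inf B" using r[OF x] by (intro cInf_greatest[OF \<open>B \<noteq> {}\<close>]) fastforce
    then show "- 2 * r - Inf B \<le> x" by simp
  qed
  moreover have A: "A \<subseteq> {Inf A..Sup A}" and B: "B \<subseteq> {Inf B..Sup B}"
    using bA bB by (auto intro: cSup_upper cInf_lower)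
  moreover have "Inf A \<le> Sup A" "Inf B \<le> Sup B"
    using x0 y0 A B by force+
  moreover have "emeasure lborel A \<le> ennreal (Sup A - Inf A)" "emeasure lborel B \<le> ennreal (Sup B - Inf B)"
    using emeasure_mono[OF A, of lborel] emeasure_mono[OF B, of lborel] \<open>Inf A \<le> Sup A\<close> \<open>Inf B \<le> Sup B\<close>
    by auto
  then have "emeasure lborel A + emeasure lborel B \<le> ennreal ((Sup A - Inf A) + (Sup B - Inf B))"
    using \<open>Inf A \<le> Sup A\<close> \<open>Inf B \<le> Sup B\<close> by (subst ennreal_plus) (auto intro: add_mono)
  ultimately show ?thesis
    by (intro order_trans[OF _ ennreal_leI[of "(Sup A - Inf A) + (Sup B - Inf B)" "4 * r"]]) auto
qed

lemma std_normal_level_set: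
  assumes t: "0 < t" and z: "t < std_normal_density z"
  obtains r where "0 < r" "{z. t < std_normal_density z} = {-r<..<r}"
proof -
  \<comment> \<open>\<open>q\<close> is the squared half-length of the level set, obtained by
    solving for equality with \<open>t\<close>; the witness \<open>z\<close> makes it
    positive.\<close>
  define q where "q = - 2 * ln (t * sqrt (2 * pi))"
  have eq: "t < std_normal_density x \<longleftrightarrow> x\<^sup>2 < q" for x
  proof -
    have "t < std_normal_density x \<longleftrightarrow> t * sqrt (2 * pi) < exp (- x\<^sup>2 / 2)"
      by (simp add: std_normal_density_def field_simps)
    also have "\<dots> \<longleftrightarrow> exp (ln (t * sqrt (2 * pi))) < exp (- x\<^sup>2 / 2)" using t by simp
    finally show ?thesis unfolding exp_less_cancel_iff by (auto simp: q_def)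
  qed
  have q: "0 < q" using z eq[of z] by (meson le_less_trans zero_le_power2)
  have "x\<^sup>2 < q \<longleftrightarrow> \<bar>x\<bar> < sqrt q" for x
    using q by (metis real_sqrt_abs real_sqrt_less_iff)
  then have "{z. t < std_normal_density z} = {z. \<bar>z\<bar> < sqrt q}"
    using eq by blast
  also have "\<dots> = {-sqrt q<..<sqrt q}" by (auto simp: abs_less_iff)
  finally have "{z. t < std_normal_density z} = {-sqrt q<..<sqrt q}" .
  with q show thesis by (intro that[of "sqrt q"]) auto
qed

text \<open>Prekopa-Leindler inequality proved level by level. The common supremum \<open>m\<close>
  makes the superlevel sets of \<open>a\<close> and \<open>b\<close> nonempty for the same levels,
  as Brunn-Minkowski requires. Under this normalization the sum is bounded, which is stronger than
  bounding the product.\<close>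

lemma prekopa_leindler_normal_normalized:
  fixes a b :: "real \<Rightarrow> real"
  assumes [measurable]: "a \<in> borel_measurable borel" "b \<in> borel_measurable borel"
    and a: "\<And>x. 0 \<le> a x" "\<And>x. a x \<le> m" and b: "\<And>x. 0 \<le> b x" "\<And>x. b x \<le> m"
    and near: "\<And>t. t < m \<Longrightarrow> \<exists>x. t < a x" "\<And>t. t < m \<Longrightarrow> \<exists>x. t < b x"
    and ab: "\<And>x y. a x * b y \<le> (std_normal_density ((x + y) / 2))\<^sup>2"
  shows "(\<integral>\<^sup>+x. a x \<partial>lborel) + (\<integral>\<^sup>+x. b x \<partial>lborel) \<le> 2"
proof -
  have level: "emeasure lborel {x. t < a x} + emeasure lborel {x. t < b x}
      \<le> 2 * emeasure lborel {x. t < std_normal_density x}" if t: "0 < t" for t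
  proof (cases "t < m")
    case True
    have gt: "t < std_normal_density ((x + y) / 2)" if "t < a x" "t < b y" for x y
    proof -
      have "t\<^sup>2 < a x * b y" using that t by (simp add: power2_eq_square mult_strict_mono)
      also have "\<dots> \<le> (std_normal_density ((x + y) / 2))\<^sup>2" by (rule ab)
      finally show ?thesis by (rule power2_less_imp_less) simp
    qed
    obtain x0 y0 where xy: "t < a x0" "t < b y0" using near[OF True] by auto
    from gt[OF this] obtain r where r: "0 < r" "{z. t < std_normal_density z} = {-r<..<r}"
      by (rule std_normal_level_set[OF t])
    have "emeasure lborel {x. t < a x} + emeasure lborel {x. t < b x} \<le> ennreal (4 * r)"
    proof (rule emeasure_add_le_of_sums_bounded)
      fix x y assume "x \<in> {x. t < a x}" "y \<in> {x. t < b x}"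
      then have "(x + y) / 2 \<in> {z. t < std_normal_density z}" using gt by auto
      then show "\<bar>x + y\<bar> \<le> 2 * r" unfolding r by (auto simp: abs_le_iff field_simps)
    qed (use xy in auto)
    also have "\<dots> = 2 * emeasure lborel {x. t < std_normal_density x}"
      unfolding r using r(1) by (simp add: ennreal_mult'[symmetric] flip: ennreal_numeral)
    finally show ?thesis .
  next
    case False
    then have "{x. t < a x} = {}" "{x. t < b x} = {}" 
      using a(2) b(2) by (auto simp: not_less) (meson order_trans)+
    then show ?thesis by simp
  qed
  have "(\<integral>\<^sup>+x. a x \<partial>lborel) + (\<integral>\<^sup>+x. b x \<partial>lborel)
    = (\<integral>\<^sup>+t. indicator {0<..} t * (emeasure lborel {x. t < a x} + emeasure lborel {x. t < b x}) \<partial>lborel)"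
    using a b
    by (simp add: nn_integral_layer_cake[OF lborel.sigma_finite_measure_axioms] distrib_left nn_integral_add)
  also have "\<dots> \<le> (\<integral>\<^sup>+t. 2 * (indicator {0<..} t * emeasure lborel {x. t < std_normal_density x}) \<partial>lborel)"
    using level by (intro nn_integral_mono) (auto split: split_indicator)
  also have "\<dots> = 2 * (\<integral>\<^sup>+x. std_normal_density x \<partial>lborel)"
    by (simp add: nn_integral_layer_cake[OF lborel.sigma_finite_measure_axioms] nn_integral_cmult)
  also have "(\<integral>\<^sup>+x. std_normal_density x \<partial>lborel) = 1"
    by (subst nn_integral_eq_integral[OF integrable_normal_density]) (auto simp: integral_normal_density)
  finally show ?thesis by simp
qed

lemma prekopa_leindler_normal:
  fixes a b :: "real \<Rightarrow> real"
  assumes [measurable]: "a \<in> borel_measurable borel" "b \<in> borel_measurable borel"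
    and a: "\<And>x. 0 \<le> a x" "\<And>x. a x \<le> A" and b: "\<And>x. 0 \<le> b x" "\<And>x. b x \<le> A"
    and ab: "\<And>x y. a x * b y \<le> (std_normal_density ((x + y) / 2))\<^sup>2"
  shows "(\<integral>\<^sup>+x. a x \<partial>lborel) * (\<integral>\<^sup>+x. b x \<partial>lborel) \<le> 1"
proof (cases "(\<forall>x. a x = 0) \<or> (\<forall>x. b x = 0)")
  case True then show ?thesis by auto
next
  case False
  define \<alpha> where "\<alpha> = (SUP x. a x)"
  define \<beta> where "\<beta> = (SUP x. b x)"
  have bdd: "bdd_above (range a)" "bdd_above (range b)" using a b by (auto intro!: bdd_aboveI2)
  have le: "a x \<le> \<alpha>" "b x \<le> \<beta>" for x
    unfolding \<alpha>_def \<beta>_def using bdd by (auto intro: cSUP_upper)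
  have pos: "0 < \<alpha>" "0 < \<beta>"
    using False le a(1) b(1) by (metis less_eq_real_def order_less_le_trans)+
  \<comment> \<open>Scaling \<open>a\<close> by s and \<open>b\<close> by 1 / s equalizes the
    suprema and preserves the product of the integrals, so the inequality of means turns the
    normalized bound on the sum into one on the product.\<close>
  define s where "s = sqrt (\<beta> / \<alpha>)"
  have s: "0 < s" using pos by (simp add: s_def)
  define m where "m = s * \<alpha>"
  have m: "\<beta> = m * s" 
  proof -
    have "s * s = \<beta> / \<alpha>" using pos by (simp add: s_def)
    then show ?thesis using pos by (simp add: m_def field_simps)
  qed
  have "(\<integral>\<^sup>+x. s * a x \<partial>lborel) + (\<integral>\<^sup>+x. b x / s \<partial>lborel) \<le> 2"
  proof (rule prekopa_leindler_normal_normalized[where m = m])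
    show "\<exists>x. t < s * a x" if "t < m" for t
    proof -
      have "t / s < \<alpha>" using that s by (simp add: m_def field_simps)
      then obtain x where "t / s < a x" unfolding \<alpha>_def using bdd by (auto simp: less_cSUP_iff)
      then show ?thesis using s by (auto simp: field_simps)
    qed
    show "\<exists>x. t < b x / s" if "t < m" for t
    proof -
      have "t * s < \<beta>" using that s by (simp add: m)
      then obtain x where "t * s < b x" unfolding \<beta>_def using bdd by (auto simp: less_cSUP_iff)
      then show ?thesis using s by (auto simp: field_simps)
    qed
    show "s * a x \<le> m" for x using le s by (simp add: m_def)
    show "b x / s \<le> m" for x using le(2)[of x] s by (simp add: m field_simps)
    show "s * a x * (b y / s) \<le> (std_normal_density ((x + y) / 2))\<^sup>2" for x y
      using ab[of x y] s by simp
  qed (use a b s in auto)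
  moreover have "(\<integral>\<^sup>+x. s * a x \<partial>lborel) = ennreal s * (\<integral>\<^sup>+x. a x \<partial>lborel)"
    using s a by (simp add: ennreal_mult nn_integral_cmult)
  moreover have "(\<integral>\<^sup>+x. b x / s \<partial>lborel) = ennreal (1 / s) * (\<integral>\<^sup>+x. b x \<partial>lborel)"
    using s b by (subst nn_integral_cmult[symmetric]) (auto simp: ennreal_mult[symmetric])
  ultimately have *: "ennreal s * (\<integral>\<^sup>+x. a x \<partial>lborel) + ennreal (1 / s) * (\<integral>\<^sup>+x. b x \<partial>lborel) \<le> 2" by simp
  show ?thesis
  proof (cases "(\<integral>\<^sup>+x. a x \<partial>lborel)")
    case top
    then have "\<top> \<le> (2::ennreal)" using * s by (simp add: ennreal_mult_top)
    then show ?thesis by (simp add: top_unique)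
  next
    case (real p)
    note p = this
    show ?thesis
    proof (cases "(\<integral>\<^sup>+x. b x \<partial>lborel)")
      case top
      then have "\<top> \<le> (2::ennreal)" using * s by (simp add: ennreal_mult_top)
      then show ?thesis by (simp add: top_unique)
    next
      case (real q)
      have "s * p + q / s \<le> 2"
        using * s p real by (simp add: ennreal_mult[symmetric] flip: ennreal_plus ennreal_numeral)
      moreover have "p * q = (s * p) * (q / s)" using s by simp
      moreover have "(s * p) * (q / s) \<le> ((s * p + q / s) / 2)\<^sup>2"
        using zero_le_power2[of "s * p - q / s"] by (simp add: power2_eq_square algebra_simps)
      moreover have "((s * p + q / s) / 2)\<^sup>2 \<le> 1"
        using \<open>s * p + q / s \<le> 2\<close> s p(1) real(1) by (intro power_le_one) auto
      ultimately have "p * q \<le> 1" by linarith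
      then show ?thesis using p real by (simp add: ennreal_mult[symmetric])
    qed
  qed
qed

text \<open>Maurey's property (tau) for the cost \<open>c\<close>, stated without infimal convolutions.\<close>

definition property_tau :: "'a measure \<Rightarrow> ('a \<Rightarrow> 'a \<Rightarrow> real) \<Rightarrow> bool" where
  "property_tau M c \<longleftrightarrow> (\<forall>u\<in>borel_measurable M. \<forall>v\<in>borel_measurable M.
     (\<forall>x\<in>space M. \<forall>y\<in>space M. u x * v y \<le> ennreal (exp (c x y))) \<longrightarrow>
     (\<integral>\<^sup>+x. u x \<partial>M) * (\<integral>\<^sup>+x. v x \<partial>M) \<le> 1)"

lemma property_tauD:
  assumes "property_tau M c" "u \<in> borel_measurable M" "v \<in> borel_measurable M"
    "\<And>x y. x \<in> space M \<Longrightarrow> y \<in> space M \<Longrightarrow> u x * v y \<le> ennreal (exp (c x y))"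
  shows "(\<integral>\<^sup>+x. u x \<partial>M) * (\<integral>\<^sup>+x. v x \<partial>M) \<le> 1"
  using assms unfolding property_tau_def by blast

lemma nn_integral_min_nat_tendsto:
  fixes u :: "'a \<Rightarrow> ennreal"
  assumes [measurable]: "u \<in> borel_measurable M"
  shows "(\<lambda>k. \<integral>\<^sup>+x. min (u x) (of_nat k) \<partial>M) \<longlonglongrightarrow> (\<integral>\<^sup>+x. u x \<partial>M)"
proof (rule nn_integral_LIMSEQ)
  show "incseq (\<lambda>k x. min (u x) (of_nat k))"
    by (auto simp: incseq_def le_fun_def min_le_iff_disj intro: min.mono)
  show "(\<lambda>k. min (u x) (of_nat k)) \<longlonglongrightarrow> u x" for x
  proof (cases "u x")
    case (real r)
    obtain N where "r \<le> real N" using real_arch_simple by blast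
    then have "min (u x) (of_nat k) = u x" if "k \<ge> N" for k
      using real that by (intro min_absorb1) (auto simp: ennreal_of_nat_eq_real_of_nat intro: ennreal_leI)
    then show ?thesis by (intro tendsto_eventually eventually_sequentiallyI[of N])
  next
    case top
    then show ?thesis using of_nat_tendsto_top_ennreal by simp
  qed
qed auto

lemma prob_space_std_normal: "prob_space std_normal_distribution"
  by (rule prob_space_normal_density) simp

text \<open>The factor 1/4 in the cost comes from the parallelogram identity: the densities at x and
  y times exp ((x - y)^2 / 4) give the squared density at the midpoint, the right side of
  \<open>prekopa_leindler_normal\<close>. Truncation supplies the boundedness demanded
  there.\<close>

lemma property_tau_std_normal: "property_tau std_normal_distribution (\<lambda>x y. (x - y)\<^sup>2 / 4)"
  unfolding property_tau_def
proof (intro ballI impI)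
  fix u v :: "real \<Rightarrow> ennreal"
  assume "u \<in> borel_measurable std_normal_distribution" "v \<in> borel_measurable std_normal_distribution"
  then have [measurable]: "u \<in> borel_measurable borel" "v \<in> borel_measurable borel" by simp_all
  assume uv': "\<forall>x\<in>space std_normal_distribution. \<forall>y\<in>space std_normal_distribution.
    u x * v y \<le> ennreal (exp ((x - y)\<^sup>2 / 4))"
  have uv: "u x * v y \<le> ennreal (exp ((x - y)\<^sup>2 / 4))" for x y using uv' by simp
  have trunc: "(\<integral>\<^sup>+x. min (u x) (of_nat k) \<partial>std_normal_distribution)
      * (\<integral>\<^sup>+x. min (v x) (of_nat k) \<partial>std_normal_distribution) \<le> 1" for k :: nat
  proof -
    define a where "a x = enn2real (min (u x) (of_nat k))" for x
    define b where "b x = enn2real (min (v x) (of_nat k))" for x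
    have a: "ennreal (a x) = min (u x) (of_nat k)" and b: "ennreal (b x) = min (v x) (of_nat k)" for x
      unfolding a_def b_def by (auto simp: min_less_iff_disj ennreal_of_nat_eq_real_of_nat)
    have [measurable]: "a \<in> borel_measurable borel" "b \<in> borel_measurable borel"
      by (auto simp: a_def[abs_def] b_def[abs_def])
    have ak: "a x \<le> real k" "b x \<le> real k" for x
      using a[of x] b[of x] by (metis ennreal_le_iff ennreal_of_nat_eq_real_of_nat min.cobounded2 of_nat_0_le_iff)+
    have nn: "0 \<le> a x" "0 \<le> b x" for x by (auto simp: a_def b_def)
    have bd: "std_normal_density x \<le> 1" for x
    proof -
      have "exp (- x\<^sup>2 / 2) \<le> 1" by simp
      also have "(1::real) \<le> sqrt (2 * pi)" using pi_gt3 by simp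
      finally show ?thesis by (simp add: std_normal_density_def divide_le_eq)
    qed
    have "(\<integral>\<^sup>+x. std_normal_density x * a x \<partial>lborel) * (\<integral>\<^sup>+x. std_normal_density x * b x \<partial>lborel) \<le> 1"
    proof (rule prekopa_leindler_normal[where A = "real k"])
      fix x y
      have "ennreal (a x * b y) \<le> u x * v y"
        using nn by (simp add: ennreal_mult a b mult_mono)
      then have "ennreal (a x * b y) \<le> ennreal (exp ((x - y)\<^sup>2 / 4))" using uv order_trans by blast
      then have ab: "a x * b y \<le> exp ((x - y)\<^sup>2 / 4)" by simp
      have "std_normal_density x * std_normal_density y * exp ((x - y)\<^sup>2 / 4)
        = 1 / (2 * pi) * exp (- x\<^sup>2 / 2 - y\<^sup>2 / 2 + (x - y)\<^sup>2 / 4)"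
      proof -
        have "sqrt (2 * pi) * sqrt (2 * pi) = 2 * pi" by simp
        then show ?thesis
          unfolding diff_conv_add_uminus exp_add std_normal_density_def
          by (simp add: divide_simps)
      qed
      also have "- x\<^sup>2 / 2 - y\<^sup>2 / 2 + (x - y)\<^sup>2 / 4 = - ((x + y) / 2)\<^sup>2 / 2 + - ((x + y) / 2)\<^sup>2 / 2"
        by (simp add: power2_eq_square field_simps)
      also have "1 / (2 * pi) * exp (- ((x + y) / 2)\<^sup>2 / 2 + - ((x + y) / 2)\<^sup>2 / 2)
        = (std_normal_density ((x + y) / 2))\<^sup>2"
        unfolding exp_add std_normal_density_def power_mult_distrib
        by (simp add: power2_eq_square power_divide)
      finally have eq: "std_normal_density x * std_normal_density y * exp ((x - y)\<^sup>2 / 4)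
        = (std_normal_density ((x + y) / 2))\<^sup>2" .
      have "std_normal_density x * a x * (std_normal_density y * b y)
          = std_normal_density x * std_normal_density y * (a x * b y)" by simp
      also have "\<dots> \<le> std_normal_density x * std_normal_density y * exp ((x - y)\<^sup>2 / 4)"
        by (intro mult_left_mono ab) auto
      finally show "std_normal_density x * a x * (std_normal_density y * b y)
        \<le> (std_normal_density ((x + y) / 2))\<^sup>2" unfolding eq .
    next
      fix x
      have "std_normal_density x * a x \<le> 1 * real k" using bd ak nn by (intro mult_mono) auto
      then show "std_normal_density x * a x \<le> real k" by simp
      have "std_normal_density x * b x \<le> 1 * real k" using bd ak nn by (intro mult_mono) auto
      then show "std_normal_density x * b x \<le> real k" by simp
    qed (use nn in auto)
    then show ?thesis
      using nn by (simp add: nn_integral_density ennreal_mult a b)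
  qed
  show "(\<integral>\<^sup>+x. u x \<partial>std_normal_distribution) * (\<integral>\<^sup>+x. v x \<partial>std_normal_distribution) \<le> 1"
  \<comment> \<open>A zero factor is split off because the limit of a product in
    \<open>ennreal\<close> has to exclude 0 times infinity.\<close>
  proof (cases "(\<integral>\<^sup>+x. u x \<partial>std_normal_distribution) = 0 \<or> (\<integral>\<^sup>+x. v x \<partial>std_normal_distribution) = 0")
    case False
    have "(\<lambda>k. (\<integral>\<^sup>+x. min (u x) (of_nat k) \<partial>std_normal_distribution)
      * (\<integral>\<^sup>+x. min (v x) (of_nat k) \<partial>std_normal_distribution))
      \<longlonglongrightarrow> (\<integral>\<^sup>+x. u x \<partial>std_normal_distribution) * (\<integral>\<^sup>+x. v x \<partial>std_normal_distribution)"
      using False by (intro tendsto_mult_ennreal nn_integral_min_nat_tendsto) auto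
    then show ?thesis by (rule LIMSEQ_le_const2) (use trunc in auto)
  qed auto
qed

text \<open>Base case of both inductions below, for dimension 0 and for an empty set of observed
  noise vectors.\<close>

lemma property_tau_0:
  assumes "prob_space M" shows "property_tau M (\<lambda>_ _. 0)"
  unfolding property_tau_def
proof (intro ballI impI)
  interpret prob_space M by fact
  fix u v :: "'a \<Rightarrow> ennreal" assume [measurable]: "u \<in> borel_measurable M" "v \<in> borel_measurable M"
    and uv: "\<forall>x\<in>space M. \<forall>y\<in>space M. u x * v y \<le> ennreal (exp 0)"
  have "(\<integral>\<^sup>+x. u x \<partial>M) * (\<integral>\<^sup>+x. v x \<partial>M) = (\<integral>\<^sup>+x. (\<integral>\<^sup>+y. u x * v y \<partial>M) \<partial>M)"
    by (simp add: nn_integral_cmult nn_integral_multc)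
  also have "\<dots> \<le> (\<integral>\<^sup>+x. (\<integral>\<^sup>+y. 1 \<partial>M) \<partial>M)"
    using uv by (intro nn_integral_mono) auto
  finally show "(\<integral>\<^sup>+x. u x \<partial>M) * (\<integral>\<^sup>+x. v x \<partial>M) \<le> 1" by (simp add: emeasure_space_1)
qed

lemma property_tau_distr:
  assumes [measurable]: "T \<in> M \<rightarrow>\<^sub>M N" and "property_tau M (\<lambda>x y. c (T x) (T y))"
  shows "property_tau (distr M N T) c"
  unfolding property_tau_def
proof (intro ballI impI)
  fix u v :: "'b \<Rightarrow> ennreal" assume "u \<in> borel_measurable (distr M N T)" "v \<in> borel_measurable (distr M N T)"
  then have [measurable]: "u \<in> borel_measurable N" "v \<in> borel_measurable N" by simp_all
  assume uv: "\<forall>x\<in>space (distr M N T). \<forall>y\<in>space (distr M N T). u x * v y \<le> ennreal (exp (c x y))"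
  have "(\<integral>\<^sup>+x. u (T x) \<partial>M) * (\<integral>\<^sup>+x. v (T x) \<partial>M) \<le> 1"
    by (rule property_tauD[OF assms(2)]) (use uv measurable_space[OF assms(1)] in auto)
  then show "(\<integral>\<^sup>+x. u x \<partial>distr M N T) * (\<integral>\<^sup>+x. v x \<partial>distr M N T) \<le> 1"
    by (simp add: nn_integral_distr)
qed

text \<open>Tensorization. For fixed first coordinates x, x' property (tau) in the second factor is
  applied to u scaled by exp (- c x x'). The resulting bound on the section integrals is the
  hypothesis of property (tau) in the first factor.\<close>

lemma property_tau_pair:
  assumes M: "prob_space M" and N: "prob_space N" and cM: "property_tau M c" and cN: "property_tau N c'"
  shows "property_tau (M \<Otimes>\<^sub>M N) (\<lambda>p q. c (fst p) (fst q) + c' (snd p) (snd q))"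
  unfolding property_tau_def
proof (intro ballI impI)
  interpret M: prob_space M by fact
  interpret N: prob_space N by fact
  interpret pair_prob_space M N ..
  fix u v :: "'a \<times> 'b \<Rightarrow> ennreal"
  assume [measurable]: "u \<in> borel_measurable (M \<Otimes>\<^sub>M N)" "v \<in> borel_measurable (M \<Otimes>\<^sub>M N)"
    and uv: "\<forall>p\<in>space (M \<Otimes>\<^sub>M N). \<forall>q\<in>space (M \<Otimes>\<^sub>M N).
      u p * v q \<le> ennreal (exp (c (fst p) (fst q) + c' (snd p) (snd q)))"
  have "(\<integral>\<^sup>+x. (\<integral>\<^sup>+y. u (x, y) \<partial>N) \<partial>M) * (\<integral>\<^sup>+x. (\<integral>\<^sup>+y. v (x, y) \<partial>N) \<partial>M) \<le> 1"
  proof (rule property_tauD[OF cM])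
    fix x x' assume x: "x \<in> space M" and x': "x' \<in> space M"
    have [measurable]: "(\<lambda>y. u (x, y)) \<in> borel_measurable N" "(\<lambda>y. v (x', y)) \<in> borel_measurable N"
      using x x' by measurable
    have "(\<integral>\<^sup>+y. u (x, y) * ennreal (exp (- c x x')) \<partial>N) * (\<integral>\<^sup>+y. v (x', y) \<partial>N) \<le> 1"
    proof (rule property_tauD[OF cN])
      fix y y' assume "y \<in> space N" "y' \<in> space N"
      then have "u (x, y) * v (x', y') \<le> ennreal (exp (c x x' + c' y y'))"
        using x x' uv[rule_format, of "(x, y)" "(x', y')"] by (simp add: space_pair_measure)
      then have "ennreal (exp (- c x x')) * (u (x, y) * v (x', y'))
        \<le> ennreal (exp (- c x x')) * ennreal (exp (c x x' + c' y y'))" by (rule mult_left_mono) simp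
      also have "\<dots> = ennreal (exp (c' y y'))"
        by (simp add: ennreal_mult[symmetric] exp_add[symmetric])
      finally show "u (x, y) * ennreal (exp (- c x x')) * v (x', y') \<le> ennreal (exp (c' y y'))"
        by (simp add: mult_ac)
    qed auto
    then have *: "ennreal (exp (- c x x')) * ((\<integral>\<^sup>+y. u (x, y) \<partial>N) * (\<integral>\<^sup>+y. v (x', y) \<partial>N)) \<le> 1"
      by (simp add: nn_integral_multc mult_ac)
    have "(\<integral>\<^sup>+y. u (x, y) \<partial>N) * (\<integral>\<^sup>+y. v (x', y) \<partial>N)
      = ennreal (exp (c x x')) * (ennreal (exp (- c x x')) * ((\<integral>\<^sup>+y. u (x, y) \<partial>N) * (\<integral>\<^sup>+y. v (x', y) \<partial>N)))"
      unfolding mult.assoc[symmetric] by (simp add: ennreal_mult[symmetric] exp_add[symmetric])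
    also have "\<dots> \<le> ennreal (exp (c x x')) * 1" by (intro mult_left_mono *) auto
    finally show "(\<integral>\<^sup>+y. u (x, y) \<partial>N) * (\<integral>\<^sup>+y. v (x', y) \<partial>N) \<le> ennreal (exp (c x x'))" by simp
  qed auto
  then show "(\<integral>\<^sup>+p. u p \<partial>(M \<Otimes>\<^sub>M N)) * (\<integral>\<^sup>+p. v p \<partial>(M \<Otimes>\<^sub>M N)) \<le> 1"
    by (simp add: N.nn_integral_fst)
qed

lemma prob_space_std_gaussian [simp]: "prob_space (std_gaussian d)"
  unfolding std_gaussian_def by (intro prob_space_PiM prob_space_std_normal)

lemma sets_std_gaussian [measurable_cong, simp]: "sets (std_gaussian d) = sets (Rd d)"
  unfolding std_gaussian_def by (intro sets_PiM_cong) auto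

lemma space_std_gaussian [simp]: "space (std_gaussian d) = space (Rd d)"
  by (rule sets_eq_imp_space_eq) simp

text \<open>The squared distance adds over coordinates, so tensorization keeps the factor 1/4 in
  every dimension. This is why the final constant does not depend on \<open>d\<close>.\<close>

lemma property_tau_std_gaussian: "property_tau (std_gaussian d) (\<lambda>x y. (eucl_dist d x y)\<^sup>2 / 4)"
proof (induction d)
  case 0
  show ?case using property_tau_0[of "std_gaussian 0"] by (simp add: eucl_dist_def)
next
  case (Suc d)
  let ?N = "\<lambda>_::nat. std_normal_distribution"
  have eq: "std_gaussian (Suc d)
    = distr (std_normal_distribution \<Otimes>\<^sub>M std_gaussian d) (std_gaussian (Suc d)) (\<lambda>(x, X). X(d := x))"
    using distr_pair_PiM_eq_PiM[of "{..<d}" ?N d] prob_space_std_normal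
    by (simp add: std_gaussian_def lessThan_Suc)
  show ?case
  proof (subst eq, rule property_tau_distr)
    show "(\<lambda>(x, X). X(d := x)) \<in> std_normal_distribution \<Otimes>\<^sub>M std_gaussian d \<rightarrow>\<^sub>M std_gaussian (Suc d)"
      unfolding std_gaussian_def lessThan_Suc by measurable
    have "(eucl_dist (Suc d) (X(d := x)) (Y(d := y)))\<^sup>2 = (x - y)\<^sup>2 + (eucl_dist d X Y)\<^sup>2" for X Y x y
      by (simp add: eucl_dist_power2)
    then show "property_tau (std_normal_distribution \<Otimes>\<^sub>M std_gaussian d) (\<lambda>x y.
      (eucl_dist (Suc d) (case x of (x, X) \<Rightarrow> X(d := x)) (case y of (x, X) \<Rightarrow> X(d := x)))\<^sup>2 / 4)"
      using property_tau_pair[OF prob_space_std_normal prob_space_std_gaussian property_tau_std_normal Suc]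
      by (simp add: case_prod_unfold add_divide_distrib)
  qed
qed

definition noise :: "nat \<Rightarrow> (nat \<Rightarrow> nat \<Rightarrow> real) measure" where
  "noise d = Pi\<^sub>M UNIV (\<lambda>_. std_gaussian d)"

lemma prob_space_noise [simp]: "prob_space (noise d)"
  unfolding noise_def by (intro prob_space_PiM) simp

lemma noise_iter: "distr (std_gaussian d \<Otimes>\<^sub>M noise d) (noise d) (\<lambda>(s, \<omega>). case_nat s \<omega>) = noise d"
proof -
  interpret prob_space "std_gaussian d" by simp
  interpret sequence_space "std_gaussian d" ..
  show ?thesis unfolding noise_def by (rule PiM_iter)
qed

lemma measurable_noise_component [measurable]: "(\<lambda>z. z k) \<in> noise d \<rightarrow>\<^sub>M std_gaussian d"
  unfolding noise_def by simp

lemma measurable_case_nat_noise [measurable]: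
  "(\<lambda>(s, \<omega>). case_nat s \<omega>) \<in> std_gaussian d \<Otimes>\<^sub>M noise d \<rightarrow>\<^sub>M noise d"
  unfolding noise_def by measurable

text \<open>The cost looks at the first \<open>n\<close> noise vectors, so it is finite on infinite
  sequences. \<open>noise_iter\<close> peels off the first vector, and the induction is again
  tensorization.\<close>

lemma property_tau_noise:
  "property_tau (noise d) (\<lambda>z z'. (\<Sum>k<n. (eucl_dist d (z k) (z' k))\<^sup>2) / 4)"
proof (induction n)
  case 0
  show ?case using property_tau_0[of "noise d"] by simp
next
  case (Suc n)
  show ?case
  proof (subst noise_iter[symmetric], rule property_tau_distr)
    have "(\<Sum>k<Suc n. (eucl_dist d (case_nat s \<omega> k) (case_nat s' \<omega>' k))\<^sup>2)
      = (eucl_dist d s s')\<^sup>2 + (\<Sum>k<n. (eucl_dist d (\<omega> k) (\<omega>' k))\<^sup>2)" for s s' \<omega> \<omega>'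
      by (subst sum.lessThan_Suc_shift) simp
    then show "property_tau (std_gaussian d \<Otimes>\<^sub>M noise d) (\<lambda>x y.
      (\<Sum>k<Suc n. (eucl_dist d ((case x of (s, \<omega>) \<Rightarrow> case_nat s \<omega>) k) ((case y of (s, \<omega>) \<Rightarrow> case_nat s \<omega>) k))\<^sup>2) / 4)"
      using property_tau_pair[OF prob_space_std_gaussian prob_space_noise property_tau_std_gaussian Suc]
      by (simp add: case_prod_unfold add_divide_distrib)
  qed measurable
qed

section \<open>Concentration and Poincare inequality\<close>

text \<open>Exponential integrability of F and - F then yields moments up to order three, the order
  of the remainder terms in the Poincare argument.\<close>

lemma abs_power3_le_exp: "\<bar>x\<bar> ^ 3 \<le> 6 * (exp x + exp (- x))" for x :: real
proof -
  obtain t where "exp \<bar>x\<bar> = (\<Sum>m<4. \<bar>x\<bar> ^ m / fact m) + exp t / fact 4 * \<bar>x\<bar> ^ 4"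
    using Maclaurin_exp_le[of "\<bar>x\<bar>" 4] by blast
  then have "exp \<bar>x\<bar> = 1 + \<bar>x\<bar> + \<bar>x\<bar>\<^sup>2 / 2 + \<bar>x\<bar> ^ 3 / 6 + exp t / 24 * \<bar>x\<bar> ^ 4"
    by (simp add: numeral_eq_Suc)
  moreover have "0 \<le> 1 + \<bar>x\<bar> + \<bar>x\<bar>\<^sup>2 / 2" "0 \<le> exp t / 24 * \<bar>x\<bar> ^ 4" by auto
  ultimately have "\<bar>x\<bar> ^ 3 / 6 \<le> exp \<bar>x\<bar>" by linarith
  moreover have "exp \<bar>x\<bar> \<le> exp x + exp (- x)" by (cases "x \<ge> 0") (auto simp: abs_if add_increasing)
  ultimately show ?thesis by argo
qed

text \<open>Valid for both signs of x because the Lagrange remainder has even order.\<close>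

lemma exp_lower_Taylor_cubic: "1 + x + x\<^sup>2 / 2 + x ^ 3 / 6 \<le> exp x" for x :: real
proof -
  obtain t where "exp x = (\<Sum>m<4. x ^ m / fact m) + exp t / fact 4 * x ^ 4"
    using Maclaurin_exp_le[of x 4] by blast
  then have "exp x = 1 + x + x\<^sup>2 / 2 + x ^ 3 / 6 + exp t / 24 * x ^ 4"
    by (simp add: numeral_eq_Suc)
  moreover have "0 \<le> exp t / 24 * x ^ 4" by simp
  ultimately show ?thesis by linarith
qed

lemma abs_power_le_one_plus: "\<bar>x\<bar> ^ k \<le> 1 + \<bar>x\<bar> ^ 3" if "k \<le> 3" for x :: real
proof (cases "\<bar>x\<bar> \<le> 1")
  case True
  then have "\<bar>x\<bar> ^ k \<le> 1" by (simp add: power_le_one)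
  then show ?thesis by (simp add: add_increasing2)
next
  case False
  then have "\<bar>x\<bar> ^ k \<le> \<bar>x\<bar> ^ 3" using that by (intro power_increasing) auto
  then show ?thesis by simp
qed

text \<open>\<open>r\<close> may be a pseudometric: the instance \<open>noise_dist\<close> looks
  only at the first \<open>n\<close> noise vectors.\<close>

locale tau_space = prob_space M for M :: "'a measure" +
  fixes r :: "'a \<Rightarrow> 'a \<Rightarrow> real"
  assumes tau: "property_tau M (\<lambda>x y. (r x y)\<^sup>2 / 4)"
    and r_nonneg: "\<And>x y. 0 \<le> r x y"
begin

text \<open>Property (tau) tested with exp (t F - t^2 k^2) and exp (- t F). The pointwise hypothesis
  is Young's inequality |t k| r \<le> t^2 k^2 + r^2 / 4.\<close>

lemma lipschitz_nn_mgf_mult: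
  assumes [measurable]: "F \<in> borel_measurable M"
    and F: "\<And>x y. x \<in> space M \<Longrightarrow> y \<in> space M \<Longrightarrow> \<bar>F x - F y\<bar> \<le> k * r x y"
  shows "(\<integral>\<^sup>+x. exp (t * F x) \<partial>M) * (\<integral>\<^sup>+x. exp (- (t * F x)) \<partial>M) \<le> ennreal (exp (t\<^sup>2 * k\<^sup>2))"
proof -
  have "(\<integral>\<^sup>+x. ennreal (exp (t * F x - t\<^sup>2 * k\<^sup>2)) \<partial>M) * (\<integral>\<^sup>+x. exp (- (t * F x)) \<partial>M) \<le> 1"
  proof (rule property_tauD[OF tau])
    fix x y assume xy: "x \<in> space M" "y \<in> space M"
    have "t * (F x - F y) \<le> \<bar>t\<bar> * \<bar>F x - F y\<bar>" by (metis abs_ge_self abs_mult)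
    also have "\<dots> \<le> \<bar>t\<bar> * (k * r x y)" by (intro mult_left_mono F xy) auto
    also have "\<dots> \<le> \<bar>t\<bar> * (\<bar>k\<bar> * r x y)" by (intro mult_left_mono mult_right_mono) (auto simp: r_nonneg)
    also have "\<dots> \<le> t\<^sup>2 * k\<^sup>2 + (r x y)\<^sup>2 / 4"
      using zero_le_power2[of "\<bar>t\<bar> * \<bar>k\<bar> - r x y / 2"]
      by (simp add: power2_eq_square algebra_simps abs_mult_self_eq)
    finally show "ennreal (exp (t * F x - t\<^sup>2 * k\<^sup>2)) * ennreal (exp (- (t * F y))) \<le> ennreal (exp ((r x y)\<^sup>2 / 4))"
      by (simp add: ennreal_mult[symmetric] exp_add[symmetric] algebra_simps)
  qed auto
  then have "ennreal (exp (t\<^sup>2 * k\<^sup>2)) * ((\<integral>\<^sup>+x. ennreal (exp (t * F x - t\<^sup>2 * k\<^sup>2)) \<partial>M) * (\<integral>\<^sup>+x. exp (- (t * F x)) \<partial>M))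
    \<le> ennreal (exp (t\<^sup>2 * k\<^sup>2)) * 1" by (rule mult_left_mono) simp
  moreover have "ennreal (exp (t\<^sup>2 * k\<^sup>2)) * (\<integral>\<^sup>+x. ennreal (exp (t * F x - t\<^sup>2 * k\<^sup>2)) \<partial>M) = (\<integral>\<^sup>+x. exp (t * F x) \<partial>M)"
    by (subst nn_integral_cmult[symmetric])
       (auto simp: ennreal_mult[symmetric] exp_add[symmetric])
  ultimately show ?thesis by (simp add: mult.assoc[symmetric])
qed

text \<open>The product bound forces its first factor to be finite, because the second, the integral
  of a positive function, is not zero. In this way integrability comes out of property (tau)
  itself.\<close>

lemma lipschitz_exp_integrable:
  assumes [measurable]: "F \<in> borel_measurable M"
    and F: "\<And>x y. x \<in> space M \<Longrightarrow> y \<in> space M \<Longrightarrow> \<bar>F x - F y\<bar> \<le> k * r x y"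
  shows "integrable M (\<lambda>x. exp (t * F x))"
proof -
  have "(\<integral>\<^sup>+x. exp (- (t * F x)) \<partial>M) \<noteq> 0"
    using not_AE_zero_ennreal_E not_AE_zero_E by (simp add: nn_integral_0_iff_AE)
  then have "(\<integral>\<^sup>+x. exp (t * F x) \<partial>M) \<noteq> \<top>"
    using lipschitz_nn_mgf_mult[OF assms, of t] by (auto simp: ennreal_top_mult top_unique)
  then show ?thesis by (intro integrableI_nonneg) (auto simp: less_top)
qed

lemma lipschitz_power_integrable:
  assumes [measurable]: "F \<in> borel_measurable M"
    and F: "\<And>x y. x \<in> space M \<Longrightarrow> y \<in> space M \<Longrightarrow> \<bar>F x - F y\<bar> \<le> k * r x y" and j: "j \<le> 3"
  shows "integrable M (\<lambda>x. \<bar>F x\<bar> ^ j)" "integrable M (\<lambda>x. F x ^ j)"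
proof -
  have 1: "integrable M (\<lambda>x. 1 + 6 * (exp (1 * F x) + exp ((- 1) * F x)))"
    by (intro Bochner_Integration.integrable_add integrable_mult_right lipschitz_exp_integrable[OF assms(1,2)]) auto
  have 2: "\<bar>F x\<bar> ^ j \<le> 1 + 6 * (exp (1 * F x) + exp ((- 1) * F x))" for x
    using abs_power_le_one_plus[OF j, of "F x"] abs_power3_le_exp[of "F x"] by simp
  show "integrable M (\<lambda>x. \<bar>F x\<bar> ^ j)" "integrable M (\<lambda>x. F x ^ j)"
    by (rule Bochner_Integration.integrable_bound[OF 1]; use 2 in \<open>auto simp: power_abs intro: order_trans[OF _ abs_ge_self]\<close>)+
qed

lemma lipschitz_integrable:
  assumes "F \<in> borel_measurable M"
    and "\<And>x y. x \<in> space M \<Longrightarrow> y \<in> space M \<Longrightarrow> \<bar>F x - F y\<bar> \<le> k * r x y"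
  shows "integrable M F" "integrable M (\<lambda>x. (F x)\<^sup>2)"
  using lipschitz_power_integrable(2)[OF assms, of 1] lipschitz_power_integrable(2)[OF assms, of 2] by auto

text \<open>The factor with - t F is at least exp (- t m) with m the mean of F, by integrating the
  tangent line of exp there (Jensen's inequality). Dividing the product bound by it leaves the
  Gaussian estimate.\<close>

lemma lipschitz_mgf:
  assumes [measurable]: "F \<in> borel_measurable M"
    and F: "\<And>x y. x \<in> space M \<Longrightarrow> y \<in> space M \<Longrightarrow> \<bar>F x - F y\<bar> \<le> k * r x y"
  shows "(\<integral>x. exp (t * F x) \<partial>M) \<le> exp (t * (\<integral>x. F x \<partial>M) + t\<^sup>2 * k\<^sup>2)"
proof -
  note int = lipschitz_exp_integrable[OF assms]
  have int': "integrable M (\<lambda>x. exp (- (t * F x)))" using int[of "- t"] by simp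
  let ?m = "\<integral>x. F x \<partial>M"
  have "exp (- (t * ?m)) * (1 - t * (expectation F - ?m)) = (\<integral>x. exp (- (t * ?m)) * (1 - t * (F x - ?m)) \<partial>M)"
    using lipschitz_integrable(1)[OF assms] by (simp add: prob_space)
  also have "\<dots> \<le> (\<integral>x. exp (- (t * F x)) \<partial>M)"
  proof (rule integral_mono)
    fix x
    have "exp (- (t * ?m)) * (1 + (- (t * (F x - ?m)))) \<le> exp (- (t * ?m)) * exp (- (t * (F x - ?m)))"
      by (intro mult_left_mono exp_ge_add_one_self) auto
    also have "\<dots> = exp (- (t * F x))" unfolding exp_add[symmetric] by (simp add: algebra_simps)
    finally show "exp (- (t * ?m)) * (1 - t * (F x - ?m)) \<le> exp (- (t * F x))" by simp
  qed (use lipschitz_integrable(1)[OF assms] int' in auto)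
  finally have low: "exp (- (t * ?m)) \<le> (\<integral>x. exp (- (t * F x)) \<partial>M)" by simp
  have "(\<integral>x. exp (t * F x) \<partial>M) * (\<integral>x. exp (- (t * F x)) \<partial>M) \<le> exp (t\<^sup>2 * k\<^sup>2)"
    using lipschitz_nn_mgf_mult[OF assms, of t] int[of t] int'
    by (simp add: nn_integral_eq_integral ennreal_mult[symmetric])
  moreover have "(\<integral>x. exp (t * F x) \<partial>M) * exp (- (t * ?m)) \<le> (\<integral>x. exp (t * F x) \<partial>M) * (\<integral>x. exp (- (t * F x)) \<partial>M)"
    by (intro mult_left_mono low Bochner_Integration.integral_nonneg) auto
  ultimately have "(\<integral>x. exp (t * F x) \<partial>M) * exp (- (t * ?m)) \<le> exp (t\<^sup>2 * k\<^sup>2)"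
    by (rule order_trans[rotated])
  then have "(\<integral>x. exp (t * F x) \<partial>M) * exp (- (t * ?m)) * exp (t * ?m) \<le> exp (t\<^sup>2 * k\<^sup>2) * exp (t * ?m)"
    by (rule mult_right_mono) simp
  then show ?thesis by (simp add: mult.assoc exp_add[symmetric] add.commute)
qed

text \<open>The Poincare inequality is the second-order expansion of property (tau) at constants; a local
  Lipschitz bound \<open>s\<close> takes the place of the gradient, so \<open>F\<close> need not be differentiable.\<close>

lemma local_lipschitz_poincare:
  assumes [measurable]: "F \<in> borel_measurable M" "s \<in> borel_measurable M"
    and F: "\<And>x y. x \<in> space M \<Longrightarrow> y \<in> space M \<Longrightarrow> \<bar>F x - F y\<bar> \<le> k * r x y"
    and s: "\<And>x. x \<in> space M \<Longrightarrow> 0 \<le> s x" "\<And>x. x \<in> space M \<Longrightarrow> s x \<le> B"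
    and loc: "\<And>x y. x \<in> space M \<Longrightarrow> y \<in> space M \<Longrightarrow>
      \<bar>F x - F y\<bar> \<le> s x * sqrt (exp (a\<^sup>2 * (r x y)\<^sup>2) - 1)"
    and a: "0 < a"
  shows "(\<integral>x. (F x - (\<integral>x. F x \<partial>M))\<^sup>2 \<partial>M) \<le> a\<^sup>2 * (\<integral>x. (s x)\<^sup>2 \<partial>M)"
proof -
  define G where "G x = F x - (\<integral>x. F x \<partial>M)" for x
  have [measurable]: "G \<in> borel_measurable M" unfolding G_def by measurable
  have GF: "G x - G y = F x - F y" for x y by (simp add: G_def)
  have G: "\<And>x y. x \<in> space M \<Longrightarrow> y \<in> space M \<Longrightarrow> \<bar>G x - G y\<bar> \<le> k * r x y"
    unfolding GF by (rule F)
  note intG = lipschitz_power_integrable[OF \<open>G \<in> borel_measurable M\<close> G]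
  have iG: "integrable M G" "integrable M (\<lambda>x. (G x)\<^sup>2)" "integrable M (\<lambda>x. \<bar>G x\<bar>)"
      "integrable M (\<lambda>x. \<bar>G x\<bar>\<^sup>2)" "integrable M (\<lambda>x. \<bar>G x\<bar> ^ 3)"
    using intG(2)[of 1] intG(2)[of 2] intG(1)[of 1] intG(1)[of 2] intG(1)[of 3] by auto
  have EG: "expectation G = 0"
    unfolding G_def using lipschitz_integrable(1)[OF assms(1) F] by (simp add: prob_space)
  define p where "p = (\<integral>x. (G x)\<^sup>2 \<partial>M)"
  define q where "q = (\<integral>x. (s x)\<^sup>2 \<partial>M)"
  have B0: "0 \<le> B" using s not_empty by (meson ex_in_conv order_trans)
  have is2: "integrable M (\<lambda>x. (s x)\<^sup>2)"
    using s by (intro integrable_const_bound[where B = "B\<^sup>2"] AE_I2) (auto intro: power_mono)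
  \<comment> \<open>The loss factor 1 + \<eta> pays for replacing sqrt (exp y - 1) by sqrt y near 0;
    it is removed at the end by letting \<eta> tend to 0.\<close>
  have main: "p \<le> A * q" if \<eta>: "0 < \<eta>" and A: "A = a\<^sup>2 * (1 + \<eta>)" for \<eta> A
  proof -
    have A0: "0 < A" using \<eta> a by (simp add: A add_pos_pos)
    \<comment> \<open>Within this radius y = a^2 r^2 is at most min \<eta> 1, where exp y - 1 \<le>
      y + y^2 \<le> (1 + \<eta>) y.\<close>
    define r0 where "r0 = sqrt (min \<eta> 1) / a"
    have r0: "0 < r0" using \<eta> a by (simp add: r0_def)
    have near: "sqrt (exp (a\<^sup>2 * t\<^sup>2) - 1) \<le> sqrt A * t" if t: "0 \<le> t" "t \<le> r0" for t
    proof -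
      have "a * t \<le> sqrt (min \<eta> 1)" using t a by (simp add: r0_def field_simps)
      then have "(a * t)\<^sup>2 \<le> (sqrt (min \<eta> 1))\<^sup>2" using t a by (intro power_mono) auto
      then have y: "a\<^sup>2 * t\<^sup>2 \<le> min \<eta> 1" using \<eta> by (simp add: power_mult_distrib)
      then have "exp (a\<^sup>2 * t\<^sup>2) \<le> 1 + a\<^sup>2 * t\<^sup>2 + (a\<^sup>2 * t\<^sup>2)\<^sup>2" by (intro exp_bound) auto
      also have "(a\<^sup>2 * t\<^sup>2)\<^sup>2 \<le> \<eta> * (a\<^sup>2 * t\<^sup>2)"
        unfolding power2_eq_square[of "a\<^sup>2 * t\<^sup>2"] using y by (intro mult_right_mono) auto
      finally have "exp (a\<^sup>2 * t\<^sup>2) - 1 \<le> A * t\<^sup>2" by (simp add: A algebra_simps)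
      then have "sqrt (exp (a\<^sup>2 * t\<^sup>2) - 1) \<le> sqrt (A * t\<^sup>2)" by simp
      then show ?thesis using t by (simp add: real_sqrt_mult)
    qed
    \<comment> \<open>e^3 W is the error allowed in the second-order lower bound of the test
      function \<open>?u\<close> below.\<close>
    define W where "W x = A * B\<^sup>2 * \<bar>G x\<bar> + (\<bar>G x\<bar> + A * B\<^sup>2) ^ 3 / 6" for x
    define C1 where "C1 = (\<integral>x. W x \<partial>M)"
    define C2 where "C2 = (\<integral>x. \<bar>G x\<bar> ^ 3 / 6 \<partial>M)"
    have iC1: "integrable M W"
    proof -
      have "(\<bar>G x\<bar> + A * B\<^sup>2) ^ 3 = \<bar>G x\<bar> ^ 3 + 3 * (A * B\<^sup>2) * \<bar>G x\<bar>\<^sup>2 + 3 * (A * B\<^sup>2)\<^sup>2 * \<bar>G x\<bar> + (A * B\<^sup>2) ^ 3" for x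
        by (simp add: power2_eq_square power3_eq_cube algebra_simps)
      then show ?thesis unfolding W_def using iG by simp
    qed
    \<comment> \<open>Property (tau) is tested with exp (e G - e^2 A s^2) and exp (- e G). Their
      second-order expansions multiply to 1 + e^2 (p - A q) up to higher order, so the limit e to 0
      compares p with A q.\<close>
    have ineq: "(p - A * q) - e * (C1 + C2) + e\<^sup>2 * ((p / 2 - A * q - e * C1) * (p / 2 - e * C2)) \<le> 0"
      if e: "0 < e" "e \<le> 1" "e * (4 * (\<bar>k\<bar> + 1)) \<le> r0" "0 \<le> 1 + e\<^sup>2 * (p / 2 - e * C2)" for e
    proof -
      let ?u = "\<lambda>x. exp (e * G x - e\<^sup>2 * A * (s x)\<^sup>2)"
      have "(\<integral>\<^sup>+x. ennreal (?u x) \<partial>M) * (\<integral>\<^sup>+x. ennreal (exp (- e * G x)) \<partial>M) \<le> 1"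
      proof (rule property_tauD[OF tau])
        fix x y assume xy: "x \<in> space M" "y \<in> space M"
        have "e * (G x - G y) \<le> e\<^sup>2 * A * (s x)\<^sup>2 + (r x y)\<^sup>2 / 4"
        \<comment> \<open>Near pairs use the local slope \<open>s\<close> and Young's inequality;
          far pairs use the global Lipschitz bound, which r^2 / 4 dominates because e is small
          compared with \<open>r0\<close>.\<close>
        proof (cases "r x y \<le> r0")
          case True
          have "e * (G x - G y) \<le> e * (s x * sqrt (exp (a\<^sup>2 * (r x y)\<^sup>2) - 1))"
            using loc[OF xy] e unfolding GF by (intro mult_left_mono) auto
          also have "\<dots> \<le> e * (s x * (sqrt A * r x y))"
            using near[OF r_nonneg True] s(1)[OF xy(1)] e by (intro mult_left_mono) auto
          also have "\<dots> \<le> e\<^sup>2 * A * (s x)\<^sup>2 + (r x y)\<^sup>2 / 4"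
          proof -
            have "0 \<le> (e * sqrt A * s x - r x y / 2)\<^sup>2" by simp
            also have "\<dots> = e\<^sup>2 * (sqrt A)\<^sup>2 * (s x)\<^sup>2 + (r x y)\<^sup>2 / 4 - e * (s x * (sqrt A * r x y))"
              by (simp add: power2_eq_square algebra_simps)
            finally show ?thesis using A0 by simp
          qed
          finally show ?thesis .
        next
          case False
          have "e * (G x - G y) \<le> e * (k * r x y)"
            using G[OF xy] e by (intro mult_left_mono) auto
          also have "\<dots> \<le> e * (\<bar>k\<bar> + 1) * r x y"
            using e r_nonneg[of x y] by (simp add: mult.assoc mult_right_mono)
          also have "\<dots> \<le> r x y / 4 * r x y"
            using e(3) False r_nonneg[of x y] by (intro mult_right_mono) (auto simp: algebra_simps)
          also have "\<dots> \<le> e\<^sup>2 * A * (s x)\<^sup>2 + (r x y)\<^sup>2 / 4"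
            using A0 by (simp add: power2_eq_square)
          finally show ?thesis .
        qed
        then show "ennreal (?u x) * ennreal (exp (- e * G y)) \<le> ennreal (exp ((r x y)\<^sup>2 / 4))"
          by (simp add: ennreal_mult[symmetric] exp_add[symmetric] algebra_simps)
      qed auto
      moreover have iv: "integrable M (\<lambda>x. exp (- e * G x))"
        using lipschitz_exp_integrable[OF _ G, of "- e"] by simp
      moreover have iu: "integrable M ?u"
        by (rule Bochner_Integration.integrable_bound[OF lipschitz_exp_integrable[OF _ G, of e]])
           (use A0 in auto)
      ultimately have XY: "(\<integral>x. ?u x \<partial>M) * (\<integral>x. exp (- e * G x) \<partial>M) \<le> 1"
        by (simp add: nn_integral_eq_integral ennreal_mult[symmetric])
      have X: "1 + e\<^sup>2 * (p / 2 - A * q - e * C1) \<le> (\<integral>x. ?u x \<partial>M)"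
      proof -
        have "1 + e\<^sup>2 * (p / 2 - A * q - e * C1) = (\<integral>x. 1 + e * G x - e\<^sup>2 * A * (s x)\<^sup>2 + e\<^sup>2 / 2 * (G x)\<^sup>2
           - e ^ 3 * W x \<partial>M)"
        proof -
          have "(\<integral>x. 1 + e * G x - e\<^sup>2 * A * (s x)\<^sup>2 + e\<^sup>2 / 2 * (G x)\<^sup>2 - e ^ 3 * W x \<partial>M)
            = 1 + e * expectation G - e\<^sup>2 * A * q + e\<^sup>2 / 2 * p - e ^ 3 * C1"
            unfolding p_def q_def C1_def using iG iC1 is2 by (simp add: prob_space)
          then show ?thesis unfolding EG by (simp add: algebra_simps power3_eq_cube power2_eq_square)
        qed
        also have "\<dots> \<le> (\<integral>x. ?u x \<partial>M)"
        proof (rule integral_mono)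
          fix x assume x: "x \<in> space M"
          define h where "h = A * (s x)\<^sup>2"
          define g where "g = G x"
          define K where "K = A * B\<^sup>2"
          have h: "0 \<le> h" "h \<le> K" using A0 s[OF x] by (auto simp: h_def K_def intro: power_mono)
          have K: "0 \<le> K" using h by simp
          define y where "y = e * g - e\<^sup>2 * h"
          have y2: "y\<^sup>2 / 2 \<ge> e\<^sup>2 / 2 * g\<^sup>2 - e ^ 3 * (K * \<bar>g\<bar>)"
          proof -
            have "y\<^sup>2 / 2 = e\<^sup>2 / 2 * g\<^sup>2 - e ^ 3 * (h * g) + (e\<^sup>2 * h)\<^sup>2 / 2"
              by (simp add: y_def power2_eq_square power3_eq_cube field_simps)
            moreover have "e ^ 3 * (h * g) \<le> e ^ 3 * (K * \<bar>g\<bar>)"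
            proof (intro mult_left_mono)
              have "h * g \<le> h * \<bar>g\<bar>" using h by (intro mult_left_mono) auto
              also have "\<dots> \<le> K * \<bar>g\<bar>" using h by (intro mult_right_mono) auto
              finally show "h * g \<le> K * \<bar>g\<bar>" .
            qed (use e in simp)
            moreover have "0 \<le> (e\<^sup>2 * h)\<^sup>2 / 2" by simp
            ultimately show ?thesis by linarith
          qed
          have "\<bar>y\<bar> \<le> e * \<bar>g\<bar> + e\<^sup>2 * h"
            using e h abs_triangle_ineq4[of "e * g" "e\<^sup>2 * h"] by (simp add: y_def abs_mult)
          also have "\<dots> \<le> e * \<bar>g\<bar> + e * K"
            using e h mult_mono[of "e\<^sup>2" e h K] by (simp add: power2_eq_square mult_left_le)
          finally have "\<bar>y\<bar> ^ 3 \<le> (e * (\<bar>g\<bar> + K)) ^ 3"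
            by (intro power_mono) (auto simp: algebra_simps)
          then have y3: "y ^ 3 / 6 \<ge> - (e ^ 3 * ((\<bar>g\<bar> + K) ^ 3 / 6))"
            using abs_ge_minus_self[of "y ^ 3"] by (simp add: power_abs power_mult_distrib)
          have "1 + e * g - e\<^sup>2 * h + e\<^sup>2 / 2 * g\<^sup>2 - e ^ 3 * (K * \<bar>g\<bar> + (\<bar>g\<bar> + K) ^ 3 / 6) \<le> exp y"
            using exp_lower_Taylor_cubic[of y] y2 y3 unfolding y_def distrib_left by linarith
          then show "1 + e * G x - e\<^sup>2 * A * (s x)\<^sup>2 + e\<^sup>2 / 2 * (G x)\<^sup>2
            - e ^ 3 * W x \<le> ?u x"
            by (simp add: g_def h_def K_def y_def W_def mult.assoc)
        qed (use iG iC1 is2 iu in auto)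
        finally show ?thesis .
      qed
      have Y: "1 + e\<^sup>2 * (p / 2 - e * C2) \<le> (\<integral>x. exp (- e * G x) \<partial>M)"
      proof -
        have "1 + e\<^sup>2 * (p / 2 - e * C2) = (\<integral>x. 1 - e * G x + e\<^sup>2 / 2 * (G x)\<^sup>2 - e ^ 3 * (\<bar>G x\<bar> ^ 3 / 6) \<partial>M)"
        proof -
          have "(\<integral>x. 1 - e * G x + e\<^sup>2 / 2 * (G x)\<^sup>2 - e ^ 3 * (\<bar>G x\<bar> ^ 3 / 6) \<partial>M)
            = 1 - e * expectation G + e\<^sup>2 / 2 * p - e ^ 3 * C2"
            unfolding p_def C2_def using iG by (simp add: prob_space)
          then show ?thesis unfolding EG by (simp add: algebra_simps power3_eq_cube power2_eq_square)
        qed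
        also have "\<dots> \<le> (\<integral>x. exp (- e * G x) \<partial>M)"
        proof (rule integral_mono)
          fix x
          have "- ((e * G x) ^ 3) \<ge> - (e ^ 3 * \<bar>G x\<bar> ^ 3)"
            using e abs_ge_self[of "(e * G x) ^ 3"] by (simp add: power_abs abs_mult power_mult_distrib)
          then show "1 - e * G x + e\<^sup>2 / 2 * (G x)\<^sup>2 - e ^ 3 * (\<bar>G x\<bar> ^ 3 / 6) \<le> exp (- e * G x)"
            using exp_lower_Taylor_cubic[of "- (e * G x)"] by (simp add: power_mult_distrib)
        qed (use iG iv in auto)
        finally show ?thesis .
      qed
      have X0: "0 \<le> (\<integral>x. ?u x \<partial>M)" by (rule Bochner_Integration.integral_nonneg) simp
      have "(1 + e\<^sup>2 * (p / 2 - A * q - e * C1)) * (1 + e\<^sup>2 * (p / 2 - e * C2)) \<le> 1"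
        using mult_mono[OF X Y X0 e(4)] XY by linarith
      then have "e\<^sup>2 * ((p - A * q) - e * (C1 + C2) + e\<^sup>2 * ((p / 2 - A * q - e * C1) * (p / 2 - e * C2))) \<le> 0"
        by (simp add: algebra_simps)
      then show ?thesis using e by (simp add: mult_le_0_iff)
    qed
    have "((\<lambda>e. (p - A * q) - e * (C1 + C2) + e\<^sup>2 * ((p / 2 - A * q - e * C1) * (p / 2 - e * C2)))
      \<longlongrightarrow> (p - A * q) - 0 * (C1 + C2) + 0\<^sup>2 * ((p / 2 - A * q - 0 * C1) * (p / 2 - 0 * C2))) (at_right 0)"
      by (intro tendsto_intros)
    moreover have "\<forall>\<^sub>F e in at_right 0. 0 < e \<and> e \<le> 1 \<and> e * (4 * (\<bar>k\<bar> + 1)) \<le> r0 \<and> 0 \<le> 1 + e\<^sup>2 * (p / 2 - e * C2)"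
    proof (intro eventually_conj)
      have "((\<lambda>e. e * (4 * (\<bar>k\<bar> + 1))) \<longlongrightarrow> 0 * (4 * (\<bar>k\<bar> + 1))) (at_right 0)" by (intro tendsto_intros)
      then have "\<forall>\<^sub>F e in at_right 0. e * (4 * (\<bar>k\<bar> + 1)) < r0"
        using r0 by (intro order_tendstoD(2)) auto
      then show "\<forall>\<^sub>F e in at_right 0. e * (4 * (\<bar>k\<bar> + 1)) \<le> r0" by eventually_elim simp
      have "((\<lambda>e. 1 + e\<^sup>2 * (p / 2 - e * C2)) \<longlongrightarrow> 1 + 0\<^sup>2 * (p / 2 - 0 * C2)) (at_right 0)" by (intro tendsto_intros)
      then have "\<forall>\<^sub>F e in at_right 0. 0 < 1 + e\<^sup>2 * (p / 2 - e * C2)"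
        by (intro order_tendstoD(1)) auto
      then show "\<forall>\<^sub>F e in at_right 0. 0 \<le> 1 + e\<^sup>2 * (p / 2 - e * C2)" by eventually_elim simp
    qed (auto simp: eventually_at_right_less intro: eventually_at_rightI[of 0 1])
    ultimately have "(p - A * q) - 0 * (C1 + C2) + 0\<^sup>2 * ((p / 2 - A * q - 0 * C1) * (p / 2 - 0 * C2)) \<le> 0"
      by (elim tendsto_upperbound) (auto elim!: eventually_mono intro: ineq)
    then show "p \<le> A * q" by simp
  qed
  have "((\<lambda>\<eta>. a\<^sup>2 * (1 + \<eta>) * q) \<longlongrightarrow> a\<^sup>2 * (1 + 0) * q) (at_right 0)" by (intro tendsto_intros)
  then have "p \<le> a\<^sup>2 * (1 + 0) * q"
    by (rule tendsto_lowerbound) (auto intro!: eventually_at_rightI[of 0 1] main)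
  then show ?thesis by (simp add: p_def q_def G_def)
qed

end

section \<open>Gaussian shifts\<close>

lemma Cauchy_Schwarz_integral:
  fixes f g :: "'a \<Rightarrow> real"
  assumes [measurable]: "f \<in> borel_measurable M" "g \<in> borel_measurable M"
    and f: "integrable M (\<lambda>x. (f x)\<^sup>2)" and g: "integrable M (\<lambda>x. (g x)\<^sup>2)"
  shows "integrable M (\<lambda>x. f x * g x)"
    "(\<integral>x. f x * g x \<partial>M)\<^sup>2 \<le> (\<integral>x. (f x)\<^sup>2 \<partial>M) * (\<integral>x. (g x)\<^sup>2 \<partial>M)"
    "\<bar>\<integral>x. f x * g x \<partial>M\<bar> \<le> sqrt (\<integral>x. (f x)\<^sup>2 \<partial>M) * sqrt (\<integral>x. (g x)\<^sup>2 \<partial>M)"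
    "(\<integral>x. \<bar>f x\<bar> * \<bar>g x\<bar> \<partial>M) \<le> sqrt (\<integral>x. (f x)\<^sup>2 \<partial>M) * sqrt (\<integral>x. (g x)\<^sup>2 \<partial>M)"
proof -
  have "\<bar>f x * g x\<bar> \<le> (f x)\<^sup>2 + (g x)\<^sup>2" for x
  proof -
    have "2 * (\<bar>f x\<bar> * \<bar>g x\<bar>) \<le> (f x)\<^sup>2 + (g x)\<^sup>2"
      using sum_squares_bound[of "\<bar>f x\<bar>" "\<bar>g x\<bar>"] by simp
    moreover have "0 \<le> \<bar>f x\<bar> * \<bar>g x\<bar>" by simp
    ultimately show ?thesis unfolding abs_mult by linarith
  qed
  then show i: "integrable M (\<lambda>x. f x * g x)"
    by (intro Bochner_Integration.integrable_bound[OF Bochner_Integration.integrable_add[OF f g]]) auto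
  then have i': "integrable M (\<lambda>x. \<bar>f x\<bar> * \<bar>g x\<bar>)" by (simp flip: abs_mult)
  have "(\<integral>\<^sup>+x. ennreal \<bar>f x\<bar> * ennreal \<bar>g x\<bar> \<partial>M)\<^sup>2 \<le> (\<integral>\<^sup>+x. (ennreal \<bar>f x\<bar>)\<^sup>2 \<partial>M) * (\<integral>\<^sup>+x. (ennreal \<bar>g x\<bar>)\<^sup>2 \<partial>M)"
    by (intro Cauchy_Schwarz_nn_integral) auto
  also have "\<dots> = ennreal ((\<integral>x. (f x)\<^sup>2 \<partial>M) * (\<integral>x. (g x)\<^sup>2 \<partial>M))"
    using f g by (simp add: ennreal_power ennreal_mult nn_integral_eq_integral)
  also have "(\<integral>\<^sup>+x. ennreal \<bar>f x\<bar> * ennreal \<bar>g x\<bar> \<partial>M) = ennreal (\<integral>x. \<bar>f x\<bar> * \<bar>g x\<bar> \<partial>M)"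
    using i' by (simp add: ennreal_mult[symmetric] nn_integral_eq_integral)
  finally have sq: "(\<integral>x. \<bar>f x\<bar> * \<bar>g x\<bar> \<partial>M)\<^sup>2 \<le> (\<integral>x. (f x)\<^sup>2 \<partial>M) * (\<integral>x. (g x)\<^sup>2 \<partial>M)"
    by (simp add: ennreal_power)
  have ab: "\<bar>\<integral>x. f x * g x \<partial>M\<bar> \<le> (\<integral>x. \<bar>f x\<bar> * \<bar>g x\<bar> \<partial>M)"
    using integral_abs_bound[of M "\<lambda>x. f x * g x"] by (simp add: abs_mult)
  have "(\<integral>x. f x * g x \<partial>M)\<^sup>2 \<le> (\<integral>x. \<bar>f x\<bar> * \<bar>g x\<bar> \<partial>M)\<^sup>2"
    using ab by (intro abs_le_square_iff[THEN iffD1]) auto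
  with sq show "(\<integral>x. f x * g x \<partial>M)\<^sup>2 \<le> (\<integral>x. (f x)\<^sup>2 \<partial>M) * (\<integral>x. (g x)\<^sup>2 \<partial>M)" by linarith
  show le: "(\<integral>x. \<bar>f x\<bar> * \<bar>g x\<bar> \<partial>M) \<le> sqrt (\<integral>x. (f x)\<^sup>2 \<partial>M) * sqrt (\<integral>x. (g x)\<^sup>2 \<partial>M)"
    unfolding real_sqrt_mult[symmetric] by (rule real_le_rsqrt[OF sq])
  with ab show "\<bar>\<integral>x. f x * g x \<partial>M\<bar> \<le> sqrt (\<integral>x. (f x)\<^sup>2 \<partial>M) * sqrt (\<integral>x. (g x)\<^sup>2 \<partial>M)" by linarith
qed

lemma nn_integral_std_normal_shift:
  assumes [measurable]: "f \<in> borel_measurable borel"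
  shows "(\<integral>\<^sup>+z. f (z + t) \<partial>std_normal_distribution)
    = (\<integral>\<^sup>+z. f z * ennreal (exp (t * z - t\<^sup>2 / 2)) \<partial>std_normal_distribution)"
proof -
  have "(\<integral>\<^sup>+z. f z * ennreal (exp (t * z - t\<^sup>2 / 2)) \<partial>std_normal_distribution)
    = (\<integral>\<^sup>+z. ennreal (std_normal_density (z - t)) * f z \<partial>lborel)"
  proof -
    have "std_normal_density z * exp (t * z - t\<^sup>2 / 2) = std_normal_density (z - t)" for z
    proof -
      have "- z\<^sup>2 / 2 + (t * z - t\<^sup>2 / 2) = - (z - t)\<^sup>2 / 2" by (simp add: power2_eq_square field_simps)
      then show ?thesis unfolding std_normal_density_def mult.assoc exp_add[symmetric] by simp
    qed
    then have "ennreal (std_normal_density z) * (f z * ennreal (exp (t * z - t\<^sup>2 / 2)))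
      = ennreal (std_normal_density (z - t)) * f z" for z
      by (metis (no_types) ennreal_mult'' exp_ge_zero mult.assoc mult.commute)
    then show ?thesis by (simp add: nn_integral_density)
  qed
  also have "\<dots> = (\<integral>\<^sup>+z. ennreal (std_normal_density z) * f (z + t) \<partial>lborel)"
    by (subst nn_integral_real_affine[where c = 1 and t = t]) (auto simp: add.commute)
  finally show ?thesis by (simp add: nn_integral_density)
qed

text \<open>Cameron-Martin density of the standard Gaussian translated by \<open>t\<close>.\<close>

definition shift_weight :: "nat \<Rightarrow> (nat \<Rightarrow> real) \<Rightarrow> (nat \<Rightarrow> real) \<Rightarrow> real" where
  "shift_weight d t z = exp (\<Sum>i<d. t i * z i - (t i)\<^sup>2 / 2)"

lemma measurable_shift_weight [measurable]: "shift_weight d t \<in> borel_measurable (Rd d)"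
  unfolding shift_weight_def by measurable

text \<open>The translation is carried out one coordinate at a time; \<open>f\<close> is arbitrary
  in the induction because the last coordinate has been integrated out when the induction hypothesis
  is applied.\<close>

lemma nn_integral_std_gaussian_shift:
  assumes "f \<in> borel_measurable (Rd d)"
  shows "(\<integral>\<^sup>+z. f (\<lambda>i\<in>{..<d}. z i + t i) \<partial>std_gaussian d)
    = (\<integral>\<^sup>+z. f z * ennreal (shift_weight d t z) \<partial>std_gaussian d)"
  using assms
proof (induction d arbitrary: f)
  case 0
  have "(\<integral>\<^sup>+z. f (\<lambda>i\<in>{..<0}. z i + t i) \<partial>std_gaussian 0) = (\<integral>\<^sup>+z. f z \<partial>std_gaussian 0)"
    by (intro nn_integral_cong arg_cong[of _ _ f]) (auto simp: space_PiM)
  then show ?case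
    unfolding shift_weight_def by (simp only: lessThan_0 sum.empty exp_zero ennreal_1 mult_1_right)
next
  case (Suc d)
  interpret product_sigma_finite "\<lambda>_::nat. std_normal_distribution"
    unfolding product_sigma_finite_def using prob_space_imp_sigma_finite[OF prob_space_std_normal] by simp
  have Suc_eq: "Rd (Suc d) = Pi\<^sub>M (insert d {..<d}) (\<lambda>_. borel)" by (simp add: lessThan_Suc)
  have [measurable]: "f \<in> borel_measurable (Pi\<^sub>M (insert d {..<d}) (\<lambda>_. borel))"
    using Suc.prems unfolding Suc_eq .
  have [measurable]: "f \<in> borel_measurable (Pi\<^sub>M (insert d {..<d}) (\<lambda>_. std_normal_distribution))"
    by (subst measurable_cong_sets[OF sets_PiM_cong refl]) auto
  have [measurable]: "(\<lambda>z. \<lambda>i\<in>insert d {..<d}. z i + t i) \<in> Pi\<^sub>M (insert d {..<d}) (\<lambda>_. std_normal_distribution)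
      \<rightarrow>\<^sub>M Pi\<^sub>M (insert d {..<d}) (\<lambda>_. std_normal_distribution)"
    by (intro measurable_restrict) measurable
  have [measurable]: "shift_weight (Suc d) t \<in> borel_measurable (Pi\<^sub>M (insert d {..<d}) (\<lambda>_. std_normal_distribution))"
    unfolding shift_weight_def lessThan_Suc by measurable
  let ?e = "\<lambda>y. ennreal (exp (t d * y - (t d)\<^sup>2 / 2))"
  have fm: "(\<lambda>y. f (x(d := y))) \<in> borel_measurable borel" if "x \<in> space (Rd d)" for x
    by (rule measurable_compose[OF measurable_component_update[of x "{..<d}" "\<lambda>_. borel" d]]) (use that in auto)
  have "(\<integral>\<^sup>+z. f (\<lambda>i\<in>{..<Suc d}. z i + t i) \<partial>std_gaussian (Suc d))
    = (\<integral>\<^sup>+x. (\<integral>\<^sup>+y. f (\<lambda>i\<in>insert d {..<d}. (x(d := y)) i + t i) \<partial>std_normal_distribution) \<partial>std_gaussian d)"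
    unfolding std_gaussian_def lessThan_Suc by (subst product_nn_integral_insert) auto
  also have "\<dots> = (\<integral>\<^sup>+x. (\<integral>\<^sup>+y. f ((\<lambda>i\<in>{..<d}. x i + t i)(d := y)) * ?e y \<partial>std_normal_distribution) \<partial>std_gaussian d)"
  proof (rule nn_integral_cong)
    fix x
    have "(\<lambda>i\<in>insert d {..<d}. (x(d := y)) i + t i) = (\<lambda>i\<in>{..<d}. x i + t i)(d := y + t d)" for y
      by (auto simp: fun_eq_iff)
    then show "(\<integral>\<^sup>+y. f (\<lambda>i\<in>insert d {..<d}. (x(d := y)) i + t i) \<partial>std_normal_distribution)
      = (\<integral>\<^sup>+y. f ((\<lambda>i\<in>{..<d}. x i + t i)(d := y)) * ?e y \<partial>std_normal_distribution)"
      using nn_integral_std_normal_shift[OF fm, of "\<lambda>i\<in>{..<d}. x i + t i" "t d"] by simp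
  qed
  also have "\<dots> = (\<integral>\<^sup>+x. (\<integral>\<^sup>+y. f (x(d := y)) * ?e y \<partial>std_normal_distribution) * ennreal (shift_weight d t x) \<partial>std_gaussian d)"
  proof (rule Suc.IH)
    have "(\<lambda>(x, y). x(d := y)) \<in> Rd d \<Otimes>\<^sub>M borel \<rightarrow>\<^sub>M Pi\<^sub>M (insert d {..<d}) (\<lambda>_. borel)"
      by measurable
    then have [measurable]: "(\<lambda>(x, y). f (x(d := y))) \<in> borel_measurable (Rd d \<Otimes>\<^sub>M std_normal_distribution)"
      by (subst measurable_cong_sets[OF sets_pair_measure_cong refl, of _ "Rd d" _ borel])
         (auto intro: measurable_compose[of _ _ _ f] simp: case_prod_unfold)
    interpret sigma_finite_measure std_normal_distribution
      by (rule prob_space_imp_sigma_finite[OF prob_space_std_normal])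
    show "(\<lambda>x. \<integral>\<^sup>+y. f (x(d := y)) * ?e y \<partial>std_normal_distribution) \<in> borel_measurable (Rd d)"
      by measurable
  qed
  also have "\<dots> = (\<integral>\<^sup>+x. (\<integral>\<^sup>+y. f (x(d := y)) * ennreal (shift_weight (Suc d) t (x(d := y))) \<partial>std_normal_distribution) \<partial>std_gaussian d)"
  proof (rule nn_integral_cong)
    fix x assume "x \<in> space (std_gaussian d)"
    then have x: "x \<in> space (Rd d)" by simp
    have w: "shift_weight (Suc d) t (x(d := y)) = exp (t d * y - (t d)\<^sup>2 / 2) * shift_weight d t x" for y
      by (simp add: shift_weight_def exp_add[symmetric])
    note fm[OF x, measurable]
    show "(\<integral>\<^sup>+y. f (x(d := y)) * ?e y \<partial>std_normal_distribution) * ennreal (shift_weight d t x)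
      = (\<integral>\<^sup>+y. f (x(d := y)) * ennreal (shift_weight (Suc d) t (x(d := y))) \<partial>std_normal_distribution)"
      unfolding w by (subst nn_integral_multc[symmetric])
        (auto simp: ennreal_mult shift_weight_def mult.assoc intro!: nn_integral_cong)
  qed
  also have "\<dots> = (\<integral>\<^sup>+z. f z * ennreal (shift_weight (Suc d) t z) \<partial>std_gaussian (Suc d))"
    unfolding std_gaussian_def lessThan_Suc by (subst product_nn_integral_insert) auto
  finally show ?case .
qed

lemma distr_std_gaussian_shift:
  "distr (std_gaussian d) (Rd d) (\<lambda>z. \<lambda>i\<in>{..<d}. z i + t i) = density (std_gaussian d) (shift_weight d t)"
proof (rule measure_eqI)
  have [measurable]: "(\<lambda>z. \<lambda>i\<in>{..<d}. z i + t i) \<in> Rd d \<rightarrow>\<^sub>M Rd d"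
    by (intro measurable_restrict) measurable
  fix A assume "A \<in> sets (distr (std_gaussian d) (Rd d) (\<lambda>z. \<lambda>i\<in>{..<d}. z i + t i))"
  then have [measurable]: "A \<in> sets (Rd d)" by simp
  have "emeasure (distr (std_gaussian d) (Rd d) (\<lambda>z. \<lambda>i\<in>{..<d}. z i + t i)) A
    = (\<integral>\<^sup>+z. indicator A (\<lambda>i\<in>{..<d}. z i + t i) \<partial>std_gaussian d)"
    by (subst nn_integral_distr[symmetric, where M' = "Rd d"]) auto
  also have "\<dots> = (\<integral>\<^sup>+z. indicator A z * ennreal (shift_weight d t z) \<partial>std_gaussian d)"
    by (rule nn_integral_std_gaussian_shift) measurable
  also have "\<dots> = emeasure (density (std_gaussian d) (shift_weight d t)) A"
    by (subst emeasure_density) (auto simp: mult.commute)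
  finally show "emeasure (distr (std_gaussian d) (Rd d) (\<lambda>z. \<lambda>i\<in>{..<d}. z i + t i)) A
    = emeasure (density (std_gaussian d) (shift_weight d t)) A" .
qed simp

text \<open>The squared density is exp |t|^2 times the density for 2 t. Hence the variance of the
  density, a chi-square divergence, is exp |t|^2 - 1.\<close>

lemma shift_weight_moments:
  shows "integrable (std_gaussian d) (shift_weight d t)" "(\<integral>z. shift_weight d t z \<partial>std_gaussian d) = 1"
    "integrable (std_gaussian d) (\<lambda>z. (shift_weight d t z)\<^sup>2)"
    "(\<integral>z. (shift_weight d t z)\<^sup>2 \<partial>std_gaussian d) = exp (\<Sum>i<d. (t i)\<^sup>2)"
proof -
  interpret prob_space "std_gaussian d" by simp
  have nn: "(\<integral>\<^sup>+z. ennreal (shift_weight d t z) \<partial>std_gaussian d) = 1" for t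
    using nn_integral_std_gaussian_shift[of "\<lambda>_. 1" d t] by (simp add: emeasure_space_1[unfolded space_std_gaussian])
  have i: "integrable (std_gaussian d) (shift_weight d t)" for t
    using nn[of t] by (intro integrableI_nonneg) (auto simp: shift_weight_def)
  have e: "(\<integral>z. shift_weight d t z \<partial>std_gaussian d) = 1" for t
  proof -
    have "0 \<le> shift_weight d t z" for z by (simp add: shift_weight_def)
    then show ?thesis using nn[of t] nn_integral_eq_integral[OF i[of t]] by simp
  qed
  show "integrable (std_gaussian d) (shift_weight d t)" "(\<integral>z. shift_weight d t z \<partial>std_gaussian d) = 1"
    by (rule i e)+
  have sq: "(shift_weight d t z)\<^sup>2 = exp (\<Sum>i<d. (t i)\<^sup>2) * shift_weight d (\<lambda>i. 2 * t i) z" for z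
  proof -
    have "2 * (\<Sum>i<d. t i * z i - (t i)\<^sup>2 / 2) = (\<Sum>i<d. (t i)\<^sup>2) + (\<Sum>i<d. 2 * t i * z i - (2 * t i)\<^sup>2 / 2)"
      unfolding sum_distrib_left sum.distrib[symmetric] by (intro sum.cong) (auto simp: power2_eq_square algebra_simps)
    then show ?thesis unfolding shift_weight_def exp_add[symmetric] by (simp add: exp_double[symmetric])
  qed
  show "integrable (std_gaussian d) (\<lambda>z. (shift_weight d t z)\<^sup>2)"
    "(\<integral>z. (shift_weight d t z)\<^sup>2 \<partial>std_gaussian d) = exp (\<Sum>i<d. (t i)\<^sup>2)"
    unfolding sq using i e by simp_all
qed

text \<open>The change of the mean is the covariance of u with the Cameron-Martin density, and
  Cauchy-Schwarz applies. The right side explains the modulus sqrt (exp (a^2 r^2) - 1) in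
  \<open>local_lipschitz_poincare\<close>.\<close>

lemma std_gaussian_shift_variance_bound:
  assumes [measurable]: "u \<in> borel_measurable (Rd d)"
    and u2: "integrable (std_gaussian d) (\<lambda>z. (u z)\<^sup>2)"
  defines "m \<equiv> (\<integral>z. u z \<partial>std_gaussian d)"
  shows "((\<integral>z. u (\<lambda>i\<in>{..<d}. z i + t i) \<partial>std_gaussian d) - m)\<^sup>2
    \<le> (\<integral>z. (u z - m)\<^sup>2 \<partial>std_gaussian d) * (exp (\<Sum>i<d. (t i)\<^sup>2) - 1)"
proof -
  interpret prob_space "std_gaussian d" by simp
  let ?w = "shift_weight d t"
  note w = shift_weight_moments[of d t]
  have shift[measurable]: "(\<lambda>z. \<lambda>i\<in>{..<d}. z i + t i) \<in> Rd d \<rightarrow>\<^sub>M Rd d"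
    by (intro measurable_restrict) measurable
  have "(\<integral>z. u (\<lambda>i\<in>{..<d}. z i + t i) \<partial>std_gaussian d)
      = (\<integral>z. u z \<partial>distr (std_gaussian d) (Rd d) (\<lambda>z. \<lambda>i\<in>{..<d}. z i + t i))"
    by (subst integral_distr) auto
  also have "\<dots> = (\<integral>z. ?w z * u z \<partial>std_gaussian d)"
    unfolding distr_std_gaussian_shift by (subst integral_real_density) (auto simp: shift_weight_def)
  finally have 1: "(\<integral>z. u (\<lambda>i\<in>{..<d}. z i + t i) \<partial>std_gaussian d) = (\<integral>z. ?w z * u z \<partial>std_gaussian d)" .
  have u1: "integrable (std_gaussian d) u"
    by (rule square_integrable_imp_integrable[OF _ u2]) simp
  have iwu: "integrable (std_gaussian d) (\<lambda>z. ?w z * u z)"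
    by (rule Cauchy_Schwarz_integral(1)[OF _ _ w(3) u2]) auto
  have um: "integrable (std_gaussian d) (\<lambda>z. (u z - m)\<^sup>2)"
    using u1 u2 by (simp add: power2_diff)
  have wm: "integrable (std_gaussian d) (\<lambda>z. (?w z - 1)\<^sup>2)" "(\<integral>z. (?w z - 1)\<^sup>2 \<partial>std_gaussian d) = exp (\<Sum>i<d. (t i)\<^sup>2) - 1"
    using w prob_space by (simp_all add: power2_diff)
  have "(\<integral>z. (u z - m) * (?w z - 1) \<partial>std_gaussian d) = (\<integral>z. ?w z * u z - u z - m * ?w z + m \<partial>std_gaussian d)"
    by (intro Bochner_Integration.integral_cong) (auto simp: algebra_simps)
  also have "\<dots> = (\<integral>z. ?w z * u z \<partial>std_gaussian d) - m"
    using u1 iwu w prob_space by (simp add: m_def)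
  finally show ?thesis
    using Cauchy_Schwarz_integral(2)[OF _ _ um wm(1)] by (simp add: 1 wm(2))
qed

section \<open>Lipschitz functions on the coordinate space\<close>

lemma Lip_nonneg_const:
  assumes "1 \<le> d" "h \<in> Lip (space (Rd d)) (eucl_dist d) L" shows "0 \<le> L"
proof -
  \<comment> \<open>Two distinct points exist because d \<ge> 1; on a one-point space a negative L
    would satisfy the Lipschitz condition.\<close>
  let ?x = "\<lambda>i\<in>{..<d}. 1::real" and ?y = "\<lambda>i\<in>{..<d}. 0::real"
  have "0 \<le> \<bar>h ?x - h ?y\<bar>" by simp
  also have "\<dots> \<le> L * eucl_dist d ?x ?y" using assms(2) by (auto simp: Lip_def)
  finally have "0 \<le> L * eucl_dist d ?x ?y" .
  moreover have "0 < eucl_dist d ?x ?y"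
  proof -
    have "0 < (\<Sum>i<d. (?x i - ?y i)\<^sup>2)" using assms(1) by (simp add: sum.cong[of _ _ _ "\<lambda>_. 1"])
    then show ?thesis unfolding eucl_dist_power2[symmetric] by (simp only: zero_less_power2 less_le eucl_dist_nonneg) simp
  qed
  ultimately show ?thesis by (simp add: zero_le_mult_iff)
qed

text \<open>\<open>Lip\<close> says nothing about arguments outside the space, so \<open>h\<close>
  is composed with \<open>restrict\<close> to become continuous on all sequences. The countable
  product sigma-algebra is the Borel one, and filling with zeros embeds \<open>Rd d\<close>
  measurably.\<close>

lemma Lip_measurable:
  assumes h: "h \<in> Lip (space (Rd d)) (eucl_dist d) L"
  shows "h \<in> borel_measurable (Rd d)"
proof -
  define h' where "h' y = h (restrict y {..<d})" for y :: "nat \<Rightarrow> real"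
  have dist: "eucl_dist d (restrict x {..<d}) (restrict y {..<d}) = eucl_dist d x y" for x y
    unfolding eucl_dist_def by (rule L2_set_cong) auto
  have bound: "\<bar>h' x - h' y\<bar> \<le> L * eucl_dist d x y" for x y
  proof -
    have "\<bar>h (restrict x {..<d}) - h (restrict y {..<d})\<bar> \<le> L * eucl_dist d (restrict x {..<d}) (restrict y {..<d})"
      using h[unfolded Lip_def mem_Collect_eq, rule_format, OF restrict_in_space_Rd restrict_in_space_Rd] .
    then show ?thesis unfolding h'_def dist .
  qed
  have "continuous_on UNIV h'"
    unfolding continuous_on_def
  proof
    fix y :: "nat \<Rightarrow> real"
    have "continuous_on UNIV (\<lambda>x::nat \<Rightarrow> real. L * eucl_dist d x y)"
      unfolding eucl_dist_def L2_set_def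
      by (intro continuous_intros continuous_on_product_coordinates)
    then have "((\<lambda>x. L * eucl_dist d x y) \<longlongrightarrow> L * eucl_dist d y y) (at y)"
      unfolding continuous_on_def by blast
    then have "((\<lambda>x. L * eucl_dist d x y) \<longlongrightarrow> 0) (at y)" by simp
    moreover have "\<forall>\<^sub>F x in at y. norm (h' x - h' y) \<le> L * eucl_dist d x y"
      using bound by (intro always_eventually allI) simp
    ultimately have "((\<lambda>x. h' x - h' y) \<longlongrightarrow> 0) (at y)"
      by (rule Lim_null_comparison[rotated])
    then show "(h' \<longlongrightarrow> h' y) (at y within UNIV)" by (simp add: LIM_zero_iff)
  qed
  then have "h' \<in> borel_measurable borel" by (rule borel_measurable_continuous_onI)
  then have "h' \<in> borel_measurable (Pi\<^sub>M UNIV (\<lambda>_::nat. borel :: real measure))"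
    by (simp add: measurable_cong_sets[OF sets_PiM_equal_borel refl])
  moreover have "(\<lambda>x i. if i < d then x i else 0) \<in> Rd d \<rightarrow>\<^sub>M Pi\<^sub>M UNIV (\<lambda>_::nat. borel :: real measure)"
  proof (rule measurable_PiM_single')
    show "(\<lambda>x. if i < d then x i else 0) \<in> borel_measurable (Rd d)" for i by (cases "i < d") auto
  qed auto
  ultimately have "(\<lambda>x. h' (\<lambda>i. if i < d then x i else 0)) \<in> borel_measurable (Rd d)"
    by (rule measurable_compose[rotated])
  moreover have "h' (\<lambda>i. if i < d then x i else 0) = h x" if "x \<in> space (Rd d)" for x
    using that unfolding h'_def
    by (intro arg_cong[of _ _ h]) (auto simp: space_Rd PiE_def extensional_def fun_eq_iff)
  ultimately show ?thesis by (simp cong: measurable_cong)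
qed

lemma abs_le_eucl_dist: "i < d \<Longrightarrow> \<bar>x i - y i\<bar> \<le> eucl_dist d x y"
proof (rule power2_le_imp_le)
  assume "i < d"
  then show "\<bar>x i - y i\<bar>\<^sup>2 \<le> (eucl_dist d x y)\<^sup>2"
    unfolding eucl_dist_power2 power2_abs by (intro member_le_sum) auto
qed simp

abbreviation origin :: "nat \<Rightarrow> nat \<Rightarrow> real" where "origin d \<equiv> (\<lambda>i\<in>{..<d}. 0)"

lemma LipD: "h \<in> Lip S c L \<Longrightarrow> x \<in> S \<Longrightarrow> y \<in> S \<Longrightarrow> \<bar>h x - h y\<bar> \<le> L * c x y"
  by (simp add: Lip_def)

lemma eucl_dist_diff_le: "\<bar>eucl_dist d x a - eucl_dist d y a\<bar> \<le> eucl_dist d x y"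
  using eucl_dist_triangle[of d x a y] eucl_dist_triangle[of d y a x] eucl_dist_commute[of d x y] by linarith

lemma Lip_eucl_dist: "(\<lambda>x. eucl_dist d x a) \<in> Lip S (eucl_dist d) 1"
  by (simp add: Lip_def eucl_dist_diff_le)

lemma measurable_eucl_dist [measurable]: "(\<lambda>x. eucl_dist d x a) \<in> borel_measurable (Rd d)"
  by (rule Lip_measurable[OF Lip_eucl_dist])

lemma measurable_eucl_dist_pair [measurable]:
  assumes f: "f \<in> M \<rightarrow>\<^sub>M Rd d" and g: "g \<in> M \<rightarrow>\<^sub>M Rd d"
  shows "(\<lambda>x. eucl_dist d (f x) (g x)) \<in> borel_measurable M"
proof -
  have "(\<lambda>x. f x i) \<in> borel_measurable M" "(\<lambda>x. g x i) \<in> borel_measurable M" if "i < d" for i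
    using f g that by (auto intro: measurable_compose[OF _ measurable_component_singleton])
  then show ?thesis unfolding eucl_dist_def L2_set_def by measurable
qed

lemma Lip_square_integrable:
  assumes "finite_measure \<mu>" and [measurable_cong]: "sets \<mu> = sets (Rd d)"
    and m2: "integrable \<mu> (\<lambda>x. (eucl_dist d x (origin d))\<^sup>2)"
    and h: "h \<in> Lip (space (Rd d)) (eucl_dist d) l"
  shows "integrable \<mu> (\<lambda>x. (h x)\<^sup>2)" "integrable \<mu> h"
proof -
  interpret finite_measure \<mu> by fact
  have hm[measurable]: "h \<in> borel_measurable \<mu>"
    using Lip_measurable[OF h] by measurable
  show h2: "integrable \<mu> (\<lambda>x. (h x)\<^sup>2)"
  proof (rule Bochner_Integration.integrable_bound)
    show "integrable \<mu> (\<lambda>x. 2 * (h (origin d))\<^sup>2 + 2 * l\<^sup>2 * (eucl_dist d x (origin d))\<^sup>2)"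
      using m2 by auto
    show "AE x in \<mu>. norm ((h x)\<^sup>2) \<le> norm (2 * (h (origin d))\<^sup>2 + 2 * l\<^sup>2 * (eucl_dist d x (origin d))\<^sup>2)"
    proof (rule AE_I2)
      fix x assume "x \<in> space \<mu>"
      then have "x \<in> space (Rd d)" using sets_eq_imp_space_eq[OF assms(2)] by simp
      then have "\<bar>h x - h (origin d)\<bar> \<le> \<bar>l * eucl_dist d x (origin d)\<bar>"
        using LipD[OF h, of x "origin d"] by simp
      then have "(h x - h (origin d))\<^sup>2 \<le> (l * eucl_dist d x (origin d))\<^sup>2"
        by (rule abs_le_square_iff[THEN iffD1])
      moreover have "(h x)\<^sup>2 \<le> 2 * (h (origin d))\<^sup>2 + 2 * (h x - h (origin d))\<^sup>2"
        using zero_le_power2[of "h x - 2 * h (origin d)"] by (simp add: power2_eq_square algebra_simps)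
      ultimately show "norm ((h x)\<^sup>2) \<le> norm (2 * (h (origin d))\<^sup>2 + 2 * l\<^sup>2 * (eucl_dist d x (origin d))\<^sup>2)"
        by (simp add: power_mult_distrib)
    qed
  qed measurable
  show "integrable \<mu> h" by (rule square_integrable_imp_integrable[OF hm h2])
qed

lemma (in prob_space) variance_le_second_moment:
  fixes f :: "'a \<Rightarrow> real"
  assumes "integrable M f" "integrable M (\<lambda>x. (f x)\<^sup>2)"
  shows "variance f \<le> (\<integral>x. (f x - c)\<^sup>2 \<partial>M)"
proof -
  define m where "m = expectation f"
  have i: "integrable M (\<lambda>x. (f x - m)\<^sup>2)" using assms by (simp add: power2_diff)
  have "(\<integral>x. (f x - c)\<^sup>2 \<partial>M) = (\<integral>x. (f x - m)\<^sup>2 + 2 * (m - c) * (f x - m) + (m - c)\<^sup>2 \<partial>M)"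
    by (intro Bochner_Integration.integral_cong) (auto simp: power2_eq_square algebra_simps)
  also have "\<dots> = (\<integral>x. (f x - m)\<^sup>2 \<partial>M) + 2 * (m - c) * (expectation f - m) + (m - c)\<^sup>2"
    using i assms(1) by (simp add: prob_space)
  finally show ?thesis by (simp add: m_def)
qed

section \<open>Mixing of the chain in mean square\<close>

locale ula =
  fixes d :: nat and U :: "(nat \<Rightarrow> real) \<Rightarrow> real" and L\<^sub>U m\<^sub>U \<gamma> :: real
  assumes ula: "ula_condition d U L\<^sub>U m\<^sub>U" and gamma_pos: "0 < \<gamma>" and gamma_less: "\<gamma> < 2 / (m\<^sub>U + L\<^sub>U)"
begin

abbreviation step :: "(nat \<Rightarrow> real) \<Rightarrow> (nat \<Rightarrow> real) \<Rightarrow> nat \<Rightarrow> real" where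
  "step \<equiv> ula_step d U \<gamma>"
abbreviation rate :: real where "rate \<equiv> Delta2 (ula_kappa L\<^sub>U m\<^sub>U) \<gamma>"
abbreviation \<sigma>\<^sub>0 :: real where "\<sigma>\<^sub>0 \<equiv> sqrt (2 * \<gamma>)"
abbreviation lipschitz :: "real \<Rightarrow> ((nat \<Rightarrow> real) \<Rightarrow> real) set" where
  "lipschitz \<equiv> Lip (space (Rd d)) (eucl_dist d)"
abbreviation gauss :: "(nat \<Rightarrow> real) measure" where "gauss \<equiv> std_gaussian d"

sublocale G: tau_space gauss "eucl_dist d"
proof -
  interpret prob_space gauss by simp
  show "tau_space gauss (eucl_dist d)"
    by unfold_locales (simp_all add: property_tau_std_gaussian)
qed

lemma kappa_gamma: "0 < ula_kappa L\<^sub>U m\<^sub>U * \<gamma>" "ula_kappa L\<^sub>U m\<^sub>U * \<gamma> < 1"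
  using kappa_gamma_bounds[of L\<^sub>U m\<^sub>U \<gamma>] ula gamma_pos gamma_less by (auto simp: ula_condition_def)

lemmas rate_bounds = Delta2_bounds[OF kappa_gamma]

lemma rate_less: "0 < rate" "0 \<le> rate" "rate < 1" "rate \<le> 1"
  using rate_bounds by auto

lemma step_dist:
  assumes "x \<in> space (Rd d)" "y \<in> space (Rd d)"
  shows "eucl_dist d (step x z) (step y z') \<le> rate * eucl_dist d x y + \<sigma>\<^sub>0 * eucl_dist d z z'"
  by (rule ula_step_dist[OF ula gamma_pos gamma_less assms])

lemma step_dist_noise:
  assumes "x \<in> space (Rd d)" shows "eucl_dist d (step x z) (step x z') \<le> \<sigma>\<^sub>0 * eucl_dist d z z'"
  using step_dist[OF assms assms, of z z'] by simp

lemma step_dist_state: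
  assumes "x \<in> space (Rd d)" "y \<in> space (Rd d)"
  shows "eucl_dist d (step x z) (step y z) \<le> rate * eucl_dist d x y"
  using step_dist[OF assms, of z z] by simp

lemma measurable_grad: "i < d \<Longrightarrow> (\<lambda>x. grad d U x i) \<in> borel_measurable (Rd d)"
proof (rule Lip_measurable[of _ d L\<^sub>U])
  assume i: "i < d"
  show "(\<lambda>x. grad d U x i) \<in> Lip (space (Rd d)) (eucl_dist d) L\<^sub>U"
    unfolding Lip_def
  proof (intro CollectI ballI)
    fix x y assume "x \<in> space (Rd d)" "y \<in> space (Rd d)"
    then have "eucl_dist d (grad d U x) (grad d U y) \<le> L\<^sub>U * eucl_dist d x y"
      using ula by (auto simp: ula_condition_def)
    with abs_le_eucl_dist[OF i, of "grad d U x" "grad d U y"]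
    show "\<bar>grad d U x i - grad d U y i\<bar> \<le> L\<^sub>U * eucl_dist d x y" by linarith
  qed
qed

lemma measurable_step [measurable]:
  assumes f: "f \<in> M \<rightarrow>\<^sub>M Rd d" and g: "g \<in> M \<rightarrow>\<^sub>M Rd d"
  shows "(\<lambda>\<omega>. step (f \<omega>) (g \<omega>)) \<in> M \<rightarrow>\<^sub>M Rd d"
  unfolding ula_step_def
proof (rule measurable_restrict)
  fix i assume "i \<in> {..<d}"
  then have i: "i < d" by simp
  have "(\<lambda>x. f x i) \<in> borel_measurable M" "(\<lambda>x. g x i) \<in> borel_measurable M"
    using f g i by (auto intro: measurable_compose[OF _ measurable_component_singleton])
  moreover have "(\<lambda>x. grad d U (f x) i) \<in> borel_measurable M"
    by (rule measurable_compose[OF f measurable_grad[OF i]])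
  ultimately show "(\<lambda>x. f x i - \<gamma> * grad d U (f x) i + \<sigma>\<^sub>0 * g x i) \<in> borel_measurable M" by measurable
qed

text \<open>Transition operator of the chain, written over the fixed Gaussian rather than over
  \<open>ula_kernel\<close>, so that different starting points are integrated with the same
  noise.\<close>

definition P :: "((nat \<Rightarrow> real) \<Rightarrow> real) \<Rightarrow> (nat \<Rightarrow> real) \<Rightarrow> real" where
  "P u x = (\<integral>z. u (step x z) \<partial>gauss)"

text \<open>Discrete counterpart of the squared gradient: its \<pi>-integral is the loss of squared
  norm in one step, see \<open>integral_local_var\<close>.\<close>

definition local_var :: "((nat \<Rightarrow> real) \<Rightarrow> real) \<Rightarrow> (nat \<Rightarrow> real) \<Rightarrow> real" where
  "local_var u x = (\<integral>z. (u (step x z) - P u x)\<^sup>2 \<partial>gauss)"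

lemma lipschitz_step:
  assumes u: "u \<in> lipschitz l" and l: "0 \<le> l" and x: "x \<in> space (Rd d)"
  shows "\<bar>u (step x z) - u (step x z')\<bar> \<le> l * \<sigma>\<^sub>0 * eucl_dist d z z'"
proof -
  have "\<bar>u (step x z) - u (step x z')\<bar> \<le> l * eucl_dist d (step x z) (step x z')"
    by (rule LipD[OF u]) auto
  also have "\<dots> \<le> l * (\<sigma>\<^sub>0 * eucl_dist d z z')" by (intro mult_left_mono step_dist_noise x l)
  finally show ?thesis by simp
qed

lemma measurable_lipschitz_step:
  assumes "u \<in> lipschitz l" "x \<in> space (Rd d)"
  shows "(\<lambda>z. u (step x z)) \<in> borel_measurable gauss"
proof -
  note Lip_measurable[OF assms(1), measurable]
  have [measurable]: "(\<lambda>_. x) \<in> gauss \<rightarrow>\<^sub>M Rd d" using assms(2) by simp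
  have "(\<lambda>z. step x z) \<in> gauss \<rightarrow>\<^sub>M Rd d" by measurable
  then show ?thesis by measurable
qed

lemma integrable_lipschitz_step:
  assumes "u \<in> lipschitz l" "0 \<le> l" "x \<in> space (Rd d)"
  shows "integrable gauss (\<lambda>z. u (step x z))" "integrable gauss (\<lambda>z. (u (step x z))\<^sup>2)"
  using G.lipschitz_integrable[OF measurable_lipschitz_step[OF assms(1,3)] lipschitz_step[OF assms]] by auto

lemma lipschitz_P:
  assumes u: "u \<in> lipschitz l" and l: "0 \<le> l"
  shows "P u \<in> lipschitz (rate * l)"
  unfolding Lip_def
proof (intro CollectI ballI)
  fix x y assume x: "x \<in> space (Rd d)" and y: "y \<in> space (Rd d)"
  note i = integrable_lipschitz_step(1)[OF u l x] integrable_lipschitz_step(1)[OF u l y]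
  have "\<bar>P u x - P u y\<bar> = \<bar>\<integral>z. u (step x z) - u (step y z) \<partial>gauss\<bar>"
    using i by (simp add: P_def)
  also have "\<dots> \<le> (\<integral>z. \<bar>u (step x z) - u (step y z)\<bar> \<partial>gauss)" by (rule integral_abs_bound)
  also have "\<dots> \<le> (\<integral>z. rate * l * eucl_dist d x y \<partial>gauss)"
  proof (rule integral_mono)
    fix z
    have "\<bar>u (step x z) - u (step y z)\<bar> \<le> l * eucl_dist d (step x z) (step y z)"
      by (rule LipD[OF u]) auto
    also have "\<dots> \<le> l * (rate * eucl_dist d x y)" by (intro mult_left_mono step_dist_state x y l)
    finally show "\<bar>u (step x z) - u (step y z)\<bar> \<le> rate * l * eucl_dist d x y" by (simp add: mult_ac)
  qed (use i in auto)
  finally show "\<bar>P u x - P u y\<bar> \<le> rate * l * eucl_dist d x y" using G.prob_space by simp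
qed

lemma local_var_eq:
  assumes "u \<in> lipschitz l" "0 \<le> l" "x \<in> space (Rd d)"
  shows "local_var u x = (\<integral>z. (u (step x z))\<^sup>2 \<partial>gauss) - (P u x)\<^sup>2"
  unfolding local_var_def P_def
  by (rule G.variance_eq) (rule integrable_lipschitz_step[OF assms])+

lemma local_var_nonneg: "0 \<le> local_var u x"
  unfolding local_var_def by simp

text \<open>The bound is uniform in the state, as \<open>local_lipschitz_poincare\<close> asks for a
  bounded slope.\<close>

lemma local_var_le:
  assumes "u \<in> lipschitz l" "0 \<le> l" "x \<in> space (Rd d)"
  shows "local_var u x \<le> (l * \<sigma>\<^sub>0)\<^sup>2 * (\<integral>z. (eucl_dist d z (origin d))\<^sup>2 \<partial>gauss)"
proof -
  have iz: "integrable gauss (\<lambda>z. (eucl_dist d z (origin d))\<^sup>2)"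
    by (rule G.lipschitz_integrable(2)[of _ 1]) (auto simp: eucl_dist_diff_le)
  note i = integrable_lipschitz_step[OF assms]
  have "local_var u x \<le> (\<integral>z. (u (step x z) - u (step x (origin d)))\<^sup>2 \<partial>gauss)"
    unfolding local_var_def P_def by (rule G.variance_le_second_moment[OF i])
  also have "\<dots> \<le> (\<integral>z. (l * \<sigma>\<^sub>0)\<^sup>2 * (eucl_dist d z (origin d))\<^sup>2 \<partial>gauss)"
  proof (rule integral_mono)
    fix z
    have "\<bar>u (step x z) - u (step x (origin d))\<bar> \<le> \<bar>l * \<sigma>\<^sub>0 * eucl_dist d z (origin d)\<bar>"
      using lipschitz_step[OF assms, of z "origin d"] by linarith
    then have "(u (step x z) - u (step x (origin d)))\<^sup>2 \<le> (l * \<sigma>\<^sub>0 * eucl_dist d z (origin d))\<^sup>2"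
      by (rule abs_le_square_iff[THEN iffD1])
    then show "(u (step x z) - u (step x (origin d)))\<^sup>2 \<le> (l * \<sigma>\<^sub>0)\<^sup>2 * (eucl_dist d z (origin d))\<^sup>2"
      by (simp add: power_mult_distrib)
  next
    show "integrable gauss (\<lambda>z. (u (step x z) - u (step x (origin d)))\<^sup>2)"
      using i by (simp add: power2_diff)
  qed (use iz in auto)
  finally show ?thesis using iz by simp
qed

text \<open>Moving the start from x to y has the same effect as translating the noise by
  \<open>t\<close>, the difference of the two gradient steps divided by the noise scale. The
  translation bound then controls the slope of P u by the fluctuations of u, a reverse Poincare
  inequality.\<close>

lemma P_local_lipschitz:
  assumes u: "u \<in> lipschitz l" and l: "0 \<le> l" and x: "x \<in> space (Rd d)" and y: "y \<in> space (Rd d)"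
  shows "\<bar>P u x - P u y\<bar> \<le> sqrt (local_var u x) * sqrt (exp (rate\<^sup>2 * (eucl_dist d x y)\<^sup>2 / (2 * \<gamma>)) - 1)"
proof -
  define T where "T x i = x i - \<gamma> * grad d U x i" for x i
  define t where "t i = (T y i - T x i) / \<sigma>\<^sub>0" for i
  have s: "0 < \<sigma>\<^sub>0" "\<sigma>\<^sub>0\<^sup>2 = 2 * \<gamma>" using gamma_pos by auto
  have sh: "step y z = step x (\<lambda>i\<in>{..<d}. z i + t i)" for z
  proof -
    have "y i - \<gamma> * grad d U y i + \<sigma>\<^sub>0 * z i = x i - \<gamma> * grad d U x i + \<sigma>\<^sub>0 * (z i + t i)" for i
      using s by (simp add: t_def T_def field_simps)
    then show ?thesis by (auto simp: ula_step_def fun_eq_iff)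
  qed
  have "(\<Sum>i<d. (t i)\<^sup>2) = (eucl_dist d (T x) (T y))\<^sup>2 / (2 * \<gamma>)"
    using s(2) by (simp add: t_def eucl_dist_power2 power_divide sum_divide_distrib[symmetric] power2_commute)
  also have "\<dots> \<le> (rate * eucl_dist d x y)\<^sup>2 / (2 * \<gamma>)"
    using gradient_step_contraction[OF ula gamma_pos gamma_less x y] gamma_pos
    by (intro divide_right_mono power_mono) (auto simp: T_def[abs_def])
  finally have t: "(\<Sum>i<d. (t i)\<^sup>2) \<le> rate\<^sup>2 * (eucl_dist d x y)\<^sup>2 / (2 * \<gamma>)" by (simp add: power_mult_distrib)
  have "(P u y - P u x)\<^sup>2 \<le> local_var u x * (exp (\<Sum>i<d. (t i)\<^sup>2) - 1)"
    using std_gaussian_shift_variance_bound[of "\<lambda>z. u (step x z)" d t]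
      measurable_lipschitz_step[OF u x, unfolded measurable_cong_sets[OF sets_std_gaussian refl]]
      integrable_lipschitz_step(2)[OF u l x]
    by (simp add: P_def local_var_def sh)
  also have "\<dots> \<le> local_var u x * (exp (rate\<^sup>2 * (eucl_dist d x y)\<^sup>2 / (2 * \<gamma>)) - 1)"
    using t by (intro mult_left_mono local_var_nonneg) auto
  finally have "\<bar>P u y - P u x\<bar> \<le> sqrt (local_var u x * (exp (rate\<^sup>2 * (eucl_dist d x y)\<^sup>2 / (2 * \<gamma>)) - 1))"
    by (intro real_le_rsqrt) simp
  then show ?thesis by (simp add: real_sqrt_mult abs_minus_commute)
qed

lemma measurable_local_var:
  assumes u: "u \<in> lipschitz l" and l: "0 \<le> l"
  shows "local_var u \<in> borel_measurable (Rd d)"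
proof -
  note Lip_measurable[OF u, measurable] Lip_measurable[OF lipschitz_P[OF u l], measurable]
  have "(\<lambda>(x, z). (u (step x z) - P u x)\<^sup>2) \<in> borel_measurable (Rd d \<Otimes>\<^sub>M gauss)" by measurable
  then have "(\<lambda>x. \<integral>z. (u (step x z) - P u x)\<^sup>2 \<partial>gauss) \<in> borel_measurable (Rd d)"
    by (rule G.borel_measurable_lebesgue_integral)
  then show ?thesis by (simp add: local_var_def[abs_def])
qed

text \<open>Poincare inequality in the noise for P u after one step, with the root of
  \<open>local_var\<close> u as slope. The squared distance created by the noise carries a factor 2
  \<gamma>, which cancels the 2 \<gamma> of \<open>P_local_lipschitz\<close>.\<close>

lemma local_var_P_le:
  assumes u: "u \<in> lipschitz l" and l: "0 \<le> l" and x: "x \<in> space (Rd d)"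
  shows "local_var (P u) x \<le> rate\<^sup>2 * (\<integral>z. local_var u (step x z) \<partial>gauss)"
proof -
  note Pu = lipschitz_P[OF u l]
  have rl: "0 \<le> rate * l" using l rate_less by simp
  have "(\<integral>z. (P u (step x z) - (\<integral>z. P u (step x z) \<partial>gauss))\<^sup>2 \<partial>gauss)
    \<le> rate\<^sup>2 * (\<integral>z. (sqrt (local_var u (step x z)))\<^sup>2 \<partial>gauss)"
  proof (rule G.local_lipschitz_poincare)
    show "(\<lambda>z. P u (step x z)) \<in> borel_measurable gauss" by (rule measurable_lipschitz_step[OF Pu x])
    have [measurable]: "(\<lambda>_. x) \<in> gauss \<rightarrow>\<^sub>M Rd d" using x by simp
    note measurable_local_var[OF u l, measurable]
    have "(\<lambda>z. step x z) \<in> gauss \<rightarrow>\<^sub>M Rd d" by measurable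
    then show "(\<lambda>z. sqrt (local_var u (step x z))) \<in> borel_measurable gauss" by measurable
    show "\<bar>P u (step x z) - P u (step x z')\<bar> \<le> rate * l * \<sigma>\<^sub>0 * eucl_dist d z z'" for z z'
      by (rule lipschitz_step[OF Pu rl x])
    show "0 \<le> sqrt (local_var u (step x z))" for z by (simp add: local_var_nonneg)
    show "sqrt (local_var u (step x z)) \<le> sqrt ((l * \<sigma>\<^sub>0)\<^sup>2 * (\<integral>z. (eucl_dist d z (origin d))\<^sup>2 \<partial>gauss))" for z
      using local_var_le[OF u l, of "step x z"] by simp
    show "0 < rate" by (rule rate_less)
    fix z z'
    have "rate\<^sup>2 * (eucl_dist d (step x z) (step x z'))\<^sup>2 / (2 * \<gamma>) \<le> rate\<^sup>2 * (\<sigma>\<^sub>0 * eucl_dist d z z')\<^sup>2 / (2 * \<gamma>)"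
      using gamma_pos by (intro divide_right_mono mult_left_mono power_mono step_dist_noise x) auto
    also have "\<dots> = rate\<^sup>2 * (eucl_dist d z z')\<^sup>2" using gamma_pos by (simp add: power_mult_distrib)
    finally have "sqrt (exp (rate\<^sup>2 * (eucl_dist d (step x z) (step x z'))\<^sup>2 / (2 * \<gamma>)) - 1)
      \<le> sqrt (exp (rate\<^sup>2 * (eucl_dist d z z')\<^sup>2) - 1)" by simp
    then have "sqrt (local_var u (step x z)) * sqrt (exp (rate\<^sup>2 * (eucl_dist d (step x z) (step x z'))\<^sup>2 / (2 * \<gamma>)) - 1)
      \<le> sqrt (local_var u (step x z)) * sqrt (exp (rate\<^sup>2 * (eucl_dist d z z')\<^sup>2) - 1)"
      by (rule mult_left_mono) (simp add: local_var_nonneg)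
    with P_local_lipschitz[OF u l ula_step_in_space ula_step_in_space]
    show "\<bar>P u (step x z) - P u (step x z')\<bar>
      \<le> sqrt (local_var u (step x z)) * sqrt (exp (rate\<^sup>2 * (eucl_dist d z z')\<^sup>2) - 1)"
      by (rule order_trans)
  qed
  then show ?thesis by (simp add: local_var_def[of "P u"] P_def[of "P u"] local_var_nonneg)
qed

end

section \<open>The invariant measure and the mean-square contraction\<close>

locale stationary_ula = ula +
  fixes \<pi> :: "(nat \<Rightarrow> real) measure"
  assumes inv: "ula_invariant d U \<gamma> \<pi>"
begin

sublocale pi: prob_space \<pi> using inv by (simp add: ula_invariant_def)

lemma sets_pi [measurable_cong, simp]: "sets \<pi> = sets (Rd d)"
  using inv by (simp add: ula_invariant_def)

lemma space_pi [simp]: "space \<pi> = space (Rd d)"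
  by (rule sets_eq_imp_space_eq) simp

sublocale piG: pair_prob_space \<pi> gauss ..

lemma nn_integral_stationary:
  assumes [measurable]: "f \<in> borel_measurable (Rd d)"
  shows "(\<integral>\<^sup>+x. (\<integral>\<^sup>+z. f (step x z) \<partial>gauss) \<partial>\<pi>) = (\<integral>\<^sup>+x. f x \<partial>\<pi>)"
proof -
  have [measurable]: "ula_kernel d U \<gamma> \<in> \<pi> \<rightarrow>\<^sub>M subprob_algebra (Rd d)"
    unfolding ula_kernel_def[abs_def]
  proof (rule measurable_distr2)
    show "case_prod step \<in> \<pi> \<Otimes>\<^sub>M Rd d \<rightarrow>\<^sub>M Rd d" unfolding case_prod_unfold by measurable
    have "gauss \<in> space (subprob_algebra (Rd d))"
      using G.prob_space_axioms by (intro prob_space.M_in_subprob[THEN subset_trans[of "{gauss}", simplified]])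
         (auto simp: space_subprob_algebra intro!: prob_space_imp_subprob_space)
    then show "(\<lambda>_. gauss) \<in> \<pi> \<rightarrow>\<^sub>M subprob_algebra (Rd d)" by simp
  qed
  have "(\<integral>\<^sup>+x. f x \<partial>\<pi>) = (\<integral>\<^sup>+x. f x \<partial>(\<pi> \<bind> ula_kernel d U \<gamma>))"
    using inv by (simp add: ula_invariant_def)
  also have "\<dots> = (\<integral>\<^sup>+x. (\<integral>\<^sup>+y. f y \<partial>ula_kernel d U \<gamma> x) \<partial>\<pi>)"
    by (rule nn_integral_bind) measurable
  also have "\<dots> = (\<integral>\<^sup>+x. (\<integral>\<^sup>+z. f (step x z) \<partial>gauss) \<partial>\<pi>)"
  proof (rule nn_integral_cong)
    fix x assume "x \<in> space \<pi>"
    then have [measurable]: "(\<lambda>_. x) \<in> gauss \<rightarrow>\<^sub>M Rd d" by simp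
    show "(\<integral>\<^sup>+y. f y \<partial>ula_kernel d U \<gamma> x) = (\<integral>\<^sup>+z. f (step x z) \<partial>gauss)"
      unfolding ula_kernel_def by (subst nn_integral_distr) (auto intro!: measurable_step)
  qed
  finally show ?thesis by simp
qed

lemma distr_step: "distr (\<pi> \<Otimes>\<^sub>M gauss) (Rd d) (\<lambda>p. step (fst p) (snd p)) = \<pi>"
proof (rule measure_eqI)
  fix A assume "A \<in> sets (distr (\<pi> \<Otimes>\<^sub>M gauss) (Rd d) (\<lambda>p. step (fst p) (snd p)))"
  then have [measurable]: "A \<in> sets (Rd d)" by simp
  have "emeasure (distr (\<pi> \<Otimes>\<^sub>M gauss) (Rd d) (\<lambda>p. step (fst p) (snd p))) A
    = (\<integral>\<^sup>+p. indicator A (step (fst p) (snd p)) \<partial>(\<pi> \<Otimes>\<^sub>M gauss))"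
    by (subst nn_integral_distr[symmetric, where M' = "Rd d"]) auto
  also have "\<dots> = (\<integral>\<^sup>+x. (\<integral>\<^sup>+z. indicator A (step x z) \<partial>gauss) \<partial>\<pi>)"
    by (subst G.nn_integral_fst[symmetric]) auto
  also have "\<dots> = emeasure \<pi> A"
    by (subst nn_integral_stationary) auto
  finally show "emeasure (distr (\<pi> \<Otimes>\<^sub>M gauss) (Rd d) (\<lambda>p. step (fst p) (snd p))) A = emeasure \<pi> A" .
qed simp

lemma integral_stationary:
  fixes f :: "(nat \<Rightarrow> real) \<Rightarrow> real"
  assumes f: "integrable \<pi> f"
  shows "integrable \<pi> (\<lambda>x. \<integral>z. f (step x z) \<partial>gauss)"
    "(\<integral>x. (\<integral>z. f (step x z) \<partial>gauss) \<partial>\<pi>) = (\<integral>x. f x \<partial>\<pi>)"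
proof -
  have [measurable]: "f \<in> borel_measurable (Rd d)" using f by (auto dest: borel_measurable_integrable)
  have "integrable (distr (\<pi> \<Otimes>\<^sub>M gauss) (Rd d) (\<lambda>p. step (fst p) (snd p))) f"
    unfolding distr_step by (rule f)
  then have i: "integrable (\<pi> \<Otimes>\<^sub>M gauss) (\<lambda>p. f (step (fst p) (snd p)))"
    by (subst (asm) integrable_distr_eq) auto
  show "integrable \<pi> (\<lambda>x. \<integral>z. f (step x z) \<partial>gauss)"
    using piG.integrable_fst'[OF i] by simp
  have "(\<integral>x. (\<integral>z. f (step x z) \<partial>gauss) \<partial>\<pi>) = (\<integral>p. f (step (fst p) (snd p)) \<partial>(\<pi> \<Otimes>\<^sub>M gauss))"
    using piG.integral_fst'[OF i] by simp
  also have "\<dots> = (\<integral>x. f x \<partial>distr (\<pi> \<Otimes>\<^sub>M gauss) (Rd d) (\<lambda>p. step (fst p) (snd p)))"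
    by (subst integral_distr) auto
  finally show "(\<integral>x. (\<integral>z. f (step x z) \<partial>gauss) \<partial>\<pi>) = (\<integral>x. f x \<partial>\<pi>)" unfolding distr_step .
qed

text \<open>No moment of \<open>\<pi>\<close> is known beforehand, so the drift inequality
  \<open>V (step x z) \<le> rate * V x + W z\<close> is integrated after truncating both sides.\<close>

lemma pi_second_moment: "integrable \<pi> (\<lambda>x. (eucl_dist d x (origin d))\<^sup>2)"
proof -
  let ?o = "origin d"
  define V where "V x = (eucl_dist d x ?o)\<^sup>2" for x
  define c where "c = eucl_dist d (step ?o ?o) ?o"
  define W where "W z = (\<sigma>\<^sub>0 * eucl_dist d z ?o + c)\<^sup>2 / (1 - rate)" for z
  have [measurable]: "V \<in> borel_measurable (Rd d)" unfolding V_def by measurable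
  have V0: "0 \<le> V x" for x by (simp add: V_def)
  have drift: "V (step x z) \<le> rate * V x + W z" if x: "x \<in> space (Rd d)" for x z
  proof -
    define a where "a = eucl_dist d x ?o"
    define b where "b = \<sigma>\<^sub>0 * eucl_dist d z ?o + c"
    have "eucl_dist d (step x z) ?o \<le> eucl_dist d (step x z) (step ?o ?o) + c"
      unfolding c_def by (rule eucl_dist_triangle)
    also have "\<dots> \<le> rate * a + b"
      using step_dist[OF x, of ?o z ?o] by (simp add: a_def b_def)
    finally have "V (step x z) \<le> (rate * a + b)\<^sup>2" unfolding V_def by (intro power_mono) auto
    \<comment> \<open>Convexity of the square with the weights rate and 1 - rate, at the points a
      and b / (1 - rate).\<close>
    also have "\<dots> \<le> rate * a\<^sup>2 + b\<^sup>2 / (1 - rate)"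
    proof -
      have "(1 - rate) * (rate * a\<^sup>2 + b\<^sup>2 / (1 - rate)) - (1 - rate) * (rate * a + b)\<^sup>2 = rate * ((1 - rate) * a - b)\<^sup>2"
      proof -
        have "(1 - rate) * (b\<^sup>2 / (1 - rate)) = b\<^sup>2" using rate_less by simp
        then show ?thesis unfolding distrib_left by (simp add: power2_eq_square algebra_simps)
      qed
      moreover have "0 \<le> rate * ((1 - rate) * a - b)\<^sup>2" using rate_less by simp
      ultimately have "(1 - rate) * (rate * a + b)\<^sup>2 \<le> (1 - rate) * (rate * a\<^sup>2 + b\<^sup>2 / (1 - rate))" by linarith
      then show ?thesis using rate_less by (simp only: mult_le_cancel_left_pos diff_gt_0_iff_gt)
    qed
    finally show ?thesis by (simp add: W_def V_def a_def b_def)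
  qed
  have iW: "integrable gauss W"
  proof -
    have "integrable gauss (\<lambda>z. (\<sigma>\<^sub>0 * eucl_dist d z ?o + c)\<^sup>2)"
    proof (rule G.lipschitz_integrable(2)[of _ \<sigma>\<^sub>0])
      fix x y
      have "\<bar>(\<sigma>\<^sub>0 * eucl_dist d x ?o + c) - (\<sigma>\<^sub>0 * eucl_dist d y ?o + c)\<bar> = \<sigma>\<^sub>0 * \<bar>eucl_dist d x ?o - eucl_dist d y ?o\<bar>"
        using gamma_pos by (simp add: right_diff_distrib[symmetric] abs_mult)
      also have "\<dots> \<le> \<sigma>\<^sub>0 * eucl_dist d x y"
        using gamma_pos by (intro mult_left_mono eucl_dist_diff_le) auto
      finally show "\<bar>(\<sigma>\<^sub>0 * eucl_dist d x ?o + c) - (\<sigma>\<^sub>0 * eucl_dist d y ?o + c)\<bar> \<le> \<sigma>\<^sub>0 * eucl_dist d x y" .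
    qed measurable
    then show ?thesis unfolding W_def by simp
  qed
  define w where "w = (\<integral>z. W z \<partial>gauss)"
  have trunc: "(\<integral>\<^sup>+x. ennreal ((1 - rate) * V x) * indicator {x. V x \<le> real M} x \<partial>\<pi>) \<le> ennreal w" for M :: nat
  proof -
    have im: "integrable \<pi> (\<lambda>x. min (k * V x) (real M))" if "0 \<le> k" for k
      using that V0 by (intro pi.integrable_const_bound[where B = "real M"]) auto
    have im1: "integrable \<pi> (\<lambda>x. min (V x) (real M))" using im[of 1] by simp
    have "(\<integral>x. min (V x) (real M) \<partial>\<pi>) = (\<integral>x. (\<integral>z. min (V (step x z)) (real M) \<partial>gauss) \<partial>\<pi>)"
      by (rule integral_stationary(2)[symmetric, OF im1])
    also have "\<dots> \<le> (\<integral>x. min (rate * V x) (real M) + w \<partial>\<pi>)"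
    proof (rule integral_mono)
      show "integrable \<pi> (\<lambda>x. \<integral>z. min (V (step x z)) (real M) \<partial>gauss)" by (rule integral_stationary(1)[OF im1])
      show "integrable \<pi> (\<lambda>x. min (rate * V x) (real M) + w)" using im[of rate] rate_less by simp
      fix x assume "x \<in> space \<pi>"
      then have x: "x \<in> space (Rd d)" by simp
      have [measurable]: "(\<lambda>_. x) \<in> gauss \<rightarrow>\<^sub>M Rd d" using x by simp
      have "(\<integral>z. min (V (step x z)) (real M) \<partial>gauss) \<le> (\<integral>z. min (rate * V x) (real M) + W z \<partial>gauss)"
      proof (rule integral_mono)
        show "integrable gauss (\<lambda>z. min (V (step x z)) (real M))"
          using V0 by (intro G.integrable_const_bound[where B = "real M"]) auto
        fix z
        have "0 \<le> W z" unfolding W_def using rate_less by simp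
        then show "min (V (step x z)) (real M) \<le> min (rate * V x) (real M) + W z"
          using drift[OF x, of z] by linarith
      qed (use iW in simp)
      also have "\<dots> = min (rate * V x) (real M) + w" using iW G.prob_space by (simp add: w_def)
      finally show "(\<integral>z. min (V (step x z)) (real M) \<partial>gauss) \<le> min (rate * V x) (real M) + w" .
    qed
    also have "\<dots> = (\<integral>x. min (rate * V x) (real M) \<partial>\<pi>) + w"
      using im[of rate] rate_less pi.prob_space by simp
    finally have le: "(\<integral>x. min (V x) (real M) - min (rate * V x) (real M) \<partial>\<pi>) \<le> w"
      using im1 im[of rate] rate_less by simp
    \<comment> \<open>On {V \<le> M} neither truncation acts and the difference of the minima is
      exactly (1 - rate) V; elsewhere it is nonnegative. Letting M grow gives the moment.\<close>
    have "(\<integral>\<^sup>+x. ennreal ((1 - rate) * V x) * indicator {x. V x \<le> real M} x \<partial>\<pi>)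
      \<le> (\<integral>\<^sup>+x. ennreal (min (V x) (real M) - min (rate * V x) (real M)) \<partial>\<pi>)"
    proof (rule nn_integral_mono)
      fix x
      have "rate * V x \<le> V x" using V0[of x] rate_less by (simp add: mult_left_le_one_le)
      then show "ennreal ((1 - rate) * V x) * indicator {x. V x \<le> real M} x
        \<le> ennreal (min (V x) (real M) - min (rate * V x) (real M))"
        by (auto split: split_indicator simp: algebra_simps intro!: ennreal_leI)
    qed
    also have "\<dots> = ennreal (\<integral>x. min (V x) (real M) - min (rate * V x) (real M) \<partial>\<pi>)"
    proof (rule nn_integral_eq_integral)
      show "AE x in \<pi>. 0 \<le> min (V x) (real M) - min (rate * V x) (real M)"
        using V0 rate_less by (auto simp: mult_left_le_one_le min_le_iff_disj)
    qed (use im1 im[of rate] rate_less in simp)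
    also have "\<dots> \<le> ennreal w" using le by (rule ennreal_leI)
    finally show ?thesis .
  qed
  have "(\<lambda>M. \<integral>\<^sup>+x. ennreal ((1 - rate) * V x) * indicator {x. V x \<le> real M} x \<partial>\<pi>)
    \<longlonglongrightarrow> (\<integral>\<^sup>+x. ennreal ((1 - rate) * V x) \<partial>\<pi>)"
  proof (rule nn_integral_LIMSEQ)
    show "incseq (\<lambda>M x. ennreal ((1 - rate) * V x) * indicator {x. V x \<le> real M} x)"
      by (auto simp: incseq_def le_fun_def split: split_indicator)
    show "(\<lambda>M. ennreal ((1 - rate) * V x) * indicator {x. V x \<le> real M} x) \<longlonglongrightarrow> ennreal ((1 - rate) * V x)" for x
    proof -
      obtain N :: nat where "V x \<le> real N" using real_arch_simple by blast
      then show ?thesis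
        by (intro tendsto_eventually eventually_sequentiallyI[of N]) auto
    qed
  qed measurable
  then have "(\<integral>\<^sup>+x. ennreal ((1 - rate) * V x) \<partial>\<pi>) \<le> ennreal w"
    by (rule LIMSEQ_le_const2) (use trunc in auto)
  then have "integrable \<pi> (\<lambda>x. (1 - rate) * V x)"
    using V0 rate_less by (intro integrableI_nonneg) (auto simp: le_less_trans)
  then have "integrable \<pi> (\<lambda>x. (1 - rate) * V x / (1 - rate))" by (rule integrable_divide)
  moreover have "(1 - rate) * V x / (1 - rate) = V x" for x using rate_less by simp
  ultimately show ?thesis by (simp only: V_def)
qed

lemmas pi_lipschitz_integrable = Lip_square_integrable[OF pi.finite_measure_axioms sets_pi pi_second_moment]

lemma integral_P:
  assumes "u \<in> lipschitz l" shows "(\<integral>x. P u x \<partial>\<pi>) = (\<integral>x. u x \<partial>\<pi>)"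
  unfolding P_def by (rule integral_stationary(2)[OF pi_lipschitz_integrable(2)[OF assms]])

text \<open>Stationarity replaces the integral of P (u^2) by that of u^2, so the mean local variance
  is a telescoping difference of squared norms.\<close>

lemma integral_local_var:
  assumes u: "u \<in> lipschitz l" and l: "0 \<le> l"
  shows "integrable \<pi> (local_var u)"
    "(\<integral>x. local_var u x \<partial>\<pi>) = (\<integral>x. (u x)\<^sup>2 \<partial>\<pi>) - (\<integral>x. (P u x)\<^sup>2 \<partial>\<pi>)"
proof -
  note i = integral_stationary[OF pi_lipschitz_integrable(1)[OF u]]
  note i' = pi_lipschitz_integrable(1)[OF lipschitz_P[OF u l]]
  have eq: "x \<in> space \<pi> \<Longrightarrow> local_var u x = (\<integral>z. (u (step x z))\<^sup>2 \<partial>gauss) - (P u x)\<^sup>2" for x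
    using local_var_eq[OF u l] by simp
  have "integrable \<pi> (\<lambda>x. (\<integral>z. (u (step x z))\<^sup>2 \<partial>gauss) - (P u x)\<^sup>2)" using i i' by simp
  then show "integrable \<pi> (local_var u)" 
    using eq by (subst Bochner_Integration.integrable_cong[of \<pi> \<pi> _ "\<lambda>x. (\<integral>z. (u (step x z))\<^sup>2 \<partial>gauss) - (P u x)\<^sup>2"]) auto
  have "(\<integral>x. local_var u x \<partial>\<pi>) = (\<integral>x. (\<integral>z. (u (step x z))\<^sup>2 \<partial>gauss) - (P u x)\<^sup>2 \<partial>\<pi>)"
    using eq by (intro Bochner_Integration.integral_cong) auto
  then show "(\<integral>x. local_var u x \<partial>\<pi>) = (\<integral>x. (u x)\<^sup>2 \<partial>\<pi>) - (\<integral>x. (P u x)\<^sup>2 \<partial>\<pi>)"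
    using i i' by simp
qed

lemma integral_local_var_P_le:
  assumes u: "u \<in> lipschitz l" and l: "0 \<le> l"
  shows "(\<integral>x. local_var (P u) x \<partial>\<pi>) \<le> rate\<^sup>2 * (\<integral>x. local_var u x \<partial>\<pi>)"
proof -
  note i = integral_stationary[OF integral_local_var(1)[OF u l]]
  have rl: "0 \<le> rate * l" using l rate_less by simp
  have "(\<integral>x. local_var (P u) x \<partial>\<pi>) \<le> (\<integral>x. rate\<^sup>2 * (\<integral>z. local_var u (step x z) \<partial>gauss) \<partial>\<pi>)"
    using local_var_P_le[OF u l] integral_local_var(1)[OF lipschitz_P[OF u l] rl] i(1)
    by (intro integral_mono) auto
  then show ?thesis using i by simp
qed

text \<open>The decrements \<open>v\<^sub>k\<close> of \<open>\<parallel>P\<^sup>k u\<parallel>\<^sup>2\<close> satisfy \<open>v\<^sub>k\<^sub>+\<^sub>1 \<le> rate\<^sup>2 v\<^sub>k\<close>; summing them gives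
  the contraction although the chain need not be reversible.\<close>

theorem L2_contraction:
  assumes u: "u \<in> lipschitz l" and l: "0 \<le> l" and mean: "(\<integral>x. u x \<partial>\<pi>) = 0"
  shows "(\<integral>x. (P u x)\<^sup>2 \<partial>\<pi>) \<le> rate\<^sup>2 * (\<integral>x. (u x)\<^sup>2 \<partial>\<pi>)"
proof -
  define uk where "uk k = (P ^^ k) u" for k
  have uS: "uk (Suc k) = P (uk k)" for k by (simp add: uk_def)
  have uk: "uk k \<in> lipschitz (rate ^ k * l)" for k
  proof (induction k)
    case (Suc k)
    show ?case using lipschitz_P[OF Suc] l rate_less by (simp add: uS mult.assoc)
  qed (use u in \<open>simp add: uk_def\<close>)
  have nn: "0 \<le> rate ^ k * l" for k using l rate_less by simp
  have mk: "(\<integral>x. uk k x \<partial>\<pi>) = 0" for k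
    by (induction k) (simp_all add: uk_def mean integral_P[OF uk, unfolded uk_def])
  define a where "a k = (\<integral>x. (uk k x)\<^sup>2 \<partial>\<pi>)" for k
  have v: "(\<integral>x. local_var (uk k) x \<partial>\<pi>) = a k - a (Suc k)" for k
    unfolding a_def uS by (rule integral_local_var(2)[OF uk nn])
  have dec: "a (Suc k) - a (Suc (Suc k)) \<le> rate\<^sup>2 * (a k - a (Suc k))" for k
    using integral_local_var_P_le[OF uk nn, of k] unfolding uS[symmetric] v .
  have tel: "a 1 - a (Suc k) \<le> rate\<^sup>2 * (a 0 - a k)" for k
  proof (induction k)
    case (Suc k)
    then show ?case using dec[of k] by (simp add: algebra_simps)
  qed simp
  define m where "m = (\<integral>x. (eucl_dist d x (origin d))\<^sup>2 \<partial>\<pi>)"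
  \<comment> \<open>The iterates have mean zero and Lipschitz constant rate^k l, so the second
    moment of \<pi> makes their squared norms tend to 0. The telescoped inequality needs this at
    infinity.\<close>
  have ale: "a k \<le> (rate ^ k * l)\<^sup>2 * m" for k
  proof -
    note i = pi_lipschitz_integrable[OF uk]
    have "a k \<le> (\<integral>x. (uk k x - uk k (origin d))\<^sup>2 \<partial>\<pi>)"
      using pi.variance_le_second_moment[OF i(2,1), where c = "uk k (origin d)"] by (simp add: a_def mk)
    also have "\<dots> \<le> (\<integral>x. (rate ^ k * l)\<^sup>2 * (eucl_dist d x (origin d))\<^sup>2 \<partial>\<pi>)"
    proof (rule integral_mono)
      fix x assume "x \<in> space \<pi>"
      then have "\<bar>uk k x - uk k (origin d)\<bar> \<le> \<bar>rate ^ k * l * eucl_dist d x (origin d)\<bar>"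
        using LipD[OF uk, of x "origin d" k] by simp
      then have "(uk k x - uk k (origin d))\<^sup>2 \<le> (rate ^ k * l * eucl_dist d x (origin d))\<^sup>2"
        by (rule abs_le_square_iff[THEN iffD1])
      then show "(uk k x - uk k (origin d))\<^sup>2 \<le> (rate ^ k * l)\<^sup>2 * (eucl_dist d x (origin d))\<^sup>2"
        by (simp add: power_mult_distrib)
    qed (use i pi_second_moment in \<open>auto simp: power2_diff\<close>)
    finally show ?thesis using pi_second_moment by (simp add: m_def)
  qed
  have "(\<lambda>k. (rate ^ k * l)\<^sup>2 * m) \<longlonglongrightarrow> (0 * l)\<^sup>2 * m"
    using rate_less by (intro tendsto_intros LIMSEQ_realpow_zero) auto
  then have lim: "(\<lambda>k. (rate ^ k * l)\<^sup>2 * m) \<longlonglongrightarrow> 0" by simp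
  have nn_a: "\<forall>k. 0 \<le> a k" by (simp add: a_def)
  have a0: "a \<longlonglongrightarrow> 0"
    by (rule tendsto_sandwich[OF always_eventually[OF nn_a] always_eventually[OF allI[OF ale]] tendsto_const lim])
  have "(\<lambda>k. a 1 - a (Suc k)) \<longlonglongrightarrow> a 1 - 0" by (intro tendsto_intros LIMSEQ_Suc a0)
  moreover have "(\<lambda>k. rate\<^sup>2 * (a 0 - a k)) \<longlonglongrightarrow> rate\<^sup>2 * (a 0 - 0)" by (intro tendsto_intros a0)
  ultimately have "a 1 - 0 \<le> rate\<^sup>2 * (a 0 - 0)" by (rule LIMSEQ_le) (use tel in auto)
  then show ?thesis by (simp add: a_def uk_def)
qed

end

section \<open>Transport inequalities and couplings\<close>

lemma abs_mult_ln_le: "\<bar>t * ln t\<bar> \<le> 1 + B\<^sup>2" if "0 \<le> t" "t \<le> B" for t B :: real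
proof (cases "t = 0")
  case False
  then have t: "0 < t" using that by simp
  have "- (t * ln t) = t * ln (1 / t)" using t by (simp add: ln_div)
  also have "\<dots> \<le> t * (1 / t - 1)" using t by (intro mult_left_mono ln_le_minus_one) auto
  also have "\<dots> \<le> 1" using t by (simp add: algebra_simps)
  finally have 1: "- (t * ln t) \<le> 1" .
  have "t * ln t \<le> t * (t - 1)" using t by (intro mult_left_mono ln_le_minus_one) auto
  also have "\<dots> \<le> t\<^sup>2" using t by (simp add: algebra_simps power2_eq_square)
  also have "\<dots> \<le> B\<^sup>2" using that by (intro power_mono) auto
  finally have "t * ln t \<le> B\<^sup>2" .
  with 1 show ?thesis by (simp add: abs_le_iff add_increasing2 add_increasing)
qed simp

text \<open>Boundedness of the density keeps \<phi> ln \<phi> integrable, so \<open>KL\<close> takes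
  its finite branch. It is applied to normalized indicators and to truncated exponential
  tilts.\<close>

lemma (in prob_space) KL_bounded_density:
  assumes [measurable]: "\<phi> \<in> borel_measurable M" and \<phi>: "\<And>x. 0 \<le> \<phi> x" "\<And>x. \<phi> x \<le> B"
    and int: "(\<integral>x. \<phi> x \<partial>M) = 1"
  shows "prob_space (density M \<phi>)" "integrable M \<phi>" "integrable M (\<lambda>x. \<phi> x * ln (\<phi> x))"
    "KL (density M \<phi>) M = ennreal (\<integral>x. \<phi> x * ln (\<phi> x) \<partial>M)" "0 \<le> (\<integral>x. \<phi> x * ln (\<phi> x) \<partial>M)"
proof -
  show i: "integrable M \<phi>"
    using \<phi> by (intro integrable_const_bound[where B = B]) auto
  show "prob_space (density M \<phi>)"
    by (rule prob_spaceI) (use i \<phi> int in \<open>simp add: emeasure_density nn_integral_eq_integral cong: nn_integral_cong_simp\<close>)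
  show il: "integrable M (\<lambda>x. \<phi> x * ln (\<phi> x))"
    using \<phi> abs_mult_ln_le[of "\<phi> _" B] by (intro integrable_const_bound[where B = "1 + B\<^sup>2"]) auto
  have e: "(1::real) < exp 1" by simp
  have "density M (RN_deriv M (density M \<phi>)) = density M \<phi>"
    using \<phi> by (intro density_RN_deriv_density) auto
  then have eq: "AE x in M. RN_deriv M (density M \<phi>) x = \<phi> x"
    using \<phi> by (intro density_unique) auto
  have eq': "AE x in M. \<phi> x * entropy_density (exp 1) M (density M \<phi>) x = \<phi> x * ln (\<phi> x)"
    using eq \<phi> by (auto simp: entropy_density_def log_def)
  have [measurable]: "entropy_density (exp 1) M (density M (\<lambda>x. ennreal (\<phi> x))) \<in> borel_measurable M"
    by (auto simp: comp_def entropy_density_def)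
  have "integrable M (\<lambda>x. \<phi> x * entropy_density (exp 1) M (density M \<phi>) x)"
    using il eq' by (subst integrable_cong_AE[OF _ _ eq']) auto
  then have "integrable (density M \<phi>) (entropy_density (exp 1) M (density M \<phi>))"
    using \<phi> by (subst integrable_real_density) auto
  moreover have "absolutely_continuous M (density M \<phi>)"
    by (rule absolutely_continuousI_density) measurable
  moreover have "KL_divergence (exp 1) M (density M \<phi>) = (\<integral>x. \<phi> x * ln (\<phi> x) \<partial>M)"
    using \<phi> by (subst KL_density[OF e]) (auto simp: log_def)
  ultimately show "KL (density M \<phi>) M = ennreal (\<integral>x. \<phi> x * ln (\<phi> x) \<partial>M)"
    by (simp add: KL_def)
  have "(\<integral>x. \<phi> x - 1 \<partial>M) \<le> (\<integral>x. \<phi> x * ln (\<phi> x) \<partial>M)"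
  proof (rule integral_mono)
    fix x
    show "\<phi> x - 1 \<le> \<phi> x * ln (\<phi> x)"
    proof (cases "\<phi> x = 0")
      case False
      then have t: "0 < \<phi> x" using \<phi>(1)[of x] by simp
      have "\<phi> x * ln (1 / \<phi> x) \<le> \<phi> x * (1 / \<phi> x - 1)" using t by (intro mult_left_mono ln_le_minus_one) auto
      then show ?thesis using t by (simp add: ln_div algebra_simps)
    qed simp
  qed (use i il in auto)
  then show "0 \<le> (\<integral>x. \<phi> x * ln (\<phi> x) \<partial>M)" using i int prob_space by simp
qed

lemma ennreal_sqrt_le_iff: "ennreal_sqrt x \<le> ennreal_sqrt y \<longleftrightarrow> x \<le> y"
  by (cases x; cases y) (auto simp: ennreal_sqrt_def top_unique)

lemma ennreal_sqrt_power2: "(ennreal_sqrt x)\<^sup>2 = x"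
  by (cases x) (auto simp: ennreal_sqrt_def ennreal_power)

lemma ennreal_sqrt_eq_top_iff: "ennreal_sqrt x = \<top> \<longleftrightarrow> x = \<top>"
  by (simp add: ennreal_sqrt_def)

definition transport_cost :: "nat \<Rightarrow> ((nat \<Rightarrow> real) \<times> (nat \<Rightarrow> real)) measure \<Rightarrow> ennreal" where
  "transport_cost d q = (\<integral>\<^sup>+p. ennreal ((eucl_dist d (fst p) (snd p))\<^sup>2) \<partial>q)"

lemma W2_eq: "W2 (eucl_dist d) \<mu> \<nu> = ennreal_sqrt (INF q\<in>couplings \<mu> \<nu>. transport_cost d q)"
  by (simp add: W2_def transport_cost_def case_prod_unfold)

locale Rd_coupling =
  fixes d :: nat and \<mu> \<nu> :: "(nat \<Rightarrow> real) measure" and q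
  assumes \<mu>: "prob_space \<mu>" "sets \<mu> = sets (Rd d)" and \<nu>: "prob_space \<nu>" "sets \<nu> = sets (Rd d)"
    and q: "q \<in> couplings \<mu> \<nu>"
begin

lemma sets_q [measurable_cong]: "sets q = sets (Rd d \<Otimes>\<^sub>M Rd d)"
  using q \<mu>(2) \<nu>(2) by (auto simp: couplings_def cong: sets_pair_measure_cong)

lemma space_q: "space q = space (Rd d) \<times> space (Rd d)"
  using sets_eq_imp_space_eq[OF sets_q] by (simp add: space_pair_measure)

lemma distr_fst: "distr q (Rd d) fst = \<mu>"
proof -
  have "distr q (Rd d) fst = distr q \<mu> fst" by (rule distr_cong) (simp_all add: \<mu>(2))
  then show ?thesis using q by (simp add: couplings_def)
qed

lemma distr_snd: "distr q (Rd d) snd = \<nu>"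
proof -
  have "distr q (Rd d) snd = distr q \<nu> snd" by (rule distr_cong) (simp_all add: \<nu>(2))
  then show ?thesis using q by (simp add: couplings_def)
qed

sublocale q: prob_space q
proof (rule prob_space_distrD)
  show "fst \<in> q \<rightarrow>\<^sub>M Rd d" by measurable
  show "prob_space (distr q (Rd d) fst)" unfolding distr_fst by (rule \<mu>)
qed

lemma nn_integral_fst: "f \<in> borel_measurable (Rd d) \<Longrightarrow> (\<integral>\<^sup>+p. f (fst p) \<partial>q) = (\<integral>\<^sup>+x. f x \<partial>\<mu>)"
  unfolding distr_fst[symmetric] by (subst nn_integral_distr) auto

lemma nn_integral_snd: "f \<in> borel_measurable (Rd d) \<Longrightarrow> (\<integral>\<^sup>+p. f (snd p) \<partial>q) = (\<integral>\<^sup>+x. f x \<partial>\<nu>)"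
  unfolding distr_snd[symmetric] by (subst nn_integral_distr) auto

lemma integrable_fst:
  fixes f :: "(nat \<Rightarrow> real) \<Rightarrow> real"
  assumes "integrable \<mu> f" shows "integrable q (\<lambda>p. f (fst p))" "(\<integral>p. f (fst p) \<partial>q) = (\<integral>x. f x \<partial>\<mu>)"
proof -
  have [measurable]: "f \<in> borel_measurable (Rd d)"
    using borel_measurable_integrable[OF assms] unfolding measurable_cong_sets[OF \<mu>(2) refl] .
  have "integrable (distr q (Rd d) fst) f" unfolding distr_fst by fact
  then show "integrable q (\<lambda>p. f (fst p))" by (subst (asm) integrable_distr_eq) auto
  show "(\<integral>p. f (fst p) \<partial>q) = (\<integral>x. f x \<partial>\<mu>)"
    unfolding distr_fst[symmetric] by (subst integral_distr) auto
qed

lemma integrable_snd: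
  fixes f :: "(nat \<Rightarrow> real) \<Rightarrow> real"
  assumes "integrable \<nu> f" shows "integrable q (\<lambda>p. f (snd p))" "(\<integral>p. f (snd p) \<partial>q) = (\<integral>x. f x \<partial>\<nu>)"
proof -
  have [measurable]: "f \<in> borel_measurable (Rd d)"
    using borel_measurable_integrable[OF assms] unfolding measurable_cong_sets[OF \<nu>(2) refl] .
  have "integrable (distr q (Rd d) snd) f" unfolding distr_snd by fact
  then show "integrable q (\<lambda>p. f (snd p))" by (subst (asm) integrable_distr_eq) auto
  show "(\<integral>p. f (snd p) \<partial>q) = (\<integral>x. f x \<partial>\<nu>)"
    unfolding distr_snd[symmetric] by (subst integral_distr) auto
qed

lemma integrable_cost:
  assumes "transport_cost d q < \<top>"
  shows "integrable q (\<lambda>p. (eucl_dist d (fst p) (snd p))\<^sup>2)"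
    "transport_cost d q = ennreal (\<integral>p. (eucl_dist d (fst p) (snd p))\<^sup>2 \<partial>q)"
proof -
  show i: "integrable q (\<lambda>p. (eucl_dist d (fst p) (snd p))\<^sup>2)"
    using assms unfolding transport_cost_def by (intro integrableI_nonneg) auto
  show "transport_cost d q = ennreal (\<integral>p. (eucl_dist d (fst p) (snd p))\<^sup>2 \<partial>q)"
    unfolding transport_cost_def by (rule nn_integral_eq_integral[OF i]) auto
qed

text \<open>The easy half of Kantorovich duality, followed by Cauchy-Schwarz to pass from order one
  to order two. Squared and divided by l^2, the bound can be taken under the infimum over
  couplings.\<close>

lemma lipschitz_diff_le_cost:
  assumes g: "g \<in> Lip (space (Rd d)) (eucl_dist d) l" and l: "0 < l"
    and i: "integrable \<mu> g" "integrable \<nu> g"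
  shows "ennreal (((\<integral>x. g x \<partial>\<nu>) - (\<integral>x. g x \<partial>\<mu>))\<^sup>2 / l\<^sup>2) \<le> transport_cost d q"
proof (cases "transport_cost d q < \<top>")
  case True
  note c = integrable_cost[OF True]
  let ?e = "\<lambda>p. eucl_dist d (fst p) (snd p)"
  have ie: "integrable q ?e" by (rule q.square_integrable_imp_integrable[OF _ c(1)]) measurable
  note f = integrable_fst[OF i(1)] integrable_snd[OF i(2)]
  have "\<bar>(\<integral>x. g x \<partial>\<nu>) - (\<integral>x. g x \<partial>\<mu>)\<bar> = \<bar>\<integral>p. g (snd p) - g (fst p) \<partial>q\<bar>"
    using f by simp
  also have "\<dots> \<le> (\<integral>p. \<bar>g (snd p) - g (fst p)\<bar> \<partial>q)" by (rule integral_abs_bound)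
  also have "\<dots> \<le> (\<integral>p. l * ?e p \<partial>q)"
    using f ie by (intro integral_mono) (auto simp: space_q abs_minus_commute[of "g (snd _)"] intro!: LipD[OF g])
  also have "\<dots> = l * (\<integral>p. ?e p * 1 \<partial>q)" by simp
  also have "\<dots> \<le> l * (sqrt (\<integral>p. (?e p)\<^sup>2 \<partial>q) * sqrt (\<integral>p. 1\<^sup>2 \<partial>q))"
    using l Cauchy_Schwarz_integral(3)[of ?e q "\<lambda>_. 1"] c(1)
    by (intro mult_left_mono) (auto intro: order_trans[OF abs_ge_self])
  finally have "\<bar>(\<integral>x. g x \<partial>\<nu>) - (\<integral>x. g x \<partial>\<mu>)\<bar> \<le> l * sqrt (\<integral>p. (?e p)\<^sup>2 \<partial>q)"
    by (simp add: q.prob_space)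
  then have "\<bar>(\<integral>x. g x \<partial>\<nu>) - (\<integral>x. g x \<partial>\<mu>)\<bar>\<^sup>2 \<le> (l * sqrt (\<integral>p. (?e p)\<^sup>2 \<partial>q))\<^sup>2"
    by (rule power_mono) simp
  also have "\<dots> = l\<^sup>2 * (\<integral>p. (?e p)\<^sup>2 \<partial>q)" by (simp add: power_mult_distrib)
  finally show ?thesis unfolding c(2) using l by (intro ennreal_leI) (simp add: field_simps)
qed (simp add: not_less top_unique)

lemma second_moment_transfer:
  assumes "transport_cost d q < \<top>" "integrable \<nu> (\<lambda>x. (eucl_dist d x (origin d))\<^sup>2)"
  shows "integrable \<mu> (\<lambda>x. (eucl_dist d x (origin d))\<^sup>2)"
proof -
  have "integrable q (\<lambda>p. (eucl_dist d (fst p) (origin d))\<^sup>2)"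
  proof (rule Bochner_Integration.integrable_bound)
    show "integrable q (\<lambda>p. 2 * (eucl_dist d (fst p) (snd p))\<^sup>2 + 2 * (eucl_dist d (snd p) (origin d))\<^sup>2)"
      using integrable_cost(1)[OF assms(1)] integrable_snd(1)[OF assms(2)] by simp
    have "(eucl_dist d x (origin d))\<^sup>2 \<le> 2 * (eucl_dist d x y)\<^sup>2 + 2 * (eucl_dist d y (origin d))\<^sup>2" for x y
    proof -
      have "(eucl_dist d x (origin d))\<^sup>2 \<le> (eucl_dist d x y + eucl_dist d y (origin d))\<^sup>2"
        by (intro power_mono eucl_dist_triangle) simp
      also have "\<dots> \<le> 2 * (eucl_dist d x y)\<^sup>2 + 2 * (eucl_dist d y (origin d))\<^sup>2"
        using zero_le_power2[of "eucl_dist d x y - eucl_dist d y (origin d)"] by (simp add: power2_eq_square algebra_simps)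
      finally show ?thesis .
    qed
    then show "AE p in q. norm ((eucl_dist d (fst p) (origin d))\<^sup>2)
      \<le> norm (2 * (eucl_dist d (fst p) (snd p))\<^sup>2 + 2 * (eucl_dist d (snd p) (origin d))\<^sup>2)" by auto
  qed measurable
  then have "integrable (distr q (Rd d) fst) (\<lambda>x. (eucl_dist d x (origin d))\<^sup>2)"
    by (subst integrable_distr_eq) auto
  then show ?thesis unfolding distr_fst .
qed

end

locale T2_measure = xi: prob_space \<xi> for \<xi> :: "(nat \<Rightarrow> real) measure" +
  fixes d :: nat and \<beta> :: real
  assumes sets_xi [measurable_cong, simp]: "sets \<xi> = sets (Rd d)"
    and beta_pos: "0 < \<beta>" and T2: "\<xi> \<in> T2 (eucl_dist d) \<beta>"
begin

lemma space_xi [simp]: "space \<xi> = space (Rd d)"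
  by (rule sets_eq_imp_space_eq) simp

lemma T2_bounded_density:
  assumes "\<phi> \<in> borel_measurable \<xi>" "\<And>x. 0 \<le> \<phi> x" "\<And>x. \<phi> x \<le> B" "(\<integral>x. \<phi> x \<partial>\<xi>) = 1"
  shows "(INF q\<in>couplings \<xi> (density \<xi> \<phi>). transport_cost d q)
    \<le> ennreal (2 * \<beta> * (\<integral>x. \<phi> x * ln (\<phi> x) \<partial>\<xi>))"
proof -
  note k = xi.KL_bounded_density[OF assms]
  have "W2 (eucl_dist d) \<xi> (density \<xi> \<phi>) \<le> ennreal_sqrt (2 * ennreal \<beta> * KL (density \<xi> \<phi>) \<xi>)"
    using T2 k(1) by (auto simp: T2_def)
  then have "(INF q\<in>couplings \<xi> (density \<xi> \<phi>). transport_cost d q) \<le> 2 * ennreal \<beta> * KL (density \<xi> \<phi>) \<xi>"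
    unfolding W2_eq ennreal_sqrt_le_iff .
  also have "\<dots> = ennreal (2 * \<beta> * (\<integral>x. \<phi> x * ln (\<phi> x) \<partial>\<xi>))"
    unfolding k(4) using beta_pos k(5) by (simp add: ennreal_mult)
  finally show ?thesis .
qed

lemma Rd_coupling_density:
  assumes "\<phi> \<in> borel_measurable \<xi>" "\<And>x. 0 \<le> \<phi> x" "\<And>x. \<phi> x \<le> B" "(\<integral>x. \<phi> x \<partial>\<xi>) = 1"
    "q \<in> couplings \<xi> (density \<xi> \<phi>)"
  shows "Rd_coupling d \<xi> (density \<xi> \<phi>) q"
  using xi.KL_bounded_density(1)[OF assms(1-4)] assms(5) xi.prob_space_axioms
  by (intro Rd_coupling.intro) auto

text \<open>T2 is applied to \<xi> conditioned on a ball of positive mass. This density is bounded,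
  so some coupling has finite cost, and it transfers the second moment from the bounded support back
  to \<xi>.\<close>

lemma xi_second_moment: "integrable \<xi> (\<lambda>x. (eucl_dist d x (origin d))\<^sup>2)"
proof -
  define B where "B k = {x\<in>space \<xi>. eucl_dist d x (origin d) \<le> real k}" for k :: nat
  have [measurable]: "B k \<in> sets \<xi>" for k unfolding B_def by measurable
  have UB: "(\<Union>k. B k) = space \<xi>" by (auto simp: B_def real_arch_simple)
  have "\<exists>k. B k \<notin> null_sets \<xi>"
  proof (rule ccontr)
    assume "\<nexists>k. B k \<notin> null_sets \<xi>"
    then have "(\<Union>k. B k) \<in> null_sets \<xi>" by (intro null_sets_UN) auto
    then show False unfolding UB using xi.emeasure_space_1 by (simp add: null_sets_def)
  qed
  then obtain k where "B k \<notin> null_sets \<xi>" ..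
  then have "emeasure \<xi> (B k) \<noteq> 0" using \<open>B k \<in> sets \<xi>\<close> unfolding null_sets_def by blast
  then have k: "0 < measure \<xi> (B k)" by (simp add: xi.emeasure_eq_measure zero_less_measure_iff)
  define \<phi> where "\<phi> x = indicator (B k) x / measure \<xi> (B k)" for x
  have BS: "B k \<inter> space (Rd d) = B k" by (auto simp: B_def)
  have \<phi>: "\<phi> \<in> borel_measurable \<xi>" "0 \<le> \<phi> x" "\<phi> x \<le> 1 / measure \<xi> (B k)" "(\<integral>x. \<phi> x \<partial>\<xi>) = 1" for x
    using k by (auto simp: \<phi>_def[abs_def] BS split: split_indicator)
  have "(INF q\<in>couplings \<xi> (density \<xi> \<phi>). transport_cost d q) < \<top>"
    using T2_bounded_density[OF \<phi>] by (rule le_less_trans) simp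
  then obtain q where q: "q \<in> couplings \<xi> (density \<xi> \<phi>)" "transport_cost d q < \<top>"
    by (auto simp: INF_less_iff)
  note cost = q(2)
  interpret Rd_coupling d \<xi> "density \<xi> \<phi>" q by (rule Rd_coupling_density[OF \<phi> q(1)])
  have "integrable \<xi> (\<lambda>x. \<phi> x * (eucl_dist d x (origin d))\<^sup>2)"
  proof (rule xi.integrable_const_bound[where B = "1 / measure \<xi> (B k) * (real k)\<^sup>2"])
    show "AE x in \<xi>. norm (\<phi> x * (eucl_dist d x (origin d))\<^sup>2) \<le> 1 / measure \<xi> (B k) * (real k)\<^sup>2"
      using k by (intro AE_I2) (auto simp: \<phi>_def B_def divide_right_mono power_mono split: split_indicator)
  qed (use \<phi>(1) in measurable)
  then have "integrable (density \<xi> \<phi>) (\<lambda>x. (eucl_dist d x (origin d))\<^sup>2)"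
    using \<phi> by (subst integrable_real_density) auto
  then show ?thesis by (rule second_moment_transfer[OF cost])
qed

lemmas xi_lipschitz_integrable = Lip_square_integrable[OF xi.finite_measure_axioms sets_xi xi_second_moment]

text \<open>\<open>lipschitz_diff_le_cost\<close> bounds every coupling from below and T2 bounds the
  infimum from above, so transport turns into a statement about means.\<close>

lemma T2_tilt:
  assumes \<phi>: "\<phi> \<in> borel_measurable \<xi>" "\<And>x. 0 \<le> \<phi> x" "\<And>x. \<phi> x \<le> B" "(\<integral>x. \<phi> x \<partial>\<xi>) = 1"
    and g: "g \<in> Lip (space (Rd d)) (eucl_dist d) l" and l: "0 < l"
  shows "((\<integral>x. \<phi> x * g x \<partial>\<xi>) - (\<integral>x. g x \<partial>\<xi>))\<^sup>2 \<le> l\<^sup>2 * (2 * \<beta> * (\<integral>x. \<phi> x * ln (\<phi> x) \<partial>\<xi>))"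
proof -
  note [measurable] = \<phi>(1) Lip_measurable[OF g]
  note ig = xi_lipschitz_integrable(2)[OF g]
  have ip: "integrable \<xi> (\<lambda>x. \<phi> x * g x)"
  proof (rule Bochner_Integration.integrable_bound)
    show "integrable \<xi> (\<lambda>x. B * g x)" using ig by simp
    show "AE x in \<xi>. norm (\<phi> x * g x) \<le> norm (B * g x)"
      using \<phi>(2,3) by (intro AE_I2) (auto simp: abs_mult intro!: mult_right_mono intro: order_trans[OF \<phi>(3) abs_ge_self])
  qed measurable
  have id: "integrable (density \<xi> \<phi>) g" "(\<integral>x. g x \<partial>density \<xi> \<phi>) = (\<integral>x. \<phi> x * g x \<partial>\<xi>)"
    using ip \<phi>(2) by (auto simp: integrable_real_density integral_real_density)
  have "ennreal (((\<integral>x. \<phi> x * g x \<partial>\<xi>) - (\<integral>x. g x \<partial>\<xi>))\<^sup>2 / l\<^sup>2)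
    \<le> (INF q\<in>couplings \<xi> (density \<xi> \<phi>). transport_cost d q)"
  proof (rule INF_greatest)
    fix q assume q: "q \<in> couplings \<xi> (density \<xi> \<phi>)"
    interpret Rd_coupling d \<xi> "density \<xi> \<phi>" q by (rule Rd_coupling_density[OF \<phi> q])
    show "ennreal (((\<integral>x. \<phi> x * g x \<partial>\<xi>) - (\<integral>x. g x \<partial>\<xi>))\<^sup>2 / l\<^sup>2) \<le> transport_cost d q"
      using lipschitz_diff_le_cost[OF g l ig id(1)] unfolding id(2) .
  qed
  also have "\<dots> \<le> ennreal (2 * \<beta> * (\<integral>x. \<phi> x * ln (\<phi> x) \<partial>\<xi>))" by (rule T2_bounded_density[OF \<phi>])
  finally have "((\<integral>x. \<phi> x * g x \<partial>\<xi>) - (\<integral>x. g x \<partial>\<xi>))\<^sup>2 / l\<^sup>2 \<le> 2 * \<beta> * (\<integral>x. \<phi> x * ln (\<phi> x) \<partial>\<xi>)"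
    using xi.KL_bounded_density(5)[OF \<phi>] beta_pos by (subst (asm) ennreal_le_iff) auto
  then show ?thesis using l by (simp add: field_simps)
qed

text \<open>The Bobkov-Goetze argument: T2 is applied to the exponential tilt of \<open>\<xi>\<close> by \<open>min g M\<close>.\<close>

lemma exp_lipschitz_le:
  assumes g: "g \<in> Lip (space (Rd d)) (eucl_dist d) l" and l: "0 < l"
  shows "integrable \<xi> (\<lambda>x. exp (g x))" "(\<integral>x. exp (g x) \<partial>\<xi>) \<le> exp ((\<integral>x. g x \<partial>\<xi>) + \<beta> * l\<^sup>2 / 2)"
proof -
  note [measurable] = Lip_measurable[OF g]
  note ig = xi_lipschitz_integrable(2)[OF g]
  have trunc: "(\<integral>\<^sup>+x. ennreal (exp (min (g x) (real M))) \<partial>\<xi>) \<le> ennreal (exp ((\<integral>x. g x \<partial>\<xi>) + \<beta> * l\<^sup>2 / 2))" for M :: nat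
  proof -
    define h where "h x = min (g x) (real M)" for x
    have h: "h \<in> Lip (space (Rd d)) (eucl_dist d) l"
      unfolding Lip_def h_def
    proof (intro CollectI ballI)
      fix x y assume "x \<in> space (Rd d)" "y \<in> space (Rd d)"
      then show "\<bar>min (g x) (real M) - min (g y) (real M)\<bar> \<le> l * eucl_dist d x y" using LipD[OF g, of x y] by linarith
    qed
    note [measurable] = Lip_measurable[OF h]
    note ih = xi_lipschitz_integrable(2)[OF h]
    have ie: "integrable \<xi> (\<lambda>x. exp (h x))"
      by (rule xi.integrable_const_bound[where B = "exp (real M)"]) (auto simp: h_def)
    define Z where "Z = (\<integral>x. exp (h x) \<partial>\<xi>)"
    have nn: "(\<integral>\<^sup>+x. ennreal (exp (h x)) \<partial>\<xi>) = ennreal Z"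
      unfolding Z_def by (rule nn_integral_eq_integral[OF ie]) simp
    have Z: "0 < Z"
    proof -
      have "(\<integral>\<^sup>+x. ennreal (exp (h x)) \<partial>\<xi>) \<noteq> 0" by (simp add: nn_integral_0_iff_AE)
      then show ?thesis unfolding nn by (simp add: ennreal_eq_0_iff)
    qed
    \<comment> \<open>Gibbs density of the truncated function. Its entropy is the tilted mean minus
      ln Z, which ties T2 to the exponential moment.\<close>
    define \<phi> where "\<phi> x = exp (h x) / Z" for x
    have \<phi>: "\<phi> \<in> borel_measurable \<xi>" "0 \<le> \<phi> x" "\<phi> x \<le> exp (real M) / Z" "(\<integral>x. \<phi> x \<partial>\<xi>) = 1" for x
      using Z ie by (auto simp: \<phi>_def[abs_def] h_def divide_right_mono Z_def)
    define m where "m = (\<integral>x. h x \<partial>\<xi>)"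
    define s where "s = (\<integral>x. \<phi> x * h x \<partial>\<xi>) - m"
    define k where "k = (\<integral>x. \<phi> x * ln (\<phi> x) \<partial>\<xi>)"
    have k0: "0 \<le> k" unfolding k_def by (rule xi.KL_bounded_density(5)[OF \<phi>])
    have s2: "s\<^sup>2 \<le> l\<^sup>2 * (2 * \<beta> * k)" unfolding s_def k_def m_def by (rule T2_tilt[OF \<phi> h l])
    have k: "k = s + m - ln Z"
    proof -
      have "\<phi> x * h x = \<phi> x * ln (\<phi> x) + ln Z * \<phi> x" for x
      proof -
        have ln: "ln (\<phi> x) = h x - ln Z" using Z by (simp add: \<phi>_def ln_div)
        show ?thesis unfolding ln by (simp add: algebra_simps)
      qed
      then have "(\<integral>x. \<phi> x * h x \<partial>\<xi>) = k + ln Z"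
        using xi.KL_bounded_density(2,3)[OF \<phi>] \<phi>(4) by (simp add: k_def)
      then show ?thesis by (simp add: s_def)
    qed
    \<comment> \<open>From s^2 \<le> 2 \<beta> l^2 k by the inequality of means. Since k = s + m -
      ln Z, both s and the entropy drop out and a bound on ln Z remains.\<close>
    have "s \<le> k + \<beta> * l\<^sup>2 / 2"
    proof (rule power2_le_imp_le)
      have "(k + \<beta> * l\<^sup>2 / 2)\<^sup>2 - l\<^sup>2 * (2 * \<beta> * k) = (k - \<beta> * l\<^sup>2 / 2)\<^sup>2"
        by (simp add: power2_eq_square algebra_simps)
      with s2 zero_le_power2[of "k - \<beta> * l\<^sup>2 / 2"] show "s\<^sup>2 \<le> (k + \<beta> * l\<^sup>2 / 2)\<^sup>2" by linarith
      show "0 \<le> k + \<beta> * l\<^sup>2 / 2" using k0 beta_pos by simp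
    qed
    moreover have "m \<le> (\<integral>x. g x \<partial>\<xi>)"
      unfolding m_def using ih ig by (intro integral_mono) (auto simp: h_def)
    ultimately have "ln Z \<le> (\<integral>x. g x \<partial>\<xi>) + \<beta> * l\<^sup>2 / 2" using k by linarith
    then have "Z \<le> exp ((\<integral>x. g x \<partial>\<xi>) + \<beta> * l\<^sup>2 / 2)" using Z by (metis exp_le_cancel_iff exp_ln)
    then show ?thesis using nn by (simp add: h_def ennreal_leI)
  qed
  have "(\<lambda>M. \<integral>\<^sup>+x. ennreal (exp (min (g x) (real M))) \<partial>\<xi>) \<longlonglongrightarrow> (\<integral>\<^sup>+x. ennreal (exp (g x)) \<partial>\<xi>)"
  proof (rule nn_integral_LIMSEQ)
    show "incseq (\<lambda>M x. ennreal (exp (min (g x) (real M))))"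
      by (auto simp: incseq_def le_fun_def intro!: ennreal_leI)
    show "(\<lambda>M. ennreal (exp (min (g x) (real M)))) \<longlonglongrightarrow> ennreal (exp (g x))" for x
    proof -
      obtain N :: nat where "g x \<le> real N" using real_arch_simple by blast
      then show ?thesis
        by (intro tendsto_eventually eventually_sequentiallyI[of N]) (auto simp: min_def)
    qed
  qed measurable
  then have le: "(\<integral>\<^sup>+x. ennreal (exp (g x)) \<partial>\<xi>) \<le> ennreal (exp ((\<integral>x. g x \<partial>\<xi>) + \<beta> * l\<^sup>2 / 2))"
    by (rule LIMSEQ_le_const2) (use trunc in auto)
  then show i: "integrable \<xi> (\<lambda>x. exp (g x))"
    by (intro integrableI_nonneg) (auto intro: le_less_trans)
  show "(\<integral>x. exp (g x) \<partial>\<xi>) \<le> exp ((\<integral>x. g x \<partial>\<xi>) + \<beta> * l\<^sup>2 / 2)"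
    using le unfolding nn_integral_eq_integral[OF i AE_I2[OF exp_ge_zero]] by simp
qed

end

lemma pair_measure_in_couplings:
  assumes "prob_space \<mu>" "prob_space \<nu>" shows "\<mu> \<Otimes>\<^sub>M \<nu> \<in> couplings \<mu> \<nu>"
proof -
  interpret \<mu>: prob_space \<mu> by fact
  interpret \<nu>: prob_space \<nu> by fact
  interpret pair_prob_space \<mu> \<nu> ..
  have "distr (\<mu> \<Otimes>\<^sub>M \<nu>) \<mu> fst = \<mu>" by (rule \<nu>.distr_pair_fst)
  moreover have "distr (\<mu> \<Otimes>\<^sub>M \<nu>) \<nu> snd = \<nu>"
  proof (rule measure_eqI)
    fix A assume "A \<in> sets (distr (\<mu> \<Otimes>\<^sub>M \<nu>) \<nu> snd)"
    then have A: "A \<in> sets \<nu>" by simp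
    have "snd -` A \<inter> space (\<mu> \<Otimes>\<^sub>M \<nu>) = space \<mu> \<times> A"
      using sets.sets_into_space[OF A] by (auto simp: space_pair_measure)
    then show "emeasure (distr (\<mu> \<Otimes>\<^sub>M \<nu>) \<nu> snd) A = emeasure \<nu> A"
      using A by (simp add: emeasure_distr \<nu>.emeasure_pair_measure_Times \<mu>.emeasure_space_1)
  qed simp
  ultimately show ?thesis by (simp add: couplings_def)
qed

section \<open>Wasserstein distances under finite second moments\<close>

locale Rd_moment2 = prob_space \<mu> for \<mu> :: "(nat \<Rightarrow> real) measure" +
  fixes d :: nat
  assumes sets_mu [measurable_cong, simp]: "sets \<mu> = sets (Rd d)"
    and moment2: "integrable \<mu> (\<lambda>x. (eucl_dist d x (origin d))\<^sup>2)"
begin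

lemma space_mu [simp]: "space \<mu> = space (Rd d)"
  by (rule sets_eq_imp_space_eq) simp

lemma W2_finite:
  assumes "Rd_moment2 \<nu> d"
  shows "W2 (eucl_dist d) \<mu> \<nu> < \<top>"
proof -
  interpret \<nu>: Rd_moment2 \<nu> d by fact
  interpret Rd_coupling d \<mu> \<nu> "\<mu> \<Otimes>\<^sub>M \<nu>"
    by (intro Rd_coupling.intro prob_space_axioms \<nu>.prob_space_axioms pair_measure_in_couplings) auto
  have "transport_cost d (\<mu> \<Otimes>\<^sub>M \<nu>)
    \<le> (\<integral>\<^sup>+p. ennreal (2 * (eucl_dist d (fst p) (origin d))\<^sup>2 + 2 * (eucl_dist d (snd p) (origin d))\<^sup>2) \<partial>(\<mu> \<Otimes>\<^sub>M \<nu>))"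
    unfolding transport_cost_def
  proof (intro nn_integral_mono ennreal_leI)
    fix p
    let ?a = "eucl_dist d (fst p) (origin d)" and ?b = "eucl_dist d (snd p) (origin d)"
    have "(eucl_dist d (fst p) (snd p))\<^sup>2 \<le> (?a + ?b)\<^sup>2"
      using eucl_dist_triangle[of d "fst p" "snd p" "origin d"]
      by (intro power_mono) (auto simp: eucl_dist_commute[of d "snd p"])
    also have "\<dots> \<le> 2 * ?a\<^sup>2 + 2 * ?b\<^sup>2"
      using zero_le_power2[of "?a - ?b"] by (simp add: power2_eq_square algebra_simps)
    finally show "(eucl_dist d (fst p) (snd p))\<^sup>2 \<le> 2 * ?a\<^sup>2 + 2 * ?b\<^sup>2" .
  qed
  also have "\<dots> < \<top>"
    using integrable_fst(1)[OF moment2] integrable_snd(1)[OF \<nu>.moment2] by (subst nn_integral_eq_integral) auto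
  finally have "(INF q\<in>couplings \<mu> \<nu>. transport_cost d q) < \<top>"
    using q by (metis INF_less_iff)
  then show ?thesis unfolding W2_eq by (metis ennreal_sqrt_eq_top_iff less_top)
qed

text \<open>A minimizing coupling is not constructed. Any cost above the squared distance is
  reached, and \<open>initial_bias\<close> lets \<open>c\<close> decrease to it.\<close>

lemma near_optimal_coupling:
  assumes "Rd_moment2 \<nu> d" and c: "(enn2real (W2 (eucl_dist d) \<mu> \<nu>))\<^sup>2 < c"
  obtains q where "Rd_coupling d \<mu> \<nu> q" "integrable q (\<lambda>p. (eucl_dist d (fst p) (snd p))\<^sup>2)"
    "(\<integral>p. (eucl_dist d (fst p) (snd p))\<^sup>2 \<partial>q) < c"
proof -
  interpret \<nu>: Rd_moment2 \<nu> d by fact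
  let ?W = "W2 (eucl_dist d) \<mu> \<nu>"
  have "(INF q\<in>couplings \<mu> \<nu>. transport_cost d q) = ?W\<^sup>2" unfolding W2_eq ennreal_sqrt_power2 ..
  also have "\<dots> = ennreal ((enn2real ?W)\<^sup>2)"
    using W2_finite[OF assms(1)] by (simp add: ennreal_power[symmetric])
  also have "\<dots> < ennreal c" using c by (simp add: ennreal_less_iff)
  finally obtain q where q: "q \<in> couplings \<mu> \<nu>" "transport_cost d q < ennreal c" by (auto simp: INF_less_iff)
  note qc = q(2)
  interpret Rd_coupling d \<mu> \<nu> q
    by (intro Rd_coupling.intro prob_space_axioms \<nu>.prob_space_axioms q) auto
  have fin: "transport_cost d q < \<top>" using qc by (rule less_trans) simp
  show thesis
    using integrable_cost[OF fin] qc by (intro that[of q] Rd_coupling_axioms) (auto simp: ennreal_less_iff)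
qed

text \<open>All couplings with a point mass have the same cost, because their first coordinate is
  almost surely at distance 0 from \<open>a\<close>.\<close>

lemma W2_return:
  assumes a: "a \<in> space (Rd d)"
  shows "W2 (eucl_dist d) (return (Rd d) a) \<mu> = ennreal_sqrt (\<integral>\<^sup>+x. ennreal ((eucl_dist d a x)\<^sup>2) \<partial>\<mu>)"
proof -
  have pr: "prob_space (return (Rd d) a)" using a by (rule prob_space_return)
  have am[measurable]: "(\<lambda>x. ennreal ((eucl_dist d a x)\<^sup>2)) \<in> borel_measurable (Rd d)"
    unfolding eucl_dist_commute[of d a] by measurable
  have cost: "transport_cost d q = (\<integral>\<^sup>+x. ennreal ((eucl_dist d a x)\<^sup>2) \<partial>\<mu>)"
    if q: "q \<in> couplings (return (Rd d) a) \<mu>" for q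
  proof -
    interpret Rd_coupling d "return (Rd d) a" \<mu> q
      by (intro Rd_coupling.intro pr q prob_space_axioms) auto
    have "(\<integral>\<^sup>+p. ennreal (eucl_dist d (fst p) a) \<partial>q) = (\<integral>\<^sup>+x. ennreal (eucl_dist d x a) \<partial>return (Rd d) a)"
      by (rule nn_integral_fst) measurable
    also have "\<dots> = 0" using a by (subst nn_integral_return) auto
    finally have "AE p in q. ennreal (eucl_dist d (fst p) a) = 0"
      by (subst (asm) nn_integral_0_iff_AE) auto
    then have "AE p in q. (eucl_dist d (fst p) (snd p))\<^sup>2 = (eucl_dist d a (snd p))\<^sup>2"
    proof eventually_elim
      case (elim p)
      then have "eucl_dist d (fst p) a = 0" by (simp add: ennreal_eq_0_iff order_antisym)
      then have "eucl_dist d (fst p) (snd p) = eucl_dist d a (snd p)"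
        using eucl_dist_diff_le[of d "fst p" "snd p" a] by simp
      then show ?case by simp
    qed
    then have "transport_cost d q = (\<integral>\<^sup>+p. ennreal ((eucl_dist d a (snd p))\<^sup>2) \<partial>q)"
      unfolding transport_cost_def by (intro nn_integral_cong_AE) auto
    also have "\<dots> = (\<integral>\<^sup>+x. ennreal ((eucl_dist d a x)\<^sup>2) \<partial>\<mu>)"
      by (rule nn_integral_snd) measurable
    finally show ?thesis .
  qed
  have "couplings (return (Rd d) a) \<mu> \<noteq> {}" using pair_measure_in_couplings[OF pr prob_space_axioms] by auto
  then show ?thesis unfolding W2_eq using cost by simp
qed

lemma integrable_sq_dist:
  assumes "a \<in> space (Rd d)" shows "integrable \<mu> (\<lambda>x. (eucl_dist d x a)\<^sup>2)"
  by (rule Lip_square_integrable(1)[OF finite_measure_axioms sets_mu moment2 Lip_eucl_dist])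

lemma W2_return_finite:
  assumes "a \<in> space (Rd d)" shows "W2 (eucl_dist d) (return (Rd d) a) \<mu> < \<top>"
proof -
  have "(\<integral>\<^sup>+x. ennreal ((eucl_dist d a x)\<^sup>2) \<partial>\<mu>) = ennreal (\<integral>x. (eucl_dist d x a)\<^sup>2 \<partial>\<mu>)"
    unfolding eucl_dist_commute[of d a] by (rule nn_integral_eq_integral[OF integrable_sq_dist[OF assms]]) simp
  then show ?thesis unfolding W2_return[OF assms] by (simp add: ennreal_sqrt_def)
qed

lemma W2_spread_power2:
  "(W2_spread d \<mu>)\<^sup>2 = (\<integral>\<^sup>+y. (\<integral>\<^sup>+x. ennreal ((eucl_dist d y x)\<^sup>2) \<partial>\<mu>) \<partial>\<mu>)"
  unfolding W2_spread_def ennreal_sqrt_power2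
  by (rule nn_integral_cong) (simp add: W2_return ennreal_sqrt_power2)

lemma W2_spread_finite: "W2_spread d \<mu> < \<top>"
proof -
  let ?m = "\<integral>x. (eucl_dist d x (origin d))\<^sup>2 \<partial>\<mu>"
  have "(\<integral>\<^sup>+x. ennreal ((eucl_dist d y x)\<^sup>2) \<partial>\<mu>) \<le> ennreal (2 * (eucl_dist d y (origin d))\<^sup>2 + 2 * ?m)" for y
  proof -
    have "(\<integral>\<^sup>+x. ennreal ((eucl_dist d y x)\<^sup>2) \<partial>\<mu>)
      \<le> (\<integral>\<^sup>+x. ennreal (2 * (eucl_dist d y (origin d))\<^sup>2 + 2 * (eucl_dist d x (origin d))\<^sup>2) \<partial>\<mu>)"
    proof (intro nn_integral_mono ennreal_leI)
      fix x
      let ?a = "eucl_dist d y (origin d)" and ?b = "eucl_dist d x (origin d)"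
      have "(eucl_dist d y x)\<^sup>2 \<le> (?a + ?b)\<^sup>2"
        using eucl_dist_triangle[of d y x "origin d"]
        by (intro power_mono) (auto simp: eucl_dist_commute[of d x])
      also have "\<dots> \<le> 2 * ?a\<^sup>2 + 2 * ?b\<^sup>2"
        using zero_le_power2[of "?a - ?b"] by (simp add: power2_eq_square algebra_simps)
      finally show "(eucl_dist d y x)\<^sup>2 \<le> 2 * ?a\<^sup>2 + 2 * ?b\<^sup>2" .
    qed
    also have "\<dots> = ennreal (2 * (eucl_dist d y (origin d))\<^sup>2 + 2 * ?m)"
      using moment2 by (subst nn_integral_eq_integral) (auto simp: prob_space[unfolded space_mu])
    finally show ?thesis .
  qed
  then have "(W2_spread d \<mu>)\<^sup>2 \<le> (\<integral>\<^sup>+y. ennreal (2 * (eucl_dist d y (origin d))\<^sup>2 + 2 * ?m) \<partial>\<mu>)"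
    unfolding W2_spread_power2 by (intro nn_integral_mono)
  also have "\<dots> < \<top>" using moment2 by (subst nn_integral_eq_integral) auto
  finally show ?thesis by (auto simp: less_top[symmetric])
qed

text \<open>The variance is at most the mean square deviation from h y for every y; averaging over y
  produces the spread. It is used for D \<le> \<open>const_sigma\<close>, which lets bias terms in D
  be charged to the latter.\<close>

lemma variance_le_spread:
  assumes h: "h \<in> Lip (space (Rd d)) (eucl_dist d) L" and L: "0 \<le> L"
  shows "variance h \<le> (L * enn2real (W2_spread d \<mu>))\<^sup>2"
proof -
  note ih = Lip_square_integrable[OF finite_measure_axioms sets_mu moment2 h]
  have "ennreal (variance h) \<le> ennreal (L\<^sup>2) * (\<integral>\<^sup>+x. ennreal ((eucl_dist d y x)\<^sup>2) \<partial>\<mu>)"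
    if y: "y \<in> space (Rd d)" for y
  proof -
    have "variance h \<le> (\<integral>x. (h x - h y)\<^sup>2 \<partial>\<mu>)" by (rule variance_le_second_moment[OF ih(2,1)])
    also have "\<dots> \<le> (\<integral>x. L\<^sup>2 * (eucl_dist d x y)\<^sup>2 \<partial>\<mu>)"
    proof (rule integral_mono)
      fix x assume "x \<in> space \<mu>"
      then have "\<bar>h x - h y\<bar> \<le> \<bar>L * eucl_dist d x y\<bar>" using LipD[OF h, of x y] y by simp
      then have "(h x - h y)\<^sup>2 \<le> (L * eucl_dist d x y)\<^sup>2" by (rule abs_le_square_iff[THEN iffD1])
      then show "(h x - h y)\<^sup>2 \<le> L\<^sup>2 * (eucl_dist d x y)\<^sup>2" by (simp add: power_mult_distrib)
    next
      show "integrable \<mu> (\<lambda>x. (h x - h y)\<^sup>2)" using ih by (simp add: power2_diff)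
    qed (use integrable_sq_dist[OF y] in simp)
    finally have "ennreal (variance h) \<le> ennreal (L\<^sup>2) * ennreal (\<integral>x. (eucl_dist d x y)\<^sup>2 \<partial>\<mu>)"
      by (simp add: ennreal_mult[symmetric] ennreal_leI)
    also have "ennreal (\<integral>x. (eucl_dist d x y)\<^sup>2 \<partial>\<mu>) = (\<integral>\<^sup>+x. ennreal ((eucl_dist d y x)\<^sup>2) \<partial>\<mu>)"
      unfolding eucl_dist_commute[of d y] by (rule nn_integral_eq_integral[OF integrable_sq_dist[OF y], symmetric]) simp
    finally show ?thesis .
  qed
  then have "(\<integral>\<^sup>+y. ennreal (variance h) \<partial>\<mu>) \<le> (\<integral>\<^sup>+y. ennreal (L\<^sup>2) * (\<integral>\<^sup>+x. ennreal ((eucl_dist d y x)\<^sup>2) \<partial>\<mu>) \<partial>\<mu>)"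
    by (intro nn_integral_mono) simp
  also have "\<dots> = ennreal (L\<^sup>2) * (W2_spread d \<mu>)\<^sup>2"
  proof -
    have "(\<lambda>(y, x). ennreal ((eucl_dist d y x)\<^sup>2)) \<in> borel_measurable (\<mu> \<Otimes>\<^sub>M \<mu>)"
      unfolding case_prod_unfold by measurable
    then have "(\<lambda>y. \<integral>\<^sup>+x. ennreal ((eucl_dist d y x)\<^sup>2) \<partial>\<mu>) \<in> borel_measurable \<mu>"
      by (rule borel_measurable_nn_integral)
    then show ?thesis unfolding W2_spread_power2 by (rule nn_integral_cmult)
  qed
  also have "\<dots> = ennreal ((L * enn2real (W2_spread d \<mu>))\<^sup>2)"
    using W2_spread_finite by (simp add: power_mult_distrib ennreal_mult ennreal_power[symmetric])
  finally have "ennreal (variance h) \<le> ennreal ((L * enn2real (W2_spread d \<mu>))\<^sup>2)"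
    by (simp add: emeasure_space_1[unfolded space_mu])
  then show ?thesis by simp
qed

text \<open>Finiteness of \<open>const_A1\<close> comes first, since \<open>enn2real\<close> sends
  infinity to 0 and would destroy the comparison.\<close>

lemma const_A1_bounds:
  assumes "Rd_moment2 \<xi> d"
  shows "2 * enn2real (W2 (eucl_dist d) \<xi> \<mu>) \<le> enn2real (const_A1 d \<xi> \<mu>)"
proof -
  interpret \<xi>: Rd_moment2 \<xi> d by fact
  have fin: "W2 (eucl_dist d) \<xi> \<mu> < \<top>" by (rule \<xi>.W2_finite) unfold_locales
  have "(INF x\<in>space (Rd d). W2 (eucl_dist d) (return (Rd d) x) \<mu>) \<le> W2 (eucl_dist d) (return (Rd d) (origin d)) \<mu>"
    by (rule INF_lower) simp
  also have "\<dots> < \<top>" by (rule W2_return_finite) simp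
  finally have "const_A1 d \<xi> \<mu> < \<top>"
    unfolding const_A1_def using fin W2_spread_finite
    by (simp add: ennreal_mult_less_top)
  moreover have "2 * W2 (eucl_dist d) \<xi> \<mu> \<le> const_A1 d \<xi> \<mu>"
    unfolding const_A1_def by (simp add: add.assoc add_increasing add_increasing2)
  ultimately have "enn2real (2 * W2 (eucl_dist d) \<xi> \<mu>) \<le> enn2real (const_A1 d \<xi> \<mu>)" by (rule enn2real_mono[rotated])
  then show ?thesis by (simp add: enn2real_mult)
qed

end

section \<open>Trajectories and stationary autocovariances\<close>

lemma ula_space_eq: "ula_space d \<mu> = \<mu> \<Otimes>\<^sub>M noise d"
  by (simp add: ula_space_def noise_def)

lemma measurable_noise_coordinate [measurable]: "(\<lambda>z. z k) \<in> noise d \<rightarrow>\<^sub>M Rd d"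
  using measurable_noise_component unfolding measurable_cong_sets[OF refl sets_std_gaussian] .

definition noise_dist :: "nat \<Rightarrow> nat \<Rightarrow> (nat \<Rightarrow> nat \<Rightarrow> real) \<Rightarrow> (nat \<Rightarrow> nat \<Rightarrow> real) \<Rightarrow> real" where
  "noise_dist d n z z' = L2_set (\<lambda>k. eucl_dist d (z k) (z' k)) {..<n}"

lemma tau_space_noise: "tau_space (noise d) (noise_dist d n)"
proof -
  interpret prob_space "noise d" by simp
  show ?thesis
    by unfold_locales (simp_all add: noise_dist_def L2_set_power2 property_tau_noise)
qed

lemma L2_set_lessThan_Suc_ge: "L2_set a {..<n} \<le> L2_set a {..<Suc n}"
  unfolding L2_set_def by simp

text \<open>Up to the initial term the shifted sequence has the same norm, so the triangle
  inequality applied to the recursion can be solved for the norm. The factor 1 / (1 - r) is the same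
  for every length \<open>n\<close>.\<close>

lemma L2_set_recursive_bound:
  assumes r: "0 \<le> r" "r < 1" and a: "\<And>k. 0 \<le> a k" and s: "\<And>k. 0 \<le> s k"
    and rec: "\<And>k. a (Suc k) \<le> r * a k + s k"
  shows "(1 - r) * L2_set a {..<n} \<le> a 0 + L2_set s {..<n}"
proof -
  have "L2_set a {..<n} \<le> L2_set a {..<Suc n}" by (rule L2_set_lessThan_Suc_ge)
  also have "\<dots> = sqrt ((a 0)\<^sup>2 + (L2_set (\<lambda>k. a (Suc k)) {..<n})\<^sup>2)"
    unfolding L2_set_power2 by (simp add: L2_set_def sum.lessThan_Suc_shift del: sum.lessThan_Suc)
  also have "\<dots> \<le> a 0 + L2_set (\<lambda>k. a (Suc k)) {..<n}"
    by (rule sqrt_sum_squares_le_sum) (auto simp: a)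
  also have "L2_set (\<lambda>k. a (Suc k)) {..<n} \<le> L2_set (\<lambda>k. r * a k + s k) {..<n}"
    by (rule L2_set_mono) (auto simp: rec a)
  also have "\<dots> \<le> r * L2_set a {..<n} + L2_set s {..<n}"
    using L2_set_triangle_ineq[of "\<lambda>k. r * a k" s "{..<n}"] r by (simp add: L2_set_right_distrib)
  finally show ?thesis by (simp add: algebra_simps)
qed

lemma integrable_pair_comp:
  fixes f :: "'a \<Rightarrow> real" and g :: "'b \<Rightarrow> real"
  assumes M: "prob_space M" and N: "prob_space N"
  shows "integrable M f \<Longrightarrow> integrable (M \<Otimes>\<^sub>M N) (\<lambda>p. f (fst p))"
    "integrable N g \<Longrightarrow> integrable (M \<Otimes>\<^sub>M N) (\<lambda>p. g (snd p))"
    "integrable M f \<Longrightarrow> (\<integral>p. f (fst p) \<partial>(M \<Otimes>\<^sub>M N)) = (\<integral>x. f x \<partial>M)"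
proof -
  have d: "distr (M \<Otimes>\<^sub>M N) M fst = M" "distr (M \<Otimes>\<^sub>M N) N snd = N"
    using pair_measure_in_couplings[OF M N] by (auto simp: couplings_def)
  show "integrable (M \<Otimes>\<^sub>M N) (\<lambda>p. f (fst p))" if "integrable M f"
    using that by (subst (asm) d(1)[symmetric], subst (asm) integrable_distr_eq) auto
  show "integrable (M \<Otimes>\<^sub>M N) (\<lambda>p. g (snd p))" if "integrable N g"
    using that by (subst (asm) d(2)[symmetric], subst (asm) integrable_distr_eq) auto
  show "(\<integral>p. f (fst p) \<partial>(M \<Otimes>\<^sub>M N)) = (\<integral>x. f x \<partial>M)" if "integrable M f"
  proof -
    have "(\<integral>x. f x \<partial>distr (M \<Otimes>\<^sub>M N) M fst) = (\<integral>p. f (fst p) \<partial>(M \<Otimes>\<^sub>M N))"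
      using that by (subst integral_distr) auto
    then show ?thesis unfolding d(1) by simp
  qed
qed

context ula begin

abbreviation chain :: "ula_outcome \<Rightarrow> nat \<Rightarrow> nat \<Rightarrow> real" where
  "chain \<equiv> ula_chain d U \<gamma>"

lemma measurable_chain [measurable]:
  assumes f: "f \<in> M \<rightarrow>\<^sub>M Rd d" and g: "g \<in> M \<rightarrow>\<^sub>M noise d"
  shows "(\<lambda>\<omega>. chain (f \<omega>, g \<omega>) k) \<in> M \<rightarrow>\<^sub>M Rd d"
proof (induction k)
  case (Suc k)
  have "(\<lambda>\<omega>. g \<omega> k) \<in> M \<rightarrow>\<^sub>M Rd d" by (rule measurable_compose[OF g measurable_noise_coordinate])
  then show ?case using measurable_step[OF Suc] by simp
qed (use f in simp)

lemma measurable_chain':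
  assumes [measurable_cong]: "sets \<mu> = sets (Rd d)"
  shows "(\<lambda>\<omega>. chain \<omega> k) \<in> \<mu> \<Otimes>\<^sub>M noise d \<rightarrow>\<^sub>M Rd d"
proof -
  have "(\<lambda>\<omega>. chain (fst \<omega>, snd \<omega>) k) \<in> \<mu> \<Otimes>\<^sub>M noise d \<rightarrow>\<^sub>M Rd d" by measurable
  then show ?thesis by simp
qed

lemma chain_in_space: "x \<in> space (Rd d) \<Longrightarrow> chain (x, z) k \<in> space (Rd d)"
  by (cases k) simp_all

lemma chain_dist_initial:
  assumes "x \<in> space (Rd d)" "y \<in> space (Rd d)"
  shows "eucl_dist d (chain (x, z) k) (chain (y, z) k) \<le> rate ^ k * eucl_dist d x y"
proof (induction k)
  case (Suc k)
  have "eucl_dist d (chain (x, z) (Suc k)) (chain (y, z) (Suc k)) \<le> rate * eucl_dist d (chain (x, z) k) (chain (y, z) k)"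
    using step_dist_state[OF chain_in_space chain_in_space, OF assms] by simp
  also have "\<dots> \<le> rate * (rate ^ k * eucl_dist d x y)" using rate_less by (intro mult_left_mono Suc) auto
  finally show ?case by simp
qed simp

lemma chain_path_dist_initial:
  assumes "x \<in> space (Rd d)" "y \<in> space (Rd d)"
  shows "L2_set (\<lambda>k. eucl_dist d (chain (x, z) k) (chain (y, z) k)) {..<n} \<le> eucl_dist d x y / (1 - rate)"
proof -
  have "(1 - rate) * L2_set (\<lambda>k. eucl_dist d (chain (x, z) k) (chain (y, z) k)) {..<n}
    \<le> eucl_dist d (chain (x, z) 0) (chain (y, z) 0) + L2_set (\<lambda>_. 0) {..<n}"
    using step_dist_state[OF chain_in_space chain_in_space, OF assms] rate_less
    by (intro L2_set_recursive_bound) auto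
  then show ?thesis using rate_less by (simp add: L2_set_0' field_simps)
qed

text \<open>The constant does not grow with \<open>n\<close>. Consequently the squared seminorms
  fluctuate at order sqrt n up to logarithms, which is the rate after division by n.\<close>

lemma chain_path_dist_noise:
  assumes "x \<in> space (Rd d)"
  shows "L2_set (\<lambda>k. eucl_dist d (chain (x, z) k) (chain (x, z') k)) {..<n} \<le> \<sigma>\<^sub>0 / (1 - rate) * noise_dist d n z z'"
proof -
  have "(1 - rate) * L2_set (\<lambda>k. eucl_dist d (chain (x, z) k) (chain (x, z') k)) {..<n}
    \<le> eucl_dist d (chain (x, z) 0) (chain (x, z') 0) + L2_set (\<lambda>k. \<sigma>\<^sub>0 * eucl_dist d (z k) (z' k)) {..<n}"
    using step_dist[OF chain_in_space chain_in_space, OF assms assms] rate_less gamma_pos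
    by (intro L2_set_recursive_bound) auto
  also have "\<dots> = \<sigma>\<^sub>0 * noise_dist d n z z'"
    using gamma_pos by (simp add: noise_dist_def L2_set_right_distrib)
  finally show ?thesis using rate_less by (simp add: field_simps)
qed

lemma chain_Suc_case_nat: "chain (x, case_nat s \<omega>) (Suc k) = chain (step x s, \<omega>) k"
  by (induction k) simp_all

lemma lipschitz_chain_noise:
  assumes h: "h \<in> lipschitz l" and l: "0 \<le> l" and x: "x \<in> space (Rd d)"
  shows "\<bar>h (chain (x, z) k) - h (chain (x, z') k)\<bar> \<le> l * \<sigma>\<^sub>0 / (1 - rate) * noise_dist d (Suc k) z z'"
proof -
  have "\<bar>h (chain (x, z) k) - h (chain (x, z') k)\<bar> \<le> l * eucl_dist d (chain (x, z) k) (chain (x, z') k)"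
    by (intro LipD[OF h] chain_in_space x)
  also have "eucl_dist d (chain (x, z) k) (chain (x, z') k)
    \<le> L2_set (\<lambda>k. eucl_dist d (chain (x, z) k) (chain (x, z') k)) {..<Suc k}"
    by (rule member_le_L2_set) auto
  also have "\<dots> \<le> \<sigma>\<^sub>0 / (1 - rate) * noise_dist d (Suc k) z z'" by (rule chain_path_dist_noise[OF x])
  finally show ?thesis using l by (simp add: mult_left_mono)
qed

lemma integrable_chain_noise:
  assumes h: "h \<in> lipschitz l" and l: "0 \<le> l" and x: "x \<in> space (Rd d)"
  shows "integrable (noise d) (\<lambda>z. h (chain (x, z) k))" "integrable (noise d) (\<lambda>z. (h (chain (x, z) k))\<^sup>2)"
proof -
  interpret N: tau_space "noise d" "noise_dist d (Suc k)" by (rule tau_space_noise)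
  note [measurable] = Lip_measurable[OF h]
  have [measurable]: "(\<lambda>_. x) \<in> noise d \<rightarrow>\<^sub>M Rd d" using x by simp
  have m: "(\<lambda>z. h (chain (x, z) k)) \<in> borel_measurable (noise d)" by measurable
  show "integrable (noise d) (\<lambda>z. h (chain (x, z) k))" "integrable (noise d) (\<lambda>z. (h (chain (x, z) k))\<^sup>2)"
    using N.lipschitz_integrable[OF m lipschitz_chain_noise[OF h l x]] by auto
qed

lemma funpow_P_lipschitz: "h \<in> lipschitz l \<Longrightarrow> 0 \<le> l \<Longrightarrow> (P ^^ k) h \<in> lipschitz (rate ^ k * l)"
proof (induction k)
  case (Suc k)
  then show ?case using lipschitz_P[OF Suc.IH] rate_less by (simp add: mult.assoc)
qed simp

text \<open>\<open>noise_iter\<close> peels off the first noise vector, so the induction over k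
  needs an arbitrary starting point.\<close>

lemma integral_chain_noise:
  assumes h: "h \<in> lipschitz l" and l: "0 \<le> l"
  shows "x \<in> space (Rd d) \<Longrightarrow> (\<integral>z. h (chain (x, z) k) \<partial>noise d) = (P ^^ k) h x"
proof (induction k arbitrary: x)
  case 0
  interpret prob_space "noise d" by simp
  show ?case by (simp add: prob_space)
next
  case (Suc k)
  interpret N: prob_space "noise d" by simp
  interpret GN: pair_prob_space gauss "noise d" ..
  note [measurable] = Lip_measurable[OF h]
  have [measurable]: "(\<lambda>_. x) \<in> noise d \<rightarrow>\<^sub>M Rd d" using Suc.prems by simp
  define f where "f z = h (chain (x, z) (Suc k))" for z
  have m: "f \<in> borel_measurable (noise d)"
    unfolding f_def by (rule measurable_compose[OF measurable_chain]) measurable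
  have fi: "integrable (noise d) f" unfolding f_def by (rule integrable_chain_noise(1)[OF h l Suc.prems])
  have i: "integrable (gauss \<Otimes>\<^sub>M noise d) (\<lambda>p. f (case p of (s, \<omega>) \<Rightarrow> case_nat s \<omega>))"
    using integrable_distr_eq[OF measurable_case_nat_noise m] fi unfolding noise_iter by simp
  have f: "f (case_nat s \<omega>) = h (chain (step x s, \<omega>) k)" for s \<omega>
    unfolding f_def chain_Suc_case_nat ..
  have "(\<integral>z. f z \<partial>noise d) = (\<integral>p. f (case p of (s, \<omega>) \<Rightarrow> case_nat s \<omega>) \<partial>(gauss \<Otimes>\<^sub>M noise d))"
    using integral_distr[OF measurable_case_nat_noise m] unfolding noise_iter .
  also have "\<dots> = (\<integral>s. (\<integral>\<omega>. f (case_nat s \<omega>) \<partial>noise d) \<partial>gauss)"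
    using GN.integral_fst'[OF i] by simp
  also have "\<dots> = (\<integral>s. (P ^^ k) h (step x s) \<partial>gauss)"
    unfolding f by (simp add: Suc.IH)
  also have "\<dots> = (P ^^ Suc k) h x" by (simp add: P_def[of "(P ^^ k) h"])
  finally show ?case unfolding f_def .
qed

text \<open>Comparison with the chain started at the origin and driven by the same noise, which
  concentration makes square integrable; the difference is controlled by the second moment of
  \<mu>.\<close>

lemma chain_square_integrable:
  assumes \<mu>: "Rd_moment2 \<mu> d" and h: "h \<in> lipschitz l" and l: "0 \<le> l"
  shows "integrable (\<mu> \<Otimes>\<^sub>M noise d) (\<lambda>\<omega>. (h (chain \<omega> k))\<^sup>2)" "integrable (\<mu> \<Otimes>\<^sub>M noise d) (\<lambda>\<omega>. h (chain \<omega> k))"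
proof -
  interpret \<mu>: Rd_moment2 \<mu> d by fact
  interpret N: prob_space "noise d" by simp
  interpret MN: pair_prob_space \<mu> "noise d" ..
  note hm[measurable] = Lip_measurable[OF h]
  have m: "(\<lambda>\<omega>. h (chain \<omega> k)) \<in> borel_measurable (\<mu> \<Otimes>\<^sub>M noise d)"
    by (rule measurable_compose[OF measurable_chain' hm]) simp
  show sq: "integrable (\<mu> \<Otimes>\<^sub>M noise d) (\<lambda>\<omega>. (h (chain \<omega> k))\<^sup>2)"
  proof (rule Bochner_Integration.integrable_bound)
    show "integrable (\<mu> \<Otimes>\<^sub>M noise d) (\<lambda>\<omega>. 2 * (h (chain (origin d, snd \<omega>) k))\<^sup>2 + 2 * l\<^sup>2 * (eucl_dist d (fst \<omega>) (origin d))\<^sup>2)"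
      by (intro Bochner_Integration.integrable_add integrable_mult_right
        integrable_pair_comp(2)[OF \<mu>.prob_space_axioms N.prob_space_axioms integrable_chain_noise(2)[OF h l]]
        integrable_pair_comp(1)[OF \<mu>.prob_space_axioms N.prob_space_axioms \<mu>.moment2]) simp
    show "AE \<omega> in \<mu> \<Otimes>\<^sub>M noise d. norm ((h (chain \<omega> k))\<^sup>2)
      \<le> norm (2 * (h (chain (origin d, snd \<omega>) k))\<^sup>2 + 2 * l\<^sup>2 * (eucl_dist d (fst \<omega>) (origin d))\<^sup>2)"
    proof (rule AE_I2)
      fix \<omega> assume "\<omega> \<in> space (\<mu> \<Otimes>\<^sub>M noise d)"
      then have x: "fst \<omega> \<in> space (Rd d)" by (simp add: space_pair_measure mem_Times_iff)
      let ?a = "h (chain \<omega> k)" and ?b = "h (chain (origin d, snd \<omega>) k)" and ?e = "eucl_dist d (fst \<omega>) (origin d)"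
      have "\<bar>?a - ?b\<bar> \<le> l * eucl_dist d (chain (fst \<omega>, snd \<omega>) k) (chain (origin d, snd \<omega>) k)"
        using LipD[OF h chain_in_space[OF x, of "snd \<omega>" k] chain_in_space[of "origin d" "snd \<omega>" k]] by simp
      also have "\<dots> \<le> l * (rate ^ k * ?e)" using x by (intro mult_left_mono chain_dist_initial l) auto
      also have "\<dots> \<le> l * (1 * ?e)" using rate_less l by (intro mult_left_mono mult_right_mono power_le_one) auto
      finally have "\<bar>?a - ?b\<bar> \<le> \<bar>l * ?e\<bar>" using l by simp
      then have "(?a - ?b)\<^sup>2 \<le> (l * ?e)\<^sup>2" by (rule abs_le_square_iff[THEN iffD1])
      moreover have "?a\<^sup>2 \<le> 2 * ?b\<^sup>2 + 2 * (?a - ?b)\<^sup>2"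
        using zero_le_power2[of "?a - 2 * ?b"] by (simp add: power2_eq_square algebra_simps)
      ultimately show "norm (?a\<^sup>2) \<le> norm (2 * ?b\<^sup>2 + 2 * l\<^sup>2 * ?e\<^sup>2)" by (simp add: power_mult_distrib)
    qed
  qed (use m in measurable)
  show "integrable (\<mu> \<Otimes>\<^sub>M noise d) (\<lambda>\<omega>. h (chain \<omega> k))"
    by (rule MN.P.square_integrable_imp_integrable[OF m sq])
qed

end

section \<open>Stationarity of the path and decay of its autocovariances\<close>

context stationary_ula begin

lemma Rd_moment2_pi: "Rd_moment2 \<pi> d"
  using pi_second_moment by unfold_locales auto

sublocale noise: prob_space "noise d" by simp
sublocale piN: pair_prob_space \<pi> "noise d" ..

lemmas chain_L2 = chain_square_integrable[OF Rd_moment2_pi]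

text \<open>Time shift of the canonical chain. It acts on outcomes, so the single invariance
  statement \<open>distr_shift\<close> gives stationarity of all joint laws.\<close>

definition shift :: "ula_outcome \<Rightarrow> ula_outcome" where
  "shift \<omega> = (step (fst \<omega>) (snd \<omega> 0), \<lambda>k. snd \<omega> (Suc k))"

lemma chain_shift: "chain \<omega> (Suc k) = chain (shift \<omega>) k"
  by (induction k) (simp_all add: shift_def)

lemma measurable_shift [measurable]: "shift \<in> \<pi> \<Otimes>\<^sub>M noise d \<rightarrow>\<^sub>M \<pi> \<Otimes>\<^sub>M noise d"
proof -
  have sm: "(\<lambda>z k. z (Suc k)) \<in> noise d \<rightarrow>\<^sub>M noise d"
    unfolding noise_def by (rule measurable_PiM_single') (auto simp: space_PiM PiE_iff)
  have s0: "(\<lambda>\<omega>. snd \<omega> 0) \<in> \<pi> \<Otimes>\<^sub>M noise d \<rightarrow>\<^sub>M Rd d"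
    by (rule measurable_compose[OF measurable_snd measurable_noise_coordinate])
  have "fst \<in> \<pi> \<Otimes>\<^sub>M noise d \<rightarrow>\<^sub>M Rd d"
    using measurable_fst[of \<pi> "noise d"] unfolding measurable_cong_sets[OF refl sets_pi] .
  then have "(\<lambda>\<omega>. step (fst \<omega>) (snd \<omega> 0)) \<in> \<pi> \<Otimes>\<^sub>M noise d \<rightarrow>\<^sub>M \<pi>"
    unfolding measurable_cong_sets[OF refl sets_pi] by (rule measurable_step[OF _ s0])
  moreover have "(\<lambda>\<omega>. \<lambda>k. snd \<omega> (Suc k)) \<in> \<pi> \<Otimes>\<^sub>M noise d \<rightarrow>\<^sub>M noise d"
    by (rule measurable_compose[OF measurable_snd sm])
  ultimately show ?thesis unfolding shift_def[abs_def] by (rule measurable_Pair)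
qed

lemma distr_shift: "distr (\<pi> \<Otimes>\<^sub>M noise d) (\<pi> \<Otimes>\<^sub>M noise d) shift = \<pi> \<Otimes>\<^sub>M noise d"
proof (rule measure_eqI)
  fix A assume "A \<in> sets (distr (\<pi> \<Otimes>\<^sub>M noise d) (\<pi> \<Otimes>\<^sub>M noise d) shift)"
  then have [measurable]: "A \<in> sets (\<pi> \<Otimes>\<^sub>M noise d)" by simp
  then have [measurable]: "A \<in> sets (Rd d \<Otimes>\<^sub>M noise d)"
    by (simp cong: sets_pair_measure_cong)
  have "emeasure (distr (\<pi> \<Otimes>\<^sub>M noise d) (\<pi> \<Otimes>\<^sub>M noise d) shift) A
    = (\<integral>\<^sup>+\<omega>. indicator A (shift \<omega>) \<partial>(\<pi> \<Otimes>\<^sub>M noise d))"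
    by (subst nn_integral_distr[symmetric, where M' = "\<pi> \<Otimes>\<^sub>M noise d"]) auto
  also have "\<dots> = (\<integral>\<^sup>+x. (\<integral>\<^sup>+z. indicator A (shift (x, z)) \<partial>noise d) \<partial>\<pi>)"
    by (subst noise.nn_integral_fst[symmetric]) measurable
  also have "\<dots> = (\<integral>\<^sup>+x. (\<integral>\<^sup>+s. (\<integral>\<^sup>+\<omega>. indicator A (step x s, \<omega>) \<partial>noise d) \<partial>gauss) \<partial>\<pi>)"
  proof (rule nn_integral_cong)
    fix x assume x: "x \<in> space \<pi>"
    have m: "(\<lambda>z. indicator A (shift (x, z)) :: ennreal) \<in> borel_measurable (noise d)"
    proof -
      have [measurable]: "(\<lambda>z. (x, z)) \<in> noise d \<rightarrow>\<^sub>M \<pi> \<Otimes>\<^sub>M noise d" using x by measurable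
      show ?thesis by measurable
    qed
    have "(\<integral>\<^sup>+z. indicator A (shift (x, z)) \<partial>noise d)
      = (\<integral>\<^sup>+z. indicator A (shift (x, z)) \<partial>distr (gauss \<Otimes>\<^sub>M noise d) (noise d) (\<lambda>(s, \<omega>). case_nat s \<omega>))"
      unfolding noise_iter ..
    also have "\<dots> = (\<integral>\<^sup>+p. indicator A (shift (x, case p of (s, \<omega>) \<Rightarrow> case_nat s \<omega>)) \<partial>(gauss \<Otimes>\<^sub>M noise d))"
      by (subst nn_integral_distr) (use m in auto)
    also have "\<dots> = (\<integral>\<^sup>+s. (\<integral>\<^sup>+\<omega>. indicator A (shift (x, case_nat s \<omega>)) \<partial>noise d) \<partial>gauss)"
      by (subst noise.nn_integral_fst[symmetric])
         (auto intro!: measurable_compose[OF measurable_case_nat_noise m])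
    finally show "(\<integral>\<^sup>+z. indicator A (shift (x, z)) \<partial>noise d)
      = (\<integral>\<^sup>+s. (\<integral>\<^sup>+\<omega>. indicator A (step x s, \<omega>) \<partial>noise d) \<partial>gauss)" by (simp add: shift_def)
  qed
  also have "\<dots> = (\<integral>\<^sup>+x. (\<integral>\<^sup>+\<omega>. indicator A (x, \<omega>) \<partial>noise d) \<partial>\<pi>)"
    by (rule nn_integral_stationary) measurable
  also have "\<dots> = emeasure (\<pi> \<Otimes>\<^sub>M noise d) A"
    by (rule noise.emeasure_pair_measure[symmetric]) measurable
  finally show "emeasure (distr (\<pi> \<Otimes>\<^sub>M noise d) (\<pi> \<Otimes>\<^sub>M noise d) shift) A = emeasure (\<pi> \<Otimes>\<^sub>M noise d) A" .
qed simp

definition autocov :: "((nat \<Rightarrow> real) \<Rightarrow> real) \<Rightarrow> nat \<Rightarrow> real" where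
  "autocov h l = (\<integral>\<omega>. h (chain \<omega> 0) * h (chain \<omega> l) \<partial>(\<pi> \<Otimes>\<^sub>M noise d))"

lemma integrable_chain_mult:
  assumes "g \<in> lipschitz l" "h \<in> lipschitz l" "0 \<le> l"
  shows "integrable (\<pi> \<Otimes>\<^sub>M noise d) (\<lambda>\<omega>. g (chain \<omega> j) * h (chain \<omega> k))"
  using chain_L2[OF assms(1,3), of j] chain_L2[OF assms(2,3), of k]
  by (intro Cauchy_Schwarz_integral(1)) auto

lemma integral_chain_mult:
  assumes h: "h \<in> lipschitz l" and l: "0 \<le> l"
  shows "(\<integral>\<omega>. h (chain \<omega> j) * h (chain \<omega> (j + k)) \<partial>(\<pi> \<Otimes>\<^sub>M noise d)) = autocov h k"
proof (induction j)
  case (Suc j)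
  have m: "(\<lambda>\<omega>. h (chain \<omega> j) * h (chain \<omega> (j + k))) \<in> borel_measurable (\<pi> \<Otimes>\<^sub>M noise d)"
    using integrable_chain_mult[OF h h l] by (rule borel_measurable_integrable)
  have "(\<integral>\<omega>. h (chain \<omega> (Suc j)) * h (chain \<omega> (Suc j + k)) \<partial>(\<pi> \<Otimes>\<^sub>M noise d))
    = (\<integral>\<omega>. h (chain (shift \<omega>) j) * h (chain (shift \<omega>) (j + k)) \<partial>(\<pi> \<Otimes>\<^sub>M noise d))"
    by (simp only: chain_shift add_Suc)
  also have "\<dots> = (\<integral>\<omega>. h (chain \<omega> j) * h (chain \<omega> (j + k)) \<partial>distr (\<pi> \<Otimes>\<^sub>M noise d) (\<pi> \<Otimes>\<^sub>M noise d) shift)"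
    using m by (subst integral_distr) auto
  also have "\<dots> = autocov h k" unfolding distr_shift by (rule Suc.IH)
  finally show ?case .
qed (simp add: autocov_def)

lemma funpow_P_L2:
  assumes h: "h \<in> lipschitz l" and l: "0 \<le> l" and mean: "(\<integral>x. h x \<partial>\<pi>) = 0"
  shows "(\<integral>x. (P ^^ k) h x \<partial>\<pi>) = 0" "(\<integral>x. ((P ^^ k) h x)\<^sup>2 \<partial>\<pi>) \<le> (rate ^ k)\<^sup>2 * (\<integral>x. (h x)\<^sup>2 \<partial>\<pi>)"
proof -
  note Pk = funpow_P_lipschitz[OF h l]
  have nn: "0 \<le> rate ^ k * l" for k using l rate_less by simp
  show mk: "(\<integral>x. (P ^^ k) h x \<partial>\<pi>) = 0" for k
    by (induction k) (simp_all add: mean integral_P[OF Pk])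
  show "(\<integral>x. ((P ^^ k) h x)\<^sup>2 \<partial>\<pi>) \<le> (rate ^ k)\<^sup>2 * (\<integral>x. (h x)\<^sup>2 \<partial>\<pi>)"
  proof (induction k)
    case (Suc k)
    have "(\<integral>x. ((P ^^ Suc k) h x)\<^sup>2 \<partial>\<pi>) \<le> rate\<^sup>2 * (\<integral>x. ((P ^^ k) h x)\<^sup>2 \<partial>\<pi>)"
      using L2_contraction[OF Pk nn mk] by simp
    also have "\<dots> \<le> rate\<^sup>2 * ((rate ^ k)\<^sup>2 * (\<integral>x. (h x)\<^sup>2 \<partial>\<pi>))" by (intro mult_left_mono Suc) auto
    finally show ?case by (simp add: power_mult_distrib mult.assoc)
  qed simp
qed

text \<open>Conditioning on the initial state replaces the later factor by P^k h, on which the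
  contraction acts. Two different functions appear for the sake of the polarization in
  \<open>autocov_diff_le\<close>.\<close>

lemma integral_cross_le:
  assumes g: "g \<in> lipschitz l" and h: "h \<in> lipschitz l" and l: "0 \<le> l" and mean: "(\<integral>x. h x \<partial>\<pi>) = 0"
  shows "\<bar>\<integral>\<omega>. g (chain \<omega> 0) * h (chain \<omega> k) \<partial>(\<pi> \<Otimes>\<^sub>M noise d)\<bar>
    \<le> rate ^ k * (sqrt (\<integral>x. (g x)\<^sup>2 \<partial>\<pi>) * sqrt (\<integral>x. (h x)\<^sup>2 \<partial>\<pi>))"
proof -
  note ig = pi_lipschitz_integrable[OF g] and iP = pi_lipschitz_integrable[OF funpow_P_lipschitz[OF h l]]
  have "(\<integral>\<omega>. g (chain \<omega> 0) * h (chain \<omega> k) \<partial>(\<pi> \<Otimes>\<^sub>M noise d))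
    = (\<integral>x. (\<integral>z. g x * h (chain (x, z) k) \<partial>noise d) \<partial>\<pi>)"
    using piN.integral_fst'[OF integrable_chain_mult[OF g h l, of 0 k]] by simp
  also have "\<dots> = (\<integral>x. g x * (P ^^ k) h x \<partial>\<pi>)"
    by (intro Bochner_Integration.integral_cong) (simp_all add: integral_chain_noise[OF h l])
  also have "\<bar>\<dots>\<bar> \<le> sqrt (\<integral>x. (g x)\<^sup>2 \<partial>\<pi>) * sqrt (\<integral>x. ((P ^^ k) h x)\<^sup>2 \<partial>\<pi>)"
    using ig iP by (intro Cauchy_Schwarz_integral(3)) auto
  also have "\<dots> \<le> sqrt (\<integral>x. (g x)\<^sup>2 \<partial>\<pi>) * sqrt ((rate ^ k)\<^sup>2 * (\<integral>x. (h x)\<^sup>2 \<partial>\<pi>))"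
    using funpow_P_L2(2)[OF h l mean] by (intro mult_left_mono) auto
  also have "sqrt ((rate ^ k)\<^sup>2 * (\<integral>x. (h x)\<^sup>2 \<partial>\<pi>)) = rate ^ k * sqrt (\<integral>x. (h x)\<^sup>2 \<partial>\<pi>)"
    using rate_less by (simp add: real_sqrt_mult)
  finally show ?thesis by (simp add: mult_ac)
qed

lemma autocov_le:
  assumes "h \<in> lipschitz l" "0 \<le> l" "(\<integral>x. h x \<partial>\<pi>) = 0"
  shows "\<bar>autocov h k\<bar> \<le> rate ^ k * (\<integral>x. (h x)\<^sup>2 \<partial>\<pi>)"
  using integral_cross_le[OF assms(1,1,2,3), of k] by (simp add: autocov_def)

text \<open>Polarization: g g - h h = (g - h) g + h (g - h), the factors taken at the two times. The
  doubled Lipschitz constant puts all functions in one class and does not enter the bound.\<close>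

lemma autocov_diff_le:
  assumes g: "g \<in> lipschitz l" and h: "h \<in> lipschitz l" and l: "0 \<le> l"
    and mean: "(\<integral>x. g x \<partial>\<pi>) = 0" "(\<integral>x. h x \<partial>\<pi>) = 0"
  shows "\<bar>autocov g k - autocov h k\<bar> \<le> rate ^ k * (sqrt (\<integral>x. (g x - h x)\<^sup>2 \<partial>\<pi>)
    * (sqrt (\<integral>x. (g x)\<^sup>2 \<partial>\<pi>) + sqrt (\<integral>x. (h x)\<^sup>2 \<partial>\<pi>)))"
proof -
  define e where "e x = g x - h x" for x
  have lip2: "u \<in> lipschitz (2 * l)" if "u \<in> lipschitz l" for u
    unfolding Lip_def
  proof (intro CollectI ballI)
    fix x y assume "x \<in> space (Rd d)" "y \<in> space (Rd d)"
    then have "\<bar>u x - u y\<bar> \<le> l * eucl_dist d x y" by (rule LipD[OF that])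
    also have "\<dots> \<le> 2 * l * eucl_dist d x y" using l by (intro mult_right_mono) auto
    finally show "\<bar>u x - u y\<bar> \<le> 2 * l * eucl_dist d x y" .
  qed
  note g2 = lip2[OF g] and h2 = lip2[OF h]
  have l2: "0 \<le> 2 * l" using l by simp
  have e: "e \<in> lipschitz (2 * l)"
    unfolding Lip_def
  proof (intro CollectI ballI)
    fix x y assume "x \<in> space (Rd d)" "y \<in> space (Rd d)"
    then show "\<bar>e x - e y\<bar> \<le> 2 * l * eucl_dist d x y"
      using LipD[OF g, of x y] LipD[OF h, of x y] unfolding e_def by simp
  qed
  have me: "(\<integral>x. e x \<partial>\<pi>) = 0"
    using pi_lipschitz_integrable(2)[OF g] pi_lipschitz_integrable(2)[OF h] mean by (simp add: e_def)
  have "autocov g k - autocov h k = (\<integral>\<omega>. g (chain \<omega> 0) * g (chain \<omega> k) - h (chain \<omega> 0) * h (chain \<omega> k) \<partial>(\<pi> \<Otimes>\<^sub>M noise d))"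
    unfolding autocov_def
    by (rule Bochner_Integration.integral_diff[symmetric]) (rule integrable_chain_mult[OF g g l] integrable_chain_mult[OF h h l])+
  also have "\<dots> = (\<integral>\<omega>. e (chain \<omega> 0) * g (chain \<omega> k) + h (chain \<omega> 0) * e (chain \<omega> k) \<partial>(\<pi> \<Otimes>\<^sub>M noise d))"
    by (intro Bochner_Integration.integral_cong) (auto simp: e_def algebra_simps)
  also have "\<dots> = (\<integral>\<omega>. e (chain \<omega> 0) * g (chain \<omega> k) \<partial>(\<pi> \<Otimes>\<^sub>M noise d))
      + (\<integral>\<omega>. h (chain \<omega> 0) * e (chain \<omega> k) \<partial>(\<pi> \<Otimes>\<^sub>M noise d))"
    by (rule Bochner_Integration.integral_add) (rule integrable_chain_mult[OF e g2 l2] integrable_chain_mult[OF h2 e l2])+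
  finally show ?thesis
    using integral_cross_le[OF e g2 l2 mean(1), of k] integral_cross_le[OF h2 e l2 me, of k]
    unfolding e_def by (simp add: algebra_simps)
qed

end

section \<open>Lag-window quadratic forms\<close>

definition lags :: "nat \<Rightarrow> int set" where "lags b = {l. \<bar>l\<bar> < int b}"

lemma lags_finite [simp]: "finite (lags b)" and card_lags: "card (lags b) \<le> 2 * b"
proof -
  have *: "lags b = {- int b <..< int b}" by (auto simp: lags_def)
  show "finite (lags b)" unfolding * by simp
  show "card (lags b) \<le> 2 * b" unfolding * by simp
qed

lemma lag_window_le: "lag_window w \<Longrightarrow> \<bar>w y\<bar> \<le> 1"
proof -
  assume w: "lag_window w"
  have nonneg: "\<bar>w y\<bar> \<le> 1" if "0 \<le> y" for y
    using w that by (cases "y \<le> 1") (auto simp: lag_window_def)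
  have "w (- y) = w y" using w unfolding lag_window_def by blast
  then show "\<bar>w y\<bar> \<le> 1" using nonneg[of y] nonneg[of "- y"] by (cases "0 \<le> y") simp_all
qed

definition lag_product :: "nat \<Rightarrow> nat \<Rightarrow> (nat \<Rightarrow> real) \<Rightarrow> (nat \<Rightarrow> real) \<Rightarrow> real" where
  "lag_product n m x y = (\<Sum>k<n - m. x k * y (k + m))"

definition lag_form :: "(real \<Rightarrow> real) \<Rightarrow> nat \<Rightarrow> nat \<Rightarrow> (nat \<Rightarrow> real) \<Rightarrow> (nat \<Rightarrow> real) \<Rightarrow> real" where
  "lag_form w b n x y = (\<Sum>l\<in>lags b. w (of_int l / real b) * lag_product n (nat \<bar>l\<bar>) x y)"

lemma lag_product_le: "\<bar>lag_product n m x y\<bar> \<le> L2_set x {..<n} * L2_set y {..<n}"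
proof -
  have x: "L2_set x {..<n - m} \<le> L2_set x {..<n}"
    unfolding L2_set_def by (intro real_sqrt_le_mono sum_mono2) auto
  have "(\<Sum>k<n - m. (y (k + m))\<^sup>2) = (\<Sum>k\<in>(\<lambda>k. k + m) ` {..<n - m}. (y k)\<^sup>2)"
    by (subst sum.reindex) (auto simp: inj_on_def)
  also have "\<dots> \<le> (\<Sum>k<n. (y k)\<^sup>2)" by (intro sum_mono2) auto
  finally have y: "L2_set (\<lambda>k. y (k + m)) {..<n - m} \<le> L2_set y {..<n}"
    unfolding L2_set_def by (rule real_sqrt_le_mono)
  have "\<bar>lag_product n m x y\<bar> \<le> (\<Sum>k<n - m. \<bar>x k\<bar> * \<bar>y (k + m)\<bar>)"
    unfolding lag_product_def abs_mult[symmetric] by (rule sum_abs)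
  also have "\<dots> \<le> L2_set x {..<n - m} * L2_set (\<lambda>k. y (k + m)) {..<n - m}" by (rule L2_set_mult_ineq)
  also have "\<dots> \<le> L2_set x {..<n} * L2_set y {..<n}" using x y by (intro mult_mono) auto
  finally show ?thesis .
qed

text \<open>Absolute values are taken lag by lag, as the window need not be positive definite. The
  resulting 2 b is the weight added in \<open>sv_norm\<close>.\<close>

lemma lag_form_le:
  assumes w: "lag_window w"
  shows "\<bar>lag_form w b n x y\<bar> \<le> 2 * real b * (L2_set x {..<n} * L2_set y {..<n})"
proof -
  have "\<bar>lag_form w b n x y\<bar> \<le> (\<Sum>l\<in>lags b. \<bar>w (of_int l / real b) * lag_product n (nat \<bar>l\<bar>) x y\<bar>)"
    unfolding lag_form_def by (rule sum_abs)
  also have "\<dots> \<le> (\<Sum>l\<in>lags b. 1 * (L2_set x {..<n} * L2_set y {..<n}))"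
    unfolding abs_mult by (intro sum_mono mult_mono lag_window_le[OF w] lag_product_le) auto
  also have "\<dots> = real (card (lags b)) * (L2_set x {..<n} * L2_set y {..<n})" by simp
  also have "\<dots> \<le> 2 * real b * (L2_set x {..<n} * L2_set y {..<n})"
    using card_lags[of b] by (intro mult_right_mono) (auto simp flip: of_nat_mult)
  finally show ?thesis .
qed

lemma lag_product_add_mult:
  "lag_product n m (\<lambda>k. x k + t * y k) z = lag_product n m x z + t * lag_product n m y z"
  "lag_product n m z (\<lambda>k. x k + t * y k) = lag_product n m z x + t * lag_product n m z y"
  unfolding lag_product_def sum_distrib_left sum.distrib[symmetric]
  by (auto intro!: sum.cong simp: algebra_simps)

lemma lag_form_add_mult:
  "lag_form w b n (\<lambda>k. x k + t * y k) z = lag_form w b n x z + t * lag_form w b n y z"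
  "lag_form w b n z (\<lambda>k. x k + t * y k) = lag_form w b n z x + t * lag_form w b n z y"
  unfolding lag_form_def lag_product_add_mult sum_distrib_left sum.distrib[symmetric]
  by (auto intro!: sum.cong simp: algebra_simps)

lemma quadratic_nonneg_discriminant:
  fixes a c s :: real
  assumes nn: "\<And>t. 0 \<le> a + 2 * t * s + t\<^sup>2 * c" and c: "0 \<le> c"
  shows "s\<^sup>2 \<le> a * c"
proof (cases "c = 0")
  case True
  have "s = 0"
  proof (rule ccontr)
    assume "s \<noteq> 0"
    then have "2 * (- (a + 1) / (2 * s)) * s = - (a + 1)" by simp
    with nn[of "- (a + 1) / (2 * s)"] True show False by simp
  qed
  then show ?thesis using True by simp
next
  case False
  then have "0 < c" using c by simp
  have "0 \<le> c * (a + 2 * (- s / c) * s + (- s / c)\<^sup>2 * c)" using nn[of "- s / c"] c by simp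
  also have "\<dots> = a * c - s\<^sup>2" using False by (simp add: power2_eq_square field_simps)
  finally show ?thesis by simp
qed

text \<open>The discriminant of q (x + t y) in t gives Cauchy-Schwarz for the polar form
  \<open>s\<close>, hence the triangle inequality for sqrt q. Its reverse form and the norm bound on
  q give the Lipschitz constant.\<close>

lemma quadratic_seminorm_lipschitz:
  fixes q :: "(nat \<Rightarrow> real) \<Rightarrow> real" and s
  assumes q: "\<And>x y t. q (\<lambda>k. x k + t * y k) = q x + 2 * t * s x y + t\<^sup>2 * q y"
    and nn: "\<And>x. 0 \<le> q x" and le: "\<And>x. q x \<le> K * (L2_set x {..<n})\<^sup>2" and K: "0 \<le> K"
  shows "\<bar>sqrt (q x) - sqrt (q y)\<bar> \<le> sqrt K * L2_set (\<lambda>k. x k - y k) {..<n}"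
proof -
  have tri: "sqrt (q (\<lambda>k. x k + 1 * y k)) \<le> sqrt (q x) + sqrt (q y)" for x y
  proof -
    have "0 \<le> q x + 2 * t * s x y + t\<^sup>2 * q y" for t
      using nn[of "\<lambda>k. x k + t * y k"] unfolding q .
    then have "(s x y)\<^sup>2 \<le> q x * q y" by (rule quadratic_nonneg_discriminant) (rule nn)
    then have "s x y \<le> sqrt (q x * q y)" by (rule real_le_rsqrt)
    then have "q (\<lambda>k. x k + 1 * y k) \<le> (sqrt (q x) + sqrt (q y))\<^sup>2"
      unfolding q using nn by (simp add: power2_sum real_sqrt_mult)
    then show ?thesis using nn by (intro real_le_lsqrt) auto
  qed
  have one: "sqrt (q x) - sqrt (q y) \<le> sqrt K * L2_set (\<lambda>k. x k - y k) {..<n}" for x y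
  proof -
    have "sqrt (q (\<lambda>k. x k - y k)) \<le> sqrt (K * (L2_set (\<lambda>k. x k - y k) {..<n})\<^sup>2)"
      by (intro real_sqrt_le_mono le)
    then have "sqrt (q (\<lambda>k. x k - y k)) \<le> sqrt K * L2_set (\<lambda>k. x k - y k) {..<n}"
      by (simp add: real_sqrt_mult)
    then show ?thesis using tri[of y "\<lambda>k. x k - y k"] by simp
  qed
  have "L2_set (\<lambda>k. y k - x k) {..<n} = L2_set (\<lambda>k. x k - y k) {..<n}"
    unfolding L2_set_def by (simp add: power2_commute)
  then show ?thesis using one[of x y] one[of y x] by (simp add: abs_le_iff)
qed

section \<open>Centering and the two seminorms\<close>

definition centered :: "nat \<Rightarrow> (nat \<Rightarrow> real) \<Rightarrow> nat \<Rightarrow> real" where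
  "centered n x k = x k - (\<Sum>j<n. x j) / real n"

lemma centered_le: "(L2_set (centered n x) {..<n})\<^sup>2 \<le> (\<Sum>k<n. (x k - c)\<^sup>2)"
proof (cases "n = 0")
  case False
  define m where "m = (\<Sum>j<n. x j) / real n"
  have S: "(\<Sum>j<n. x j) = n * m" using False by (simp add: m_def)
  have "(\<Sum>k<n. (x k - c)\<^sup>2) = (\<Sum>k<n. (x k - m)\<^sup>2 + 2 * (m - c) * (x k - m) + (m - c)\<^sup>2)"
    by (intro sum.cong) (auto simp: power2_eq_square algebra_simps)
  also have "\<dots> = (\<Sum>k<n. (x k - m)\<^sup>2) + 2 * (m - c) * (\<Sum>k<n. x k - m) + n * (m - c)\<^sup>2"
    by (simp only: sum.distrib sum_distrib_left[symmetric] sum_constant card_lessThan)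
  also have "(\<Sum>k<n. x k - m) = 0" by (simp add: sum_subtractf S)
  finally show ?thesis by (simp add: L2_set_power2 centered_def m_def)
qed simp

lemma centered_add_mult: "centered n (\<lambda>k. x k + t * y k) = (\<lambda>k. centered n x k + t * centered n y k)"
  by (simp add: centered_def fun_eq_iff sum.distrib sum_distrib_left[symmetric] add_divide_distrib algebra_simps)

text \<open>The lag form may be negative; by \<open>lag_form_le\<close> the summand with 2 b makes
  the radicand nonnegative. \<open>sd_norm\<close> is the root of that summand, so the lag form of a
  centered path is a difference of two squares.\<close>

definition sv_norm :: "(real \<Rightarrow> real) \<Rightarrow> nat \<Rightarrow> nat \<Rightarrow> (nat \<Rightarrow> real) \<Rightarrow> real" where
  "sv_norm w b n x = sqrt (lag_form w b n (centered n x) (centered n x) + 2 * real b * (L2_set (centered n x) {..<n})\<^sup>2)"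

definition sd_norm :: "nat \<Rightarrow> nat \<Rightarrow> (nat \<Rightarrow> real) \<Rightarrow> real" where
  "sd_norm b n x = sqrt (2 * real b * (L2_set (centered n x) {..<n})\<^sup>2)"

context
  fixes w :: "real \<Rightarrow> real" and b :: nat assumes w: "lag_window w"
begin

lemma lag_form_plus_nonneg: "0 \<le> lag_form w b n x x + 2 * real b * (L2_set x {..<n})\<^sup>2"
  using lag_form_le[OF w, of b n x x] by (simp add: power2_eq_square abs_le_iff)

lemma sv_norm_power2:
  "(sv_norm w b n x)\<^sup>2 = lag_form w b n (centered n x) (centered n x) + 2 * real b * (L2_set (centered n x) {..<n})\<^sup>2"
  unfolding sv_norm_def using lag_form_plus_nonneg by simp

lemma sd_norm_power2: "(sd_norm b n x)\<^sup>2 = 2 * real b * (L2_set (centered n x) {..<n})\<^sup>2"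
  unfolding sd_norm_def by simp

lemma lag_form_centered_eq: "lag_form w b n (centered n x) (centered n x) = (sv_norm w b n x)\<^sup>2 - (sd_norm b n x)\<^sup>2"
  unfolding sv_norm_power2 sd_norm_power2 by simp

lemma norms_nonneg: "0 \<le> sv_norm w b n x" "0 \<le> sd_norm b n x"
  unfolding sv_norm_def sd_norm_def using lag_form_plus_nonneg by auto

lemma norms_power2_le:
  "(sv_norm w b n x)\<^sup>2 \<le> 4 * real b * (\<Sum>k<n. (x k - c)\<^sup>2)" "(sd_norm b n x)\<^sup>2 \<le> 4 * real b * (\<Sum>k<n. (x k - c)\<^sup>2)"
proof -
  let ?y = "centered n x"
  have S: "4 * real b * (L2_set ?y {..<n})\<^sup>2 \<le> 4 * real b * (\<Sum>k<n. (x k - c)\<^sup>2)"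
    by (intro mult_left_mono centered_le) auto
  have "lag_form w b n ?y ?y \<le> 2 * real b * (L2_set ?y {..<n})\<^sup>2"
    using lag_form_le[OF w, of b n ?y ?y] by (simp add: power2_eq_square)
  then show "(sv_norm w b n x)\<^sup>2 \<le> 4 * real b * (\<Sum>k<n. (x k - c)\<^sup>2)" using S unfolding sv_norm_power2 by linarith
  have "0 \<le> 2 * real b * (L2_set ?y {..<n})\<^sup>2" by simp
  then show "(sd_norm b n x)\<^sup>2 \<le> 4 * real b * (\<Sum>k<n. (x k - c)\<^sup>2)" using S unfolding sd_norm_power2 by linarith
qed

lemma sv_norm_lipschitz: "\<bar>sv_norm w b n x - sv_norm w b n y\<bar> \<le> sqrt (4 * real b) * L2_set (\<lambda>k. x k - y k) {..<n}"
proof -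
  define q where "q x = (sv_norm w b n x)\<^sup>2" for x
  define s where "s x y = (lag_form w b n (centered n x) (centered n y) + lag_form w b n (centered n y) (centered n x)) / 2
    + 2 * real b * (\<Sum>k<n. centered n x k * centered n y k)" for x y
  have "\<bar>sqrt (q x) - sqrt (q y)\<bar> \<le> sqrt (4 * real b) * L2_set (\<lambda>k. x k - y k) {..<n}"
  proof (rule quadratic_seminorm_lipschitz)
    fix x y t
    have "(L2_set (\<lambda>k. centered n x k + t * centered n y k) {..<n})\<^sup>2 = (L2_set (centered n x) {..<n})\<^sup>2
      + 2 * t * (\<Sum>k<n. centered n x k * centered n y k) + t\<^sup>2 * (L2_set (centered n y) {..<n})\<^sup>2"
      unfolding L2_set_power2 sum_distrib_left sum.distrib[symmetric]
      by (intro sum.cong) (auto simp: power2_eq_square algebra_simps)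
    then show "q (\<lambda>k. x k + t * y k) = q x + 2 * t * s x y + t\<^sup>2 * q y"
      unfolding q_def sv_norm_power2 centered_add_mult lag_form_add_mult s_def
      by (simp add: power2_eq_square algebra_simps)
  next
    fix x
    show "q x \<le> 4 * real b * (L2_set x {..<n})\<^sup>2"
      unfolding q_def L2_set_power2 using norms_power2_le(1)[of n x 0] by simp
  qed (auto simp: q_def)
  then show ?thesis using norms_nonneg by (simp add: q_def)
qed

lemma sd_norm_lipschitz: "\<bar>sd_norm b n x - sd_norm b n y\<bar> \<le> sqrt (4 * real b) * L2_set (\<lambda>k. x k - y k) {..<n}"
proof -
  define q where "q x = (sd_norm b n x)\<^sup>2" for x
  define s where "s x y = 2 * real b * (\<Sum>k<n. centered n x k * centered n y k)" for x y
  have "\<bar>sqrt (q x) - sqrt (q y)\<bar> \<le> sqrt (4 * real b) * L2_set (\<lambda>k. x k - y k) {..<n}"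
  proof (rule quadratic_seminorm_lipschitz)
    fix x y t
    have "(L2_set (\<lambda>k. centered n x k + t * centered n y k) {..<n})\<^sup>2 = (L2_set (centered n x) {..<n})\<^sup>2
      + 2 * t * (\<Sum>k<n. centered n x k * centered n y k) + t\<^sup>2 * (L2_set (centered n y) {..<n})\<^sup>2"
      unfolding L2_set_power2 sum_distrib_left sum.distrib[symmetric]
      by (intro sum.cong) (auto simp: power2_eq_square algebra_simps)
    then show "q (\<lambda>k. x k + t * y k) = q x + 2 * t * s x y + t\<^sup>2 * q y"
      unfolding q_def sd_norm_power2 centered_add_mult s_def
      by (simp add: power2_eq_square algebra_simps)
  next
    fix x
    show "q x \<le> 4 * real b * (L2_set x {..<n})\<^sup>2"
      unfolding q_def L2_set_power2 using norms_power2_le(2)[of n x 0] by simp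
  qed (auto simp: q_def)
  then show ?thesis using norms_nonneg by (simp add: q_def)
qed

end

lemma spectral_variance_eq:
  "spectral_variance w b n X h = lag_form w b n (centered n (\<lambda>k. h (X k))) (centered n (\<lambda>k. h (X k))) / real n"
  unfolding spectral_variance_def emp_autocov_def emp_mean_def lag_form_def lag_product_def centered_def lags_def
  by (rule trans[OF sum.cong[OF refl] sum_divide_distrib[symmetric]]) simp

section \<open>Concentration for the initial state and the noise\<close>

text \<open>Everything is read off the moment generating function: the tails by Chernoff's method,
  the variance from y^2 + 2 \<le> exp y + exp (- y).\<close>

lemma (in prob_space) subgaussian_bounds:
  assumes [measurable]: "F \<in> borel_measurable M" and v: "0 < v"
    and int: "\<And>t. integrable M (\<lambda>x. exp (t * F x))"
    and mgf: "\<And>t. (\<integral>x. exp (t * F x) \<partial>M) \<le> exp (t * expectation F + t\<^sup>2 * v)"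
  shows "integrable M F" "integrable M (\<lambda>x. (F x)\<^sup>2)" "variance F \<le> 4 * v"
    "1 < p \<Longrightarrow> prob {x\<in>space M. 2 * sqrt (v * ln p) < \<bar>F x - expectation F\<bar>} \<le> 2 / p"
proof -
  have 1: "integrable M (\<lambda>x. 1 + 6 * (exp (1 * F x) + exp ((- 1) * F x)))"
    by (intro Bochner_Integration.integrable_add integrable_mult_right int) auto
  have 2: "\<bar>F x\<bar> ^ j \<le> 1 + 6 * (exp (1 * F x) + exp ((- 1) * F x))" if "j \<le> 3" for x j
    using abs_power_le_one_plus[OF that, of "F x"] abs_power3_le_exp[of "F x"] by simp
  have ij: "integrable M (\<lambda>x. F x ^ j)" if "j \<le> 3" for j
    by (rule Bochner_Integration.integrable_bound[OF 1])
       (use 2[OF that] in \<open>auto simp: power_abs intro: order_trans[OF _ abs_ge_self]\<close>)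
  show i1: "integrable M F" and i2: "integrable M (\<lambda>x. (F x)\<^sup>2)"
    using ij[of 1] ij[of 2] by auto
  define m where "m = expectation F"
  have int': "integrable M (\<lambda>x. exp (t * (F x - m)))" for t
    using integrable_mult_right[OF int[of t], of "exp (- (t * m))"]
    by (simp add: exp_add[symmetric] algebra_simps)
  have mgf': "(\<integral>x. exp (t * (F x - m)) \<partial>M) \<le> exp (t\<^sup>2 * v)" for t
  proof -
    have "(\<integral>x. exp (t * (F x - m)) \<partial>M) = (\<integral>x. exp (- (t * m)) * exp (t * F x) \<partial>M)"
      by (intro Bochner_Integration.integral_cong) (auto simp: exp_add[symmetric] algebra_simps)
    also have "\<dots> = exp (- (t * m)) * (\<integral>x. exp (t * F x) \<partial>M)" using int by simp
    also have "\<dots> \<le> exp (- (t * m)) * exp (t * m + t\<^sup>2 * v)"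
      using mgf[of t] by (intro mult_left_mono) (auto simp: m_def)
    also have "\<dots> = exp (t\<^sup>2 * v)" by (simp add: exp_add[symmetric])
    finally show ?thesis .
  qed
  show "variance F \<le> 4 * v"
  proof -
    \<comment> \<open>With t^2 v = 1 the two exponential moments sum to at most 2 e \<le> 6, and 6 -
      2 is the factor 4.\<close>
    define t where "t = 1 / sqrt v"
    have t: "0 < t" "t\<^sup>2 = 1 / v" using v by (auto simp: t_def power_divide)
    have im: "integrable M (\<lambda>x. (F x - m)\<^sup>2)" using i1 i2 by (simp add: power2_diff)
    have "t\<^sup>2 * (\<integral>x. (F x - m)\<^sup>2 \<partial>M) + 2 = (\<integral>x. t\<^sup>2 * (F x - m)\<^sup>2 + 2 \<partial>M)"
      using im by (simp add: prob_space)
    also have "\<dots> \<le> (\<integral>x. exp (t * (F x - m)) + exp ((- t) * (F x - m)) \<partial>M)"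
    proof (rule integral_mono)
      fix x
      define y where "y = t * (F x - m)"
      have "1 + y + y\<^sup>2 / 2 + y ^ 3 / 6 \<le> exp y" by (rule exp_lower_Taylor_cubic)
      moreover have "1 - y + y\<^sup>2 / 2 - y ^ 3 / 6 \<le> exp (- y)"
        using exp_lower_Taylor_cubic[of "- y"] by simp
      ultimately have "y\<^sup>2 + 2 \<le> exp y + exp (- y)" by linarith
      then show "t\<^sup>2 * (F x - m)\<^sup>2 + 2 \<le> exp (t * (F x - m)) + exp ((- t) * (F x - m))"
        by (simp add: y_def power_mult_distrib)
    next
      show "integrable M (\<lambda>x. exp (t * (F x - m)) + exp ((- t) * (F x - m)))"
        by (rule Bochner_Integration.integrable_add[OF int'[of t] int'[of "- t"]])
    qed (use im in simp)
    also have "\<dots> = (\<integral>x. exp (t * (F x - m)) \<partial>M) + (\<integral>x. exp ((- t) * (F x - m)) \<partial>M)"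
      by (rule Bochner_Integration.integral_add[OF int'[of t] int'[of "- t"]])
    also have "\<dots> \<le> exp (t\<^sup>2 * v) + exp (t\<^sup>2 * v)" using mgf'[of t] mgf'[of "- t"] by simp
    also have "t\<^sup>2 * v = 1" using t v by simp
    also have "exp (1::real) + exp 1 \<le> 6" using exp_le by simp
    finally have "(\<integral>x. (F x - m)\<^sup>2 \<partial>M) / v \<le> 4" using t by simp
    then show ?thesis using v by (simp add: m_def field_simps)
  qed
  show "prob {x\<in>space M. 2 * sqrt (v * ln p) < \<bar>F x - expectation F\<bar>} \<le> 2 / p" if p: "1 < p"
  proof -
    define s where "s = 2 * sqrt (v * ln p)"
    \<comment> \<open>Minimizer of t^2 v - t s. Each side of the tail is then at most exp (ln p - 2
      ln p) = 1 / p.\<close>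
    define t where "t = sqrt (ln p / v)"
    have lp: "0 < ln p" using p by simp
    have t: "0 < t" using lp v by (simp add: t_def)
    have ts: "t * s = 2 * ln p"
    proof -
      have "t * s = 2 * sqrt (ln p / v * (v * ln p))" unfolding t_def s_def real_sqrt_mult by simp
      also have "ln p / v * (v * ln p) = (ln p)\<^sup>2" using v by (simp add: power2_eq_square)
      finally show ?thesis using lp by simp
    qed
    have tv: "t\<^sup>2 * v = ln p" using lp v by (simp add: t_def)
    have tail: "prob {x\<in>space M. exp (t * s) \<le> exp (u * (F x - m))} \<le> 1 / p" if u: "u\<^sup>2 = t\<^sup>2" for u
    proof -
      have "prob {x\<in>space M. exp (t * s) \<le> exp (u * (F x - m))} \<le> (\<integral>x. exp (u * (F x - m)) \<partial>M) / exp (t * s)"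
        by (rule integral_Markov_inequality_measure[OF int', where A = "{}"]) auto
      also have "\<dots> \<le> exp (ln p) / exp (2 * ln p)"
        using mgf'[of u] unfolding ts u tv by (intro divide_right_mono) auto
      also have "\<dots> = 1 / p" using p by (simp add: exp_double power2_eq_square)
      finally show ?thesis .
    qed
    have "prob {x\<in>space M. s < \<bar>F x - m\<bar>}
      \<le> prob ({x\<in>space M. exp (t * s) \<le> exp (t * (F x - m))} \<union> {x\<in>space M. exp (t * s) \<le> exp ((- t) * (F x - m))})"
    proof (rule finite_measure_mono)
      show "{x\<in>space M. s < \<bar>F x - m\<bar>} \<subseteq>
        {x\<in>space M. exp (t * s) \<le> exp (t * (F x - m))} \<union> {x\<in>space M. exp (t * s) \<le> exp ((- t) * (F x - m))}"
      proof
        fix x assume x: "x \<in> {x\<in>space M. s < \<bar>F x - m\<bar>}"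
        then have "s \<le> F x - m \<or> s \<le> - (F x - m)" by auto
        then have "t * s \<le> t * (F x - m) \<or> t * s \<le> t * (- (F x - m))"
          using t mult_left_mono[of s _ t] by (metis less_imp_le)
        then show "x \<in> {x\<in>space M. exp (t * s) \<le> exp (t * (F x - m))} \<union> {x\<in>space M. exp (t * s) \<le> exp ((- t) * (F x - m))}"
          using x by (simp add: algebra_simps)
      qed
    qed measurable
    also have "\<dots> \<le> prob {x\<in>space M. exp (t * s) \<le> exp (t * (F x - m))} + prob {x\<in>space M. exp (t * s) \<le> exp ((- t) * (F x - m))}"
      by (rule measure_Un_le) measurable
    also have "\<dots> \<le> 1 / p + 1 / p" by (intro add_mono tail) auto
    finally show ?thesis by (simp add: s_def m_def)
  qed
qed

context T2_measure begin

interpretation N: prob_space "noise d" by simp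
interpretation xiN: pair_prob_space \<xi> "noise d" ..

text \<open>Gaussian concentration in the noise, then the Bobkov-Goetze bound for the conditional mean,
  which is Lipschitz in the initial state; T2 never has to be tensorized.\<close>

lemma lipschitz_product_mgf:
  assumes F: "F \<in> borel_measurable (\<xi> \<Otimes>\<^sub>M noise d)" and k: "0 < k1" "0 \<le> k2"
    and l1: "\<And>x y z. x \<in> space (Rd d) \<Longrightarrow> y \<in> space (Rd d) \<Longrightarrow> z \<in> space (noise d) \<Longrightarrow>
      \<bar>F (x, z) - F (y, z)\<bar> \<le> k1 * eucl_dist d x y"
    and l2: "\<And>x z z'. x \<in> space (Rd d) \<Longrightarrow> z \<in> space (noise d) \<Longrightarrow> z' \<in> space (noise d) \<Longrightarrow>
      \<bar>F (x, z) - F (x, z')\<bar> \<le> k2 * noise_dist d n z z'"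
  shows "integrable (\<xi> \<Otimes>\<^sub>M noise d) (\<lambda>\<omega>. exp (t * F \<omega>))"
    "(\<integral>\<omega>. exp (t * F \<omega>) \<partial>(\<xi> \<Otimes>\<^sub>M noise d)) \<le> exp (t * (\<integral>\<omega>. F \<omega> \<partial>(\<xi> \<Otimes>\<^sub>M noise d)) + t\<^sup>2 * (\<beta> * k1\<^sup>2 / 2 + k2\<^sup>2))"
proof -
  interpret T: tau_space "noise d" "noise_dist d n" by (rule tau_space_noise)
  note [measurable] = F
  have Fx: "(\<lambda>z. F (x, z)) \<in> borel_measurable (noise d)" if "x \<in> space (Rd d)" for x
    using measurable_compose[OF measurable_Pair1'[of x \<xi> "noise d"] F] that by simp
  note iz = T.lipschitz_integrable[OF Fx l2]
  define G where "G x = (\<integral>z. F (x, z) \<partial>noise d)" for x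
  have G: "G \<in> Lip (space (Rd d)) (eucl_dist d) k1"
    unfolding Lip_def
  proof (intro CollectI ballI)
    fix x y assume x: "x \<in> space (Rd d)" and y: "y \<in> space (Rd d)"
    have "\<bar>G x - G y\<bar> = \<bar>\<integral>z. F (x, z) - F (y, z) \<partial>noise d\<bar>"
      unfolding G_def using iz(1)[OF x] iz(1)[OF y] x y by simp
    also have "\<dots> \<le> (\<integral>z. \<bar>F (x, z) - F (y, z)\<bar> \<partial>noise d)" by (rule integral_abs_bound)
    also have "\<dots> \<le> (\<integral>z. k1 * eucl_dist d x y \<partial>noise d)"
      using iz(1)[OF x] iz(1)[OF y] x y by (intro integral_mono l1) auto
    finally show "\<bar>G x - G y\<bar> \<le> k1 * eucl_dist d x y" by (simp add: N.prob_space)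
  qed
  note [measurable] = Lip_measurable[OF G]
  \<comment> \<open>The bound is first stated with the mean of the conditional mean
    \<open>G\<close>, since integrability of \<open>F\<close> follows only afterwards, from t = 1
    and t = -1. The case t = 0 is apart because \<open>exp_lipschitz_le\<close> asks for a positive
    Lipschitz constant.\<close>
  have E: "integrable (\<xi> \<Otimes>\<^sub>M noise d) (\<lambda>\<omega>. exp (t * F \<omega>)) \<and>
      (\<integral>\<omega>. exp (t * F \<omega>) \<partial>(\<xi> \<Otimes>\<^sub>M noise d)) \<le> exp (t * (\<integral>x. G x \<partial>\<xi>) + t\<^sup>2 * (\<beta> * k1\<^sup>2 / 2 + k2\<^sup>2))"
    if t: "t \<noteq> 0" for t
  proof -
    have tG: "(\<lambda>x. t * G x) \<in> Lip (space (Rd d)) (eucl_dist d) (\<bar>t\<bar> * k1)"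
      unfolding Lip_def
    proof (intro CollectI ballI)
      fix x y assume xy: "x \<in> space (Rd d)" "y \<in> space (Rd d)"
      have "\<bar>t * G x - t * G y\<bar> = \<bar>t\<bar> * \<bar>G x - G y\<bar>" by (simp add: abs_mult right_diff_distrib[symmetric])
      also have "\<dots> \<le> \<bar>t\<bar> * (k1 * eucl_dist d x y)" by (intro mult_left_mono LipD[OF G] xy) auto
      finally show "\<bar>t * G x - t * G y\<bar> \<le> \<bar>t\<bar> * k1 * eucl_dist d x y" by simp
    qed
    have tk: "0 < \<bar>t\<bar> * k1" using t k by simp
    note ex = exp_lipschitz_le[OF tG tk]
    have "(\<integral>\<^sup>+\<omega>. ennreal (exp (t * F \<omega>)) \<partial>(\<xi> \<Otimes>\<^sub>M noise d)) = (\<integral>\<^sup>+x. (\<integral>\<^sup>+z. ennreal (exp (t * F (x, z))) \<partial>noise d) \<partial>\<xi>)"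
      by (subst N.nn_integral_fst[symmetric]) auto
    also have "\<dots> \<le> (\<integral>\<^sup>+x. ennreal (exp (t\<^sup>2 * k2\<^sup>2) * exp (t * G x)) \<partial>\<xi>)"
    proof (rule nn_integral_mono)
      fix x assume "x \<in> space \<xi>"
      then have x: "x \<in> space (Rd d)" by simp
      have "(\<integral>\<^sup>+z. ennreal (exp (t * F (x, z))) \<partial>noise d) = ennreal (\<integral>z. exp (t * F (x, z)) \<partial>noise d)"
        using T.lipschitz_exp_integrable[OF Fx[OF x] l2[OF x]] by (intro nn_integral_eq_integral) auto
      also have "\<dots> \<le> ennreal (exp (t * G x + t\<^sup>2 * k2\<^sup>2))"
        unfolding G_def by (intro ennreal_leI T.lipschitz_mgf[OF Fx[OF x] l2[OF x]])
      finally show "(\<integral>\<^sup>+z. ennreal (exp (t * F (x, z))) \<partial>noise d) \<le> ennreal (exp (t\<^sup>2 * k2\<^sup>2) * exp (t * G x))"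
        by (simp add: exp_add mult.commute)
    qed
    also have "\<dots> = ennreal (exp (t\<^sup>2 * k2\<^sup>2) * (\<integral>x. exp (t * G x) \<partial>\<xi>))"
      using ex(1) by (subst nn_integral_eq_integral) auto
    also have "\<dots> \<le> ennreal (exp (t\<^sup>2 * k2\<^sup>2) * exp ((\<integral>x. t * G x \<partial>\<xi>) + \<beta> * (\<bar>t\<bar> * k1)\<^sup>2 / 2))"
      by (intro ennreal_leI mult_left_mono ex(2)) auto
    also have "exp (t\<^sup>2 * k2\<^sup>2) * exp ((\<integral>x. t * G x \<partial>\<xi>) + \<beta> * (\<bar>t\<bar> * k1)\<^sup>2 / 2)
      = exp (t * (\<integral>x. G x \<partial>\<xi>) + t\<^sup>2 * (\<beta> * k1\<^sup>2 / 2 + k2\<^sup>2))"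
      unfolding exp_add[symmetric] by (simp add: power_mult_distrib algebra_simps)
    finally have le: "(\<integral>\<^sup>+\<omega>. ennreal (exp (t * F \<omega>)) \<partial>(\<xi> \<Otimes>\<^sub>M noise d))
      \<le> ennreal (exp (t * (\<integral>x. G x \<partial>\<xi>) + t\<^sup>2 * (\<beta> * k1\<^sup>2 / 2 + k2\<^sup>2)))" .
    have i: "integrable (\<xi> \<Otimes>\<^sub>M noise d) (\<lambda>\<omega>. exp (t * F \<omega>))"
      using le by (intro integrableI_nonneg) (auto intro: le_less_trans)
    show ?thesis
      using le i unfolding nn_integral_eq_integral[OF i AE_I2[OF exp_ge_zero]] by simp
  qed
  have iF: "integrable (\<xi> \<Otimes>\<^sub>M noise d) F"
  proof (rule Bochner_Integration.integrable_bound)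
    show "integrable (\<xi> \<Otimes>\<^sub>M noise d) (\<lambda>\<omega>. exp (1 * F \<omega>) + exp ((- 1) * F \<omega>))"
      using E[of 1] E[of "- 1"] by auto
    have "\<bar>y\<bar> \<le> exp y + exp (- y)" for y :: real
      using exp_ge_add_one_self[of y] exp_ge_add_one_self[of "- y"] exp_ge_zero[of y] exp_ge_zero[of "- y"] by linarith
    then show "AE \<omega> in \<xi> \<Otimes>\<^sub>M noise d. norm (F \<omega>) \<le> norm (exp (1 * F \<omega>) + exp ((- 1) * F \<omega>))" by simp
  qed measurable
  have EG: "(\<integral>x. G x \<partial>\<xi>) = (\<integral>\<omega>. F \<omega> \<partial>(\<xi> \<Otimes>\<^sub>M noise d))"
    unfolding G_def using xiN.integral_fst'[OF iF] by simp
  show "integrable (\<xi> \<Otimes>\<^sub>M noise d) (\<lambda>\<omega>. exp (t * F \<omega>))"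
    "(\<integral>\<omega>. exp (t * F \<omega>) \<partial>(\<xi> \<Otimes>\<^sub>M noise d)) \<le> exp (t * (\<integral>\<omega>. F \<omega> \<partial>(\<xi> \<Otimes>\<^sub>M noise d)) + t\<^sup>2 * (\<beta> * k1\<^sup>2 / 2 + k2\<^sup>2))"
    using E[of t] unfolding EG by (cases "t = 0"; simp add: xiN.P.prob_space)+
qed

end

section \<open>Bias in the stationary regime\<close>

lemma sum_power_inj_le:
  fixes r :: real
  assumes r: "0 \<le> r" "r < 1" and A: "finite A" and f: "inj_on f A"
  shows "(\<Sum>k\<in>A. r ^ f k) \<le> 1 / (1 - r)"
proof -
  have "(\<Sum>k\<in>A. r ^ f k) = (\<Sum>i\<in>f ` A. r ^ i)" by (simp add: sum.reindex[OF f])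
  also have "\<dots> \<le> (\<Sum>i. r ^ i)"
    using r A by (intro sum_le_suminf) auto
  also have "\<dots> = 1 / (1 - r)" using r by (intro suminf_geometric) auto
  finally show ?thesis .
qed

lemma sums_geometric_tail:
  fixes r :: real
  assumes r: "0 \<le> r" "r < 1"
  shows "(\<lambda>l. if m \<le> l then r ^ l else 0) sums (r ^ m / (1 - r))"
proof -
  have "(\<lambda>l. r ^ l - (if l \<in> {..<m} then r ^ l else 0)) sums (1 / (1 - r) - (\<Sum>l<m. r ^ l))"
    using r by (intro sums_diff geometric_sums sums_If_finite_set) auto
  moreover have "1 / (1 - r) - (\<Sum>l<m. r ^ l) = r ^ m / (1 - r)"
  proof -
    have "(1 - r) * (\<Sum>l<m. r ^ l) = 1 - r ^ m" using one_diff_power_eq[of r m] by simp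
    then have "(\<Sum>l<m. r ^ l) = (1 - r ^ m) / (1 - r)" using r by (simp add: field_simps)
    then show ?thesis by (simp add: diff_divide_distrib)
  qed
  moreover have "r ^ l - (if l \<in> {..<m} then r ^ l else 0) = (if m \<le> l then r ^ l else 0)" for l by auto
  ultimately show ?thesis by (simp only:)
qed

lemma sum_lags: "0 < b \<Longrightarrow> (\<Sum>l\<in>lags b. F (nat \<bar>l\<bar>)) = 2 * (\<Sum>l<b. F l) - (F 0 :: real)"
proof (induction b)
  case (Suc b)
  show ?case
  proof (cases "b = 0")
    case True
    have "lags 1 = {0}" by (auto simp: lags_def)
    then show ?thesis using True by simp
  next
    case False
    have "lags (Suc b) = insert (int b) (insert (- int b) (lags b))" by (auto simp: lags_def)
    moreover have "int b \<notin> insert (- int b) (lags b)" "- int b \<notin> lags b" using False by (auto simp: lags_def)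
    ultimately have "(\<Sum>l\<in>lags (Suc b). F (nat \<bar>l\<bar>)) = F b + (F b + (\<Sum>l\<in>lags b. F (nat \<bar>l\<bar>)))" by simp
    then show ?thesis using False Suc.IH by simp
  qed
qed simp

text \<open>The integers split into the range of \<open>int\<close> and the numbers - Suc n, so 0 is
  counted once; absolute summability makes \<open>infsum\<close> agree with the ordinary series on
  each part.\<close>

lemma infsum_int_abs:
  fixes g :: "nat \<Rightarrow> real"
  assumes g: "summable (\<lambda>l. \<bar>g l\<bar>)"
  shows "(\<Sum>\<^sub>\<infinity>l\<in>(UNIV :: int set). g (nat \<bar>l\<bar>)) = 2 * (\<Sum>l. g l) - g 0"
proof -
  have sg: "summable g" by (rule summable_rabs_cancel[OF g])
  have "(g has_sum (\<Sum>l. g l)) UNIV"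
    using g by (intro norm_summable_imp_has_sum summable_sums sg) simp
  then have "((\<lambda>l. g (nat \<bar>l\<bar>)) \<circ> int has_sum (\<Sum>l. g l)) UNIV" by (simp add: o_def)
  then have 1: "((\<lambda>l. g (nat \<bar>l\<bar>)) has_sum (\<Sum>l. g l)) (range int)"
    by (subst has_sum_reindex) (auto simp: inj_on_def)
  have "(\<lambda>l. g (Suc l)) sums ((\<Sum>l. g l) - g 0)" using sg by (simp add: sums_Suc_iff summable_sums)
  moreover have "summable (\<lambda>l. norm (g (Suc l)))" 
    using summable_Suc_iff[of "\<lambda>l. \<bar>g l\<bar>"] g by simp
  ultimately have "((\<lambda>l. g (Suc l)) has_sum ((\<Sum>l. g l) - g 0)) UNIV"
    by (intro norm_summable_imp_has_sum)
  then have "((\<lambda>l. g (nat \<bar>l\<bar>)) \<circ> (\<lambda>n. - int (Suc n)) has_sum ((\<Sum>l. g l) - g 0)) UNIV"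
    by (simp add: o_def nat_add_distrib)
  then have 2: "((\<lambda>l. g (nat \<bar>l\<bar>)) has_sum ((\<Sum>l. g l) - g 0)) (range (\<lambda>n. - int (Suc n)))"
    by (subst has_sum_reindex) (auto simp: inj_on_def)
  have "range int \<inter> range (\<lambda>n. - int (Suc n)) = {}" by auto
  from has_sum_Un_disjoint[OF 1 2 this]
  have "((\<lambda>l. g (nat \<bar>l\<bar>)) has_sum ((\<Sum>l. g l) + ((\<Sum>l. g l) - g 0))) (range int \<union> range (\<lambda>n. - int (Suc n)))" .
  also have "range int \<union> range (\<lambda>n. - int (Suc n)) = UNIV"
  proof (intro equalityI subsetI UNIV_I)
    fix l :: int
    show "l \<in> range int \<union> range (\<lambda>n. - int (Suc n))"
      by (cases l) auto
  qed
  finally show ?thesis by (simp add: infsumI)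
qed

context stationary_ula begin

abbreviation path :: "ula_outcome measure" where "path \<equiv> \<pi> \<Otimes>\<^sub>M noise d"

context
  fixes h l
  assumes h: "h \<in> lipschitz l" and l: "0 \<le> l" and mean: "(\<integral>x. h x \<partial>\<pi>) = 0"
begin

definition second_moment :: real where "second_moment = (\<integral>x. (h x)\<^sup>2 \<partial>\<pi>)"

lemma second_moment_nonneg: "0 \<le> second_moment"
  unfolding second_moment_def by simp

lemma autocov_le': "\<bar>autocov h k\<bar> \<le> rate ^ k * second_moment"
  unfolding second_moment_def by (rule autocov_le[OF h l mean])

lemma integrable_mult: "integrable path (\<lambda>\<omega>. h (chain \<omega> j) * h (chain \<omega> k))"
  by (rule integrable_chain_mult[OF h h l])

lemma integral_mult: "(\<integral>\<omega>. h (chain \<omega> j) * h (chain \<omega> (j + k)) \<partial>path) = autocov h k"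
  by (rule integral_chain_mult[OF h l])

lemma integral_square: "(\<integral>\<omega>. (h (chain \<omega> j))\<^sup>2 \<partial>path) = second_moment"
proof -
  have "(\<integral>\<omega>. (h (chain \<omega> j))\<^sup>2 \<partial>path) = autocov h 0" using integral_mult[of j 0] by (simp add: power2_eq_square)
  also have "\<dots> = (\<integral>\<omega>. (h (fst \<omega>))\<^sup>2 \<partial>path)" by (simp add: autocov_def power2_eq_square)
  also have "\<dots> = second_moment"
    unfolding second_moment_def
    by (rule integrable_pair_comp(3)[OF pi.prob_space_axioms noise.prob_space_axioms pi_lipschitz_integrable(1)[OF h]])
  finally show ?thesis .
qed

text \<open>The set of times is general because the centering terms sum over both initial and final
  stretches of the path. Each row of the covariance matrix is bounded by two geometric
  series.\<close>

lemma partial_sum_second_moment: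
  assumes A: "finite A"
  shows "integrable path (\<lambda>\<omega>. (\<Sum>k\<in>A. h (chain \<omega> k))\<^sup>2)"
    "(\<integral>\<omega>. (\<Sum>k\<in>A. h (chain \<omega> k))\<^sup>2 \<partial>path) \<le> real (card A) * (2 / (1 - rate) * second_moment)"
proof -
  have eq: "(\<Sum>k\<in>A. h (chain \<omega> k))\<^sup>2 = (\<Sum>j\<in>A. \<Sum>k\<in>A. h (chain \<omega> j) * h (chain \<omega> k))" for \<omega>
    by (simp only: power2_eq_square sum_product)
  show "integrable path (\<lambda>\<omega>. (\<Sum>k\<in>A. h (chain \<omega> k))\<^sup>2)"
    unfolding eq by (intro Bochner_Integration.integrable_sum integrable_mult)
  have jk: "(\<integral>\<omega>. h (chain \<omega> j) * h (chain \<omega> k) \<partial>path) \<le> (if k \<le> j then rate ^ (j - k) else rate ^ (k - j)) * second_moment" for j k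
  proof (cases "k \<le> j")
    case True
    then have "(\<integral>\<omega>. h (chain \<omega> k) * h (chain \<omega> j) \<partial>path) = autocov h (j - k)" using integral_mult[of k "j - k"] by simp
    then show ?thesis using True autocov_le'[of "j - k"] by (simp add: mult.commute abs_le_iff)
  next
    case False
    then have "(\<integral>\<omega>. h (chain \<omega> j) * h (chain \<omega> k) \<partial>path) = autocov h (k - j)" using integral_mult[of j "k - j"] by simp
    then show ?thesis using False autocov_le'[of "k - j"] by (simp add: abs_le_iff)
  qed
  have row: "(\<Sum>k\<in>A. if k \<le> j then rate ^ (j - k) else rate ^ (k - j)) \<le> 2 / (1 - rate)" for j
  proof -
    have "(\<Sum>k\<in>A. if k \<le> j then rate ^ (j - k) else rate ^ (k - j))
      = (\<Sum>k\<in>A \<inter> {k. k \<le> j}. rate ^ (j - k)) + (\<Sum>k\<in>A \<inter> - {k. k \<le> j}. rate ^ (k - j))"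
      using A by (rule sum.If_cases)
    also have "\<dots> \<le> 1 / (1 - rate) + 1 / (1 - rate)"
      using A rate_less by (intro add_mono sum_power_inj_le) (auto simp: inj_on_def)
    finally show ?thesis by simp
  qed
  have "(\<integral>\<omega>. (\<Sum>k\<in>A. h (chain \<omega> k))\<^sup>2 \<partial>path) = (\<Sum>j\<in>A. \<Sum>k\<in>A. \<integral>\<omega>. h (chain \<omega> j) * h (chain \<omega> k) \<partial>path)"
    unfolding eq
    by (subst Bochner_Integration.integral_sum, (intro Bochner_Integration.integrable_sum integrable_mult)[1])
       (intro sum.cong refl Bochner_Integration.integral_sum integrable_mult)
  also have "\<dots> \<le> (\<Sum>j\<in>A. (\<Sum>k\<in>A. if k \<le> j then rate ^ (j - k) else rate ^ (k - j)) * second_moment)"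
    unfolding sum_distrib_right by (intro sum_mono jk)
  also have "\<dots> \<le> (\<Sum>j\<in>A. 2 / (1 - rate) * second_moment)"
    by (intro sum_mono mult_right_mono row second_moment_nonneg)
  finally show "(\<integral>\<omega>. (\<Sum>k\<in>A. h (chain \<omega> k))\<^sup>2 \<partial>path) \<le> real (card A) * (2 / (1 - rate) * second_moment)" by simp
qed

lemma integral_lag_form:
  "integrable path (\<lambda>\<omega>. lag_form w b n (\<lambda>k. h (chain \<omega> k)) (\<lambda>k. h (chain \<omega> k)))"
  "(\<integral>\<omega>. lag_form w b n (\<lambda>k. h (chain \<omega> k)) (\<lambda>k. h (chain \<omega> k)) \<partial>path)
    = (\<Sum>l\<in>lags b. w (of_int l / real b) * (real (n - nat \<bar>l\<bar>) * autocov h (nat \<bar>l\<bar>)))"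
proof -
  have i: "integrable path (\<lambda>\<omega>. lag_product n m (\<lambda>k. h (chain \<omega> k)) (\<lambda>k. h (chain \<omega> k)))" for m
    unfolding lag_product_def by (intro Bochner_Integration.integrable_sum integrable_mult)
  have e: "(\<integral>\<omega>. lag_product n m (\<lambda>k. h (chain \<omega> k)) (\<lambda>k. h (chain \<omega> k)) \<partial>path) = real (n - m) * autocov h m" for m
  proof -
    have "(\<integral>\<omega>. lag_product n m (\<lambda>k. h (chain \<omega> k)) (\<lambda>k. h (chain \<omega> k)) \<partial>path)
      = (\<Sum>k<n - m. \<integral>\<omega>. h (chain \<omega> k) * h (chain \<omega> (k + m)) \<partial>path)"
      unfolding lag_product_def by (rule Bochner_Integration.integral_sum) (rule integrable_mult)
    also have "\<dots> = real (n - m) * autocov h m" unfolding integral_mult by simp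
    finally show ?thesis .
  qed
  show "integrable path (\<lambda>\<omega>. lag_form w b n (\<lambda>k. h (chain \<omega> k)) (\<lambda>k. h (chain \<omega> k)))"
    unfolding lag_form_def by (intro Bochner_Integration.integrable_sum integrable_mult_right i)
  have "(\<integral>\<omega>. lag_form w b n (\<lambda>k. h (chain \<omega> k)) (\<lambda>k. h (chain \<omega> k)) \<partial>path)
    = (\<Sum>l\<in>lags b. \<integral>\<omega>. w (of_int l / real b) * lag_product n (nat \<bar>l\<bar>) (\<lambda>k. h (chain \<omega> k)) (\<lambda>k. h (chain \<omega> k)) \<partial>path)"
    unfolding lag_form_def by (rule Bochner_Integration.integral_sum) (intro integrable_mult_right i)
  also have "\<dots> = (\<Sum>l\<in>lags b. w (of_int l / real b) * (real (n - nat \<bar>l\<bar>) * autocov h (nat \<bar>l\<bar>)))"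
    unfolding e[symmetric] by simp
  finally show "(\<integral>\<omega>. lag_form w b n (\<lambda>k. h (chain \<omega> k)) (\<lambda>k. h (chain \<omega> k)) \<partial>path)
    = (\<Sum>l\<in>lags b. w (of_int l / real b) * (real (n - nat \<bar>l\<bar>) * autocov h (nat \<bar>l\<bar>)))" .
qed

definition asymptotic_variance :: real where
  "asymptotic_variance = 2 * (\<Sum>k. autocov h k) - autocov h 0"

lemma summable_autocov: "summable (\<lambda>k. \<bar>autocov h k\<bar>)" "summable (autocov h)"
proof -
  have "summable (\<lambda>k. rate ^ k * second_moment)"
    using rate_less by (intro summable_mult2 summable_geometric) auto
  then show 1: "summable (\<lambda>k. \<bar>autocov h k\<bar>)"
    by (rule summable_comparison_test[rotated]) (use autocov_le' in auto)
  show "summable (autocov h)" by (rule summable_rabs_cancel[OF 1])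
qed

text \<open>With b = 2 m the window equals 1 below lag m, where the error is only the factor (n - k)
  / n. From lag m on, rate^m \<le> 1 / n makes the whole tail of order 1 / n.\<close>

lemma truncation_bias:
  assumes w: "lag_window w" and n: "0 < n" and b: "b = 2 * m" "0 < m" and rm: "rate ^ m \<le> 1 / real n"
  shows "\<bar>(\<integral>\<omega>. lag_form w b n (\<lambda>k. h (chain \<omega> k)) (\<lambda>k. h (chain \<omega> k)) \<partial>path) - real n * asymptotic_variance\<bar>
    \<le> 4 * second_moment / (1 - rate)\<^sup>2"
proof -
  define a where "a k = w (real k / real b) * (real (n - k) / real n)" for k
  define a' where "a' k = (if k \<in> {..<b} then a k else 0)" for k
  define e where "e k = (1 - a' k) * autocov h k" for k
  have b0: "0 < b" using b by simp
  have wa: "w (of_int j / real b) = w (real (nat \<bar>j\<bar>) / real b)" for j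
  proof (cases "0 \<le> j")
    case False
    then have "of_int j / real b = - (real (nat \<bar>j\<bar>) / real b)" by simp
    moreover have "w (- (real (nat \<bar>j\<bar>) / real b)) = w (real (nat \<bar>j\<bar>) / real b)" using w unfolding lag_window_def by blast
    ultimately show ?thesis by simp
  qed simp
  have w0: "w 0 = 1" using w by (auto simp: lag_window_def)
  have "(\<integral>\<omega>. lag_form w b n (\<lambda>k. h (chain \<omega> k)) (\<lambda>k. h (chain \<omega> k)) \<partial>path)
    = (\<Sum>j\<in>lags b. real n * (a (nat \<bar>j\<bar>) * autocov h (nat \<bar>j\<bar>)))"
    unfolding integral_lag_form wa a_def using n by (intro sum.cong) auto
  also have "\<dots> = real n * (\<Sum>j\<in>lags b. a (nat \<bar>j\<bar>) * autocov h (nat \<bar>j\<bar>))" by (simp only: sum_distrib_left)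
  also have "\<dots> = real n * (2 * (\<Sum>k<b. a k * autocov h k) - a 0 * autocov h 0)"
    by (subst sum_lags[OF b0, of "\<lambda>k. a k * autocov h k"]) simp
  also have "a 0 = 1" using n w0 by (simp add: a_def)
  finally have E: "(\<integral>\<omega>. lag_form w b n (\<lambda>k. h (chain \<omega> k)) (\<lambda>k. h (chain \<omega> k)) \<partial>path)
    = real n * (2 * (\<Sum>k<b. a k * autocov h k) - autocov h 0)" by simp
  have fs: "(\<lambda>k. if k \<in> {..<b} then a k * autocov h k else 0) sums (\<Sum>k<b. a k * autocov h k)"
    by (rule sums_If_finite_set) simp
  have "(\<lambda>k. autocov h k - (if k \<in> {..<b} then a k * autocov h k else 0)) sums ((\<Sum>k. autocov h k) - (\<Sum>k<b. a k * autocov h k))"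
    by (intro sums_diff summable_sums summable_autocov(2) fs)
  moreover have "autocov h k - (if k \<in> {..<b} then a k * autocov h k else 0) = e k" for k
    by (simp add: e_def a'_def algebra_simps)
  ultimately have es: "e sums ((\<Sum>k. autocov h k) - (\<Sum>k<b. a k * autocov h k))" by simp
  have a01: "0 \<le> a k" "a k \<le> 1" for k
  proof -
    have w1: "0 \<le> w (real k / real b)" "w (real k / real b) \<le> 1"
      using w lag_window_le[OF w, of "real k / real b"] by (auto simp: lag_window_def)
    moreover have "0 \<le> real (n - k) / real n" "real (n - k) / real n \<le> 1" using n by auto
    ultimately show "0 \<le> a k" "a k \<le> 1"
      unfolding a_def using mult_mono[of "w (real k / real b)" 1 "real (n - k) / real n" 1] by auto
  qed
  \<comment> \<open>\<open>Suc k\<close> in place of k turns the weighted sum into the derivative of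
    the geometric series, with value 1 / (1 - rate)^2.\<close>
  have coeff: "\<bar>1 - a' k\<bar> \<le> real (Suc k) / real n + (if m \<le> k then 1 else 0)" for k
  proof (cases "m \<le> k")
    case True
    have "\<bar>1 - a' k\<bar> \<le> 1" using a01[of k] by (simp add: a'_def)
    then show ?thesis using True by (simp add: add_increasing)
  next
    case False
    then have kb: "k < b" "real k / real b \<le> 1 / 2" using b by (auto simp: field_simps)
    have "real k / real b \<in> {-1/2..1/2}"
    proof -
      have "0 \<le> real k / real b" by simp
      then have "-1/2 \<le> real k / real b" by linarith
      then show ?thesis using kb(2) by simp
    qed
    then have "w (real k / real b) = 1" using w unfolding lag_window_def by blast
    then have "a' k = real (n - k) / real n" using kb by (simp add: a'_def a_def)
    moreover have "1 - real k / real n \<le> real (n - k) / real n" "real (n - k) / real n \<le> 1"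
    proof -
      have "real n - real k \<le> real (n - k)" by linarith
      then have "(real n - real k) / real n \<le> real (n - k) / real n" by (rule divide_right_mono) simp
      then show "1 - real k / real n \<le> real (n - k) / real n" using n by (simp add: diff_divide_distrib)
      show "real (n - k) / real n \<le> 1" using n by simp
    qed
    moreover have "real k / real n \<le> real (Suc k) / real n" by (simp add: divide_right_mono)
    ultimately show ?thesis using False by simp
  qed
  have g: "(\<lambda>k. real (Suc k) * rate ^ k) sums (1 / (1 - rate)\<^sup>2)"
    using geometric_deriv_sums[of rate] rate_less by simp
  have major: "(\<lambda>k. (1 / real n * (real (Suc k) * rate ^ k) + (if m \<le> k then rate ^ k else 0)) * second_moment)
    sums ((1 / real n * (1 / (1 - rate)\<^sup>2) + rate ^ m / (1 - rate)) * second_moment)"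
    using rate_less by (intro sums_mult2 sums_add sums_mult g sums_geometric_tail) auto
  have ek: "\<bar>e k\<bar> \<le> (1 / real n * (real (Suc k) * rate ^ k) + (if m \<le> k then rate ^ k else 0)) * second_moment" for k
  proof -
    have "\<bar>e k\<bar> \<le> (real (Suc k) / real n + (if m \<le> k then 1 else 0)) * (rate ^ k * second_moment)"
      unfolding e_def abs_mult by (intro mult_mono coeff autocov_le') auto
    also have "\<dots> = (1 / real n * (real (Suc k) * rate ^ k) + (if m \<le> k then rate ^ k else 0)) * second_moment"
      by (auto simp: algebra_simps add_divide_distrib)
    finally show ?thesis .
  qed
  have "summable (\<lambda>k. norm (e k))"
    by (rule summable_comparison_test[OF _ sums_summable[OF major]]) (use ek in auto)
  then have "\<bar>\<Sum>k. e k\<bar> \<le> (\<Sum>k. \<bar>e k\<bar>)" using summable_norm[of e] by simp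
  also have "\<dots> \<le> (\<Sum>k. (1 / real n * (real (Suc k) * rate ^ k) + (if m \<le> k then rate ^ k else 0)) * second_moment)"
    using \<open>summable (\<lambda>k. norm (e k))\<close> by (intro suminf_le ek sums_summable[OF major]) auto
  also have "\<dots> = (1 / real n * (1 / (1 - rate)\<^sup>2) + rate ^ m / (1 - rate)) * second_moment"
    by (rule sums_unique[OF major, symmetric])
  also have "\<dots> \<le> (2 / (real n * (1 - rate)\<^sup>2)) * second_moment"
  proof (rule mult_right_mono[OF _ second_moment_nonneg])
    have "rate ^ m / (1 - rate) \<le> (1 / real n) / (1 - rate)" using rm rate_less by (intro divide_right_mono) auto
    also have "\<dots> \<le> (1 / real n) / (1 - rate)\<^sup>2"
      using rate_less n by (intro divide_left_mono) (auto simp: power2_eq_square mult_left_le)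
    finally have "rate ^ m / (1 - rate) \<le> 1 / (real n * (1 - rate)\<^sup>2)" by simp
    moreover have "1 / real n * (1 / (1 - rate)\<^sup>2) = 1 / (real n * (1 - rate)\<^sup>2)" by simp
    moreover have "2 / (real n * (1 - rate)\<^sup>2) = 1 / (real n * (1 - rate)\<^sup>2) + 1 / (real n * (1 - rate)\<^sup>2)"
      by (simp add: add_divide_distrib[symmetric])
    ultimately show "1 / real n * (1 / (1 - rate)\<^sup>2) + rate ^ m / (1 - rate) \<le> 2 / (real n * (1 - rate)\<^sup>2)"
      by linarith
  qed
  finally have es2: "\<bar>\<Sum>k. e k\<bar> \<le> (2 / (real n * (1 - rate)\<^sup>2)) * second_moment" .
  have "(\<integral>\<omega>. lag_form w b n (\<lambda>k. h (chain \<omega> k)) (\<lambda>k. h (chain \<omega> k)) \<partial>path) - real n * asymptotic_variance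
    = - (2 * real n * (\<Sum>k. e k))"
    unfolding E asymptotic_variance_def sums_unique[OF es, symmetric] by (simp add: algebra_simps)
  then have "\<bar>(\<integral>\<omega>. lag_form w b n (\<lambda>k. h (chain \<omega> k)) (\<lambda>k. h (chain \<omega> k)) \<partial>path) - real n * asymptotic_variance\<bar>
    = 2 * real n * \<bar>\<Sum>k. e k\<bar>" by (simp add: abs_mult)
  also have "\<dots> \<le> 2 * real n * ((2 / (real n * (1 - rate)\<^sup>2)) * second_moment)" using es2 by (intro mult_left_mono) auto
  also have "\<dots> = 4 * second_moment / (1 - rate)\<^sup>2" using n by simp
  finally show ?thesis .
qed

text \<open>Subtracting the empirical mean changes each lag by three products of that mean with
  partial sums. Partial sums have L^2 norm of order sqrt n, so each product has bounded expectation.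
  The 12 counts 2 b lags, three terms each, of size 2 / (1 - rate) times the second moment.\<close>

lemma centering_bias:
  assumes w: "lag_window w" and n: "0 < n"
  shows "integrable path (\<lambda>\<omega>. lag_form w b n (centered n (\<lambda>k. h (chain \<omega> k))) (centered n (\<lambda>k. h (chain \<omega> k))))"
    "\<bar>(\<integral>\<omega>. lag_form w b n (centered n (\<lambda>k. h (chain \<omega> k))) (centered n (\<lambda>k. h (chain \<omega> k))) \<partial>path)
      - (\<integral>\<omega>. lag_form w b n (\<lambda>k. h (chain \<omega> k)) (\<lambda>k. h (chain \<omega> k)) \<partial>path)\<bar>
    \<le> 12 * real b * second_moment / (1 - rate)"
proof -
  define \<Gamma> where "\<Gamma> = 2 / (1 - rate) * second_moment"
  have \<Gamma>: "0 \<le> \<Gamma>" using second_moment_nonneg rate_less by (simp add: \<Gamma>_def)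
  define S where "S A \<omega> = (\<Sum>k\<in>A. h (chain \<omega> k))" for A \<omega>
  define m where "m \<omega> = S {..<n} \<omega> / real n" for \<omega>
  have iS: "integrable path (\<lambda>\<omega>. (S A \<omega>)\<^sup>2)" "(\<integral>\<omega>. (S A \<omega>)\<^sup>2 \<partial>path) \<le> real n * \<Gamma>"
    if A: "finite A" "card A \<le> n" for A
  proof -
    show "integrable path (\<lambda>\<omega>. (S A \<omega>)\<^sup>2)" unfolding S_def by (rule partial_sum_second_moment(1)[OF A(1)])
    have "(\<integral>\<omega>. (S A \<omega>)\<^sup>2 \<partial>path) \<le> real (card A) * \<Gamma>"
      unfolding S_def \<Gamma>_def by (rule partial_sum_second_moment(2)[OF A(1)])
    also have "\<dots> \<le> real n * \<Gamma>" using A(2) \<Gamma> by (intro mult_right_mono) auto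
    finally show "(\<integral>\<omega>. (S A \<omega>)\<^sup>2 \<partial>path) \<le> real n * \<Gamma>" .
  qed
  have mS: "S A \<in> borel_measurable path" if "finite A" for A
    unfolding S_def using chain_L2(2)[OF h l] by (intro borel_measurable_sum) auto
  have prod: "integrable path (\<lambda>\<omega>. m \<omega> * S A \<omega>)" "(\<integral>\<omega>. \<bar>m \<omega> * S A \<omega>\<bar> \<partial>path) \<le> \<Gamma>"
    if A: "finite A" "card A \<le> n" for A
  proof -
    note i1 = iS[of "{..<n}"] and i2 = iS[OF A]
    have ip: "integrable path (\<lambda>\<omega>. S {..<n} \<omega> * S A \<omega>)"
      using i1 i2 mS A by (intro Cauchy_Schwarz_integral(1)) auto
    have "integrable path (\<lambda>\<omega>. S {..<n} \<omega> * S A \<omega> / real n)" by (rule integrable_divide[OF ip])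
    then show "integrable path (\<lambda>\<omega>. m \<omega> * S A \<omega>)" by (simp add: m_def)
    have "(\<integral>\<omega>. \<bar>S {..<n} \<omega>\<bar> * \<bar>S A \<omega>\<bar> \<partial>path) \<le> sqrt (\<integral>\<omega>. (S {..<n} \<omega>)\<^sup>2 \<partial>path) * sqrt (\<integral>\<omega>. (S A \<omega>)\<^sup>2 \<partial>path)"
      using i1 i2 mS A by (intro Cauchy_Schwarz_integral(4)) auto
    also have "\<dots> \<le> sqrt (real n * \<Gamma>) * sqrt (real n * \<Gamma>)"
      using i1 i2 \<Gamma> by (intro mult_mono real_sqrt_le_mono) auto
    also have "\<dots> = real n * \<Gamma>" using \<Gamma> by simp
    finally have le: "(\<integral>\<omega>. \<bar>S {..<n} \<omega>\<bar> * \<bar>S A \<omega>\<bar> \<partial>path) \<le> real n * \<Gamma>" .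
    have "(\<integral>\<omega>. \<bar>m \<omega> * S A \<omega>\<bar> \<partial>path) = (\<integral>\<omega>. \<bar>S {..<n} \<omega>\<bar> * \<bar>S A \<omega>\<bar> / real n \<partial>path)"
      by (simp add: m_def abs_mult)
    also have "\<dots> = (\<integral>\<omega>. \<bar>S {..<n} \<omega>\<bar> * \<bar>S A \<omega>\<bar> \<partial>path) / real n" by simp
    also have "\<dots> \<le> \<Gamma>" using le n by (simp add: divide_le_eq mult.commute)
    finally show "(\<integral>\<omega>. \<bar>m \<omega> * S A \<omega>\<bar> \<partial>path) \<le> \<Gamma>" .
  qed
  let ?Y = "\<lambda>\<omega> k. h (chain \<omega> k)" and ?c = "\<lambda>j. w (of_int j / real b)"
  have inj: "lag_product n j (\<lambda>_. 1) (?Y \<omega>) = S ((\<lambda>k. k + j) ` {..<n - j}) \<omega>" for j \<omega>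
    unfolding lag_product_def S_def by (subst sum.reindex) (auto simp: inj_on_def)
  define A1 where "A1 j = (\<lambda>k. k + nat \<bar>j\<bar>) ` {..<n - nat \<bar>j\<bar>}" for j :: int
  define A2 where "A2 j = {..<n - nat \<bar>j\<bar>}" for j :: int
  have cA: "finite (A1 j)" "card (A1 j) \<le> n" "finite (A2 j)" "card (A2 j) \<le> n" for j
  proof -
    have "card (A1 j) \<le> n - nat \<bar>j\<bar>"
      using card_image_le[of "{..<n - nat \<bar>j\<bar>}" "\<lambda>k. k + nat \<bar>j\<bar>"] by (simp add: A1_def)
    then show "card (A1 j) \<le> n" by simp
  qed (auto simp: A1_def A2_def)
  define Z where "Z \<omega> = (\<Sum>j\<in>lags b. ?c j * (m \<omega> * S {..<n} \<omega> * (real (n - nat \<bar>j\<bar>) / real n) - m \<omega> * S (A1 j) \<omega> - m \<omega> * S (A2 j) \<omega>))" for \<omega>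
  have expand: "lag_form w b n (centered n (?Y \<omega>)) (centered n (?Y \<omega>)) = lag_form w b n (?Y \<omega>) (?Y \<omega>) + Z \<omega>" for \<omega>
  proof -
    have c: "centered n (?Y \<omega>) = (\<lambda>k. ?Y \<omega> k + (- m \<omega>) * 1)"
      by (simp add: centered_def m_def S_def fun_eq_iff)
    \<comment> \<open>The square of the mean is written as the mean times S / n, so that all three
      terms have the shape handled by \<open>prod\<close>.\<close>
    have mm: "m \<omega> * m \<omega> * real k = m \<omega> * S {..<n} \<omega> * (real k / real n)" for k
      using n by (simp add: m_def)
    have lp: "lag_product n k (\<lambda>_. 1) (\<lambda>_. 1) = real (n - k)" for k
      by (simp add: lag_product_def)
    have one: "m \<omega> * m \<omega> * lag_form w b n (\<lambda>_. 1) (\<lambda>_. 1) = (\<Sum>j\<in>lags b. ?c j * (m \<omega> * S {..<n} \<omega> * (real (n - nat \<bar>j\<bar>) / real n)))"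
      unfolding lag_form_def sum_distrib_left lp mm[symmetric]
      by (intro sum.cong refl) (rule mult.left_commute)
    have y1: "m \<omega> * lag_form w b n (\<lambda>_. 1) (?Y \<omega>) = (\<Sum>j\<in>lags b. ?c j * (m \<omega> * S (A1 j) \<omega>))"
      unfolding lag_form_def sum_distrib_left A1_def inj by (intro sum.cong) (auto simp: mult.left_commute)
    have y2: "m \<omega> * lag_form w b n (?Y \<omega>) (\<lambda>_. 1) = (\<Sum>j\<in>lags b. ?c j * (m \<omega> * S (A2 j) \<omega>))"
      unfolding lag_form_def sum_distrib_left A2_def S_def lag_product_def
      by (intro sum.cong) (auto simp: mult.left_commute)
    have "lag_form w b n (centered n (?Y \<omega>)) (centered n (?Y \<omega>))
      = lag_form w b n (?Y \<omega>) (?Y \<omega>) + (m \<omega> * m \<omega> * lag_form w b n (\<lambda>_. 1) (\<lambda>_. 1)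
        - m \<omega> * lag_form w b n (\<lambda>_. 1) (?Y \<omega>) - m \<omega> * lag_form w b n (?Y \<omega>) (\<lambda>_. 1))"
      unfolding c lag_form_add_mult by (simp add: algebra_simps)
    then show ?thesis
      unfolding one y1 y2 Z_def by (simp add: sum_subtractf right_diff_distrib)
  qed
  have iZ: "integrable path Z"
    unfolding Z_def[abs_def] using prod(1) cA
    by (intro Bochner_Integration.integrable_sum integrable_mult_right Bochner_Integration.integrable_diff integrable_mult_left) auto
  show "integrable path (\<lambda>\<omega>. lag_form w b n (centered n (?Y \<omega>)) (centered n (?Y \<omega>)))"
    unfolding expand by (rule Bochner_Integration.integrable_add[OF integral_lag_form(1) iZ])
  have Zle: "\<bar>Z \<omega>\<bar> \<le> (\<Sum>j\<in>lags b. \<bar>m \<omega> * S {..<n} \<omega>\<bar> + \<bar>m \<omega> * S (A1 j) \<omega>\<bar> + \<bar>m \<omega> * S (A2 j) \<omega>\<bar>)" for \<omega>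
    unfolding Z_def
  proof (rule order_trans[OF sum_abs], rule sum_mono)
    fix j
    let ?t = "m \<omega> * S {..<n} \<omega> * (real (n - nat \<bar>j\<bar>) / real n)"
    have "\<bar>?t\<bar> \<le> \<bar>m \<omega> * S {..<n} \<omega>\<bar> * 1"
      unfolding abs_mult[of "m \<omega> * S {..<n} \<omega>"] using n by (intro mult_left_mono) auto
    then have "\<bar>?t - m \<omega> * S (A1 j) \<omega> - m \<omega> * S (A2 j) \<omega>\<bar> \<le> \<bar>m \<omega> * S {..<n} \<omega>\<bar> + \<bar>m \<omega> * S (A1 j) \<omega>\<bar> + \<bar>m \<omega> * S (A2 j) \<omega>\<bar>"
      by linarith
    moreover have "\<bar>?c j * (?t - m \<omega> * S (A1 j) \<omega> - m \<omega> * S (A2 j) \<omega>)\<bar> \<le> 1 * \<bar>?t - m \<omega> * S (A1 j) \<omega> - m \<omega> * S (A2 j) \<omega>\<bar>"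
      unfolding abs_mult[of "?c j"] by (intro mult_right_mono lag_window_le[OF w]) auto
    ultimately show "\<bar>?c j * (?t - m \<omega> * S (A1 j) \<omega> - m \<omega> * S (A2 j) \<omega>)\<bar>
      \<le> \<bar>m \<omega> * S {..<n} \<omega>\<bar> + \<bar>m \<omega> * S (A1 j) \<omega>\<bar> + \<bar>m \<omega> * S (A2 j) \<omega>\<bar>" by linarith
  qed
  have ia: "integrable path (\<lambda>\<omega>. \<bar>m \<omega> * S A \<omega>\<bar>)" if "finite A" "card A \<le> n" for A
    using prod(1)[OF that] by (rule integrable_abs)
  note iin = ia[OF finite_lessThan, of n, simplified]
  have "\<bar>\<integral>\<omega>. Z \<omega> \<partial>path\<bar> \<le> (\<integral>\<omega>. \<bar>Z \<omega>\<bar> \<partial>path)" by (rule integral_abs_bound)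
  also have "\<dots> \<le> (\<integral>\<omega>. (\<Sum>j\<in>lags b. \<bar>m \<omega> * S {..<n} \<omega>\<bar> + \<bar>m \<omega> * S (A1 j) \<omega>\<bar> + \<bar>m \<omega> * S (A2 j) \<omega>\<bar>) \<partial>path)"
    by (intro integral_mono Zle integrable_abs iZ Bochner_Integration.integrable_sum Bochner_Integration.integrable_add ia iin cA) auto
  also have "\<dots> = (\<Sum>j\<in>lags b. (\<integral>\<omega>. \<bar>m \<omega> * S {..<n} \<omega>\<bar> \<partial>path) + (\<integral>\<omega>. \<bar>m \<omega> * S (A1 j) \<omega>\<bar> \<partial>path) + (\<integral>\<omega>. \<bar>m \<omega> * S (A2 j) \<omega>\<bar> \<partial>path))"
  proof -
    have i1: "integrable path (\<lambda>\<omega>. \<bar>m \<omega> * S {..<n} \<omega>\<bar>)" by (rule ia) auto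
    have i2: "integrable path (\<lambda>\<omega>. \<bar>m \<omega> * S (A1 j) \<omega>\<bar>)" for j by (rule ia[OF cA(1,2)])
    have i3: "integrable path (\<lambda>\<omega>. \<bar>m \<omega> * S (A2 j) \<omega>\<bar>)" for j by (rule ia[OF cA(3,4)])
    have "(\<integral>\<omega>. (\<Sum>j\<in>lags b. \<bar>m \<omega> * S {..<n} \<omega>\<bar> + \<bar>m \<omega> * S (A1 j) \<omega>\<bar> + \<bar>m \<omega> * S (A2 j) \<omega>\<bar>) \<partial>path)
      = (\<Sum>j\<in>lags b. \<integral>\<omega>. \<bar>m \<omega> * S {..<n} \<omega>\<bar> + \<bar>m \<omega> * S (A1 j) \<omega>\<bar> + \<bar>m \<omega> * S (A2 j) \<omega>\<bar> \<partial>path)"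
      by (rule Bochner_Integration.integral_sum) (intro Bochner_Integration.integrable_add i1 i2 i3)
    also have "\<dots> = (\<Sum>j\<in>lags b. (\<integral>\<omega>. \<bar>m \<omega> * S {..<n} \<omega>\<bar> \<partial>path) + (\<integral>\<omega>. \<bar>m \<omega> * S (A1 j) \<omega>\<bar> \<partial>path) + (\<integral>\<omega>. \<bar>m \<omega> * S (A2 j) \<omega>\<bar> \<partial>path))"
      by (simp only: Bochner_Integration.integral_add Bochner_Integration.integrable_add i1 i2 i3)
    finally show ?thesis .
  qed
  also have "\<dots> \<le> (\<Sum>j\<in>lags b. \<Gamma> + \<Gamma> + \<Gamma>)"
    by (intro sum_mono add_mono prod(2) cA) auto
  also have "\<dots> = real (card (lags b)) * (3 * \<Gamma>)" by simp
  also have "\<dots> \<le> (2 * real b) * (3 * \<Gamma>)"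
    using card_lags[of b] \<Gamma> by (intro mult_right_mono) (auto simp flip: of_nat_mult)
  also have "\<dots> = 12 * real b * second_moment / (1 - rate)" by (simp add: \<Gamma>_def)
  finally have "\<bar>\<integral>\<omega>. Z \<omega> \<partial>path\<bar> \<le> 12 * real b * second_moment / (1 - rate)" .
  moreover have "(\<integral>\<omega>. lag_form w b n (centered n (?Y \<omega>)) (centered n (?Y \<omega>)) \<partial>path)
    - (\<integral>\<omega>. lag_form w b n (?Y \<omega>) (?Y \<omega>) \<partial>path) = (\<integral>\<omega>. Z \<omega> \<partial>path)"
    unfolding expand using Bochner_Integration.integral_add[OF integral_lag_form(1) iZ] by simp
  ultimately show "\<bar>(\<integral>\<omega>. lag_form w b n (centered n (?Y \<omega>)) (centered n (?Y \<omega>)) \<partial>path)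
      - (\<integral>\<omega>. lag_form w b n (?Y \<omega>) (?Y \<omega>) \<partial>path)\<bar> \<le> 12 * real b * second_moment / (1 - rate)" by simp
qed

lemma asymptotic_variance_le: "\<bar>asymptotic_variance\<bar> \<le> 3 * second_moment / (1 - rate)"
proof -
  have g: "(\<lambda>k. rate ^ k * second_moment) sums (1 / (1 - rate) * second_moment)"
    using rate_less by (intro sums_mult2 geometric_sums) auto
  have "\<bar>\<Sum>k. autocov h k\<bar> \<le> (\<Sum>k. \<bar>autocov h k\<bar>)" using summable_norm[of "autocov h"] summable_autocov(1) by simp
  also have "\<dots> \<le> (\<Sum>k. rate ^ k * second_moment)"
    by (intro suminf_le autocov_le' summable_autocov(1) sums_summable[OF g])
  also have "\<dots> = 1 / (1 - rate) * second_moment" by (rule sums_unique[OF g, symmetric])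
  finally have 1: "\<bar>\<Sum>k. autocov h k\<bar> \<le> second_moment / (1 - rate)" by simp
  have "\<bar>autocov h 0\<bar> \<le> second_moment" using autocov_le'[of 0] by simp
  also have "\<dots> \<le> second_moment / (1 - rate)"
    using rate_less second_moment_nonneg by (simp add: le_divide_eq mult_left_le)
  finally show ?thesis using 1 unfolding asymptotic_variance_def by (simp add: abs_le_iff)
qed

end

text \<open>The price of passing to the nearest net point. The 6 is 2 from the polarization times 3
  from the two half-lines and lag 0.\<close>

lemma asymptotic_variance_diff_le:
  assumes g: "g \<in> lipschitz l" and h: "h \<in> lipschitz l" and l: "0 \<le> l"
    and mean: "(\<integral>x. g x \<partial>\<pi>) = 0" "(\<integral>x. h x \<partial>\<pi>) = 0"
    and D: "(\<integral>x. (g x)\<^sup>2 \<partial>\<pi>) \<le> D" "(\<integral>x. (h x)\<^sup>2 \<partial>\<pi>) \<le> D" and e: "sqrt (\<integral>x. (g x - h x)\<^sup>2 \<partial>\<pi>) \<le> e"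
  shows "\<bar>asymptotic_variance g - asymptotic_variance h\<bar> \<le> 6 * (e * sqrt D) / (1 - rate)"
proof -
  define K where "K = 2 * (e * sqrt D)"
  have e0: "0 \<le> e" by (rule order_trans[OF _ e]) simp
  have D0: "0 \<le> D" by (rule order_trans[OF _ D(1)]) simp
  have K0: "0 \<le> K" using e0 D0 by (simp add: K_def)
  have diff: "\<bar>autocov g k - autocov h k\<bar> \<le> rate ^ k * K" for k
  proof -
    have "\<bar>autocov g k - autocov h k\<bar> \<le> rate ^ k * (sqrt (\<integral>x. (g x - h x)\<^sup>2 \<partial>\<pi>)
      * (sqrt (\<integral>x. (g x)\<^sup>2 \<partial>\<pi>) + sqrt (\<integral>x. (h x)\<^sup>2 \<partial>\<pi>)))"
      by (rule autocov_diff_le[OF g h l mean])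
    also have "\<dots> \<le> rate ^ k * (e * (sqrt D + sqrt D))"
      using D e e0 rate_less by (intro mult_left_mono mult_mono add_mono) auto
    finally show ?thesis by (simp add: K_def)
  qed
  have s: "(\<lambda>k. rate ^ k * K) sums (1 / (1 - rate) * K)"
    using rate_less by (intro sums_mult2 geometric_sums) auto
  note sg = summable_autocov(2)[OF g l mean(1)] and sh = summable_autocov(2)[OF h l mean(2)]
  have sd: "summable (\<lambda>k. \<bar>autocov g k - autocov h k\<bar>)"
    by (rule summable_comparison_test[OF _ sums_summable[OF s]]) (use diff in auto)
  have "\<bar>(\<Sum>k. autocov g k) - (\<Sum>k. autocov h k)\<bar> = \<bar>\<Sum>k. autocov g k - autocov h k\<bar>"
    using suminf_diff[OF sg sh] by simp
  also have "\<dots> \<le> (\<Sum>k. \<bar>autocov g k - autocov h k\<bar>)" using summable_norm[of "\<lambda>k. autocov g k - autocov h k"] sd by simp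
  also have "\<dots> \<le> (\<Sum>k. rate ^ k * K)" by (intro suminf_le diff sd sums_summable[OF s])
  also have "\<dots> = K / (1 - rate)" using sums_unique[OF s] by simp
  finally have 1: "\<bar>(\<Sum>k. autocov g k) - (\<Sum>k. autocov h k)\<bar> \<le> K / (1 - rate)" .
  have "\<bar>autocov g 0 - autocov h 0\<bar> \<le> K" using diff[of 0] by simp
  also have "\<dots> \<le> K / (1 - rate)" using rate_less K0 by (simp add: le_divide_eq mult_left_le)
  finally have "\<bar>asymptotic_variance g - asymptotic_variance h\<bar> \<le> 3 * (K / (1 - rate))"
    using 1 unfolding asymptotic_variance_def[OF g l mean(1)] asymptotic_variance_def[OF h l mean(2)] by (simp add: abs_le_iff)
  then show ?thesis by (simp add: K_def)
qed

end

section \<open>Spectral variance for an arbitrary initial law\<close>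

lemma le_right_limit:
  fixes f :: "real \<Rightarrow> real"
  assumes "(f \<longlongrightarrow> y) (at_right a)" "\<And>c. a < c \<Longrightarrow> x \<le> f c"
  shows "x \<le> y"
  using assms(1)
proof (rule tendsto_lowerbound)
  show "\<forall>\<^sub>F c in at_right a. x \<le> f c"
    using eventually_at_right_less[of a] by eventually_elim (rule assms(2))
qed simp

text \<open>The cross terms contain the norm of \<open>y\<close> alone, so they can be evaluated
  along the stationary path.\<close>

lemma lag_form_diff_le:
  assumes w: "lag_window w"
  shows "\<bar>lag_form w b n (centered n x) (centered n x) - lag_form w b n (centered n y) (centered n y)\<bar>
    \<le> 2 * real b * (2 * L2_set (\<lambda>k. x k - y k) {..<n} * L2_set y {..<n} + (L2_set (\<lambda>k. x k - y k) {..<n})\<^sup>2)"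
proof -
  define e where "e k = x k - y k" for k
  let ?u = "centered n y" and ?v = "centered n e"
  have le: "L2_set (centered n z) {..<n} \<le> L2_set z {..<n}" for z
  proof (rule power2_le_imp_le)
    show "(L2_set (centered n z) {..<n})\<^sup>2 \<le> (L2_set z {..<n})\<^sup>2"
      using centered_le[of n z 0] unfolding L2_set_power2[of z] by simp
  qed simp
  have cx: "centered n x = (\<lambda>k. ?u k + 1 * ?v k)"
    using centered_add_mult[of n y 1 e] by (simp add: e_def)
  have eq: "lag_form w b n (centered n x) (centered n x) - lag_form w b n ?u ?u
    = lag_form w b n ?v ?u + lag_form w b n ?u ?v + lag_form w b n ?v ?v"
    unfolding cx lag_form_add_mult by simp
  have "\<bar>lag_form w b n ?v ?u + lag_form w b n ?u ?v + lag_form w b n ?v ?v\<bar> \<le> 2 * real b * (L2_set ?v {..<n} * L2_set ?u {..<n}) + 2 * real b * (L2_set ?u {..<n} * L2_set ?v {..<n})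
      + 2 * real b * (L2_set ?v {..<n} * L2_set ?v {..<n})"
    by (rule order_trans[OF abs_triangle_ineq add_mono[OF order_trans[OF abs_triangle_ineq add_mono]]])
       (rule lag_form_le[OF w])+
  also have "\<dots> = 2 * real b * (2 * (L2_set ?v {..<n} * L2_set ?u {..<n}) + L2_set ?v {..<n} * L2_set ?v {..<n})"
    by (simp only: mult.commute[of "L2_set ?u {..<n}" "L2_set ?v {..<n}"] distrib_left mult_2)
  also have "\<dots> \<le> 2 * real b * (2 * (L2_set e {..<n} * L2_set y {..<n}) + L2_set e {..<n} * L2_set e {..<n})"
    by (intro mult_left_mono add_mono mult_mono le) auto
  finally show ?thesis unfolding eq by (simp only: e_def[abs_def] power2_eq_square mult.assoc)
qed

lemma centered_shift: "0 < n \<Longrightarrow> centered n (\<lambda>k. x k - c) = centered n x"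
  by (simp add: centered_def fun_eq_iff sum_subtractf diff_divide_distrib)

locale ula_estimation = stationary_ula d U L\<^sub>U m\<^sub>U \<gamma> \<pi> + T2_measure \<xi> d \<beta>
  for d U L\<^sub>U m\<^sub>U \<gamma> \<pi> \<xi> \<beta>
begin

lemma Rd_moment2_xi: "Rd_moment2 \<xi> d"
  using xi_second_moment by unfold_locales auto

sublocale xiN: pair_prob_space \<xi> "noise d" ..

abbreviation start_dist :: real where "start_dist \<equiv> enn2real (W2 (eucl_dist d) \<xi> \<pi>)"

context
  fixes h L
  assumes h: "h \<in> lipschitz L" and L: "0 \<le> L" and mean: "(\<integral>x. h x \<partial>\<pi>) = 0"
begin

definition sq_sum :: "nat \<Rightarrow> ula_outcome \<Rightarrow> real" where
  "sq_sum n \<omega> = (\<Sum>k<n. (h (chain \<omega> k))\<^sup>2)"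

definition form :: "(real \<Rightarrow> real) \<Rightarrow> nat \<Rightarrow> nat \<Rightarrow> ula_outcome \<Rightarrow> real" where
  "form w b n \<omega> = lag_form w b n (centered n (\<lambda>k. h (chain \<omega> k))) (centered n (\<lambda>k. h (chain \<omega> k)))"

lemma sq_sum_eq: "sq_sum n \<omega> = (L2_set (\<lambda>k. h (chain \<omega> k)) {..<n})\<^sup>2"
  unfolding sq_sum_def L2_set_power2 ..

lemma sq_sum_nonneg: "0 \<le> sq_sum n \<omega>"
  unfolding sq_sum_eq by simp

lemma integrable_sq_sum: "Rd_moment2 \<mu> d \<Longrightarrow> integrable (\<mu> \<Otimes>\<^sub>M noise d) (sq_sum n)"
  unfolding sq_sum_def[abs_def]
  by (intro Bochner_Integration.integrable_sum chain_square_integrable(1)[OF _ h L])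

lemma integrable_sq_sum_noise: "x \<in> space (Rd d) \<Longrightarrow> integrable (noise d) (\<lambda>z. sq_sum n (x, z))"
  unfolding sq_sum_def by (intro Bochner_Integration.integrable_sum integrable_chain_noise(2)[OF h L])

lemma form_le: "lag_window w \<Longrightarrow> \<bar>form w b n \<omega>\<bar> \<le> 2 * real b * sq_sum n \<omega>"
proof -
  assume w: "lag_window w"
  have "form w b n \<omega> = lag_form w b n (centered n (\<lambda>k. h (chain \<omega> k))) (centered n (\<lambda>k. h (chain \<omega> k)))
      - lag_form w b n (centered n (\<lambda>_. 0)) (centered n (\<lambda>_. 0))"
    by (simp add: form_def centered_def lag_form_def lag_product_def)
  then show ?thesis
    using lag_form_diff_le[OF w, of b n "\<lambda>k. h (chain \<omega> k)" "\<lambda>_. 0"] by (simp add: sq_sum_eq L2_set_0')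
qed

lemma measurable_form:
  assumes "\<And>k. (\<lambda>\<omega>. h (chain (f \<omega>) k)) \<in> borel_measurable M"
  shows "(\<lambda>\<omega>. form w b n (f \<omega>)) \<in> borel_measurable M"
  unfolding form_def lag_form_def lag_product_def centered_def using assms by measurable

lemma integrable_form:
  assumes "Rd_moment2 \<mu> d" and w: "lag_window w"
  shows "integrable (\<mu> \<Otimes>\<^sub>M noise d) (form w b n)"
proof (rule Bochner_Integration.integrable_bound)
  show "integrable (\<mu> \<Otimes>\<^sub>M noise d) (\<lambda>\<omega>. 2 * real b * sq_sum n \<omega>)"
    using integrable_sq_sum[OF assms(1)] by simp
  show "form w b n \<in> borel_measurable (\<mu> \<Otimes>\<^sub>M noise d)"
    using chain_square_integrable(2)[OF assms(1) h L] by (intro measurable_form[where f = "\<lambda>\<omega>. \<omega>"]) auto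
qed (use form_le[OF w] sq_sum_nonneg in auto)

lemma integrable_form_noise:
  assumes "x \<in> space (Rd d)" and w: "lag_window w"
  shows "integrable (noise d) (\<lambda>z. form w b n (x, z))"
proof (rule Bochner_Integration.integrable_bound)
  show "integrable (noise d) (\<lambda>z. 2 * real b * sq_sum n (x, z))"
    using integrable_sq_sum_noise[OF assms(1)] by simp
  show "(\<lambda>z. form w b n (x, z)) \<in> borel_measurable (noise d)"
    using integrable_chain_noise(1)[OF h L assms(1)] by (intro measurable_form) auto
qed (use form_le[OF w] sq_sum_nonneg in auto)

text \<open>Synchronously coupled paths approach each other geometrically, so their total squared
  distance stays bounded as \<open>n\<close> grows.\<close>

lemma path_diff_le:
  assumes x: "x \<in> space (Rd d)" and y: "y \<in> space (Rd d)"
  shows "(L2_set (\<lambda>k. h (chain (x, z) k) - h (chain (y, z) k)) {..<n})\<^sup>2 \<le> L\<^sup>2 * (eucl_dist d x y)\<^sup>2 / (1 - rate\<^sup>2)"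
proof -
  have r2: "0 \<le> rate\<^sup>2" "rate\<^sup>2 < 1" using rate_less by (auto simp: power_less_one_iff)
  have "(L2_set (\<lambda>k. h (chain (x, z) k) - h (chain (y, z) k)) {..<n})\<^sup>2
    = (\<Sum>k<n. (h (chain (x, z) k) - h (chain (y, z) k))\<^sup>2)" by (rule L2_set_power2)
  also have "\<dots> \<le> (\<Sum>k<n. (L * eucl_dist d x y)\<^sup>2 * (rate\<^sup>2) ^ k)"
  proof (rule sum_mono)
    fix k
    have "\<bar>h (chain (x, z) k) - h (chain (y, z) k)\<bar> \<le> L * eucl_dist d (chain (x, z) k) (chain (y, z) k)"
      by (intro LipD[OF h] chain_in_space x y)
    also have "\<dots> \<le> L * (rate ^ k * eucl_dist d x y)" by (intro mult_left_mono chain_dist_initial x y L)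
    finally have "\<bar>h (chain (x, z) k) - h (chain (y, z) k)\<bar> \<le> \<bar>L * (rate ^ k * eucl_dist d x y)\<bar>" by simp
    then have "(h (chain (x, z) k) - h (chain (y, z) k))\<^sup>2 \<le> (L * (rate ^ k * eucl_dist d x y))\<^sup>2"
      by (rule abs_le_square_iff[THEN iffD1])
    then show "(h (chain (x, z) k) - h (chain (y, z) k))\<^sup>2 \<le> (L * eucl_dist d x y)\<^sup>2 * (rate\<^sup>2) ^ k"
      by (simp add: power_mult_distrib power_mult[symmetric] mult_ac)
  qed
  also have "\<dots> = (L * eucl_dist d x y)\<^sup>2 * (\<Sum>k<n. (rate\<^sup>2) ^ k)" by (simp add: sum_distrib_left)
  also have "\<dots> \<le> (L * eucl_dist d x y)\<^sup>2 * (1 / (1 - rate\<^sup>2))"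
    using r2 sum_power_inj_le[of "rate\<^sup>2" "{..<n}" "\<lambda>k. k"] by (intro mult_left_mono) auto
  finally show ?thesis by (simp add: power_mult_distrib)
qed

text \<open>Averages over the noise for a fixed start. The coupling of \<xi> and \<pi> then concerns
  initial states only, with both chains sharing the noise.\<close>

definition sq_mean :: "nat \<Rightarrow> (nat \<Rightarrow> real) \<Rightarrow> real" where
  "sq_mean n x = (\<integral>z. sq_sum n (x, z) \<partial>noise d)"

definition form_mean :: "(real \<Rightarrow> real) \<Rightarrow> nat \<Rightarrow> nat \<Rightarrow> (nat \<Rightarrow> real) \<Rightarrow> real" where
  "form_mean w b n x = (\<integral>z. form w b n (x, z) \<partial>noise d)"

lemma sq_mean_nonneg: "0 \<le> sq_mean n x"
  unfolding sq_mean_def by (rule Bochner_Integration.integral_nonneg) (rule sq_sum_nonneg)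

lemma sq_mean_integral:
  assumes \<mu>: "Rd_moment2 \<mu> d"
  shows "integrable \<mu> (sq_mean n)" "(\<integral>x. sq_mean n x \<partial>\<mu>) = (\<integral>\<omega>. sq_sum n \<omega> \<partial>(\<mu> \<Otimes>\<^sub>M noise d))"
proof -
  interpret \<mu>: Rd_moment2 \<mu> d by fact
  interpret muN: pair_prob_space \<mu> "noise d" ..
  show "integrable \<mu> (sq_mean n)" "(\<integral>x. sq_mean n x \<partial>\<mu>) = (\<integral>\<omega>. sq_sum n \<omega> \<partial>(\<mu> \<Otimes>\<^sub>M noise d))"
    using muN.integrable_fst'[OF integrable_sq_sum[OF \<mu>]] muN.integral_fst'[OF integrable_sq_sum[OF \<mu>]]
    by (simp_all add: sq_mean_def[abs_def])
qed

lemma form_mean_integral: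
  assumes \<mu>: "Rd_moment2 \<mu> d" and w: "lag_window w"
  shows "integrable \<mu> (form_mean w b n)" "(\<integral>x. form_mean w b n x \<partial>\<mu>) = (\<integral>\<omega>. form w b n \<omega> \<partial>(\<mu> \<Otimes>\<^sub>M noise d))"
proof -
  interpret \<mu>: Rd_moment2 \<mu> d by fact
  interpret muN: pair_prob_space \<mu> "noise d" ..
  show "integrable \<mu> (form_mean w b n)" "(\<integral>x. form_mean w b n x \<partial>\<mu>) = (\<integral>\<omega>. form w b n \<omega> \<partial>(\<mu> \<Otimes>\<^sub>M noise d))"
    using muN.integrable_fst'[OF integrable_form[OF \<mu> w]] muN.integral_fst'[OF integrable_form[OF \<mu> w]]
    by (simp_all add: form_mean_def[abs_def])
qed

lemma sq_sum_stationary: "(\<integral>\<omega>. sq_sum n \<omega> \<partial>path) = real n * second_moment h"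
proof -
  have "(\<integral>\<omega>. sq_sum n \<omega> \<partial>path) = (\<Sum>k<n. \<integral>\<omega>. (h (chain \<omega> k))\<^sup>2 \<partial>path)"
    unfolding sq_sum_def by (rule Bochner_Integration.integral_sum) (rule chain_L2(1)[OF h L])
  then show ?thesis by (simp add: integral_square[OF h L mean])
qed

lemma sq_mean_diff:
  assumes x: "x \<in> space (Rd d)" and y: "y \<in> space (Rd d)"
  shows "sq_mean n x \<le> 2 * sq_mean n y + 2 * (L\<^sup>2 * (eucl_dist d x y)\<^sup>2 / (1 - rate\<^sup>2))"
proof -
  let ?c = "L\<^sup>2 * (eucl_dist d x y)\<^sup>2 / (1 - rate\<^sup>2)"
  have "sq_mean n x \<le> (\<integral>z. 2 * sq_sum n (y, z) + 2 * ?c \<partial>noise d)"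
    unfolding sq_mean_def
  proof (rule integral_mono)
    fix z
    let ?a = "\<lambda>k. h (chain (x, z) k)" and ?b = "\<lambda>k. h (chain (y, z) k)"
    have "sq_sum n (x, z) \<le> (\<Sum>k<n. 2 * (?b k)\<^sup>2 + 2 * (?a k - ?b k)\<^sup>2)"
      unfolding sq_sum_def
    proof (rule sum_mono)
      fix k
      show "(?a k)\<^sup>2 \<le> 2 * (?b k)\<^sup>2 + 2 * (?a k - ?b k)\<^sup>2"
        using zero_le_power2[of "?a k - 2 * ?b k"] by (simp add: power2_eq_square algebra_simps)
    qed
    also have "\<dots> = 2 * sq_sum n (y, z) + 2 * (L2_set (\<lambda>k. ?a k - ?b k) {..<n})\<^sup>2"
      by (simp add: sq_sum_def L2_set_power2 sum.distrib sum_distrib_left)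
    also have "\<dots> \<le> 2 * sq_sum n (y, z) + 2 * ?c" using path_diff_le[OF x y] by (intro add_left_mono mult_left_mono) auto
    finally show "sq_sum n (x, z) \<le> 2 * sq_sum n (y, z) + 2 * ?c" .
  qed (use integrable_sq_sum_noise[OF x] integrable_sq_sum_noise[OF y] in auto)
  also have "\<dots> = 2 * sq_mean n y + 2 * ?c"
    using integrable_sq_sum_noise[OF y] by (simp add: sq_mean_def noise.prob_space)
  finally show ?thesis .
qed

lemma form_mean_diff:
  assumes x: "x \<in> space (Rd d)" and y: "y \<in> space (Rd d)" and w: "lag_window w"
  shows "\<bar>form_mean w b n x - form_mean w b n y\<bar>
    \<le> 2 * real b * (2 * (L / sqrt (1 - rate\<^sup>2) * eucl_dist d x y * sqrt (sq_mean n y)) + L\<^sup>2 * (eucl_dist d x y)\<^sup>2 / (1 - rate\<^sup>2))"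
proof -
  have r2: "0 < 1 - rate\<^sup>2" using rate_less by (auto simp: power_less_one_iff)
  let ?c = "L\<^sup>2 * (eucl_dist d x y)\<^sup>2 / (1 - rate\<^sup>2)" and ?e = "L / sqrt (1 - rate\<^sup>2) * eucl_dist d x y"
  have e2: "?e\<^sup>2 = ?c" using r2 by (simp add: power_mult_distrib power_divide)
  have e0: "0 \<le> ?e" using L r2 by simp
  define s where "s z = sqrt (sq_sum n (y, z))" for z
  note iy = integrable_sq_sum_noise[OF y]
  have sm: "s \<in> borel_measurable (noise d)" unfolding s_def using iy by simp
  have s2: "(s z)\<^sup>2 = sq_sum n (y, z)" for z by (simp add: s_def sq_sum_nonneg)
  have is2: "integrable (noise d) (\<lambda>z. (s z)\<^sup>2)" unfolding s2 by (rule iy)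
  have is1: "integrable (noise d) s" by (rule noise.square_integrable_imp_integrable[OF sm is2])
  have "\<bar>\<integral>z. s z * 1 \<partial>noise d\<bar> \<le> sqrt (\<integral>z. (s z)\<^sup>2 \<partial>noise d) * sqrt (\<integral>z. 1\<^sup>2 \<partial>noise d)"
    by (rule Cauchy_Schwarz_integral(3)[OF sm _ is2]) auto
  then have int_s: "(\<integral>z. s z \<partial>noise d) \<le> sqrt (sq_mean n y)"
    by (simp add: noise.prob_space s2 sq_mean_def)
  have "\<bar>form_mean w b n x - form_mean w b n y\<bar> = \<bar>\<integral>z. form w b n (x, z) - form w b n (y, z) \<partial>noise d\<bar>"
    unfolding form_mean_def using integrable_form_noise[OF x w] integrable_form_noise[OF y w] by simp
  also have "\<dots> \<le> (\<integral>z. \<bar>form w b n (x, z) - form w b n (y, z)\<bar> \<partial>noise d)" by (rule integral_abs_bound)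
  also have "\<dots> \<le> (\<integral>z. 2 * real b * (2 * (?e * s z) + ?c) \<partial>noise d)"
  proof (rule integral_mono)
    fix z
    let ?E = "L2_set (\<lambda>k. h (chain (x, z) k) - h (chain (y, z) k)) {..<n}"
    have E: "?E\<^sup>2 \<le> ?e\<^sup>2" unfolding e2 by (rule path_diff_le[OF x y])
    then have Ee: "?E \<le> ?e" using e0 by (rule power2_le_imp_le)
    have ys: "L2_set (\<lambda>k. h (chain (y, z) k)) {..<n} = s z"
      by (simp add: s_def sq_sum_eq)
    have "\<bar>form w b n (x, z) - form w b n (y, z)\<bar> \<le> 2 * real b * (2 * ?E * s z + ?E\<^sup>2)"
      unfolding form_def ys[symmetric] by (rule lag_form_diff_le[OF w])
    also have "\<dots> \<le> 2 * real b * (2 * ?e * s z + ?e\<^sup>2)"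
      using E Ee by (intro mult_left_mono add_mono mult_right_mono) (auto simp: s_def sq_sum_nonneg)
    finally show "\<bar>form w b n (x, z) - form w b n (y, z)\<bar> \<le> 2 * real b * (2 * (?e * s z) + ?c)"
      unfolding e2 by (simp add: mult.assoc)
  qed (use integrable_form_noise[OF x w] integrable_form_noise[OF y w] is1 in auto)
  also have "\<dots> = 2 * real b * (2 * (?e * (\<integral>z. s z \<partial>noise d)) + ?c)" using is1 by (simp add: noise.prob_space)
  also have "\<dots> \<le> 2 * real b * (2 * (?e * sqrt (sq_mean n y)) + ?c)"
    using int_s e0 by (intro mult_left_mono add_right_mono) auto
  finally show ?thesis .
qed

lemma coupling_bounds:
  assumes c: "start_dist\<^sup>2 < c" and w: "lag_window w"
  shows "(\<integral>\<omega>. sq_sum n \<omega> \<partial>(\<xi> \<Otimes>\<^sub>M noise d)) \<le> 2 * (real n * second_moment h) + 2 * (L\<^sup>2 * c / (1 - rate\<^sup>2))"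
    "\<bar>(\<integral>\<omega>. form w b n \<omega> \<partial>(\<xi> \<Otimes>\<^sub>M noise d)) - (\<integral>\<omega>. form w b n \<omega> \<partial>path)\<bar>
      \<le> 2 * real b * (2 * (L / sqrt (1 - rate\<^sup>2) * (sqrt c * sqrt (real n * second_moment h))) + L\<^sup>2 * c / (1 - rate\<^sup>2))"
proof -
  have r2: "0 < 1 - rate\<^sup>2" using rate_less by (auto simp: power_less_one_iff)
  interpret xi2: Rd_moment2 \<xi> d by (rule Rd_moment2_xi)
  obtain q where "Rd_coupling d \<xi> \<pi> q" and iq: "integrable q (\<lambda>p. (eucl_dist d (fst p) (snd p))\<^sup>2)"
    and cq: "(\<integral>p. (eucl_dist d (fst p) (snd p))\<^sup>2 \<partial>q) < c"
    by (rule xi2.near_optimal_coupling[OF Rd_moment2_pi c])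
  interpret Q: Rd_coupling d \<xi> \<pi> q by fact
  let ?d = "\<lambda>p. eucl_dist d (fst p) (snd p)" and ?C = "\<integral>p. (eucl_dist d (fst p) (snd p))\<^sup>2 \<partial>q"
  have S: "fst p \<in> space (Rd d)" "snd p \<in> space (Rd d)" if "p \<in> space q" for p
    using that by (auto simp: Q.space_q)
  note T1 = Q.integrable_fst[OF sq_mean_integral(1)[OF Rd_moment2_xi, of n]]
    and T2 = Q.integrable_snd[OF sq_mean_integral(1)[OF Rd_moment2_pi, of n]]
  note F1 = Q.integrable_fst[OF form_mean_integral(1)[OF Rd_moment2_xi w, of b n]]
    and F2 = Q.integrable_snd[OF form_mean_integral(1)[OF Rd_moment2_pi w, of b n]]
  have ET2: "(\<integral>p. sq_mean n (snd p) \<partial>q) = real n * second_moment h"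
    unfolding T2(2) sq_mean_integral(2)[OF Rd_moment2_pi] by (rule sq_sum_stationary)
  have "(\<integral>\<omega>. sq_sum n \<omega> \<partial>(\<xi> \<Otimes>\<^sub>M noise d)) = (\<integral>p. sq_mean n (fst p) \<partial>q)"
    unfolding T1(2) sq_mean_integral(2)[OF Rd_moment2_xi] ..
  also have "\<dots> \<le> (\<integral>p. 2 * sq_mean n (snd p) + 2 * (L\<^sup>2 / (1 - rate\<^sup>2) * (?d p)\<^sup>2) \<partial>q)"
  proof (rule integral_mono)
    fix p assume "p \<in> space q"
    from sq_mean_diff[OF S[OF this], of n]
    show "sq_mean n (fst p) \<le> 2 * sq_mean n (snd p) + 2 * (L\<^sup>2 / (1 - rate\<^sup>2) * (?d p)\<^sup>2)" by simp
  qed (use T1(1) T2(1) iq in auto)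
  also have "\<dots> = 2 * (real n * second_moment h) + 2 * (L\<^sup>2 / (1 - rate\<^sup>2) * ?C)"
    using T2(1) iq by (simp add: ET2)
  also have "\<dots> \<le> 2 * (real n * second_moment h) + 2 * (L\<^sup>2 / (1 - rate\<^sup>2) * c)"
    using cq r2 by (intro add_left_mono mult_left_mono) auto
  finally show "(\<integral>\<omega>. sq_sum n \<omega> \<partial>(\<xi> \<Otimes>\<^sub>M noise d)) \<le> 2 * (real n * second_moment h) + 2 * (L\<^sup>2 * c / (1 - rate\<^sup>2))"
    by simp
  define s where "s p = sqrt (sq_mean n (snd p))" for p :: "(nat \<Rightarrow> real) \<times> (nat \<Rightarrow> real)"
  have s2: "(s p)\<^sup>2 = sq_mean n (snd p)" for p by (simp add: s_def sq_mean_nonneg)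
  have sm: "s \<in> borel_measurable q" unfolding s_def using T2(1) by simp
  have dm: "?d \<in> borel_measurable q" by measurable
  have is2: "integrable q (\<lambda>p. (s p)\<^sup>2)" unfolding s2 by (rule T2(1))
  note cs = Cauchy_Schwarz_integral(1,3)[OF dm sm iq is2]
  have ds: "(\<integral>p. ?d p * s p \<partial>q) \<le> sqrt c * sqrt (real n * second_moment h)"
  proof -
    have "(\<integral>p. ?d p * s p \<partial>q) \<le> sqrt ?C * sqrt (\<integral>p. (s p)\<^sup>2 \<partial>q)" using cs(2) by linarith
    also have "\<dots> \<le> sqrt c * sqrt (real n * second_moment h)"
      unfolding s2 ET2 using cq by (intro mult_right_mono real_sqrt_le_mono) (auto simp: second_moment_nonneg[OF h L mean])
    finally show ?thesis .
  qed
  have "\<bar>(\<integral>\<omega>. form w b n \<omega> \<partial>(\<xi> \<Otimes>\<^sub>M noise d)) - (\<integral>\<omega>. form w b n \<omega> \<partial>path)\<bar>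
    = \<bar>\<integral>p. form_mean w b n (fst p) - form_mean w b n (snd p) \<partial>q\<bar>"
    using F1 F2 by (simp add: form_mean_integral(2)[OF Rd_moment2_xi w] form_mean_integral(2)[OF Rd_moment2_pi w])
  also have "\<dots> \<le> (\<integral>p. \<bar>form_mean w b n (fst p) - form_mean w b n (snd p)\<bar> \<partial>q)" by (rule integral_abs_bound)
  also have "\<dots> \<le> (\<integral>p. 2 * real b * (2 * (L / sqrt (1 - rate\<^sup>2) * (?d p * s p)) + L\<^sup>2 / (1 - rate\<^sup>2) * (?d p)\<^sup>2) \<partial>q)"
  proof (rule integral_mono)
    fix p assume "p \<in> space q"
    from form_mean_diff[OF S[OF this] w, of b n]
    show "\<bar>form_mean w b n (fst p) - form_mean w b n (snd p)\<bar>
      \<le> 2 * real b * (2 * (L / sqrt (1 - rate\<^sup>2) * (?d p * s p)) + L\<^sup>2 / (1 - rate\<^sup>2) * (?d p)\<^sup>2)"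
      by (simp add: s_def mult.assoc)
  qed (use F1(1) F2(1) cs(1) iq in auto)
  also have "\<dots> = 2 * real b * (2 * (L / sqrt (1 - rate\<^sup>2) * (\<integral>p. ?d p * s p \<partial>q)) + L\<^sup>2 / (1 - rate\<^sup>2) * ?C)"
    using cs(1) iq by simp
  also have "\<dots> \<le> 2 * real b * (2 * (L / sqrt (1 - rate\<^sup>2) * (sqrt c * sqrt (real n * second_moment h))) + L\<^sup>2 / (1 - rate\<^sup>2) * c)"
    using ds cq r2 L by (intro mult_left_mono add_mono) auto
  finally show "\<bar>(\<integral>\<omega>. form w b n \<omega> \<partial>(\<xi> \<Otimes>\<^sub>M noise d)) - (\<integral>\<omega>. form w b n \<omega> \<partial>path)\<bar>
      \<le> 2 * real b * (2 * (L / sqrt (1 - rate\<^sup>2) * (sqrt c * sqrt (real n * second_moment h))) + L\<^sup>2 * c / (1 - rate\<^sup>2))"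
    by simp
qed

text \<open>The limit of \<open>coupling_bounds\<close> as \<open>c\<close> decreases to the squared
  distance. Later \<open>\<Lambda>\<close> becomes R / 2, and its cross term with n D is the origin
  of sqrt (D R) in \<open>const_C2\<close>.\<close>

lemma initial_bias:
  assumes w: "lag_window w" and \<Lambda>: "L\<^sup>2 * start_dist\<^sup>2 / (1 - rate\<^sup>2) \<le> \<Lambda>"
  shows "(\<integral>\<omega>. sq_sum n \<omega> \<partial>(\<xi> \<Otimes>\<^sub>M noise d)) \<le> 2 * (real n * second_moment h) + 2 * \<Lambda>"
    "\<bar>(\<integral>\<omega>. form w b n \<omega> \<partial>(\<xi> \<Otimes>\<^sub>M noise d)) - (\<integral>\<omega>. form w b n \<omega> \<partial>path)\<bar>
      \<le> 2 * real b * (2 * sqrt (\<Lambda> * (real n * second_moment h)) + \<Lambda>)"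
proof -
  have r2: "0 < 1 - rate\<^sup>2" using rate_less by (auto simp: power_less_one_iff)
  let ?a = "start_dist\<^sup>2"
  have "(\<integral>\<omega>. sq_sum n \<omega> \<partial>(\<xi> \<Otimes>\<^sub>M noise d)) \<le> 2 * (real n * second_moment h) + 2 * (L\<^sup>2 * ?a / (1 - rate\<^sup>2))"
  proof (rule le_right_limit)
    show "((\<lambda>c. 2 * (real n * second_moment h) + 2 * (L\<^sup>2 * c / (1 - rate\<^sup>2)))
      \<longlongrightarrow> 2 * (real n * second_moment h) + 2 * (L\<^sup>2 * ?a / (1 - rate\<^sup>2))) (at_right ?a)"
      using r2 by (intro tendsto_intros) auto
  qed (rule coupling_bounds(1)[OF _ w])
  then show "(\<integral>\<omega>. sq_sum n \<omega> \<partial>(\<xi> \<Otimes>\<^sub>M noise d)) \<le> 2 * (real n * second_moment h) + 2 * \<Lambda>" using \<Lambda> by linarith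
  let ?f = "\<lambda>c. 2 * real b * (2 * (L / sqrt (1 - rate\<^sup>2) * (sqrt c * sqrt (real n * second_moment h))) + L\<^sup>2 * c / (1 - rate\<^sup>2))"
  have "\<bar>(\<integral>\<omega>. form w b n \<omega> \<partial>(\<xi> \<Otimes>\<^sub>M noise d)) - (\<integral>\<omega>. form w b n \<omega> \<partial>path)\<bar> \<le> ?f ?a"
  proof (rule le_right_limit)
    show "(?f \<longlongrightarrow> ?f ?a) (at_right ?a)" using r2 by (intro tendsto_intros) auto
  qed (rule coupling_bounds(2)[OF _ w])
  also have "?f ?a = 2 * real b * (2 * sqrt (L\<^sup>2 * ?a / (1 - rate\<^sup>2) * (real n * second_moment h)) + L\<^sup>2 * ?a / (1 - rate\<^sup>2))"
    using L by (simp add: real_sqrt_mult real_sqrt_divide)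
  also have "\<dots> \<le> 2 * real b * (2 * sqrt (\<Lambda> * (real n * second_moment h)) + \<Lambda>)"
    using \<Lambda> by (intro mult_left_mono add_mono real_sqrt_le_mono mult_right_mono) (auto simp: second_moment_nonneg[OF h L mean])
  finally show "\<bar>(\<integral>\<omega>. form w b n \<omega> \<partial>(\<xi> \<Otimes>\<^sub>M noise d)) - (\<integral>\<omega>. form w b n \<omega> \<partial>path)\<bar>
      \<le> 2 * real b * (2 * sqrt (\<Lambda> * (real n * second_moment h)) + \<Lambda>)" .
qed

text \<open>A deviation of F by at most t from its mean E gives |F^2 - E^2| \<le> t (2 E + t).
  Replacing E^2 by the mean of F^2 costs the variance, at most 4 v.\<close>

lemma norm_concentration:
  assumes L0: "0 < L" and b: "0 < b"
    and v: "10 * real b * L\<^sup>2 * max \<beta> \<gamma> / (1 - rate)\<^sup>2 \<le> v"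
    and N: "\<And>x y. \<bar>N x - N y\<bar> \<le> sqrt (4 * real b) * L2_set (\<lambda>k. x k - y k) {..<n}"
    and N0: "\<And>x. 0 \<le> N x" and N2: "\<And>x. (N x)\<^sup>2 \<le> 4 * real b * (\<Sum>k<n. (x k)\<^sup>2)"
    and Nm: "(\<lambda>\<omega>. N (\<lambda>k. h (chain \<omega> k))) \<in> borel_measurable (\<xi> \<Otimes>\<^sub>M noise d)"
    and M: "(\<integral>\<omega>. sq_sum n \<omega> \<partial>(\<xi> \<Otimes>\<^sub>M noise d)) \<le> M" and p: "1 < p"
  defines "F \<equiv> \<lambda>\<omega>. N (\<lambda>k. h (chain \<omega> k))" and "t \<equiv> 2 * sqrt (v * ln p)"
  shows "integrable (\<xi> \<Otimes>\<^sub>M noise d) (\<lambda>\<omega>. (F \<omega>)\<^sup>2)"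
    "xiN.P.prob {\<omega>\<in>space (\<xi> \<Otimes>\<^sub>M noise d). t * (2 * sqrt (4 * real b * M) + t) + 4 * v < \<bar>(F \<omega>)\<^sup>2 - (\<integral>\<omega>. (F \<omega>)\<^sup>2 \<partial>(\<xi> \<Otimes>\<^sub>M noise d))\<bar>} \<le> 2 / p"
proof -
  let ?S = "\<xi> \<Otimes>\<^sub>M noise d"
  have F: "F \<in> borel_measurable ?S" unfolding F_def by (rule Nm)
  define k1 where "k1 = sqrt (4 * real b) * L / (1 - rate)"
  define k2 where "k2 = sqrt (4 * real b) * L * \<sigma>\<^sub>0 / (1 - rate)"
  have r1: "0 < 1 - rate" using rate_less by simp
  have k: "0 < k1" "0 \<le> k2" using L0 b r1 gamma_pos by (auto simp: k1_def k2_def)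
  have lipY: "L2_set (\<lambda>k. h (f k) - h (g k)) {..<n} \<le> L * L2_set (\<lambda>k. eucl_dist d (f k) (g k)) {..<n}"
    if "\<And>k. f k \<in> space (Rd d)" "\<And>k. g k \<in> space (Rd d)" for f g
  proof -
    have "L2_set (\<lambda>k. h (f k) - h (g k)) {..<n} = L2_set (\<lambda>k. \<bar>h (f k) - h (g k)\<bar>) {..<n}" by (simp add: L2_set_def)
    also have "\<dots> \<le> L2_set (\<lambda>k. L * eucl_dist d (f k) (g k)) {..<n}"
      by (intro L2_set_mono LipD[OF h] that) auto
    also have "\<dots> = L * L2_set (\<lambda>k. eucl_dist d (f k) (g k)) {..<n}" using L by (simp add: L2_set_right_distrib)
    finally show ?thesis .
  qed
  have l1: "\<bar>F (x, z) - F (y, z)\<bar> \<le> k1 * eucl_dist d x y" if "x \<in> space (Rd d)" "y \<in> space (Rd d)" for x y z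
  proof -
    have "\<bar>F (x, z) - F (y, z)\<bar> \<le> sqrt (4 * real b) * (L * L2_set (\<lambda>k. eucl_dist d (chain (x, z) k) (chain (y, z) k)) {..<n})"
      unfolding F_def using that
      by (intro order_trans[OF N] mult_left_mono lipY chain_in_space) auto
    also have "\<dots> \<le> sqrt (4 * real b) * (L * (eucl_dist d x y / (1 - rate)))"
      using L that by (intro mult_left_mono chain_path_dist_initial) auto
    finally show ?thesis by (simp add: k1_def)
  qed
  have l2: "\<bar>F (x, z) - F (x, z')\<bar> \<le> k2 * noise_dist d n z z'" if "x \<in> space (Rd d)" for x z z'
  proof -
    have "\<bar>F (x, z) - F (x, z')\<bar> \<le> sqrt (4 * real b) * (L * L2_set (\<lambda>k. eucl_dist d (chain (x, z) k) (chain (x, z') k)) {..<n})"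
      unfolding F_def using that
      by (intro order_trans[OF N] mult_left_mono lipY chain_in_space) auto
    also have "\<dots> \<le> sqrt (4 * real b) * (L * (\<sigma>\<^sub>0 / (1 - rate) * noise_dist d n z z'))"
      using L that by (intro mult_left_mono chain_path_dist_noise) auto
    finally show ?thesis by (simp add: k2_def)
  qed
  have kv: "\<beta> * k1\<^sup>2 / 2 + k2\<^sup>2 \<le> v"
  proof -
    have "k1\<^sup>2 = 4 * real b * L\<^sup>2 / (1 - rate)\<^sup>2" "k2\<^sup>2 = 4 * real b * L\<^sup>2 / (1 - rate)\<^sup>2 * (2 * \<gamma>)"
      unfolding k1_def k2_def power_divide power_mult_distrib using gamma_pos by auto
    then have "\<beta> * k1\<^sup>2 / 2 + k2\<^sup>2 = 4 * real b * L\<^sup>2 / (1 - rate)\<^sup>2 * (\<beta> / 2 + 2 * \<gamma>)" by (simp add: algebra_simps add_divide_distrib)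
    \<comment> \<open>\<beta> / 2 from T2 and 2 \<gamma> from the noise are together at most 5/2
      times the maximum, the source of the 10 in the hypothesis on \<open>v\<close>.\<close>
    also have "\<dots> \<le> 4 * real b * L\<^sup>2 / (1 - rate)\<^sup>2 * (5 / 2 * max \<beta> \<gamma>)"
      by (intro mult_left_mono) auto
    also have "\<dots> = 10 * real b * L\<^sup>2 * max \<beta> \<gamma> / (1 - rate)\<^sup>2" by simp
    finally show ?thesis using v by linarith
  qed
  have v0: "0 < v"
  proof -
    have "0 < 10 * real b * L\<^sup>2 * max \<beta> \<gamma> / (1 - rate)\<^sup>2"
      using L0 b r1 beta_pos by (intro divide_pos_pos mult_pos_pos) auto
    then show ?thesis using v by linarith
  qed
  have m: "integrable ?S (\<lambda>\<omega>. exp (s * F \<omega>))"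
    "(\<integral>\<omega>. exp (s * F \<omega>) \<partial>?S) \<le> exp (s * (\<integral>\<omega>. F \<omega> \<partial>?S) + s\<^sup>2 * (\<beta> * k1\<^sup>2 / 2 + k2\<^sup>2))" for s
    using lipschitz_product_mgf[OF F k l1 l2] by blast+
  have mgf: "(\<integral>\<omega>. exp (s * F \<omega>) \<partial>?S) \<le> exp (s * (\<integral>\<omega>. F \<omega> \<partial>?S) + s\<^sup>2 * v)" for s
  proof -
    have "s\<^sup>2 * (\<beta> * k1\<^sup>2 / 2 + k2\<^sup>2) \<le> s\<^sup>2 * v" by (intro mult_left_mono kv) auto
    then show ?thesis using m(2)[of s] by (intro order_trans[OF m(2)]) auto
  qed
  note sub = xiN.P.subgaussian_bounds[OF F v0 m(1) mgf]
  show i2: "integrable ?S (\<lambda>\<omega>. (F \<omega>)\<^sup>2)" by (rule sub(2))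
  let ?E = "\<integral>\<omega>. F \<omega> \<partial>?S" and ?E2 = "\<integral>\<omega>. (F \<omega>)\<^sup>2 \<partial>?S"
  have var: "?E2 - ?E\<^sup>2 \<le> 4 * v" "0 \<le> ?E2 - ?E\<^sup>2"
  proof -
    have "xiN.P.variance F = ?E2 - ?E\<^sup>2" using sub(1) i2 by (rule xiN.P.variance_eq)
    moreover have "0 \<le> xiN.P.variance F" by simp
    ultimately show "?E2 - ?E\<^sup>2 \<le> 4 * v" "0 \<le> ?E2 - ?E\<^sup>2" using sub(3) by simp_all
  qed
  have E0: "0 \<le> ?E" unfolding F_def by (rule Bochner_Integration.integral_nonneg) (rule N0)
  have EM: "?E \<le> sqrt (4 * real b * M)"
  proof (rule real_le_rsqrt)
    have "?E2 \<le> (\<integral>\<omega>. 4 * real b * sq_sum n \<omega> \<partial>?S)"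
    proof (rule integral_mono[OF i2])
      show "integrable ?S (\<lambda>\<omega>. 4 * real b * sq_sum n \<omega>)" using integrable_sq_sum[OF Rd_moment2_xi] by simp
      show "(F \<omega>)\<^sup>2 \<le> 4 * real b * sq_sum n \<omega>" for \<omega> unfolding F_def sq_sum_def by (rule N2)
    qed
    also have "\<dots> \<le> 4 * real b * M"
      using integrable_sq_sum[OF Rd_moment2_xi] M by (simp add: mult_left_mono)
    finally show "?E\<^sup>2 \<le> 4 * real b * M" using var by linarith
  qed
  have t0: "0 \<le> t" using v0 p by (simp add: t_def)
  have "xiN.P.prob {\<omega>\<in>space ?S. t * (2 * sqrt (4 * real b * M) + t) + 4 * v < \<bar>(F \<omega>)\<^sup>2 - ?E2\<bar>}
    \<le> xiN.P.prob {\<omega>\<in>space ?S. t < \<bar>F \<omega> - ?E\<bar>}"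
  proof (rule xiN.P.finite_measure_mono)
    show "{\<omega>\<in>space ?S. t < \<bar>F \<omega> - ?E\<bar>} \<in> xiN.P.events" using F by measurable
    show "{\<omega>\<in>space ?S. t * (2 * sqrt (4 * real b * M) + t) + 4 * v < \<bar>(F \<omega>)\<^sup>2 - ?E2\<bar>} \<subseteq> {\<omega>\<in>space ?S. t < \<bar>F \<omega> - ?E\<bar>}"
    proof (safe, rule ccontr)
      fix \<omega> assume big: "t * (2 * sqrt (4 * real b * M) + t) + 4 * v < \<bar>(F \<omega>)\<^sup>2 - ?E2\<bar>"
      assume "\<not> t < \<bar>F \<omega> - ?E\<bar>"
      then have small: "\<bar>F \<omega> - ?E\<bar> \<le> t" by simp
      have sq: "(F \<omega>)\<^sup>2 - ?E\<^sup>2 = (F \<omega> - ?E) * (2 * ?E + (F \<omega> - ?E))" by (simp add: power2_eq_square algebra_simps)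
      have "\<bar>(F \<omega>)\<^sup>2 - ?E\<^sup>2\<bar> \<le> t * (2 * sqrt (4 * real b * M) + t)"
        unfolding sq abs_mult using small E0 EM t0 by (intro mult_mono) auto
      with big var show False by linarith
    qed
  qed
  also have "\<dots> \<le> 2 / p" unfolding t_def by (rule sub(4)[OF p])
  finally show "xiN.P.prob {\<omega>\<in>space ?S. t * (2 * sqrt (4 * real b * M) + t) + 4 * v < \<bar>(F \<omega>)\<^sup>2 - ?E2\<bar>} \<le> 2 / p" .
qed

text \<open>The radius is twice that of one seminorm plus the biases from the initial law, the
  centering and the truncation. Two seminorms with two-sided tails give 4 / p.\<close>

lemma form_concentration:
  assumes L0: "0 < L" and w: "lag_window w" and n: "0 < n" and b: "b = 2 * m" "0 < m" and rm: "rate ^ m \<le> 1 / real n"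
    and \<Lambda>: "L\<^sup>2 * start_dist\<^sup>2 / (1 - rate\<^sup>2) \<le> \<Lambda>" and D: "second_moment h \<le> D"
    and v: "10 * real b * L\<^sup>2 * max \<beta> \<gamma> / (1 - rate)\<^sup>2 \<le> v" and p: "1 < p"
  defines "t \<equiv> 2 * sqrt (v * ln p)" and "M \<equiv> 2 * (real n * D) + 2 * \<Lambda>"
  shows "xiN.P.prob {\<omega>\<in>space (\<xi> \<Otimes>\<^sub>M noise d).
      2 * (t * (2 * sqrt (4 * real b * M) + t) + 4 * v) + 2 * real b * (2 * sqrt (\<Lambda> * (real n * D)) + \<Lambda>)
        + 12 * real b * D / (1 - rate) + 4 * D / (1 - rate)\<^sup>2
      < \<bar>form w b n \<omega> - real n * asymptotic_variance h\<bar>} \<le> 4 / p"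
proof -
  let ?S = "\<xi> \<Otimes>\<^sub>M noise d"
  have b0: "0 < b" using b by simp
  have r1: "0 < 1 - rate" "0 < 1 - rate\<^sup>2" using rate_less by (auto simp: power_less_one_iff)
  have \<Lambda>0: "0 \<le> \<Lambda>"
  proof -
    have "0 \<le> L\<^sup>2 * start_dist\<^sup>2 / (1 - rate\<^sup>2)" using r1 by simp
    then show ?thesis using \<Lambda> by linarith
  qed
  have nD: "real n * second_moment h \<le> real n * D" using D by (intro mult_left_mono) auto
  have M: "(\<integral>\<omega>. sq_sum n \<omega> \<partial>?S) \<le> M" using initial_bias(1)[OF w \<Lambda>, of n] nD unfolding M_def by linarith
  define F1 where "F1 \<omega> = sv_norm w b n (\<lambda>k. h (chain \<omega> k))" for \<omega>
  define F2 where "F2 \<omega> = sd_norm b n (\<lambda>k. h (chain \<omega> k))" for \<omega>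
  have hm: "(\<lambda>\<omega>. h (chain \<omega> k)) \<in> borel_measurable ?S" for k
    using chain_square_integrable(2)[OF Rd_moment2_xi h L] by auto
  have m1: "(\<lambda>\<omega>. sv_norm w b n (\<lambda>k. h (chain \<omega> k))) \<in> borel_measurable ?S"
    unfolding sv_norm_def lag_form_def lag_product_def centered_def L2_set_def using hm by measurable
  have m2: "(\<lambda>\<omega>. sd_norm b n (\<lambda>k. h (chain \<omega> k))) \<in> borel_measurable ?S"
    unfolding sd_norm_def centered_def L2_set_def using hm by measurable
  have sq1: "(sv_norm w b n x)\<^sup>2 \<le> 4 * real b * (\<Sum>k<n. (x k)\<^sup>2)" for x
    using norms_power2_le(1)[OF w, of b n x 0] by simp
  have sq2: "(sd_norm b n x)\<^sup>2 \<le> 4 * real b * (\<Sum>k<n. (x k)\<^sup>2)" for x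
    using norms_power2_le(2)[OF w, of b n x 0] by simp
  note c1 = norm_concentration[OF L0 b0 v sv_norm_lipschitz[OF w] norms_nonneg(1)[OF w] sq1 m1 M p, folded t_def F1_def]
  note c2 = norm_concentration[OF L0 b0 v sd_norm_lipschitz[OF w] norms_nonneg(2)[OF w] sq2 m2 M p, folded t_def F2_def]
  let ?E1 = "\<integral>\<omega>. (F1 \<omega>)\<^sup>2 \<partial>?S" and ?E2 = "\<integral>\<omega>. (F2 \<omega>)\<^sup>2 \<partial>?S"
  let ?T = "t * (2 * sqrt (4 * real b * M) + t) + 4 * v"
  have fm: "form w b n \<omega> = (F1 \<omega>)\<^sup>2 - (F2 \<omega>)\<^sup>2" for \<omega>
    unfolding form_def F1_def F2_def by (rule lag_form_centered_eq[OF w])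
  have Ef: "(\<integral>\<omega>. form w b n \<omega> \<partial>?S) = ?E1 - ?E2" unfolding fm using c1(1) c2(1) by simp
  let ?B1 = "2 * real b * (2 * sqrt (\<Lambda> * (real n * D)) + \<Lambda>)"
    and ?B2 = "12 * real b * D / (1 - rate)" and ?B3 = "4 * D / (1 - rate)\<^sup>2"
  have bias1: "\<bar>(?E1 - ?E2) - (\<integral>\<omega>. form w b n \<omega> \<partial>path)\<bar> \<le> ?B1"
  proof -
    have "\<bar>(?E1 - ?E2) - (\<integral>\<omega>. form w b n \<omega> \<partial>path)\<bar> \<le> 2 * real b * (2 * sqrt (\<Lambda> * (real n * second_moment h)) + \<Lambda>)"
      using initial_bias(2)[OF w \<Lambda>, of b n] unfolding Ef .
    also have "\<dots> \<le> ?B1" using nD \<Lambda>0 D by (intro mult_left_mono add_mono real_sqrt_le_mono) auto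
    finally show ?thesis .
  qed
  have bias2: "\<bar>(\<integral>\<omega>. form w b n \<omega> \<partial>path) - real n * asymptotic_variance h\<bar> \<le> ?B2 + ?B3"
  proof -
    have "12 * real b * second_moment h / (1 - rate) \<le> ?B2" "4 * second_moment h / (1 - rate)\<^sup>2 \<le> ?B3"
      using D r1 by (auto intro!: divide_right_mono mult_left_mono)
    then show ?thesis
      using centering_bias(2)[OF h L mean w n, of b] truncation_bias[OF h L mean w n b rm] unfolding form_def by linarith
  qed
  have "xiN.P.prob {\<omega>\<in>space ?S. 2 * ?T + ?B1 + ?B2 + ?B3 < \<bar>form w b n \<omega> - real n * asymptotic_variance h\<bar>}
    \<le> xiN.P.prob ({\<omega>\<in>space ?S. ?T < \<bar>(F1 \<omega>)\<^sup>2 - ?E1\<bar>} \<union> {\<omega>\<in>space ?S. ?T < \<bar>(F2 \<omega>)\<^sup>2 - ?E2\<bar>})"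
  proof (rule xiN.P.finite_measure_mono)
    have "(\<lambda>\<omega>. (F1 \<omega>)\<^sup>2) \<in> borel_measurable ?S" "(\<lambda>\<omega>. (F2 \<omega>)\<^sup>2) \<in> borel_measurable ?S" using c1(1) c2(1) by auto
    then show "{\<omega>\<in>space ?S. ?T < \<bar>(F1 \<omega>)\<^sup>2 - ?E1\<bar>} \<union> {\<omega>\<in>space ?S. ?T < \<bar>(F2 \<omega>)\<^sup>2 - ?E2\<bar>} \<in> xiN.P.events"
      by measurable
    show "{\<omega>\<in>space ?S. 2 * ?T + ?B1 + ?B2 + ?B3 < \<bar>form w b n \<omega> - real n * asymptotic_variance h\<bar>}
      \<subseteq> {\<omega>\<in>space ?S. ?T < \<bar>(F1 \<omega>)\<^sup>2 - ?E1\<bar>} \<union> {\<omega>\<in>space ?S. ?T < \<bar>(F2 \<omega>)\<^sup>2 - ?E2\<bar>}"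
      using bias1 bias2 unfolding fm by (auto simp: not_less)
  qed
  also have "\<dots> \<le> xiN.P.prob {\<omega>\<in>space ?S. ?T < \<bar>(F1 \<omega>)\<^sup>2 - ?E1\<bar>} + xiN.P.prob {\<omega>\<in>space ?S. ?T < \<bar>(F2 \<omega>)\<^sup>2 - ?E2\<bar>}"
  proof (rule measure_Un_le)
    have "(\<lambda>\<omega>. (F1 \<omega>)\<^sup>2) \<in> borel_measurable ?S" "(\<lambda>\<omega>. (F2 \<omega>)\<^sup>2) \<in> borel_measurable ?S" using c1(1) c2(1) by auto
    then show "{\<omega>\<in>space ?S. ?T < \<bar>(F1 \<omega>)\<^sup>2 - ?E1\<bar>} \<in> xiN.P.events" "{\<omega>\<in>space ?S. ?T < \<bar>(F2 \<omega>)\<^sup>2 - ?E2\<bar>} \<in> xiN.P.events"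
      by measurable
  qed
  also have "\<dots> \<le> 2 / p + 2 / p" by (intro add_mono c1(2) c2(2))
  finally show ?thesis by (simp add: add.assoc)
qed

end

end

section \<open>Selection over the net\<close>

text \<open>Since ln (1 / \<open>Delta2\<close>) \<ge> \<kappa> \<gamma> / 2, half the bandwidth is
  at most 2 ln n / (\<kappa> \<gamma>) + 1. As ln n \<ge> 2/3 and \<kappa> \<gamma> < 1, the 1 from
  rounding is at most 3/2 ln n / (\<kappa> \<gamma>); doubling gives 7.\<close>

lemma bandwidth_bounds:
  assumes k: "0 < \<kappa> * \<gamma>" "\<kappa> * \<gamma> < 1" and n: "2 \<le> n"
  obtains m where "bandwidth \<kappa> \<gamma> n = 2 * m" "0 < m" "Delta2 \<kappa> \<gamma> ^ m \<le> 1 / real n"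
    "real (bandwidth \<kappa> \<gamma> n) \<le> 7 * ln (real n) / (\<kappa> * \<gamma>)"
proof -
  let ?r = "Delta2 \<kappa> \<gamma>" and ?l = "ln (real n)"
  note r = Delta2_bounds[OF k]
  define m where "m = nat \<lceil>?l / ln (1 / ?r)\<rceil>"
  have l: "2 / 3 \<le> ?l"
    using ln2_ge_two_thirds n ln_mono[of 2 "real n"] by linarith
  have lr: "\<kappa> * \<gamma> / 2 \<le> ln (1 / ?r)"
  proof -
    have "ln ((?r)\<^sup>2) \<le> (?r)\<^sup>2 - 1" using r k by (intro ln_le_minus_one) auto
    moreover have "ln (?r\<^sup>2) = real 2 * ln ?r" by (rule ln_realpow)
    ultimately have "2 * ln ?r \<le> - (\<kappa> * \<gamma>)" unfolding r(3) by simp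
    then show ?thesis using r by (simp add: ln_div)
  qed
  then have lr0: "0 < ln (1 / ?r)" using k by linarith
  have q0: "0 < ?l / ln (1 / ?r)" using l lr0 by (intro divide_pos_pos) auto
  then have m0: "0 < m" by (simp add: m_def)
  have mge: "?l / ln (1 / ?r) \<le> real m" and mle: "real m \<le> ?l / ln (1 / ?r) + 1"
    using q0 unfolding m_def by linarith+
  have "?l \<le> real m * ln (1 / ?r)" using mge lr0 by (simp add: divide_le_eq)
  then have "ln (?r ^ m) \<le> ln (1 / real n)"
    using r n by (simp add: ln_realpow ln_div)
  then have rm: "?r ^ m \<le> 1 / real n"
    using r n by (subst (asm) ln_le_cancel_iff) auto
  have "?l / ln (1 / ?r) \<le> ?l / (\<kappa> * \<gamma> / 2)" using lr l k by (intro divide_left_mono) auto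
  then have "real m \<le> 2 * ?l / (\<kappa> * \<gamma>) + 1" using mle by (simp add: mult.commute)
  moreover have "1 \<le> 3 / 2 * ?l / (\<kappa> * \<gamma>)"
  proof -
    have "\<kappa> * \<gamma> \<le> 3 / 2 * ?l" using l k by linarith
    then show ?thesis using k by (simp add: le_divide_eq)
  qed
  ultimately have "real m \<le> 7 / 2 * ?l / (\<kappa> * \<gamma>)" by (simp add: field_simps)
  then have "2 * real m \<le> 2 * (7 / 2 * ?l / (\<kappa> * \<gamma>))" by (rule mult_left_mono) simp
  moreover have bm: "bandwidth \<kappa> \<gamma> n = 2 * m" by (simp add: bandwidth_def m_def)
  ultimately have "real (bandwidth \<kappa> \<gamma> n) \<le> 7 * ?l / (\<kappa> * \<gamma>)"
    by (simp add: mult.commute)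
  with bm m0 rm show thesis by (rule that)
qed

text \<open>Here \<open>k\<close> stands for \<open>\<kappa> * \<gamma>\<close>, \<open>r1\<close> for \<open>1 - Delta2 \<kappa> \<gamma>\<close>, \<open>B\<close> for \<open>max \<beta> \<gamma>\<close> and \<open>q\<close> for
  \<open>ln (card H\<^sub>\<epsilon> / \<delta>)\<close>.\<close>

lemma rate_bound:
  fixes n :: nat and L B D R S k r1 b l q \<Lambda> :: real
  assumes n: "2 \<le> n" and L: "0 \<le> L" and B: "0 \<le> B" and D: "0 \<le> D" and R: "0 \<le> R" and DS: "D \<le> S"
    and k: "0 < k" "k < 1" and r1: "k / 2 \<le> r1" "r1 \<le> 1" and b: "0 \<le> b" "b \<le> 7 * l / k"
    and l: "2 / 3 \<le> l" and q: "2 / 3 \<le> q" and lnp: "0 \<le> lnp" "lnp \<le> 3 * q" and \<Lambda>: "0 \<le> \<Lambda>" "\<Lambda> \<le> R / 2"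
  defines "v \<equiv> 280 * l * L\<^sup>2 * B / k ^ 3"
  defines "t \<equiv> 2 * sqrt (v * lnp)" and "M \<equiv> 2 * (real n * D) + 2 * \<Lambda>"
  shows "10 * b * L\<^sup>2 * B / r1\<^sup>2 \<le> v"
    "(2 * (t * (2 * sqrt (4 * b * M) + t) + 4 * v) + 2 * b * (2 * sqrt (\<Lambda> * (real n * D)) + \<Lambda>)
        + 12 * b * D / r1 + 4 * D / r1\<^sup>2) / real n
      \<le> 20000 * ((L * sqrt (B * (D + R)) / k\<^sup>2 + sqrt (D * R) / k) * sqrt (l\<^sup>2 * q / real n)
        + (L\<^sup>2 * B / k ^ 4 + R / k + S / k\<^sup>2) * (l\<^sup>2 * q / real n))"
proof -
  define N where "N = real n"
  have N: "2 \<le> N" using n by (simp add: N_def)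
  have l0: "0 \<le> l" and q0: "0 \<le> q" using l q by auto
  have r0: "0 < r1" using k r1 by linarith
  have S0: "0 \<le> S" using D DS by linarith
  have r2: "1 / r1 \<le> 2 / k" using r1 k r0 by (simp add: field_simps)
  have r22: "1 / r1\<^sup>2 \<le> 4 / k\<^sup>2"
    using power_mono[OF r2, of 2] r0 by (simp add: power_divide)
  have v0: "0 \<le> v" using l0 B k by (simp add: v_def)
  \<comment> \<open>280 = 10 * 7 * 4: the bandwidth contributes 7 l / k and the square of 1 / r1
    contributes 4 / k^2.\<close>
  show "10 * b * L\<^sup>2 * B / r1\<^sup>2 \<le> v"
  proof -
    have "10 * b * L\<^sup>2 * B / r1\<^sup>2 = (10 * b) * (L\<^sup>2 * B) * (1 / r1\<^sup>2)" by simp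
    also have "\<dots> \<le> (10 * (7 * l / k)) * (L\<^sup>2 * B) * (4 / k\<^sup>2)"
      using b B l0 k r22 by (intro mult_mono) auto
    also have "\<dots> = v" using k by (simp add: v_def power2_eq_square power3_eq_cube)
    finally show ?thesis .
  qed
  \<comment> \<open>The lower bounds on l and q let a lone power of l, and the constant 1, be
    absorbed into l^2 q. They come from n \<ge> 2 and from a net of at least two points.\<close>
  have lq: "l \<le> 9 / 4 * (l\<^sup>2 * q)" "1 \<le> 27 / 8 * (l\<^sup>2 * q)"
  proof -
    have "(2 / 3) * (2 / 3) \<le> l * q" using l q by (intro mult_mono) auto
    then have lq: "4 / 9 \<le> l * q" by simp
    have "l * (4 / 9) \<le> l * (l * q)" using lq l0 by (rule mult_left_mono)
    then show 1: "l \<le> 9 / 4 * (l\<^sup>2 * q)" by (simp add: power2_eq_square mult.assoc)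
    then show "1 \<le> 27 / 8 * (l\<^sup>2 * q)" using l by linarith
  qed
  define X where "X = sqrt (l\<^sup>2 * q / N)"
  define Y where "Y = l\<^sup>2 * q / N"
  have X: "X = l * sqrt (q / N)"
  proof -
    have "l\<^sup>2 * q / N = l\<^sup>2 * (q / N)" by simp
    then show ?thesis unfolding X_def using l0 by (simp only: real_sqrt_mult real_sqrt_abs abs_of_nonneg)
  qed
  have X0: "0 \<le> X" and Y0: "0 \<le> Y" using q0 N by (auto simp: X_def Y_def)
  \<comment> \<open>The main fluctuation term, the deviation times the size of the seminorm. 62500 =
    250^2 rounds 47040 up to a square.\<close>
  have T1: "2 * t * (2 * sqrt (4 * b * M)) / N \<le> 2000 * (L * sqrt (B * (D + R)) / k\<^sup>2 * X)"
  proof -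
    have M: "M \<le> 2 * (N * (D + R))"
    proof -
      have "R \<le> N * R" using N R by (simp add: mult_le_cancel_right1)
      then show ?thesis using \<Lambda> R by (simp add: M_def N_def algebra_simps)
    qed
    have M0: "0 \<le> M" using D \<Lambda> by (simp add: M_def)
    have "v * lnp * (4 * b * M) \<le> (v * (3 * q)) * (4 * (7 * l / k) * (2 * (N * (D + R))))"
      using v0 lnp b M M0 q0 by (intro mult_mono) auto
    also have "\<dots> = 47040 * (l\<^sup>2 * L\<^sup>2 * (B * (D + R)) / k ^ 4 * (q * N))"
      using k by (simp add: v_def power2_eq_square eval_nat_numeral field_simps)
    also have "\<dots> \<le> 62500 * (l\<^sup>2 * L\<^sup>2 * (B * (D + R)) / k ^ 4 * (q * N))"
      using B D R q0 N by (intro mult_right_mono) auto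
    also have "\<dots> = (250 * (l * L * sqrt (B * (D + R)) / k\<^sup>2 * sqrt (q * N)))\<^sup>2"
      using B D R q0 N by (simp add: power_mult_distrib power_divide flip: power_mult)
    finally have "sqrt (v * lnp * (4 * b * M)) \<le> 250 * (l * L * sqrt (B * (D + R)) / k\<^sup>2 * sqrt (q * N))"
      using B D R q0 N l0 L v0 lnp b M0 by (intro real_le_lsqrt) auto
    then have "2 * t * (2 * sqrt (4 * b * M)) / N \<le> 8 * (250 * (l * L * sqrt (B * (D + R)) / k\<^sup>2 * sqrt (q * N))) / N"
      using N by (intro divide_right_mono) (auto simp: t_def real_sqrt_mult)
    also have "\<dots> = 2000 * (L * sqrt (B * (D + R)) / k\<^sup>2 * (l * (sqrt (q * N) / N)))" by simp
    also have "sqrt (q * N) / N = sqrt (q / N)"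
      using N by (simp add: real_sqrt_mult real_sqrt_divide field_simps)
    finally show ?thesis unfolding X .
  qed
  have k34: "1 / k ^ 3 \<le> 1 / k ^ 4" using k by (intro divide_left_mono power_decreasing) auto
  have LB: "0 \<le> L\<^sup>2 * B" using B by simp
  have vb: "v \<le> 280 * l * (L\<^sup>2 * B / k ^ 4)"
  proof -
    have "v = 280 * l * (L\<^sup>2 * B) * (1 / k ^ 3)" by (simp add: v_def)
    also have "\<dots> \<le> 280 * l * (L\<^sup>2 * B) * (1 / k ^ 4)" using l0 LB by (intro mult_left_mono k34) auto
    finally show ?thesis by simp
  qed
  have G0: "0 \<le> L\<^sup>2 * B / k ^ 4" using LB k by simp
  have T2: "2 * t\<^sup>2 / N \<le> 10080 * (L\<^sup>2 * B / k ^ 4 * Y)"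
  proof -
    have "t\<^sup>2 = 4 * (v * lnp)" using v0 lnp by (simp add: t_def power_mult_distrib)
    also have "\<dots> \<le> 4 * ((280 * l * (L\<^sup>2 * B / k ^ 4)) * (3 * q))"
      using vb v0 lnp by (intro mult_left_mono mult_mono) auto
    also have "\<dots> = 3360 * (L\<^sup>2 * B / k ^ 4) * (l * q)" by simp
    also have "\<dots> \<le> 3360 * (L\<^sup>2 * B / k ^ 4) * (3 / 2 * (l\<^sup>2 * q))"
    proof (rule mult_left_mono)
      have "l * 1 \<le> l * (3 / 2 * l)" using l l0 by (intro mult_left_mono) auto
      then have "l * q \<le> (l * (3 / 2 * l)) * q" using q0 by (intro mult_right_mono) auto
      then show "l * q \<le> 3 / 2 * (l\<^sup>2 * q)" by (simp add: power2_eq_square)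
    qed (use G0 in simp)
    also have "\<dots> = 5040 * (L\<^sup>2 * B / k ^ 4 * (l\<^sup>2 * q))" by simp
    finally have "2 * t\<^sup>2 / N \<le> 2 * (5040 * (L\<^sup>2 * B / k ^ 4 * (l\<^sup>2 * q))) / N" using N by (intro divide_right_mono) auto
    then show ?thesis by (simp add: Y_def)
  qed
  have T3: "8 * v / N \<le> 5040 * (L\<^sup>2 * B / k ^ 4 * Y)"
  proof -
    have "8 * v \<le> 8 * (280 * l * (L\<^sup>2 * B / k ^ 4))" using vb by (rule mult_left_mono) simp
    also have "\<dots> = 2240 * (L\<^sup>2 * B / k ^ 4) * l" by simp
    also have "\<dots> \<le> 2240 * (L\<^sup>2 * B / k ^ 4) * (9 / 4 * (l\<^sup>2 * q))" using G0 lq by (intro mult_left_mono) auto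
    also have "\<dots> = 5040 * (L\<^sup>2 * B / k ^ 4 * (l\<^sup>2 * q))" by simp
    finally have "8 * v / N \<le> 5040 * (L\<^sup>2 * B / k ^ 4 * (l\<^sup>2 * q)) / N" using N by (intro divide_right_mono) auto
    then show ?thesis by (simp add: Y_def)
  qed
  \<comment> \<open>The cross term contains no q, so sqrt N / N is compared with sqrt (q / N), using
    q \<ge> 2/3 > 4/9.\<close>
  have T4: "2 * b * (2 * sqrt (\<Lambda> * (N * D))) / N \<le> 50 * (sqrt (D * R) / k * X)"
  proof -
    have "\<Lambda> * (N * D) \<le> R * (N * D)" using \<Lambda> R N D by (intro mult_right_mono) auto
    then have "sqrt (\<Lambda> * (N * D)) \<le> sqrt (D * R) * sqrt N"
      unfolding real_sqrt_mult[symmetric] by (simp add: mult_ac)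
    then have "2 * b * (2 * sqrt (\<Lambda> * (N * D))) \<le> 2 * (7 * l / k) * (2 * (sqrt (D * R) * sqrt N))"
      using b D R N \<Lambda> k l0 by (intro mult_mono) auto
    then have "2 * b * (2 * sqrt (\<Lambda> * (N * D))) / N \<le> 2 * (7 * l / k) * (2 * (sqrt (D * R) * sqrt N)) / N"
      using N by (intro divide_right_mono) auto
    also have "\<dots> = 28 * (sqrt (D * R) / k) * (l * (sqrt N / N))" by simp
    also have "\<dots> \<le> 28 * (sqrt (D * R) / k) * (l * (3 / 2 * sqrt (q / N)))"
    proof (intro mult_left_mono)
      have "sqrt N / N = sqrt (1 / N)" using N by (simp add: real_sqrt_divide field_simps)
      also have "\<dots> \<le> sqrt (9 / 4 * (q / N))"
        using q N by (intro real_sqrt_le_mono) (simp add: divide_simps)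
      also have "\<dots> = 3 / 2 * sqrt (q / N)" unfolding real_sqrt_mult by (simp add: real_sqrt_divide)
      finally show "sqrt N / N \<le> 3 / 2 * sqrt (q / N)" .
    qed (use D R k l0 in auto)
    also have "\<dots> = 42 * (sqrt (D * R) / k * X)" by (simp add: X)
    also have "\<dots> \<le> 50 * (sqrt (D * R) / k * X)" using D R k X0 by (intro mult_right_mono) auto
    finally show ?thesis .
  qed
  have T5: "2 * b * \<Lambda> / N \<le> 16 * (R / k * Y)"
  proof -
    have "2 * b * \<Lambda> \<le> 2 * (7 * l / k) * (R / 2)" using b \<Lambda> k l0 by (intro mult_mono) auto
    also have "\<dots> = 7 * (R / k) * l" by simp
    also have "\<dots> \<le> 7 * (R / k) * (9 / 4 * (l\<^sup>2 * q))" using R k lq by (intro mult_left_mono) auto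
    also have "\<dots> = 63 / 4 * (R / k * (l\<^sup>2 * q))" by simp
    also have "\<dots> \<le> 16 * (R / k * (l\<^sup>2 * q))" using R k q0 by (intro mult_right_mono) auto
    finally have "2 * b * \<Lambda> / N \<le> 16 * (R / k * (l\<^sup>2 * q)) / N" using N by (intro divide_right_mono) auto
    then show ?thesis by (simp add: Y_def)
  qed
  have T6: "12 * b * D / r1 / N \<le> 378 * (S / k\<^sup>2 * Y)"
  proof -
    have "12 * b * D / r1 = (12 * b) * D * (1 / r1)" by simp
    also have "\<dots> \<le> (12 * (7 * l / k)) * S * (2 / k)" using b D DS S0 r2 r0 l0 k by (intro mult_mono) auto
    also have "\<dots> = 168 * (S / k\<^sup>2) * l" by (simp add: power2_eq_square)
    also have "\<dots> \<le> 168 * (S / k\<^sup>2) * (9 / 4 * (l\<^sup>2 * q))" using S0 k lq by (intro mult_left_mono) auto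
    also have "\<dots> = 378 * (S / k\<^sup>2 * (l\<^sup>2 * q))" by simp
    finally have "12 * b * D / r1 / N \<le> 378 * (S / k\<^sup>2 * (l\<^sup>2 * q)) / N" using N by (intro divide_right_mono) auto
    then show ?thesis by (simp add: Y_def)
  qed
  have T7: "4 * D / r1\<^sup>2 / N \<le> 54 * (S / k\<^sup>2 * Y)"
  proof -
    have "4 * D / r1\<^sup>2 = (4 * D) * (1 / r1\<^sup>2)" by simp
    also have "\<dots> \<le> (4 * S) * (4 / k\<^sup>2)" using D DS S0 r22 by (intro mult_mono) auto
    also have "\<dots> = 16 * (S / k\<^sup>2) * 1" by simp
    also have "\<dots> \<le> 16 * (S / k\<^sup>2) * (27 / 8 * (l\<^sup>2 * q))" using S0 k lq by (intro mult_left_mono) auto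
    also have "\<dots> = 54 * (S / k\<^sup>2 * (l\<^sup>2 * q))" by simp
    finally have "4 * D / r1\<^sup>2 / N \<le> 54 * (S / k\<^sup>2 * (l\<^sup>2 * q)) / N" using N by (intro divide_right_mono) auto
    then show ?thesis by (simp add: Y_def)
  qed
  define a1 where "a1 = L * sqrt (B * (D + R)) / k\<^sup>2 * X"
  define a2 where "a2 = sqrt (D * R) / k * X"
  define a3 where "a3 = L\<^sup>2 * B / k ^ 4 * Y"
  define a4 where "a4 = R / k * Y"
  define a5 where "a5 = S / k\<^sup>2 * Y"
  have pos: "0 \<le> a1" "0 \<le> a2" "0 \<le> a3" "0 \<le> a4" "0 \<le> a5"
    using L B D R k X0 Y0 G0 S0 by (auto simp: a1_def a2_def a3_def a4_def a5_def)
  have "(2 * (t * (2 * sqrt (4 * b * M) + t) + 4 * v) + 2 * b * (2 * sqrt (\<Lambda> * (N * D)) + \<Lambda>)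
        + 12 * b * D / r1 + 4 * D / r1\<^sup>2) / N
    = 2 * t * (2 * sqrt (4 * b * M)) / N + 2 * t\<^sup>2 / N + 8 * v / N + 2 * b * (2 * sqrt (\<Lambda> * (N * D))) / N
      + 2 * b * \<Lambda> / N + 12 * b * D / r1 / N + 4 * D / r1\<^sup>2 / N"
    by (simp add: add_divide_distrib distrib_left power2_eq_square)
  also have "\<dots> \<le> 2000 * a1 + 10080 * a3 + 5040 * a3 + 50 * a2 + 16 * a4 + 378 * a5 + 54 * a5"
    unfolding a1_def a2_def a3_def a4_def a5_def by (intro add_mono T1 T2 T3 T4 T5 T6 T7)
  \<comment> \<open>The largest total coefficient is 10080 + 5040, that of
    \<open>a3\<close>.\<close>
  also have "\<dots> \<le> 20000 * (a1 + a2 + (a3 + a4 + a5))" using pos by simp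
  also have "a1 + a2 + (a3 + a4 + a5) = (L * sqrt (B * (D + R)) / k\<^sup>2 + sqrt (D * R) / k) * X + (L\<^sup>2 * B / k ^ 4 + R / k + S / k\<^sup>2) * Y"
    by (simp add: a1_def a2_def a3_def a4_def a5_def distrib_right)
  finally show "(2 * (t * (2 * sqrt (4 * b * M) + t) + 4 * v) + 2 * b * (2 * sqrt (\<Lambda> * (real n * D)) + \<Lambda>)
        + 12 * b * D / r1 + 4 * D / r1\<^sup>2) / real n
      \<le> 20000 * ((L * sqrt (B * (D + R)) / k\<^sup>2 + sqrt (D * R) / k) * sqrt (l\<^sup>2 * q / real n)
        + (L\<^sup>2 * B / k ^ 4 + R / k + S / k\<^sup>2) * (l\<^sup>2 * q / real n))"
    unfolding N_def X_def Y_def .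
qed


context ula_estimation begin

text \<open>40000 is twice the 20000 of \<open>rate_bound\<close>: the deviation enters once at the
  selected function and once at the net point near a competitor. Quantifying over all minimizers
  avoids a measurable choice of one.\<close>

lemma selection_bound:
  fixes f :: "(nat \<Rightarrow> real) \<Rightarrow> real" and G H N :: "((nat \<Rightarrow> real) \<Rightarrow> real) set" and L \<epsilon> \<delta> :: real and n :: nat
  defines "\<kappa> \<equiv> ula_kappa L\<^sub>U m\<^sub>U"
  defines "D \<equiv> sup_variance \<pi> H" and "R \<equiv> const_R d L \<kappa> \<gamma> \<xi> \<pi>" and "S \<equiv> const_sigma d L \<pi> H"
  defines "q \<equiv> ln (real (card N) / \<delta>)"
  assumes d: "1 \<le> d" and G: "\<forall>g\<in>G. integrable \<pi> g \<and> (\<integral>x. g x \<partial>\<pi>) = 0"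
    and H: "H = {(\<lambda>x. f x - g x) |g. g \<in> G}" and Hlip: "H \<subseteq> lipschitz L"
    and w: "lag_window w" and n: "2 \<le> n" and \<epsilon>: "0 < \<epsilon>" and \<delta>: "0 < \<delta>" "\<delta> < 1"
    and net: "minimal_eps_net \<pi> H \<epsilon> N"
  shows "\<P>(\<omega> in ula_space d \<xi>.
          \<forall>h_hat. is_arg_min (spectral_variance w (bandwidth \<kappa> \<gamma> n) n (chain \<omega>)) (\<lambda>h. h \<in> N) h_hat \<longrightarrow>
            V_infinity d U \<gamma> \<pi> f h_hat - (INF h\<in>H. V_infinity d U \<gamma> \<pi> f h)
            \<le> 40000 * (const_C1 \<kappa> \<gamma> D R * \<epsilon> * ln (real n) +
                   const_C2 L \<beta> \<kappa> \<gamma> D R * sqrt ((ln (real n))\<^sup>2 * q / real n) +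
                   const_C3 L \<beta> \<kappa> \<gamma> R S * ((ln (real n))\<^sup>2 * q / real n)))
      \<ge> 1 - \<delta>"
proof -
  let ?S = "\<xi> \<Otimes>\<^sub>M noise d"
  define b where "b = bandwidth \<kappa> \<gamma> n"
  define k where "k = \<kappa> * \<gamma>"
  define l where "l = ln (real n)"
  define B where "B = max \<beta> \<gamma>"
  define C1 where "C1 = const_C1 \<kappa> \<gamma> D R"
  define C2 where "C2 = const_C2 L \<beta> \<kappa> \<gamma> D R"
  define C3 where "C3 = const_C3 L \<beta> \<kappa> \<gamma> R S"
  define X where "X = sqrt (l\<^sup>2 * q / real n)"
  define Y where "Y = l\<^sup>2 * q / real n"
  define V where "V h = V_infinity d U \<gamma> \<pi> f h" for h
  define Vn where "Vn \<omega> = spectral_variance w b n (chain \<omega>)" for \<omega>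
  define bound where "bound = 40000 * (C1 * \<epsilon> * l + C2 * X + C3 * Y)"
  define good where "good hh \<longleftrightarrow> V hh - (INF h\<in>H. V h) \<le> bound" for hh
  define E where "E = {\<omega>\<in>space ?S. \<forall>hh. is_arg_min (Vn \<omega>) (\<lambda>h. h \<in> N) hh \<longrightarrow> good hh}"
  have k: "0 < k" "k < 1" using kappa_gamma by (simp_all add: k_def \<kappa>_def)
  have rate: "rate = Delta2 \<kappa> \<gamma>" by (simp add: \<kappa>_def)
  have r1: "k / 2 \<le> 1 - rate" "1 - rate \<le> 1" "0 < 1 - rate" using rate_bounds rate_less by (simp_all add: k_def \<kappa>_def)
  have l: "2 / 3 \<le> l" using ln2_ge_two_thirds n ln_mono[of 2 "real n"] unfolding l_def by linarith
  have B: "0 \<le> B" using beta_pos by (simp add: B_def)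
  have N: "finite N" "N \<subseteq> H" and cover: "\<And>h. h \<in> H \<Longrightarrow> \<exists>h'\<in>N. L2_dist \<pi> h h' \<le> \<epsilon>"
    using net by (auto simp: minimal_eps_net_def eps_net_def)
  \<comment> \<open>In the deterministic cases the event is the entire space, so its probability is
    1 without any concentration.\<close>
  have whole: ?thesis if "\<And>hh. hh \<in> N \<Longrightarrow> good hh"
  proof -
    have "E = space ?S" using that by (auto simp: E_def is_arg_min_def)
    then have "measure ?S E = 1" by (simp add: xiN.P.prob_space)
    then show ?thesis
      using \<delta> by (simp add: E_def good_def Vn_def V_def bound_def b_def C1_def C2_def C3_def X_def Y_def l_def ula_space_eq)
  qed
  show ?thesis
  proof (cases "H = {}")
    case True
    then show ?thesis using N by (intro whole) auto
  next
    case False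
    interpret pi2: Rd_moment2 \<pi> d by (rule Rd_moment2_pi)
    obtain h0 where h0: "h0 \<in> H" using False by auto
    have L: "0 \<le> L" using Lip_nonneg_const[OF d] Hlip h0 by blast
    note ih = pi_lipschitz_integrable[OF subsetD[OF Hlip]]
    define c where "c = (\<integral>x. f x \<partial>\<pi>)"
    have fi: "integrable \<pi> f"
    proof -
      obtain g where g: "g \<in> G" "h0 = (\<lambda>x. f x - g x)" using h0 H by auto
      have "integrable \<pi> (\<lambda>x. h0 x + g x)" using ih(2)[OF h0] G g by (intro Bochner_Integration.integrable_add) auto
      then show ?thesis by (simp add: g)
    qed
    have mean: "(\<integral>x. h x \<partial>\<pi>) = c" if "h \<in> H" for h
      using that G fi unfolding H c_def by auto
    define cen where "cen h = (\<lambda>x. h x - c)" for h :: "(nat \<Rightarrow> real) \<Rightarrow> real"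
    have clip: "cen h \<in> lipschitz L" if "h \<in> H" for h
      using subsetD[OF Hlip that] by (simp add: Lip_def cen_def)
    have cmean: "(\<integral>x. cen h x \<partial>\<pi>) = 0" if "h \<in> H" for h
      using mean[OF that] ih(2)[OF that] pi.prob_space by (simp add: cen_def)
    have var: "second_moment (cen h) = pi.variance h" if "h \<in> H" for h
      unfolding second_moment_def[OF clip[OF that] L cmean[OF that]] using mean[OF that] by (simp add: cen_def)
    define s where "s = enn2real (W2_spread d \<pi>)"
    have s0: "0 \<le> s" by (simp add: s_def)
    have vle: "pi.variance h \<le> (L * s)\<^sup>2" if "h \<in> H" for h
      unfolding s_def by (rule pi2.variance_le_spread[OF subsetD[OF Hlip that] L])
    have bdd: "bdd_above (pi.variance ` H)" by (rule bdd_aboveI[of _ "(L * s)\<^sup>2"]) (auto intro: vle)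
    have Dge: "second_moment (cen h) \<le> D" if "h \<in> H" for h
      unfolding var[OF that] D_def sup_variance_def using that bdd by (rule cSUP_upper)
    have D0: "0 \<le> D"
      using Dge[OF h0] second_moment_nonneg[OF clip[OF h0] L cmean[OF h0]] by linarith
    have "D \<le> (L * s)\<^sup>2"
      unfolding D_def sup_variance_def by (rule cSUP_least[OF False]) (rule vle)
    then have sD: "sqrt D \<le> L * s" using L s0 by (intro real_le_lsqrt) auto
    \<comment> \<open>This charges the centering and truncation biases, which are proportional to D,
      to the \<open>const_sigma\<close> term of \<open>const_C3\<close>.\<close>
    have DS: "D \<le> S"
    proof -
      have "D = sqrt D * sqrt D" using D0 by simp
      also have "\<dots> \<le> (L * s) * sqrt D" using sD by (rule mult_right_mono) (use D0 in simp)
      also have "\<dots> = S" by (simp add: S_def const_sigma_def s_def D_def)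
      finally show ?thesis .
    qed
    define A where "A = enn2real (const_A1 d \<xi> \<pi>)"
    have A: "2 * start_dist \<le> A" unfolding A_def by (rule pi2.const_A1_bounds[OF Rd_moment2_xi])
    have Req: "R = A * L\<^sup>2 * (1 / (1 - rate)) * start_dist"
      by (simp add: R_def const_R_def A_def rate inverse_eq_divide)
    have A0: "0 \<le> A" by (simp add: A_def)
    have R0: "0 \<le> R" using r1 A0 by (simp add: Req)
    \<comment> \<open>One factor of the squared distance is bounded through the summand of
      \<open>const_A1\<close> that contains it; the coefficient 2 there gives R / 2.\<close>
    have \<Lambda>: "L\<^sup>2 * start_dist\<^sup>2 / (1 - rate\<^sup>2) \<le> R / 2"
    proof -
      have rr: "1 - rate \<le> 1 - rate\<^sup>2" using rate_less by (simp add: power2_eq_square mult_left_le)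
      have "L\<^sup>2 * start_dist\<^sup>2 / (1 - rate\<^sup>2) \<le> L\<^sup>2 * start_dist\<^sup>2 / (1 - rate)"
        using rr r1 by (intro divide_left_mono) auto
      also have "\<dots> = start_dist * (L\<^sup>2 * (1 / (1 - rate)) * start_dist)" by (simp add: power2_eq_square)
      also have "\<dots> \<le> (A / 2) * (L\<^sup>2 * (1 / (1 - rate)) * start_dist)"
        using A r1 by (intro mult_right_mono) auto
      also have "\<dots> = R / 2" by (simp only: Req mult.assoc times_divide_eq_left)
      finally show ?thesis .
    qed
    have C1: "C1 = (sqrt R + sqrt D) / k"
      and C2: "C2 = L * sqrt (B * (D + R)) / k\<^sup>2 + sqrt (D * R) / k"
      and C3: "C3 = L\<^sup>2 * B / k ^ 4 + R / k + S / k\<^sup>2"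
      by (simp_all add: C1_def C2_def C3_def const_C1_def const_C2_def const_C3_def k_def B_def power_mult_distrib)
    have S0: "0 \<le> S" using D0 DS by linarith
    have Cpos: "0 \<le> C1" "0 \<le> C2" "0 \<le> C3"
      unfolding C1 C2 C3 using R0 D0 k L B S0 by auto
    have "N \<noteq> {}" using cover[OF h0] by auto
    then have card1: "1 \<le> card N" using N by (simp add: Suc_le_eq card_gt_0_iff)
    have q0: "0 \<le> q"
      unfolding q_def using card1 \<delta> by (intro ln_ge_zero) (simp add: le_divide_eq)
    have XY: "0 \<le> X" "0 \<le> Y" using q0 by (auto simp: X_def Y_def)
    have Veq: "V h = asymptotic_variance (cen h)" if "h \<in> H" for h
    proof -
      have "V h = (\<Sum>\<^sub>\<infinity>j\<in>(UNIV :: int set). autocov (cen h) (nat \<bar>j\<bar>))"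
        by (simp add: V_def V_infinity_def autocov_def cen_def c_def ula_space_eq)
      also have "\<dots> = 2 * (\<Sum>j. autocov (cen h) j) - autocov (cen h) 0"
        by (rule infsum_int_abs[OF summable_autocov(1)[OF clip[OF that] L cmean[OF that]]])
      finally show ?thesis unfolding asymptotic_variance_def[OF clip[OF that] L cmean[OF that]] .
    qed
    \<comment> \<open>The 12 is 6 divided by the 1/2 in 1 - rate \<ge> k / 2. Then l \<ge> 2/3
      inserts the factor ln n, and 18 = 12 * 3/2.\<close>
    have close: "V h' - V h \<le> 18 * (C1 * \<epsilon> * l)" if h: "h \<in> H" and h': "h' \<in> N" and dist: "L2_dist \<pi> h h' \<le> \<epsilon>" for h h'
    proof -
      have h'H: "h' \<in> H" using h' N by auto
      have e: "sqrt (\<integral>x. (cen h x - cen h' x)\<^sup>2 \<partial>\<pi>) \<le> \<epsilon>" using dist by (simp add: L2_dist_def cen_def)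
      have "\<bar>asymptotic_variance (cen h) - asymptotic_variance (cen h')\<bar> \<le> 6 * (\<epsilon> * sqrt D) / (1 - rate)"
        using Dge[OF h] Dge[OF h'H]
        by (intro asymptotic_variance_diff_le[OF clip[OF h] clip[OF h'H] L cmean[OF h] cmean[OF h'H] _ _ e])
           (simp_all add: second_moment_def[OF clip[OF h] L cmean[OF h]] second_moment_def[OF clip[OF h'H] L cmean[OF h'H]])
      then have "V h' - V h \<le> 6 * (\<epsilon> * sqrt D) / (1 - rate)" unfolding Veq[OF h] Veq[OF h'H] by linarith
      also have "\<dots> \<le> 6 * (\<epsilon> * sqrt D) / (k / 2)" using r1 k \<epsilon> D0 by (intro divide_left_mono) auto
      also have "\<dots> = 12 * (sqrt D / k * \<epsilon>) * 1" by simp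
      also have "\<dots> \<le> 12 * (C1 * \<epsilon>) * (3 / 2 * l)"
        using l k D0 R0 \<epsilon> Cpos(1) unfolding C1
        by (intro mult_mono mult_left_mono mult_right_mono divide_right_mono) auto
      finally show ?thesis by simp
    qed
    \<comment> \<open>Competitors are compared one by one, since the infimum over \<open>H\<close>
      need not be attained.\<close>
    have goodI: "good hh" if "\<And>h. h \<in> H \<Longrightarrow> V hh - V h \<le> bound" for hh
    proof -
      have "V hh - bound \<le> (INF h\<in>H. V h)"
        by (rule cINF_greatest[OF False]) (use that in \<open>simp add: algebra_simps\<close>)
      then show ?thesis by (simp add: good_def)
    qed
    have bound_ge: "18 * (C1 * \<epsilon> * l) + 40000 * (C2 * X + C3 * Y) \<le> bound"
    proof -
      have "0 \<le> C1 * \<epsilon> * l" using Cpos \<epsilon> l by simp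
      then show ?thesis by (simp add: bound_def)
    qed
    have tail0: "0 \<le> C2 * X + C3 * Y" using Cpos XY by simp
    show ?thesis
    \<comment> \<open>In the first case all net points are good for every outcome: a single net
      point is close to every function, and L = 0 makes all asymptotic variances vanish. Otherwise L
      > 0, as \<open>form_concentration\<close> requires.\<close>
    proof (cases "card N = 1 \<or> L = 0")
      case True
      show ?thesis
      proof (intro whole goodI)
        fix hh h assume hh: "hh \<in> N" and h: "h \<in> H"
        show "V hh - V h \<le> bound"
        proof (cases "L = 0")
          case True
          then have "D = 0" using D0 sD by simp
          have "V h' = 0" if "h' \<in> H" for h'
          proof -
            have "second_moment (cen h') = 0"
              using Dge[OF that] second_moment_nonneg[OF clip[OF that] L cmean[OF that]] \<open>D = 0\<close> by linarith
            then show ?thesis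
              using asymptotic_variance_le[OF clip[OF that] L cmean[OF that]] unfolding Veq[OF that] by simp
          qed
          moreover have "0 \<le> 18 * (C1 * \<epsilon> * l)" using Cpos \<epsilon> l by simp
          ultimately show ?thesis using bound_ge tail0 h hh N by auto
        next
          case False
          then have "card N = 1" using \<open>card N = 1 \<or> L = 0\<close> by simp
          then obtain x where "N = {x}" by (auto simp: card_1_singleton_iff)
          then have "L2_dist \<pi> h hh \<le> \<epsilon>" using cover[OF h] hh by simp
          have "0 \<le> 40000 * (C2 * X + C3 * Y)" using tail0 by (rule mult_nonneg_nonneg[rotated]) simp
          with close[OF h hh \<open>L2_dist \<pi> h hh \<le> \<epsilon>\<close>] show ?thesis using bound_ge by linarith
        qed
      qed
    next
      case False
      then have L0: "0 < L" and card2: "2 \<le> card N" using L card1 by auto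
      have q2: "ln 2 \<le> q"
        unfolding q_def
      proof (rule ln_mono)
        have "2 * \<delta> \<le> real (card N) * 1" using card2 \<delta> by (intro mult_mono) auto
        then show "2 \<le> real (card N) / \<delta>" using \<delta> by (simp add: le_divide_eq)
      qed (use card2 \<delta> in auto)
      then have q23: "2 / 3 \<le> q" using ln2_ge_two_thirds by linarith
      \<comment> \<open>4 / p = \<delta> / card N is the share of each net point in the union bound,
        and ln p = ln 4 + q \<le> 3 q because q \<ge> ln 2.\<close>
      define p where "p = 4 * (real (card N) / \<delta>)"
      have cd: "0 < real (card N) / \<delta>" "2 \<le> real (card N) / \<delta>"
        using card2 \<delta> mult_mono[of 2 "real (card N)" \<delta> 1] by (auto simp: le_divide_eq)
      have p: "1 < p" using cd by (simp add: p_def)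
      have lnp: "0 \<le> ln p" "ln p \<le> 3 * q"
      proof -
        show "0 \<le> ln p" using p by simp
        have "ln p = ln 4 + q" unfolding p_def q_def using ln_mult_pos[of 4 "real (card N) / \<delta>"] cd by simp
        moreover have "ln (4::real) = 2 * ln 2" using ln_realpow[of 2 2] by simp
        ultimately show "ln p \<le> 3 * q" using q2 by linarith
      qed
      obtain m where m: "b = 2 * m" "0 < m" "rate ^ m \<le> 1 / real n" and b7: "real b \<le> 7 * l / k"
        using bandwidth_bounds[of \<kappa> \<gamma> n] k n unfolding b_def k_def rate l_def by metis
      define v where "v = 280 * l * L\<^sup>2 * B / k ^ 3"
      define \<Delta> where "\<Delta> = 20000 * (C2 * X + C3 * Y)"
      note rb = rate_bound[OF n L B D0 R0 DS k r1(1,2) of_nat_0_le_iff b7 l q23 lnp, of "R / 2"]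
      have v: "10 * real b * L\<^sup>2 * max \<beta> \<gamma> / (1 - rate)\<^sup>2 \<le> v"
        using rb(1) R0 unfolding v_def B_def by simp
      define bad where "bad h = {\<omega>\<in>space ?S. real n * \<Delta> < \<bar>form (cen h) w b n \<omega> - real n * V h\<bar>}" for h
      have bad_sets: "bad h \<in> sets ?S" if "h \<in> H" for h
      proof -
        have "form (cen h) w b n \<in> borel_measurable ?S"
          using integrable_form[OF clip[OF that] L cmean[OF that] Rd_moment2_xi w] by auto
        then show ?thesis unfolding bad_def by measurable
      qed
      have bad_prob: "measure ?S (bad h) \<le> \<delta> / real (card N)" if h: "h \<in> H" for h
      proof -
        let ?t = "2 * sqrt (v * ln p)" and ?M = "2 * (real n * D) + 2 * (R / 2)"
        let ?Q = "2 * (?t * (2 * sqrt (4 * real b * ?M) + ?t) + 4 * v) + 2 * real b * (2 * sqrt (R / 2 * (real n * D)) + R / 2)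
          + 12 * real b * D / (1 - rate) + 4 * D / (1 - rate)\<^sup>2"
        have "?Q / real n \<le> \<Delta>"
          using rb(2) R0 unfolding v_def[symmetric] \<Delta>_def C2 C3 X_def Y_def by simp
        then have Q: "?Q \<le> real n * \<Delta>" using n by (simp add: divide_le_eq mult.commute)
        have fm: "form (cen h) w b n \<in> borel_measurable ?S"
          using integrable_form[OF clip[OF h] L cmean[OF h] Rd_moment2_xi w] by auto
        have "measure ?S (bad h) \<le> measure ?S {\<omega>\<in>space ?S. ?Q < \<bar>form (cen h) w b n \<omega> - real n * asymptotic_variance (cen h)\<bar>}"
        proof (rule xiN.P.finite_measure_mono)
          show "bad h \<subseteq> {\<omega>\<in>space ?S. ?Q < \<bar>form (cen h) w b n \<omega> - real n * asymptotic_variance (cen h)\<bar>}"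
            unfolding bad_def Veq[OF h] using Q by (auto intro: le_less_trans)
          show "{\<omega>\<in>space ?S. ?Q < \<bar>form (cen h) w b n \<omega> - real n * asymptotic_variance (cen h)\<bar>} \<in> sets ?S"
            using fm by measurable
        qed
        also have "\<dots> \<le> 4 / p"
          using n by (intro form_concentration[OF clip[OF h] L cmean[OF h] L0 w _ m \<Lambda> Dge[OF h] v p]) simp
        also have "\<dots> = \<delta> / real (card N)" by (simp add: p_def)
        finally show ?thesis .
      qed
      have NH: "h \<in> N \<Longrightarrow> h \<in> H" for h using N by auto
      have union: "measure ?S (\<Union>h\<in>N. bad h) \<le> \<delta>"
      proof -
        have "measure ?S (\<Union>h\<in>N. bad h) \<le> (\<Sum>h\<in>N. measure ?S (bad h))"
          using N bad_sets NH by (intro measure_UNION_le) auto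
        also have "\<dots> \<le> (\<Sum>h\<in>N. \<delta> / real (card N))" by (intro sum_mono bad_prob NH)
        also have "\<dots> = \<delta>" using card2 by simp
        finally show ?thesis .
      qed
      have Vn_form: "Vn \<omega> h = form (cen h) w b n \<omega> / real n" if "h \<in> H" for h \<omega>
      proof -
        have "centered n (\<lambda>k. cen h (chain \<omega> k)) = centered n (\<lambda>k. h (chain \<omega> k))"
          unfolding cen_def using n by (intro centered_shift) simp
        then show ?thesis
          unfolding Vn_def spectral_variance_eq form_def[OF clip[OF that] L cmean[OF that]] by simp
      qed
      \<comment> \<open>Only net points can be minimizers over the net, so the quantifier over all
        functions reduces to the finitely many net points that are not good. This makes the event
        measurable.\<close>
      have E_eq: "E = {\<omega>\<in>space ?S. \<forall>hh\<in>{hh\<in>N. \<not> good hh}. \<exists>y\<in>N. Vn \<omega> y < Vn \<omega> hh}"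
        unfolding E_def is_arg_min_def by auto
      have E_sets: "E \<in> sets ?S"
      proof -
        have "(\<lambda>\<omega>. Vn \<omega> h) \<in> borel_measurable ?S" if "h \<in> N" for h
        proof -
          have "form (cen h) w b n \<in> borel_measurable ?S"
            using integrable_form[OF clip[OF NH[OF that]] L cmean[OF NH[OF that]] Rd_moment2_xi w] by auto
          then show ?thesis unfolding Vn_form[OF NH[OF that]] by measurable
        qed
        then show ?thesis unfolding E_eq using N
          by (intro sets.sets_Collect_finite_All sets.sets_Collect_finite_Ex borel_measurable_less) auto
      qed
      have sub: "space ?S - (\<Union>h\<in>N. bad h) \<subseteq> E"
      proof
        fix \<omega> assume \<omega>: "\<omega> \<in> space ?S - (\<Union>h\<in>N. bad h)"
        have near: "\<bar>Vn \<omega> h - V h\<bar> \<le> \<Delta>" if h: "h \<in> N" for h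
        proof -
          have "\<bar>form (cen h) w b n \<omega> - real n * V h\<bar> \<le> real n * \<Delta>"
            using \<omega> h by (auto simp: bad_def not_less)
          moreover have "form (cen h) w b n \<omega> - real n * V h = real n * (Vn \<omega> h - V h)"
            unfolding Vn_form[OF NH[OF h]] using n by (simp add: right_diff_distrib)
          ultimately show ?thesis using n by (simp add: abs_mult)
        qed
        have "good hh" if "is_arg_min (Vn \<omega>) (\<lambda>h. h \<in> N) hh" for hh
        proof (rule goodI)
          fix h assume h: "h \<in> H"
          obtain h' where h': "h' \<in> N" "L2_dist \<pi> h h' \<le> \<epsilon>" using cover[OF h] by auto
          have hh: "hh \<in> N" "Vn \<omega> hh \<le> Vn \<omega> h'" using that h'(1) by (auto simp: is_arg_min_def not_less)
          have "V hh - V h \<le> 2 * \<Delta> + 18 * (C1 * \<epsilon> * l)"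
            using near[OF hh(1)] near[OF h'(1)] hh(2) close[OF h h'] by linarith
          also have "\<dots> \<le> bound" using bound_ge by (simp add: \<Delta>_def)
          finally show "V hh - V h \<le> bound" .
        qed
        then show "\<omega> \<in> E" using \<omega> by (auto simp: E_def)
      qed
      have "1 - \<delta> \<le> 1 - measure ?S (\<Union>h\<in>N. bad h)" using union by simp
      also have "\<dots> = measure ?S (space ?S - (\<Union>h\<in>N. bad h))"
        using N bad_sets NH by (intro xiN.P.prob_compl[symmetric] sets.finite_UN) auto
      also have "\<dots> \<le> measure ?S E" by (rule xiN.P.finite_measure_mono[OF sub E_sets])
      finally show ?thesis
        by (simp add: E_def good_def Vn_def V_def bound_def b_def C1_def C2_def C3_def X_def Y_def l_def ula_space_eq)
    qed
  qed
qed

end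

theorem theorem3p4:
  shows "\<exists>K>0::real.
    \<forall>(d::nat) (U::(nat \<Rightarrow> real) \<Rightarrow> real) (L\<^sub>U::real) (m\<^sub>U::real) (\<kappa>::real) (\<gamma>::real)
     (\<pi>::(nat \<Rightarrow> real) measure) (\<xi>::(nat \<Rightarrow> real) measure) (\<beta>::real)
     (f::(nat \<Rightarrow> real) \<Rightarrow> real) (G::((nat \<Rightarrow> real) \<Rightarrow> real) set) (H::((nat \<Rightarrow> real) \<Rightarrow> real) set)
     (L::real) (w::real \<Rightarrow> real) (n::nat) (\<epsilon>::real) (\<delta>::real)
     (H\<^sub>\<epsilon>::((nat \<Rightarrow> real) \<Rightarrow> real) set) (D::real) (R::real) (\<sigma>::real).
      1 \<le> d \<longrightarrow>
      ula_condition d U L\<^sub>U m\<^sub>U \<longrightarrow>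
      \<kappa> = ula_kappa L\<^sub>U m\<^sub>U \<longrightarrow>
      0 < \<gamma> \<longrightarrow> \<gamma> < 2 / (m\<^sub>U + L\<^sub>U) \<longrightarrow>
      ula_invariant d U \<gamma> \<pi> \<longrightarrow>
      prob_space \<xi> \<longrightarrow> sets \<xi> = sets (Rd d) \<longrightarrow>
      0 < \<beta> \<longrightarrow> \<xi> \<in> T2 (eucl_dist d) \<beta> \<longrightarrow>
      (\<forall>g\<in>G. integrable \<pi> g \<and> (\<integral>x. g x \<partial>\<pi>) = 0) \<longrightarrow>
      H = {(\<lambda>x. f x - g x) |g. g \<in> G} \<longrightarrow>
      H \<subseteq> Lip (space (Rd d)) (eucl_dist d) L \<longrightarrow>
      totally_bounded_L2 \<pi> H \<longrightarrow>
      lag_window w \<longrightarrow>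
      2 \<le> n \<longrightarrow>
      0 < \<epsilon> \<longrightarrow> 0 < \<delta> \<longrightarrow> \<delta> < 1 \<longrightarrow>
      minimal_eps_net \<pi> H \<epsilon> H\<^sub>\<epsilon> \<longrightarrow>
      D = sup_variance \<pi> H \<longrightarrow>
      R = const_R d L \<kappa> \<gamma> \<xi> \<pi> \<longrightarrow>
      \<sigma> = const_sigma d L \<pi> H \<longrightarrow>
      \<P>(\<omega> in ula_space d \<xi>.
          \<forall>h_hat. is_arg_min (spectral_variance w (bandwidth \<kappa> \<gamma> n) n (ula_chain d U \<gamma> \<omega>))
                     (\<lambda>h. h \<in> H\<^sub>\<epsilon>) h_hat \<longrightarrow>
            V_infinity d U \<gamma> \<pi> f h_hat - (INF h\<in>H. V_infinity d U \<gamma> \<pi> f h)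
            \<le> K * (const_C1 \<kappa> \<gamma> D R * \<epsilon> * ln (real n) +
                   const_C2 L \<beta> \<kappa> \<gamma> D R *
                     sqrt ((ln (real n))\<^sup>2 * ln (real (card H\<^sub>\<epsilon>) / \<delta>) / real n) +
                   const_C3 L \<beta> \<kappa> \<gamma> R \<sigma> *
                     ((ln (real n))\<^sup>2 * ln (real (card H\<^sub>\<epsilon>) / \<delta>) / real n)))
      \<ge> 1 - \<delta>"
proof (intro exI[of _ 40000] conjI allI impI)
  fix d n :: nat and U f :: "(nat \<Rightarrow> real) \<Rightarrow> real" and L\<^sub>U m\<^sub>U \<kappa> \<gamma> \<beta> L \<epsilon> \<delta> D R \<sigma> :: real
    and \<pi> \<xi> :: "(nat \<Rightarrow> real) measure" and G H H\<^sub>\<epsilon> :: "((nat \<Rightarrow> real) \<Rightarrow> real) set" and w :: "real \<Rightarrow> real"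
  assume d: "1 \<le> d" and ula: "ula_condition d U L\<^sub>U m\<^sub>U" and \<kappa>: "\<kappa> = ula_kappa L\<^sub>U m\<^sub>U"
    and \<gamma>: "0 < \<gamma>" "\<gamma> < 2 / (m\<^sub>U + L\<^sub>U)" and inv: "ula_invariant d U \<gamma> \<pi>"
    and \<xi>: "prob_space \<xi>" "sets \<xi> = sets (Rd d)" and \<beta>: "0 < \<beta>" "\<xi> \<in> T2 (eucl_dist d) \<beta>"
    and G: "\<forall>g\<in>G. integrable \<pi> g \<and> (\<integral>x. g x \<partial>\<pi>) = 0" and H: "H = {(\<lambda>x. f x - g x) |g. g \<in> G}"
    and Hlip: "H \<subseteq> Lip (space (Rd d)) (eucl_dist d) L" and w: "lag_window w" and n: "2 \<le> n"
    and \<epsilon>: "0 < \<epsilon>" and \<delta>: "0 < \<delta>" "\<delta> < 1" and net: "minimal_eps_net \<pi> H \<epsilon> H\<^sub>\<epsilon>"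
    and D: "D = sup_variance \<pi> H" and R: "R = const_R d L \<kappa> \<gamma> \<xi> \<pi>" and \<sigma>: "\<sigma> = const_sigma d L \<pi> H"
  interpret ula_estimation d U L\<^sub>U m\<^sub>U \<gamma> \<pi> \<xi> \<beta>
    by (intro ula_estimation.intro stationary_ula.intro ula.intro stationary_ula_axioms.intro
        T2_measure.intro T2_measure_axioms.intro ula \<gamma> inv \<xi> \<beta>)
  show "\<P>(\<omega> in ula_space d \<xi>.
          \<forall>h_hat. is_arg_min (spectral_variance w (bandwidth \<kappa> \<gamma> n) n (ula_chain d U \<gamma> \<omega>))
                     (\<lambda>h. h \<in> H\<^sub>\<epsilon>) h_hat \<longrightarrow>
            V_infinity d U \<gamma> \<pi> f h_hat - (INF h\<in>H. V_infinity d U \<gamma> \<pi> f h)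
            \<le> 40000 * (const_C1 \<kappa> \<gamma> D R * \<epsilon> * ln (real n) +
                   const_C2 L \<beta> \<kappa> \<gamma> D R *
                     sqrt ((ln (real n))\<^sup>2 * ln (real (card H\<^sub>\<epsilon>) / \<delta>) / real n) +
                   const_C3 L \<beta> \<kappa> \<gamma> R \<sigma> *
                     ((ln (real n))\<^sup>2 * ln (real (card H\<^sub>\<epsilon>) / \<delta>) / real n)))
      \<ge> 1 - \<delta>"
    unfolding D R \<sigma> \<kappa> by (rule selection_bound[OF d G H Hlip w n \<epsilon> \<delta> net])
qed simp

end
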